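(* Let $G=\mathbf{SL}(2,\mathbb{R})$ and let $m\in\mathbb{Z}\cong\widehat{K}$ be a $K$-type. A function $\psi\in\mathrm{Hol}(\mathfrak{a}^*_{\mathbb{C}},H^{m|_M}_\infty)$ satisfies the intertwining condition (D.2) if and only if (2.a) $J_{w,m,\lambda}\,\psi(\lambda,\cdot)=\mathbf{c}_m(\lambda)\,\psi(-\lambda,\cdot)$ for all $\lambda\in\mathfrak{a}^*_{\mathbb{C}}$ (as meromorphic functions of $\lambda$), and (2.b) $\psi(\lambda,\cdot)\in W_\lambda$ for all $\lambda\in I_\pm$, where $\pm$ is $+$ if $m$ is even and $-$ if $m$ is odd, and $W_\lambda\subset H^{\pm,\lambda}_\infty$ is the following closed $G$-submodule (with $k:=2|\lambda|$): - for $\lambda<0$ and $k\ge|m|+1$: $W_\lambda=F_k$; - for $\lambda<0$ and $k\le|m|-1$: $W_\lambda$ is the submodule containing $F_k$ with $W_\lambda/F_k\cong D_k$ if $m>0$, and with $W_\lambda/F_k\cong D_{-k}$ if $m<0$; - for $\lambda=0$ (only for $m$ odd): $W_0=D_+$ if $m>0$, $W_0=D_-$ if $m<0$; - for $\lambda>0$ and $k\le|m|-1$: $W_\lambda=D_k$ if $m>0$, $W_\lambda=D_{-k}$ if $m<0$; - for $\lambda>0$ and $k\ge|m|+1$: $W_\lambda=H^{\pm,\lambda}_\infty$ (no condition).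
   Context: Setting. $G=\mathbf{SL}(2,\mathbb{R})=KAN$ with $K=\mathbf{SO}(2)=\{k_\theta=\begin{pmatrix}\cos\theta&\sin\theta\\-\sin\theta&\cos\theta\end{pmatrix}\}$, $A=\{\mathrm{diag}(e^t,e^{-t})\}$, $N$ upper triangular unipotent, $\overline N$ lower triangular unipotent, $M=\{\pm\mathrm{Id}\}$, $\widehat{M}=\{+,-\}$ ($+$ trivial), $\widehat{K}=\{\delta_n:n\in\mathbb{Z}\}$, $\delta_n(k_\theta)=e^{in\theta}$ on $E_n=\mathbb{C}$; $\delta_n$ is also denoted $n$. With $\alpha(\mathrm{diag}(t,-t))=2t$ identify $\mathfrak{a}^*_{\mathbb{C}}\cong\mathbb{C}$ via $z\alpha\mapsto z$, so $\rho=\frac12$; $a^\nu=e^{\nu(\log a)}$, and $g=\kappa(g)a(g)n(g)\in KAN$. $m_w\in N_K(\mathfrak{a})$ represents the non-trivial Weyl group element $w$ (acting by $-1$). Principal series. For a finite-dimensional representation $\sigma$ of $M$ on $E_\sigma$ and $\lambda\in\mathfrak{a}^*_{\mathbb{C}}$: $H^{\sigma,\lambda}_\infty$ is the space of smooth $f:G\to E_\sigma$ with $f(gman)=a^{-(\lambda+\rho)}\sigma(m)^{-1}f(g)$, $G$ acting by left translation $\pi_{\sigma,\lambda}$; restriction to $K$ identifies it with $H^\sigma_\infty=\{f\in C^\infty(K,E_\sigma):f(km)=\sigma(m)^{-1}f(k)\}$. For a $K$-representation $\tau$, $H^{\tau|_M}_\infty$ is this space for $\sigma=\tau|_M$; $H^{m|_M}_\infty$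 is the case $\tau=\delta_m$ (so $\delta_m|_M=+$ or $-$ according to the parity of $m$). $\psi\in\mathrm{Hol}(\mathfrak{a}^*_{\mathbb{C}},H^{\tau|_M}_\infty)$ is holomorphic, written $\psi(\lambda,k)$. Composition series. $H^{\pm,\lambda}_\infty$ is reducible iff $\lambda\in I_\pm$, $I_+=\frac12+\mathbb{Z}$, $I_-=\mathbb{Z}$. For $k\in\mathbb{N}$, $F_k$ is the $k$-dimensional irreducible representation ($K$-types $\delta_{-(k-1)},\delta_{-(k-3)},\dots,\delta_{k-1}$), $D_{\pm k}$ the discrete series (smooth vectors) with $K$-types $\delta_{\pm(k+1+2j)}$, $j\ge0$. For $\lambda=\frac k2\in I_\pm$, $k\in\mathbb N$: $D_{-k}\oplus D_k$ is a submodule of $H^{\pm,k/2}_\infty$ with quotient $F_k$, and $F_k$ is a submodule of $H^{\pm,-k/2}_\infty$ with quotient $D_{-k}\oplus D_k$. $H^{-,0}_\infty=D_+\oplus D_-$, with $D_\pm$ having $K$-types $\delta_{\pm(1+2j)}$, $j\ge0$. Knapp-Stein operator and $\mathbf{c}$-function. For $\sigma\in\widehat M$ or $\sigma=\tau|_M$, $w\sigma(x):=\sigma(m_w^{-1}xm_w)$, and $J_{w,\sigma,\lambda}:H^{\sigma,\lambda}_\infty\to H^{w\sigma,-\lambda}_\infty$, $(J_{w,\sigma,\lambda}\varphi)(g)=\int_N\varphi(gnm_w)\,dn$ for $\mathrm{Re}\lambda>0$, continued meromorphically. $J_{w,m,\lambda}:=\delta_m(m_w)J_{w,\delta_m|_M,\lambda}$.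 $\mathbf{c}_m(\lambda)=\int_{\overline N}a(\overline n)^{-(\lambda+\rho)}\delta_m(\kappa(\overline n))\,d\overline n$ for $\mathrm{Re}\lambda>0$, continued meromorphically, with $d\overline{n}$ corresponding to $dn$ under conjugation by $m_w$; for a suitable normalization of Haar measure $\mathbf{c}_m(\lambda)=\frac1{\sqrt\pi}\frac{\Gamma(\lambda)\Gamma(\lambda+\frac12)}{\Gamma(\lambda+\frac{1+m}2)\Gamma(\lambda+\frac{1-m}2)}$. Derived representations. For $d\in\mathbb{N}_0$ let $H^\sigma_{[\lambda]}$ be the germs at $\lambda$ of holomorphic maps $\mu\mapsto\phi_\mu\in H^\sigma_\infty$ with $(g\phi)_\mu=\pi_{\sigma,\mu}(g)\phi_\mu$, $m_\lambda$ the maximal ideal of the ring of holomorphic germs at $\lambda$, $H^{\sigma,\lambda}_{\infty,(d)}:=H^\sigma_{[\lambda]}/m_\lambda^{d+1}H^\sigma_{[\lambda]}$. Similarly $\mathrm{Hom}_M(E_\tau,E_\sigma)^\lambda_{(d)}$ is the space of holomorphic $\mathrm{Hom}_M(E_\tau,E_\sigma)$-valued functions modulo $m_\lambda^{d+1}$. Intertwining data. An intertwining datum $(\xi,W)$ is a finite sequence $\xi=((\sigma_i,\lambda_i,d_i))_{i=1}^s$ with $\sigma_i\in\widehat{M}$, $\lambda_i\in\mathfrak{a}^*_{\mathbb{C}}$, $d_i\in\mathbb{N}_0$, with a proper closed $G$-subrepresentation $W\subset H_\xi:=\bigoplus_iH^{\sigma_i,\lambda_i}_{\infty,(d_i)}$.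 $D^\tau_W$ is the set of $t=(t_1,\dots,t_s)\in\bigoplus_i\mathrm{Hom}_M(E_\tau,E_{\sigma_i})^{\lambda_i}_{(d_i)}$ whose Frobenius partner $T\in\mathrm{Hom}_K(E_\tau,H_\xi)$, $T(v)_i=[\mu\mapsto(k\mapsto t_{i,\mu}\tau(k)^{-1}v)]$, takes values in $W$. Condition (D.2) for $\psi\in\mathrm{Hol}(\mathfrak{a}^*_{\mathbb{C}},H^{\tau|_M}_\infty)$: for each intertwining datum $(\xi,W)$ and each non-zero $t\in D^\tau_W$, $(t_1\circ\psi_1,\dots,t_s\circ\psi_s)\in W$, where $\psi_i$ is the class of the germ of $\psi$ at $\lambda_i$ modulo $m_{\lambda_i}^{d_i+1}$. *)

theory Defs
  imports "HOL-Complex_Analysis.Complex_Analysis"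
begin

section \<open>The group SL(2,R) and its Iwasawa decomposition\<close>

type_synonym mat2 = "real^2^2"

definition SL2 :: "mat2 set" where
  "SL2 = {g. det g = 1}"

definition rot :: "real \<Rightarrow> mat2" where
  "rot \<theta> = vector [vector [cos \<theta>, sin \<theta>], vector [- sin \<theta>, cos \<theta>]]"

definition diagA :: "real \<Rightarrow> mat2" where
  "diagA t = vector [vector [exp t, 0], vector [0, exp (- t)]]"

definition upperN :: "real \<Rightarrow> mat2" where
  "upperN x = vector [vector [1, x], vector [0, 1]]"

definition lowerN :: "real \<Rightarrow> mat2" where
  "lowerN x = vector [vector [1, 0], vector [x, 1]]"

definition SO2 :: "mat2 set" where
  "SO2 = range rot"

definition kappa :: "mat2 \<Rightarrow> mat2" where
  "kappa g = (THE k. k \<in> SO2 \<and> (\<exists>t x. g = k ** diagA t ** upperN x))"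

definition logA :: "mat2 \<Rightarrow> real" where
  "logA g = (THE t. \<exists>k\<in>SO2. \<exists>x. g = k ** diagA t ** upperN x)"

text \<open>
  The functional \<open>z \<alpha>\<close> on \<open>\<aa>\<close> is identified with the complex number \<open>z\<close>, where
  \<open>\<alpha>(diag(t,-t)) = 2 t\<close>. Thus \<open>\<rho> = 1/2\<close>, and \<open>a_pow \<nu> g\<close> is \<open>a(g)\<^sup>\<nu>\<close>.
\<close>

definition a_pow :: "complex \<Rightarrow> mat2 \<Rightarrow> complex" where
  "a_pow \<nu> g = exp (\<nu> * (2 * of_real (logA g)))"

definition rho :: complex where
  "rho = 1/2"

definition represents_w :: "mat2 \<Rightarrow> bool" where
  "represents_w mw \<longleftrightarrow>
     mw \<in> SO2 \<and> (\<forall>t. mw ** diagA t ** matrix_inv mw = diagA (- t))"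


section \<open>Characters of M and K\<close>

definition Mgrp :: "mat2 set" where
  "Mgrp = {mat 1, - mat 1}"

datatype mhat = Plus | Minus

fun mchar :: "mhat \<Rightarrow> mat2 \<Rightarrow> complex" where
  "mchar Plus x = 1"
| "mchar Minus x = (if x = mat 1 then 1 else - 1)"

text \<open>The entries of the first row of \<open>rot \<theta>\<close> are \<open>cos \<theta>\<close> and \<open>sin \<theta>\<close>, so
  \<open>delta n (rot \<theta>) = exp (\<i> n \<theta>)\<close>.\<close>

definition delta :: "int \<Rightarrow> mat2 \<Rightarrow> complex" where
  "delta n k = Complex (k $ 1 $ 1) (k $ 1 $ 2) powi n"

definition restrM :: "int \<Rightarrow> mhat" where
  "restrM m = (if even m then Plus else Minus)"


section \<open>The Frechet space of smooth vectors\<close>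

text \<open>
  Functions on \<open>K\<close> are represented by functions on all matrices that vanish off \<open>SO2\<close>.
\<close>

definition vderiv :: "(real \<Rightarrow> complex) \<Rightarrow> real \<Rightarrow> complex" where
  "vderiv f = (\<lambda>\<theta>. vector_derivative f (at \<theta>))"

definition smooth_real :: "(real \<Rightarrow> complex) \<Rightarrow> bool" where
  "smooth_real f \<longleftrightarrow> (\<forall>n \<theta>. (vderiv ^^ n) f differentiable (at \<theta>))"

definition Hinf :: "mhat \<Rightarrow> (mat2 \<Rightarrow> complex) set" where
  "Hinf \<sigma> = {\<phi>. (\<forall>k. k \<notin> SO2 \<longrightarrow> \<phi> k = 0)
      \<and> smooth_real (\<lambda>\<theta>. \<phi> (rot \<theta>))
      \<and> (\<forall>k\<in>SO2. \<forall>x\<in>Mgrp. \<phi> (k ** x) = inverse (mchar \<sigma> x) * \<phi> k)}"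

text \<open>The seminorms \<open>snorm n\<close> define the topology of \<open>Hinf \<sigma>\<close>.\<close>

definition snorm :: "nat \<Rightarrow> (mat2 \<Rightarrow> complex) \<Rightarrow> real" where
  "snorm n \<phi> = (SUP \<theta>. norm ((vderiv ^^ n) (\<lambda>s. \<phi> (rot s)) \<theta>))"

text \<open>Complex differentiability with respect to the Frechet topology:\<close>

definition hol_into :: "mhat \<Rightarrow> complex set \<Rightarrow> (complex \<Rightarrow> mat2 \<Rightarrow> complex) \<Rightarrow> bool" where
  "hol_into \<sigma> U \<phi> \<longleftrightarrow> (\<forall>\<mu>\<in>U. \<phi> \<mu> \<in> Hinf \<sigma>) \<and>
     (\<forall>\<mu>\<in>U. \<exists>\<eta>\<in>Hinf \<sigma>. \<forall>n.
        ((\<lambda>h. snorm n (\<lambda>k. (\<phi> (\<mu> + h) k - \<phi> \<mu> k) / h - \<eta> k)) \<longlongrightarrow> 0) (at 0))"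


section \<open>The principal series\<close>

text \<open>
  \<open>extend \<nu> \<phi>\<close> is the function on \<open>G\<close> with \<open>f(gman) = a\<^bsup>-(\<nu>+\<rho>)\<^esup> \<sigma>(m)\<^sup>-\<^sup>1 f(g)\<close> whose
  restriction to \<open>K\<close> is \<open>\<phi> \<in> Hinf \<sigma>\<close>, and \<open>act \<nu> g\<close> is left translation by \<open>g\<close>
  transported to \<open>Hinf \<sigma>\<close> by restriction to \<open>K\<close>.
\<close>

definition extend :: "complex \<Rightarrow> (mat2 \<Rightarrow> complex) \<Rightarrow> mat2 \<Rightarrow> complex" where
  "extend \<nu> \<phi> g = a_pow (- (\<nu> + rho)) g * \<phi> (kappa g)"

definition act :: "complex \<Rightarrow> mat2 \<Rightarrow> (mat2 \<Rightarrow> complex) \<Rightarrow> mat2 \<Rightarrow> complex" where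
  "act \<nu> g \<phi> = (\<lambda>k. if k \<in> SO2 then extend \<nu> \<phi> (matrix_inv g ** k) else 0)"

definition closed_submodule :: "mhat \<Rightarrow> complex \<Rightarrow> (mat2 \<Rightarrow> complex) set \<Rightarrow> bool" where
  "closed_submodule \<sigma> \<nu> W \<longleftrightarrow>
     W \<subseteq> Hinf \<sigma> \<and> (\<lambda>k. 0) \<in> W
     \<and> (\<forall>f\<in>W. \<forall>h\<in>W. (\<lambda>k. f k + h k) \<in> W)
     \<and> (\<forall>c. \<forall>f\<in>W. (\<lambda>k. c * f k) \<in> W)
     \<and> (\<forall>g\<in>SL2. \<forall>f\<in>W. act \<nu> g f \<in> W)
     \<and> (\<forall>f\<in>Hinf \<sigma>.
          (\<forall>N. \<forall>\<epsilon>>0. \<exists>h\<in>W. \<forall>n\<le>N. snorm n (\<lambda>k. f k - h k) < \<epsilon>) \<longrightarrow> f \<in> W)"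

definition irreducible_submodule :: "mhat \<Rightarrow> complex \<Rightarrow> (mat2 \<Rightarrow> complex) set \<Rightarrow> bool" where
  "irreducible_submodule \<sigma> \<nu> W \<longleftrightarrow>
     closed_submodule \<sigma> \<nu> W \<and> W \<noteq> {\<lambda>k. 0}
     \<and> (\<forall>V. closed_submodule \<sigma> \<nu> V \<and> V \<subseteq> W \<longrightarrow> V = {\<lambda>k. 0} \<or> V = W)"

definition Ktypes :: "complex \<Rightarrow> (mat2 \<Rightarrow> complex) set \<Rightarrow> int set" where
  "Ktypes \<nu> W = {n. \<exists>f\<in>W. f \<noteq> (\<lambda>k. 0) \<and>
      (\<forall>k0\<in>SO2. act \<nu> k0 f = (\<lambda>k. delta n k0 * f k))}"


section \<open>The submodules of the reducible principal series\<close>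

fun red_pts :: "mhat \<Rightarrow> real set" where
  "red_pts Plus = {1/2 + of_int j | j. True}"
| "red_pts Minus = {of_int j | j. True}"

text \<open>
  The \<open>K\<close>-types of a principal series have multiplicity one, so a closed submodule is
  determined by its set of \<open>K\<close>-types. The finite-dimensional module \<open>F\<^sub>k\<close> is taken inside the
  principal series with parameter \<open>-k/2\<close>. The module \<open>Dsub \<sigma> \<epsilon> k\<close>, for \<open>\<epsilon> = 1\<close> or \<open>-1\<close>, is
  \<open>D\<close> with index \<open>\<epsilon> k\<close> inside the principal series with parameter \<open>k/2\<close>; for \<open>k = 0\<close> it is
  \<open>D\<^sub>+\<close> or \<open>D\<^sub>-\<close>.
\<close>

definition Fsub :: "mhat \<Rightarrow> nat \<Rightarrow> (mat2 \<Rightarrow> complex) set" where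
  "Fsub \<sigma> k = (THE W. irreducible_submodule \<sigma> (- (of_nat k / 2)) W \<and>
      Ktypes (- (of_nat k / 2)) W = {- (int k - 1) + 2 * int j | j. j < k})"

definition Dsub :: "mhat \<Rightarrow> int \<Rightarrow> nat \<Rightarrow> (mat2 \<Rightarrow> complex) set" where
  "Dsub \<sigma> \<epsilon> k = (THE W. irreducible_submodule \<sigma> (of_nat k / 2) W \<and>
      Ktypes (of_nat k / 2) W = {\<epsilon> * (int k + 1 + 2 * int j) | j. True})"

text \<open>
  \<open>quotient_iso \<nu> W F \<mu> D\<close>: \<open>W/F\<close> (a subquotient for the parameter \<open>\<nu>\<close>) is isomorphic to
  \<open>D\<close> (a submodule for the parameter \<open>\<mu>\<close>), as witnessed by a continuous equivariant
  surjection from \<open>W\<close> onto \<open>D\<close> with kernel \<open>F\<close>. By the open mapping theorem the induced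
  bijection is a homeomorphism.
\<close>

definition quotient_iso ::
  "complex \<Rightarrow> (mat2 \<Rightarrow> complex) set \<Rightarrow> (mat2 \<Rightarrow> complex) set \<Rightarrow>
   complex \<Rightarrow> (mat2 \<Rightarrow> complex) set \<Rightarrow> bool" where
  "quotient_iso \<nu> W F \<mu> D \<longleftrightarrow> (\<exists>T :: (mat2 \<Rightarrow> complex) \<Rightarrow> (mat2 \<Rightarrow> complex).
     (\<forall>f\<in>W. \<forall>h\<in>W. T (\<lambda>k. f k + h k) = (\<lambda>k. T f k + T h k))
     \<and> (\<forall>c. \<forall>f\<in>W. T (\<lambda>k. c * f k) = (\<lambda>k. c * T f k))
     \<and> (\<forall>n. \<exists>N C. \<forall>f\<in>W. snorm n (T f) \<le> C * (\<Sum>j\<le>N. snorm j f))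
     \<and> (\<forall>g\<in>SL2. \<forall>f\<in>W. T (act \<nu> g f) = act \<mu> g (T f))
     \<and> T ` W = D
     \<and> {f \<in> W. T f = (\<lambda>k. 0)} = F)"

definition Wmod :: "int \<Rightarrow> real \<Rightarrow> (mat2 \<Rightarrow> complex) set" where
  "Wmod m r = (let \<sigma> = restrM m; k = nat \<lfloor>2 * \<bar>r\<bar>\<rfloor> in
     if r < 0 then
       (if int k \<ge> \<bar>m\<bar> + 1 then Fsub \<sigma> k
        else (THE W. closed_submodule \<sigma> (of_real r) W \<and> Fsub \<sigma> k \<subseteq> W \<and>
                quotient_iso (of_real r) W (Fsub \<sigma> k) (of_nat k / 2) (Dsub \<sigma> (sgn m) k)))
     else if r = 0 then Dsub \<sigma> (sgn m) 0
     else (if int k \<ge> \<bar>m\<bar> + 1 then Hinf \<sigma> else Dsub \<sigma> (sgn m) k))"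


section \<open>The Knapp-Stein operator and the c-function\<close>

text \<open>
  The meromorphic continuation of a function on the right half plane, normalized to have the
  value 0 at its poles.
\<close>

definition mero_cont :: "(complex \<Rightarrow> complex) \<Rightarrow> complex \<Rightarrow> complex" where
  "mero_cont f = (THE F. F nicely_meromorphic_on UNIV \<and> (\<forall>\<nu>. Re \<nu> > 0 \<longrightarrow> F \<nu> = f \<nu>))"

text \<open>
  The Haar measure on \<open>N\<close> is \<open>dx / \<pi>\<close> in the coordinate \<open>upperN x\<close>. Conjugation by a
  representative of \<open>w\<close> maps \<open>upperN x\<close> to \<open>lowerN (-x)\<close>, so the corresponding measure on
  the opposite group is \<open>dx / \<pi>\<close> in the coordinate \<open>lowerN x\<close>. With this normalization
  \<open>c_fun m\<close> is the quotient of Gamma functions with the constant \<open>1 / sqrt \<pi>\<close>.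

  The operator \<open>J_w\<close> is continued in \<open>\<nu>\<close> for a fixed vector \<open>\<phi> \<in> Hinf \<sigma>\<close>, evaluated at
  \<open>k \<in> K\<close>.
\<close>

definition J_w :: "mat2 \<Rightarrow> complex \<Rightarrow> (mat2 \<Rightarrow> complex) \<Rightarrow> mat2 \<Rightarrow> complex" where
  "J_w mw \<nu> \<phi> k = (if k \<in> SO2
     then mero_cont (\<lambda>\<mu>. (LINT x|lborel. extend \<mu> \<phi> (k ** upperN x ** mw)) / of_real pi) \<nu>
     else 0)"

definition J_wm :: "mat2 \<Rightarrow> int \<Rightarrow> complex \<Rightarrow> (mat2 \<Rightarrow> complex) \<Rightarrow> mat2 \<Rightarrow> complex" where
  "J_wm mw m \<nu> \<phi> = (\<lambda>k. delta m mw * J_w mw \<nu> \<phi> k)"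

definition c_fun :: "int \<Rightarrow> complex \<Rightarrow> complex" where
  "c_fun m = mero_cont (\<lambda>\<nu>.
     (LINT x|lborel. a_pow (- (\<nu> + rho)) (lowerN x) * delta m (kappa (lowerN x))) / of_real pi)"


section \<open>Derived representations and intertwining data\<close>

definition hol_germ :: "mhat \<Rightarrow> complex \<Rightarrow> (complex \<Rightarrow> mat2 \<Rightarrow> complex) \<Rightarrow> bool" where
  "hol_germ \<sigma> \<nu> \<phi> \<longleftrightarrow> (\<exists>U. open U \<and> \<nu> \<in> U \<and> hol_into \<sigma> U \<phi>)"

text \<open>
  \<open>jet \<sigma> \<nu> d \<phi>\<close> is the class of the germ of \<open>\<phi>\<close> in the quotient of the module of germs by
  its submodule \<open>m\<^sub>\<nu>\<^bsup>d+1\<^esup> H\<close>; this submodule consists of the germs \<open>(\<mu> - \<nu>)\<^bsup>d+1\<^esup> \<eta>\<^sub>\<mu>\<close>.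
\<close>

definition jet ::
  "mhat \<Rightarrow> complex \<Rightarrow> nat \<Rightarrow> (complex \<Rightarrow> mat2 \<Rightarrow> complex) \<Rightarrow> (complex \<Rightarrow> mat2 \<Rightarrow> complex) set" where
  "jet \<sigma> \<nu> d \<phi> = {\<phi>'. hol_germ \<sigma> \<nu> \<phi>' \<and> (\<exists>\<eta>. hol_germ \<sigma> \<nu> \<eta> \<and>
     (\<forall>\<^sub>F \<mu> in nhds \<nu>. \<forall>k. \<phi>' \<mu> k - \<phi> \<mu> k = (\<mu> - \<nu>) ^ (d + 1) * \<eta> \<mu> k))}"

type_synonym xi = "(mhat \<times> complex \<times> nat) list"
type_synonym germ = "complex \<Rightarrow> mat2 \<Rightarrow> complex"

definition germs :: "xi \<Rightarrow> germ list set" where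
  "germs \<xi> = {\<phi>s. list_all2 (\<lambda>(\<sigma>, \<nu>, d) \<phi>. hol_germ \<sigma> \<nu> \<phi>) \<xi> \<phi>s}"

definition jets :: "xi \<Rightarrow> germ list \<Rightarrow> germ set list" where
  "jets \<xi> \<phi>s = map2 (\<lambda>(\<sigma>, \<nu>, d) \<phi>. jet \<sigma> \<nu> d \<phi>) \<xi> \<phi>s"

definition Hxi :: "xi \<Rightarrow> germ set list set" where
  "Hxi \<xi> = jets \<xi> ` germs \<xi>"

definition act_germ :: "mat2 \<Rightarrow> germ \<Rightarrow> germ" where
  "act_germ g \<phi> = (\<lambda>\<mu>. act \<mu> g (\<phi> \<mu>))"

text \<open>
  The topology of \<open>Hxi \<xi>\<close> is the one given by the Taylor coefficients up to order \<open>d\<close> at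
  \<open>\<nu>\<close>, which identify the space of classes for \<open>(\<sigma>, \<nu>, d)\<close> with \<open>d + 1\<close> copies of
  \<open>Hinf \<sigma>\<close>.
\<close>

definition jets_close :: "xi \<Rightarrow> nat \<Rightarrow> real \<Rightarrow> germ list \<Rightarrow> germ list \<Rightarrow> bool" where
  "jets_close \<xi> N \<epsilon> \<phi>s \<eta>s \<longleftrightarrow>
     list_all2 (\<lambda>(\<sigma>, \<nu>, d) (\<phi>, \<eta>). \<forall>j\<le>d. \<forall>n\<le>N.
        snorm n (\<lambda>k. (deriv ^^ j) (\<lambda>\<mu>. \<phi> \<mu> k - \<eta> \<mu> k) \<nu>) < \<epsilon>) \<xi> (zip \<phi>s \<eta>s)"

definition closed_subrep :: "xi \<Rightarrow> germ set list set \<Rightarrow> bool" where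
  "closed_subrep \<xi> W \<longleftrightarrow>
     W \<subseteq> Hxi \<xi> \<and> jets \<xi> (map (\<lambda>_. \<lambda>\<mu> k. 0) \<xi>) \<in> W
     \<and> (\<forall>\<phi>s\<in>germs \<xi>. \<forall>\<eta>s\<in>germs \<xi>. jets \<xi> \<phi>s \<in> W \<and> jets \<xi> \<eta>s \<in> W \<longrightarrow>
          jets \<xi> (map2 (\<lambda>\<phi> \<eta> \<mu> k. \<phi> \<mu> k + \<eta> \<mu> k) \<phi>s \<eta>s) \<in> W)
     \<and> (\<forall>c. \<forall>\<phi>s\<in>germs \<xi>. jets \<xi> \<phi>s \<in> W \<longrightarrow> jets \<xi> (map (\<lambda>\<phi> \<mu> k. c * \<phi> \<mu> k) \<phi>s) \<in> W)
     \<and> (\<forall>g\<in>SL2. \<forall>\<phi>s\<in>germs \<xi>. jets \<xi> \<phi>s \<in> W \<longrightarrow> jets \<xi> (map (act_germ g) \<phi>s) \<in> W)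
     \<and> (\<forall>\<phi>s\<in>germs \<xi>.
          (\<forall>N. \<forall>\<epsilon>>0. \<exists>\<eta>s\<in>germs \<xi>. jets \<xi> \<eta>s \<in> W \<and> jets_close \<xi> N \<epsilon> \<phi>s \<eta>s) \<longrightarrow>
          jets \<xi> \<phi>s \<in> W)"

definition intertwining_datum :: "xi \<Rightarrow> germ set list set \<Rightarrow> bool" where
  "intertwining_datum \<xi> W \<longleftrightarrow> closed_subrep \<xi> W \<and> W \<noteq> Hxi \<xi>"

text \<open>
  Here \<open>\<tau> = \<delta>\<^sub>m\<close>, and all representation spaces are the complex numbers. Linear maps between
  them are scalars. Elements of the space of homomorphisms modulo \<open>m\<^sub>\<nu>\<^bsup>d+1\<^esup>\<close> are given by
  representatives.
\<close>

definition hom_germ :: "int \<Rightarrow> mhat \<Rightarrow> complex \<Rightarrow> (complex \<Rightarrow> complex) \<Rightarrow> bool" where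
  "hom_germ m \<sigma> \<nu> t \<longleftrightarrow> t analytic_on {\<nu>} \<and>
     (\<forall>\<^sub>F \<mu> in nhds \<nu>. \<forall>x\<in>Mgrp. t \<mu> * delta m x = mchar \<sigma> x * t \<mu>)"

definition zero_class :: "complex \<Rightarrow> nat \<Rightarrow> (complex \<Rightarrow> complex) \<Rightarrow> bool" where
  "zero_class \<nu> d t \<longleftrightarrow>
     (\<exists>r. r analytic_on {\<nu>} \<and> (\<forall>\<^sub>F \<mu> in nhds \<nu>. t \<mu> = (\<mu> - \<nu>) ^ (d + 1) * r \<mu>))"

definition frobenius :: "int \<Rightarrow> (complex \<Rightarrow> complex) \<Rightarrow> complex \<Rightarrow> germ" where
  "frobenius m t v = (\<lambda>\<mu> k. if k \<in> SO2 then t \<mu> * (inverse (delta m k) * v) else 0)"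

definition D_set :: "int \<Rightarrow> xi \<Rightarrow> germ set list set \<Rightarrow> (complex \<Rightarrow> complex) list set" where
  "D_set m \<xi> W = {ts. list_all2 (\<lambda>(\<sigma>, \<nu>, d) t. hom_germ m \<sigma> \<nu> t) \<xi> ts \<and>
     (\<forall>v. jets \<xi> (map (\<lambda>t. frobenius m t v) ts) \<in> W)}"

definition nonzero_tuple :: "xi \<Rightarrow> (complex \<Rightarrow> complex) list \<Rightarrow> bool" where
  "nonzero_tuple \<xi> ts \<longleftrightarrow> \<not> list_all2 (\<lambda>(\<sigma>, \<nu>, d) t. zero_class \<nu> d t) \<xi> ts"

definition condition_D2 :: "int \<Rightarrow> (complex \<Rightarrow> mat2 \<Rightarrow> complex) \<Rightarrow> bool" where
  "condition_D2 m \<psi> \<longleftrightarrow>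
     (\<forall>\<xi> W. intertwining_datum \<xi> W \<longrightarrow>
        (\<forall>ts\<in>D_set m \<xi> W. nonzero_tuple \<xi> ts \<longrightarrow>
           jets \<xi> (map (\<lambda>t \<mu> k. t \<mu> * \<psi> \<mu> k) ts) \<in> W))"

end

theory Submission
  imports Defs "HOL-Library.Nat_Bijection"
begin

text \<open>
  Let \<open>\<psi>\<^sub>n(\<nu>)\<close> be the coefficient of \<open>\<psi>(\<nu>)\<close> at the \<open>K\<close>-type \<open>n\<close>. Both sides of the equivalence
  say that \<open>\<psi>\<^sub>n = Q m n \<cdot> h\<^sub>n\<close> with \<open>h\<^sub>n\<close> entire and even for all \<open>n\<close>, where \<open>Q m n\<close> is the
  product of the coefficients met on the way from \<open>m\<close> to \<open>n\<close> by raising and lowering operators.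

  Given (D.2), the submodules \<open>W\<^sub>\<lambda>\<close> give (2.b), and the graph of the Knapp-Stein operator inside
  \<open>H\<^bsup>\<lambda>\<^esup> \<oplus> H\<^bsup>-\<lambda>\<^esup>\<close> gives (2.a), which amounts to \<open>Q(-\<nu>) \<psi>\<^sub>n(\<nu>) = Q(\<nu>) \<psi>\<^sub>n(-\<nu>)\<close>. From this
  equation and the vanishing of \<open>\<psi>\<^sub>n\<close> at the zeros of \<open>Q m n\<close>, provided by (2.b), one obtains
  \<open>h\<^sub>n\<close>. Conversely, fix an intertwining datum and \<open>t\<close>. The entire \<open>\<chi>\<close> with \<open>t \<circ> \<chi> \<in> W\<close> are stable
  under \<open>G\<close> and under limits, and \<open>\<delta>\<^sub>m\<close> is one of them. Raising, lowering, and the Casimir operator,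
  which acts by \<open>\<nu>\<^sup>2\<close> up to a constant, give all \<open>Q m n \<cdot> p(\<nu>\<^sup>2)\<close> at the \<open>K\<close>-type \<open>n\<close>; and an even
  entire function agrees to any finite order at finitely many points with a polynomial in \<open>\<nu>\<^sup>2\<close>.
\<close>

subsection \<open>Fourier coefficients of smooth periodic functions\<close>

text \<open>No classification of the closed subrepresentations \<open>W\<close> enters. From (D.2)
  only data with all d = 0 are used: they give conditions at each single parameter, and identities
  between entire functions then contain all jets. In the converse direction the raising and lowering
  operators act on entire sections, where they multiply by polynomials in the parameter; convergence
  uniform on disks controls every jet. Multiplicity one turns all statements into statements about
  scalar functions: Fourier coefficients and matrix coefficients. Two facts make the two conditions
  fit together. The zeros of \<open>Q m n\<close> are simple, so that mere vanishing permits
  division. And for 2 \<lambda> + 1 = s the K-types of the module in (2.b) are those of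
  \<open>Nset s m\<close>, the types that no zero of \<open>Q\<close> separates from m; this merges
  all cases of its definition. The poles of the Knapp-Stein operator sit in a factor
  \<open>cpre\<close> common to all K-types, so (2.a) becomes a relation between the entire
  functions \<open>gf n\<close>.\<close>

definition per :: "(real \<Rightarrow> complex) \<Rightarrow> bool" where
  "per F \<longleftrightarrow> (\<forall>\<theta>. F (\<theta> + 2 * pi) = F \<theta>)"

definition SP :: "(real \<Rightarrow> complex) \<Rightarrow> bool" where
  "SP F \<longleftrightarrow> smooth_real F \<and> per F"

text \<open>The sign is that of \<open>\<theta> \<mapsto> inverse (delta n (rot \<theta>))\<close>, which spans the \<open>K\<close>-type \<open>n\<close> of a
  principal series.\<close>

definition ex :: "int \<Rightarrow> real \<Rightarrow> complex" where
  "ex n \<theta> = cis (- (of_int n * \<theta>))"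

definition fc :: "(real \<Rightarrow> complex) \<Rightarrow> int \<Rightarrow> complex" where
  "fc F n = integral {0..2*pi} (\<lambda>\<theta>. F \<theta> * ex (-n) \<theta>) / (2 * of_real pi)"

definition sn :: "nat \<Rightarrow> (real \<Rightarrow> complex) \<Rightarrow> real" where
  "sn j F = (SUP \<theta>. norm ((vderiv ^^ j) F \<theta>))"

lemma snorm_sn: "snorm j \<phi> = sn j (\<lambda>s. \<phi> (rot s))"
  by (simp add: snorm_def sn_def)

text \<open>Naming the whole tower of derivatives \<open>G\<close> in advance gives smoothness and a
  formula for every iterated \<open>vderiv\<close> by a single induction.\<close>

lemma smooth_realI:
  assumes "G 0 = F" "\<And>j \<theta>. (G j has_vector_derivative G (Suc j) \<theta>) (at \<theta>)"
  shows "smooth_real F" "(vderiv ^^ j) F = G j"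
proof -
  have *: "(vderiv ^^ j) F = G j" for j
  proof (induction j)
    case (Suc j)
    then show ?case
      using assms(2) by (auto simp: vderiv_def vector_derivative_at)
  qed (simp add: assms)
  show "(vderiv ^^ j) F = G j" by (rule *)
  show "smooth_real F"
    unfolding smooth_real_def * using assms(2)
    by (meson differentiableI_vector)
qed

lemma smooth_real_vd:
  assumes "smooth_real F"
  shows "((vderiv ^^ j) F has_vector_derivative (vderiv ^^ (Suc j)) F \<theta>) (at \<theta>)"
  using assms unfolding smooth_real_def by (simp add: vderiv_def vector_derivative_works)

lemma smooth_real_vderiv: "smooth_real F \<Longrightarrow> smooth_real (vderiv F)"
  unfolding smooth_real_def by (metis funpow_Suc_right comp_apply)

lemma smooth_add:
  assumes "smooth_real F" "smooth_real G"
  shows "smooth_real (\<lambda>\<theta>. F \<theta> + G \<theta>)"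
    "(vderiv ^^ j) (\<lambda>\<theta>. F \<theta> + G \<theta>) = (\<lambda>\<theta>. (vderiv ^^ j) F \<theta> + (vderiv ^^ j) G \<theta>)"
  by (rule smooth_realI[where G = "\<lambda>j \<theta>. (vderiv ^^ j) F \<theta> + (vderiv ^^ j) G \<theta>"],
      simp, intro has_vector_derivative_add smooth_real_vd assms)+

lemma smooth_scale:
  assumes "smooth_real F"
  shows "smooth_real (\<lambda>\<theta>. c * F \<theta>)"
    "(vderiv ^^ j) (\<lambda>\<theta>. c * F \<theta>) = (\<lambda>\<theta>. c * (vderiv ^^ j) F \<theta>)"
  by (rule smooth_realI[where G = "\<lambda>j \<theta>. c * (vderiv ^^ j) F \<theta>"],
      simp, intro has_vector_derivative_mult_right smooth_real_vd assms)+

lemma smooth_diff: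
  assumes "smooth_real F" "smooth_real G"
  shows "smooth_real (\<lambda>\<theta>. F \<theta> - G \<theta>)"
    "(vderiv ^^ j) (\<lambda>\<theta>. F \<theta> - G \<theta>) = (\<lambda>\<theta>. (vderiv ^^ j) F \<theta> - (vderiv ^^ j) G \<theta>)"
  by (rule smooth_realI[where G = "\<lambda>j \<theta>. (vderiv ^^ j) F \<theta> - (vderiv ^^ j) G \<theta>"],
      simp, intro has_vector_derivative_diff smooth_real_vd assms)+

lemma smooth_cont: "smooth_real F \<Longrightarrow> continuous_on A ((vderiv ^^ j) F)"
  by (meson continuous_at_imp_continuous_on smooth_real_vd has_vector_derivative_continuous)

lemma smooth_cont0: "smooth_real F \<Longrightarrow> continuous_on A F"
  using smooth_cont[of F A 0] by simp

lemma ex_deriv: "(ex n has_vector_derivative (- \<i> * of_int n) * ex n \<theta>) (at \<theta>)"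
proof -
  have "((\<lambda>z. exp (- \<i> * of_int n * z)) has_field_derivative
     (- \<i> * of_int n) * exp (- \<i> * of_int n * of_real \<theta>)) (at (of_real \<theta>))"
    by (auto intro!: derivative_eq_intros)
  from has_vector_derivative_real_field[OF this] show ?thesis
    by (simp add: ex_def[abs_def] cis_conv_exp mult.assoc)
qed

lemma ex_vd: "smooth_real (ex n)" "(vderiv ^^ j) (ex n) = (\<lambda>\<theta>. (- \<i> * of_int n) ^ j * ex n \<theta>)"
proof -
  have *: "((\<lambda>\<theta>. (- \<i> * of_int n) ^ j * ex n \<theta>) has_vector_derivative
          (- \<i> * of_int n) ^ (Suc j) * ex n \<theta>) (at \<theta>)" for j \<theta>
    using has_vector_derivative_mult_right[OF ex_deriv, of "(- \<i> * of_int n) ^ j" n \<theta>]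
    by (simp add: mult_ac)
  show "smooth_real (ex n)" "(vderiv ^^ j) (ex n) = (\<lambda>\<theta>. (- \<i> * of_int n) ^ j * ex n \<theta>)"
    by (rule smooth_realI[where G = "\<lambda>j \<theta>. (- \<i> * of_int n) ^ j * ex n \<theta>"], simp, rule *)+
qed

lemma norm_ex [simp]: "norm (ex n \<theta>) = 1"
  by (simp add: ex_def)

lemma ex_mult: "ex n \<theta> * ex p \<theta> = ex (n + p) \<theta>"
  by (simp add: ex_def cis_mult algebra_simps)

lemma ex_0 [simp]: "ex 0 \<theta> = 1" by (simp add: ex_def)

lemma ex_add: "ex n (a + b) = ex n a * ex n b"
  by (simp add: ex_def cis_mult algebra_simps)

lemma ex_2pi [simp]: "ex n (2 * pi) = 1"
  using cis_multiple_2pi[of "- of_int n"] by (simp add: ex_def mult_ac)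

lemma per_ex: "per (ex n)"
  by (simp add: per_def ex_add)

lemma SP_ex [simp]: "SP (ex n)"
  by (simp add: SP_def per_ex ex_vd)

lemma per_int: assumes "per F" shows "F (\<theta> + 2 * pi * of_int n) = F \<theta>"
proof -
  have nat: "F (\<theta> + 2 * pi * real k) = F \<theta>" for k \<theta>
  proof (induction k arbitrary: \<theta>)
    case (Suc k)
    have "F (\<theta> + 2 * pi * real (Suc k)) = F ((\<theta> + 2 * pi * real k) + 2 * pi)"
      by (simp add: algebra_simps)
    then show ?case using Suc assms by (simp add: per_def)
  qed simp
  show ?thesis
  proof (cases "n \<ge> 0")
    case True then show ?thesis using nat[of \<theta> "nat n"] by simp
  next
    case False
    then show ?thesis using nat[of "\<theta> + 2 * pi * of_int n" "nat (- n)"] by simp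
  qed
qed

lemma per_reduce: obtains t where "t \<in> {0..2*pi}" "\<And>F. per F \<Longrightarrow> F t = F \<theta>"
proof
  let ?n = "\<lfloor>\<theta> / (2 * pi)\<rfloor>"
  let ?t = "\<theta> + 2 * pi * of_int (- ?n)"
  show "F ?t = F \<theta>" if "per F" for F using per_int[OF that] .
  have pi2: "0 < 2 * pi" by simp
  have "of_int ?n \<le> \<theta> / (2 * pi)" "\<theta> / (2 * pi) < of_int ?n + 1" by linarith+
  then have "of_int ?n * (2 * pi) \<le> \<theta>" "\<theta> < (of_int ?n + 1) * (2 * pi)"
    by (metis pos_le_divide_eq pi2, metis pos_divide_less_eq pi2)
  then have "0 \<le> ?t" "?t \<le> 2 * pi" unfolding of_int_minus by argo+
  then show "?t \<in> {0..2*pi}" by simp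
qed

text \<open>Angles are mostly obtained through \<open>Arg\<close>, hence known only modulo 2 pi.
  Comparing them through \<open>cis\<close> avoids keeping track of the multiple.\<close>

lemma per_cis: assumes "per F" "cis a = cis b" shows "F a = F b"
proof -
  have "sin a = sin b \<and> cos a = cos b" using assms(2) by (simp add: complex_eq_iff)
  then obtain n :: int where "a = b + 2 * pi * of_int n"
    using sin_cos_eq_iff[of a b] by (auto simp: mult_ac)
  then show ?thesis using per_int[OF assms(1)] by simp
qed

lemma per_vd: assumes "smooth_real F" "per F" shows "per ((vderiv ^^ j) F)"
proof (induction j)
  case (Suc j)
  show ?case unfolding per_def
  proof
    fix \<theta>
    have "((vderiv ^^ j) F has_vector_derivative (vderiv ^^ Suc j) F (\<theta> + 2*pi)) (at (\<theta> + 2 * pi))"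
      by (rule smooth_real_vd[OF assms(1)])
    then have "((vderiv ^^ j) F \<circ> (\<lambda>x. x + 2 * pi) has_vector_derivative
        1 *\<^sub>R (vderiv ^^ Suc j) F (\<theta> + 2*pi)) (at \<theta>)"
      by (intro vector_diff_chain_at) (auto intro!: derivative_eq_intros)
    also have "(vderiv ^^ j) F \<circ> (\<lambda>x. x + 2 * pi) = (vderiv ^^ j) F"
      using Suc by (auto simp: per_def)
    finally show "(vderiv ^^ Suc j) F (\<theta> + 2 * pi) = (vderiv ^^ Suc j) F \<theta>"
      using smooth_real_vd[OF assms(1), of j \<theta>] vector_derivative_unique_at by fastforce
  qed
qed (use assms in simp)

lemma SP_vderiv: "SP F \<Longrightarrow> SP (vderiv F)"
  using per_vd[of F 1] by (simp add: SP_def smooth_real_vderiv)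

lemma SP_vd: "SP F \<Longrightarrow> SP ((vderiv ^^ j) F)"
  by (induction j) (auto intro: SP_vderiv)

lemma SP_add: "SP F \<Longrightarrow> SP G \<Longrightarrow> SP (\<lambda>\<theta>. F \<theta> + G \<theta>)"
  by (auto simp: SP_def per_def smooth_add)
lemma SP_diff: "SP F \<Longrightarrow> SP G \<Longrightarrow> SP (\<lambda>\<theta>. F \<theta> - G \<theta>)"
  by (auto simp: SP_def per_def smooth_diff)
lemma SP_scale: "SP F \<Longrightarrow> SP (\<lambda>\<theta>. c * F \<theta>)"
  by (auto simp: SP_def per_def smooth_scale)
lemma SP_0: "SP (\<lambda>_. 0)"
  using SP_scale[OF SP_ex, of 0 0] by simp

lemma SP_cont: "SP F \<Longrightarrow> continuous_on A F"
  by (simp add: SP_def smooth_cont0)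

lemma per_cont_bounded:
  assumes "per F" "continuous_on UNIV F" shows "bounded (range F)"
proof -
  have "compact (F ` {0..2*pi})"
    by (intro compact_continuous_image continuous_on_subset[OF assms(2)]) auto
  moreover have "range F \<subseteq> F ` {0..2*pi}"
  proof
    fix y assume "y \<in> range F"
    then obtain \<theta> where y: "y = F \<theta>" by blast
    obtain t where "t \<in> {0..2*pi}" "F t = F \<theta>" using per_reduce[of \<theta>] assms(1) by metis
    then show "y \<in> F ` {0..2*pi}" unfolding y by (metis imageI)
  qed
  ultimately show ?thesis using bounded_subset compact_imp_bounded by blast
qed

lemma sn_bdd: assumes "SP F" shows "bdd_above (range (\<lambda>\<theta>. norm ((vderiv ^^ j) F \<theta>)))"
proof -
  have "bounded (range ((vderiv ^^ j) F))"
    using assms by (intro per_cont_bounded) (auto simp: SP_def intro: per_vd smooth_cont)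
  then obtain B where "\<And>\<theta>. norm ((vderiv ^^ j) F \<theta>) \<le> B" by (auto simp: bounded_iff)
  then show ?thesis by (intro bdd_aboveI2)
qed

lemma sn_upper: "SP F \<Longrightarrow> norm ((vderiv ^^ j) F \<theta>) \<le> sn j F"
  unfolding sn_def by (rule cSUP_upper[OF _ sn_bdd]) auto

lemma sn_upper0: "SP F \<Longrightarrow> norm (F \<theta>) \<le> sn 0 F"
  using sn_upper[of F 0] by simp

lemma sn_least: "(\<And>\<theta>. norm ((vderiv ^^ j) F \<theta>) \<le> B) \<Longrightarrow> sn j F \<le> B"
  unfolding sn_def by (rule cSUP_least) auto

lemma sn_nonneg: "SP F \<Longrightarrow> 0 \<le> sn j F"
  using sn_upper[of F j 0] norm_ge_zero order_trans by blast

lemma sn_scale: "SP F \<Longrightarrow> sn j (\<lambda>\<theta>. c * F \<theta>) \<le> norm c * sn j F"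
  by (rule sn_least) (simp add: SP_def[THEN iffD1] smooth_scale norm_mult mult_left_mono sn_upper)

lemma cont_ex: "continuous_on A (ex n)"
  by (rule smooth_cont0[OF ex_vd(1)])

lemma integrable_fc: "continuous_on UNIV F \<Longrightarrow> (\<lambda>\<theta>. F \<theta> * ex n \<theta>) integrable_on {0..2*pi}"
  by (intro integrable_continuous_real continuous_intros cont_ex) (auto intro: continuous_on_subset)

lemma fc_bound:
  assumes "continuous_on UNIV F" "\<And>\<theta>. norm (F \<theta>) \<le> B" shows "norm (fc F n) \<le> B"
proof -
  have "norm (integral {0..2*pi} (\<lambda>\<theta>. F \<theta> * ex (-n) \<theta>)) \<le> B * (2 * pi - 0)"
    by (rule integral_bound)
       (auto intro!: continuous_intros cont_ex continuous_on_subset[OF assms(1)] simp: norm_mult assms)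
  then show ?thesis by (simp add: fc_def norm_divide norm_mult field_simps)
qed

lemma fc_add: "continuous_on UNIV F \<Longrightarrow> continuous_on UNIV G \<Longrightarrow>
    fc (\<lambda>\<theta>. F \<theta> + G \<theta>) n = fc F n + fc G n"
  by (simp add: fc_def distrib_right integral_add integrable_fc add_divide_distrib)

lemma fc_diff: "continuous_on UNIV F \<Longrightarrow> continuous_on UNIV G \<Longrightarrow>
    fc (\<lambda>\<theta>. F \<theta> - G \<theta>) n = fc F n - fc G n"
  by (simp add: fc_def left_diff_distrib integral_diff integrable_fc diff_divide_distrib)

lemma fc_scale: "fc (\<lambda>\<theta>. c * F \<theta>) n = c * fc F n"
  by (simp add: fc_def mult.assoc)

lemma integral_ex: "integral {0..2*pi} (ex n) = (if n = 0 then 2 * of_real pi else 0)"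
proof (cases "n = 0")
  case True
  have "ex 0 = (\<lambda>_. 1)" by (simp add: fun_eq_iff)
  with True show ?thesis by (simp add: scaleR_conv_of_real)
next
  case False
  have "((\<lambda>\<theta>. ex n \<theta>) has_integral
     (ex n (2*pi) / (- \<i> * of_int n) - ex n 0 / (- \<i> * of_int n))) {0..2*pi}"
  proof (rule fundamental_theorem_of_calculus)
    fix x assume "x \<in> {0..2*pi}"
    have "((\<lambda>\<theta>. inverse (- \<i> * of_int n) * ex n \<theta>) has_vector_derivative
       inverse (- \<i> * of_int n) * ((- \<i> * of_int n) * ex n x)) (at x)"
      by (intro has_vector_derivative_mult_right ex_deriv)
    then show "((\<lambda>\<theta>. ex n \<theta> / (- \<i> * of_int n)) has_vector_derivative ex n x) (at x within {0..2*pi})"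
      using False by (auto intro!: has_vector_derivative_at_within simp: field_simps)
  qed simp
  then show ?thesis using False by (auto simp: ex_def[of n 0] dest: integral_unique)
qed

lemma fc_ex: "fc (ex p) n = (if n = p then 1 else 0)"
  by (simp add: fc_def ex_mult integral_ex)

lemma fc_vderiv: assumes "SP F" shows "fc (vderiv F) n = - \<i> * of_int n * fc F n"
proof -
  have sm: "smooth_real F" using assms by (simp add: SP_def)
  have d: "((\<lambda>\<theta>. F \<theta> * ex (-n) \<theta>) has_vector_derivative
      F \<theta> * ((- \<i> * of_int (-n)) * ex (-n) \<theta>) + vderiv F \<theta> * ex (-n) \<theta>) (at \<theta>)" for \<theta>
    using smooth_real_vd[OF sm, of 0 \<theta>] by (intro has_vector_derivative_mult ex_deriv) simp
  have "((\<lambda>\<theta>. F \<theta> * ((- \<i> * of_int (-n)) * ex (-n) \<theta>) + vderiv F \<theta> * ex (-n) \<theta>) has_integral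
      (F (2*pi) * ex (-n) (2*pi) - F 0 * ex (-n) 0)) {0..2*pi}"
    by (rule fundamental_theorem_of_calculus) (use d in \<open>auto intro: has_vector_derivative_at_within\<close>)
  moreover have "F (2*pi) = F 0" using assms by (metis SP_def per_def add_0)
  moreover have "ex (-n) 0 = 1" by (simp add: ex_def)
  ultimately have 0: "integral {0..2*pi} (\<lambda>\<theta>. F \<theta> * ((- \<i> * of_int (-n)) * ex (-n) \<theta>) + vderiv F \<theta> * ex (-n) \<theta>) = 0"
    by (simp add: integral_unique)
  have "(\<lambda>\<theta>. F \<theta> * ((- \<i> * of_int (-n)) * ex (-n) \<theta>)) = (\<lambda>\<theta>. (- \<i> * of_int (-n)) * (F \<theta> * ex (-n) \<theta>))"
    by (auto simp: mult_ac)
  then have "(- \<i> * of_int (-n)) * integral {0..2*pi} (\<lambda>\<theta>. F \<theta> * ex (-n) \<theta>) +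
     integral {0..2*pi} (\<lambda>\<theta>. vderiv F \<theta> * ex (-n) \<theta>) = 0"
    using 0 integrable_fc[OF SP_cont[OF assms], of "-n"] integrable_fc[OF SP_cont[OF SP_vderiv[OF assms]], of "-n"]
    by (subst (asm) integral_add) (auto intro!: integrable_on_mult_right)
  then show ?thesis unfolding fc_def by (simp add: field_simps add_eq_0_iff)
qed

lemma fc_vd: "SP F \<Longrightarrow> fc ((vderiv ^^ j) F) n = (- \<i> * of_int n) ^ j * fc F n"
proof (induction j)
  case (Suc j)
  then show ?case using fc_vderiv[OF SP_vd[OF Suc.prems, of j], of n] by simp
qed simp

lemma fc_decay: assumes "SP F" shows "\<bar>of_int n\<bar> ^ j * norm (fc F n) \<le> sn j F"
proof -
  have "norm (fc ((vderiv ^^ j) F) n) \<le> sn j F"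
    using assms by (intro fc_bound SP_cont SP_vd sn_upper)
  then show ?thesis by (simp add: fc_vd[OF assms] norm_mult norm_power)
qed

text \<open>The weight 1 + |n| stays positive at n = 0, where \<open>fc_decay\<close> with j > 0
  says nothing; the term \<open>sn 0 F\<close> covers that coefficient. For n \<noteq> 0 one has 1 +
  |n| \<le> 2 |n|, whence the power of 2.\<close>

lemma fc_decay': assumes "SP F"
  shows "(1 + \<bar>of_int n\<bar>) ^ j * norm (fc F n) \<le> 2 ^ j * (sn 0 F + sn j F)"
proof (cases "n = 0")
  case True
  have "norm (fc F 0) \<le> sn 0 F" using fc_decay[OF assms, of 0 0] by simp
  moreover have "1 * (sn 0 F + sn j F) \<le> 2 ^ j * (sn 0 F + sn j F)"
    using sn_nonneg[OF assms] by (intro mult_right_mono) (auto intro: add_nonneg_nonneg)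
  ultimately show ?thesis using True sn_nonneg[OF assms, of j] by simp
next
  case False
  then have "(1::real) \<le> \<bar>of_int n\<bar>" by linarith
  then have "(1 + \<bar>of_int n\<bar>) ^ j \<le> (2 * \<bar>of_int n\<bar> :: real) ^ j" by (intro power_mono) auto
  then have "(1 + \<bar>of_int n\<bar>) ^ j * norm (fc F n) \<le> 2 ^ j * (\<bar>of_int n\<bar> ^ j * norm (fc F n))"
    by (metis mult.assoc mult_right_mono norm_ge_zero power_mult_distrib)
  also have "\<dots> \<le> 2 ^ j * (sn 0 F + sn j F)"
    using fc_decay[OF assms, of n j] sn_nonneg[OF assms, of 0] by (intro mult_left_mono) auto
  finally show ?thesis .
qed

subsection \<open>Rapidly decreasing Fourier series\<close>

text \<open>Rapid decrease: these are exactly the coefficient sequences of smooth periodic functions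
  (\<open>rd_fc\<close>, \<open>SP_ser\<close>, \<open>fc_ser\<close>).\<close>

definition rd :: "(int \<Rightarrow> complex) \<Rightarrow> bool" where
  "rd a \<longleftrightarrow> (\<forall>K. \<exists>C. \<forall>n. (1 + \<bar>of_int n\<bar>) ^ K * norm (a n) \<le> C)"

text \<open>The enumeration \<open>int_decode\<close> turns a sum over the integers into an ordinary
  series. For \<open>rd\<close> sequences it converges absolutely, so the order is
  immaterial.\<close>

definition ser :: "(int \<Rightarrow> complex) \<Rightarrow> real \<Rightarrow> complex" where
  "ser a \<theta> = (\<Sum>j. a (int_decode j) * ex (int_decode j) \<theta>)"

definition wt :: "nat \<Rightarrow> real" where "wt j = 1 / (1 + \<bar>of_int (int_decode j)\<bar>) ^ 2"

definition wsum :: real where "wsum = (\<Sum>j. wt j)"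

lemma int_encode_bound: "real (int_encode n) \<le> 2 * \<bar>of_int n\<bar>"
  by (auto simp: int_encode_def sum_encode_def)

lemma wt_pos: "wt j > 0"
  unfolding wt_def by (intro divide_pos_pos zero_less_power) (auto intro: add_pos_nonneg)

text \<open>Since j \<le> 2 |n| for n = \<open>int_decode j\<close>, one has 1 + j \<le> 2 (1 +
  |n|), which compares \<open>wt j\<close> with 4 / (1 + j)^2.\<close>

lemma summable_wt: "summable wt"
proof (rule summable_comparison_test)
  show "summable (\<lambda>j. 4 * (1 / real (Suc j) ^ 2))"
  proof (rule summable_mult)
    have "summable (\<lambda>n. inverse (real (Suc n) ^ 2))"
      using inverse_power_summable[of 2, where 'a=real] by (subst summable_Suc_iff) simp
    then show "summable (\<lambda>j. 1 / real (Suc j) ^ 2)" by (simp only: inverse_eq_divide)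
  qed
  have "wt j \<le> 4 * (1 / real (Suc j) ^ 2)" for j
  proof -
    have "real j \<le> 2 * \<bar>of_int (int_decode j)\<bar>"
      using int_encode_bound[of "int_decode j"] by simp
    then have "real (Suc j) ^ 2 \<le> (2 * (1 + \<bar>of_int (int_decode j)\<bar>)) ^ 2"
      by (intro power_mono) auto
    then have "real (Suc j) ^ 2 \<le> 4 * (1 + \<bar>of_int (int_decode j)\<bar> :: real) ^ 2"
      unfolding power_mult_distrib by simp
    moreover have "(1 + \<bar>of_int (int_decode j)\<bar> :: real) ^ 2 > 0"
      by (intro zero_less_power) (auto intro: add_pos_nonneg)
    ultimately show ?thesis unfolding wt_def by (simp add: field_simps)
  qed
  then show "\<exists>N. \<forall>n\<ge>N. norm (wt n) \<le> 4 * (1 / real (Suc n) ^ 2)"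
    using wt_pos by (auto intro!: exI[of _ 0] simp: abs_of_pos)
qed

lemma wsum_pos: "wsum > 0"
  unfolding wsum_def by (rule suminf_pos[OF summable_wt wt_pos])

text \<open>All series over \<open>\<int>\<close> are dominated by \<open>C * wt\<close>.\<close>

lemma weight_bound:
  assumes "(1 + \<bar>of_int (int_decode j)\<bar>) ^ (K + 2) * x \<le> C"
  shows "(1 + \<bar>of_int (int_decode j)\<bar>) ^ K * x \<le> C * wt j"
proof -
  define y :: real where "y = 1 + \<bar>of_int (int_decode j)\<bar>"
  have "y > 0" unfolding y_def by (auto intro: add_pos_nonneg)
  then show ?thesis using assms unfolding wt_def y_def[symmetric]
    by (simp add: power_add field_simps power2_eq_square)
qed

lemma rdD2: assumes "rd a" obtains C where "C \<ge> 0" "\<And>j. (1 + \<bar>of_int (int_decode j)\<bar>) ^ K * norm (a (int_decode j)) \<le> C * wt j"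
proof -
  obtain C where C: "\<And>n. (1 + \<bar>of_int n\<bar>) ^ (K+2) * norm (a n) \<le> C" using assms unfolding rd_def by blast
  have "0 \<le> (1 + \<bar>of_int 0\<bar>) ^ (K+2) * norm (a 0)" by simp
  then have "0 \<le> C" using C[of 0] by linarith
  then show ?thesis using that[OF _ weight_bound[OF C]] by blast
qed

lemma rdI: "(\<And>K. \<exists>C. \<forall>n. (1 + \<bar>of_int n\<bar>) ^ K * norm (a n) \<le> C) \<Longrightarrow> rd a"
  by (auto simp: rd_def)

lemma rd_fc: "SP F \<Longrightarrow> rd (fc F)"
  by (rule rdI) (meson fc_decay')

lemma rd_mult_poly:
  assumes "rd a" "\<And>n. norm (b n) \<le> B * (1 + \<bar>of_int n\<bar>) ^ K"
  shows "rd (\<lambda>n. b n * a n)"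
proof (rule rdI)
  fix L
  obtain C where C: "\<And>n. (1 + \<bar>of_int n\<bar>) ^ (K + L) * norm (a n) \<le> C"
    using assms(1) unfolding rd_def by blast
  have B: "B \<ge> 0" using order_trans[OF norm_ge_zero assms(2)[of 0]] by simp
  have "(1 + \<bar>of_int n\<bar>) ^ L * norm (b n * a n) \<le> B * C" for n
  proof -
    have "(1 + \<bar>of_int n\<bar>) ^ L * norm (b n * a n) \<le> (1 + \<bar>of_int n\<bar>) ^ L * ((B * (1 + \<bar>of_int n\<bar>) ^ K) * norm (a n))"
      unfolding norm_mult by (intro mult_left_mono mult_right_mono assms(2)) auto
    also have "\<dots> = B * ((1 + \<bar>of_int n\<bar>) ^ (K + L) * norm (a n))" by (simp add: power_add)
    also have "\<dots> \<le> B * C" using C B by (intro mult_left_mono) auto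
    finally show ?thesis .
  qed
  then show "\<exists>C. \<forall>n. (1 + \<bar>of_int n\<bar>) ^ L * norm (b n * a n) \<le> C" by blast
qed

lemma ser_summable:
  assumes "rd a"
  shows "summable (\<lambda>j. norm (a (int_decode j)))"
    "summable (\<lambda>j. norm (a (int_decode j) * ex (int_decode j) \<theta>))"
    "summable (\<lambda>j. a (int_decode j) * ex (int_decode j) \<theta>)"
proof -
  obtain C where C: "\<And>j. (1 + \<bar>of_int (int_decode j)\<bar>) ^ 0 * norm (a (int_decode j)) \<le> C * wt j"
    using rdD2[OF assms, where K = 0] by metis
  show 1: "summable (\<lambda>j. norm (a (int_decode j)))"
    by (rule summable_comparison_test[OF _ summable_mult[OF summable_wt, of C]]) (use C in auto)
  then show "summable (\<lambda>j. norm (a (int_decode j) * ex (int_decode j) \<theta>))"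
    by (simp add: norm_mult)
  then show "summable (\<lambda>j. a (int_decode j) * ex (int_decode j) \<theta>)"
    by (rule summable_norm_cancel)
qed

lemma ser_bound:
  assumes "rd a" "\<And>j. norm (a (int_decode j)) \<le> C * wt j" shows "norm (ser a \<theta>) \<le> C * wsum"
proof -
  have "norm (ser a \<theta>) \<le> (\<Sum>j. norm (a (int_decode j) * ex (int_decode j) \<theta>))"
    unfolding ser_def by (rule summable_norm[OF ser_summable(2)[OF assms(1)]])
  also have "\<dots> \<le> (\<Sum>j. C * wt j)"
    by (intro suminf_le summable_mult summable_wt ser_summable[OF assms(1)])
       (use assms(2) in \<open>auto simp: norm_mult\<close>)
  also have "\<dots> = C * wsum" unfolding wsum_def by (rule suminf_mult[OF summable_wt])
  finally show ?thesis .
qed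

lemma ser_uniform:
  assumes "rd a"
  shows "uniform_limit UNIV (\<lambda>N \<theta>. \<Sum>j<N. a (int_decode j) * ex (int_decode j) \<theta>) (ser a) sequentially"
  unfolding ser_def[abs_def]
  by (rule Weierstrass_m_test[OF _ ser_summable(1)[OF assms]]) (simp add: norm_mult)

lemma rd_vd: "rd a \<Longrightarrow> rd (\<lambda>n. (- \<i> * of_int n) ^ j * a n)"
proof (rule rd_mult_poly[where B = 1 and K = j])
  show "norm ((- \<i> * of_int n) ^ j :: complex) \<le> 1 * (1 + \<bar>of_int n\<bar>) ^ j" for n
    by (simp add: norm_mult norm_power power_mono)
qed

text \<open>Termwise differentiation: the factor n keeps the coefficients rapidly decreasing, so the
  differentiated series converges uniformly.\<close>

lemma ser_deriv:
  assumes "rd a"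
  shows "(ser a has_vector_derivative ser (\<lambda>n. (- \<i> * of_int n) * a n) \<theta>) (at \<theta>)"
proof -
  let ?a' = "\<lambda>n. (- \<i> * of_int n) * a n"
  have rd': "rd ?a'" using rd_vd[OF assms, of 1] by simp
  have ul: "uniform_limit UNIV (\<lambda>N \<theta>. \<Sum>j<N. ?a' (int_decode j) * ex (int_decode j) \<theta>) (ser ?a') sequentially"
    by (rule ser_uniform[OF rd'])
  have "\<exists>g. \<forall>x\<in>UNIV. (\<lambda>j. a (int_decode j) * ex (int_decode j) x) sums g x \<and>
     (g has_derivative (\<lambda>h. h *\<^sub>R ser ?a' x)) (at x within UNIV)"
  proof (rule has_derivative_series[where x = 0 and
         f' = "\<lambda>j x h. h *\<^sub>R (?a' (int_decode j) * ex (int_decode j) x)"])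
    show "((\<lambda>x. a (int_decode j) * ex (int_decode j) x) has_derivative
        (\<lambda>h. h *\<^sub>R (?a' (int_decode j) * ex (int_decode j) x))) (at x within UNIV)" for j x
      using has_vector_derivative_mult_right[OF ex_deriv, of "a (int_decode j)" "int_decode j" x]
      by (simp add: has_vector_derivative_def mult_ac)
  next
    fix e :: real assume "e > 0"
    have "\<forall>\<^sub>F N in sequentially. \<forall>x\<in>UNIV. dist (\<Sum>j<N. ?a' (int_decode j) * ex (int_decode j) x) (ser ?a' x) < e"
      using ul \<open>e > 0\<close> unfolding uniform_limit_iff by blast
    then show "\<forall>\<^sub>F N in sequentially. \<forall>x\<in>UNIV. \<forall>h. norm ((\<Sum>j<N. h *\<^sub>R (?a' (int_decode j) * ex (int_decode j) x)) - h *\<^sub>R ser ?a' x) \<le> e * norm h"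
    proof eventually_elim
      case (elim N)
      show ?case
      proof (intro ballI allI)
        fix x h
        have "norm ((\<Sum>j<N. h *\<^sub>R (?a' (int_decode j) * ex (int_decode j) x)) - h *\<^sub>R ser ?a' x)
          = \<bar>h\<bar> * norm ((\<Sum>j<N. ?a' (int_decode j) * ex (int_decode j) x) - ser ?a' x)"
          unfolding scaleR_sum_right[symmetric] scaleR_diff_right[symmetric] by simp
        also have "\<dots> \<le> \<bar>h\<bar> * e"
          using elim by (intro mult_left_mono) (auto simp: dist_norm less_imp_le)
        finally show "norm ((\<Sum>j<N. h *\<^sub>R (?a' (int_decode j) * ex (int_decode j) x)) - h *\<^sub>R ser ?a' x) \<le> e * norm h"
          by (simp add: mult.commute)
      qed
    qed
  next
    show "(\<lambda>j. a (int_decode j) * ex (int_decode j) 0) sums ser a 0"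
      unfolding ser_def by (rule summable_sums[OF ser_summable(3)[OF assms]])
  qed auto
  then obtain g where g: "\<And>x. (\<lambda>j. a (int_decode j) * ex (int_decode j) x) sums g x"
     "\<And>x. (g has_derivative (\<lambda>h. h *\<^sub>R ser ?a' x)) (at x)" by blast
  have "g = ser a" unfolding ser_def[abs_def] using g(1) by (simp add: fun_eq_iff sums_unique)
  then show ?thesis using g(2) by (simp add: has_vector_derivative_def)
qed

lemma ser_vd:
  assumes "rd a"
  shows "smooth_real (ser a)" "(vderiv ^^ j) (ser a) = ser (\<lambda>n. (- \<i> * of_int n) ^ j * a n)"
proof -
  have d: "(ser (\<lambda>n. (- \<i> * of_int n) ^ j * a n) has_vector_derivative
      ser (\<lambda>n. (- \<i> * of_int n) ^ Suc j * a n) \<theta>) (at \<theta>)" for j \<theta>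
    using ser_deriv[OF rd_vd[OF assms, of j], of \<theta>] by (simp add: mult.assoc)
  show "smooth_real (ser a)" "(vderiv ^^ j) (ser a) = ser (\<lambda>n. (- \<i> * of_int n) ^ j * a n)"
    by (rule smooth_realI[where G = "\<lambda>j. ser (\<lambda>n. (- \<i> * of_int n) ^ j * a n)"], simp, rule d)+
qed

lemma SP_ser: "rd a \<Longrightarrow> SP (ser a)"
  by (auto simp: SP_def ser_vd per_def ser_def ex_add)

text \<open>Of the i + 2 powers of the weight, i pay for the derivatives and two for summability
  against \<open>wt\<close>.\<close>

lemma sn_ser:
  assumes "\<And>n. (1 + \<bar>of_int n\<bar>) ^ (i + 2) * norm (a n) \<le> C" "rd a"
  shows "sn i (ser a) \<le> C * wsum"
proof (rule sn_least)
  fix \<theta>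
  show "norm ((vderiv ^^ i) (ser a) \<theta>) \<le> C * wsum"
    unfolding ser_vd(2)[OF assms(2)]
  proof (rule ser_bound[OF rd_vd[OF assms(2)]])
    fix j
    let ?n = "int_decode j"
    have "norm ((- \<i> * of_int ?n) ^ i * a ?n) \<le> (1 + \<bar>of_int ?n\<bar>) ^ i * norm (a ?n)"
      by (auto simp: norm_mult norm_power intro!: mult_right_mono power_mono)
    also have "\<dots> \<le> C * wt j" by (rule weight_bound[OF assms(1)])
    finally show "norm ((- \<i> * of_int ?n) ^ i * a ?n) \<le> C * wt j" .
  qed
qed

lemma fc_sum: "finite A \<Longrightarrow> (\<And>j. j \<in> A \<Longrightarrow> continuous_on UNIV (F j)) \<Longrightarrow>
    fc (\<lambda>\<theta>. \<Sum>j\<in>A. F j \<theta>) n = (\<Sum>j\<in>A. fc (F j) n)"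
proof (induction A rule: finite_induct)
  case empty
  then show ?case by (simp add: fc_def)
next
  case (insert x A)
  then show ?case by (simp add: fc_add continuous_on_sum)
qed

lemma fc_uniform_limit:
  assumes "\<And>N. continuous_on UNIV (P N)" "continuous_on UNIV F" "uniform_limit UNIV P F sequentially"
  shows "(\<lambda>N. fc (P N) n) \<longlonglongrightarrow> fc F n"
proof (rule LIMSEQ_I)
  fix e :: real assume "e > 0"
  then obtain N0 where N0: "\<And>N x. N \<ge> N0 \<Longrightarrow> dist (P N x) (F x) < e/2"
    using assms(3) unfolding uniform_limit_iff eventually_sequentially
    by (metis UNIV_I half_gt_zero_iff)
  have "norm (fc (P N) n - fc F n) < e" if "N \<ge> N0" for N
  proof -
    have "norm (fc (\<lambda>\<theta>. P N \<theta> - F \<theta>) n) \<le> e/2"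
      by (rule fc_bound) (use N0[OF that] assms in \<open>auto intro!: continuous_intros simp: dist_norm less_imp_le\<close>)
    then show ?thesis using fc_diff[OF assms(1,2), of N n] \<open>e > 0\<close> by simp
  qed
  then show "\<exists>no. \<forall>N\<ge>no. norm (fc (P N) n - fc F n) < e" by blast
qed

lemma fc_ser: assumes "rd a" shows "fc (ser a) n = a n"
proof -
  let ?P = "\<lambda>N \<theta>. \<Sum>j<N. a (int_decode j) * ex (int_decode j) \<theta>"
  have "(\<lambda>N. fc (?P N) n) \<longlonglongrightarrow> fc (ser a) n"
    by (rule fc_uniform_limit[OF _ _ ser_uniform[OF assms]])
       (auto intro!: continuous_intros cont_ex SP_cont[OF SP_ser[OF assms]])
  moreover have "fc (?P N) n = a n" if "N > int_encode n" for N
  proof -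
    have "fc (?P N) n = (\<Sum>j<N. a (int_decode j) * (if n = int_decode j then 1 else 0))"
      by (subst fc_sum) (auto intro!: continuous_intros cont_ex sum.cong simp: fc_scale fc_ex)
    also have "\<dots> = (\<Sum>j<N. if j = int_encode n then a n else 0)"
      by (rule sum.cong) auto
    also have "\<dots> = a n" using that by simp
    finally show ?thesis .
  qed
  then have "(\<lambda>N. fc (?P N) n) \<longlonglongrightarrow> a n"
    by (intro tendsto_eventually) (auto simp: eventually_sequentially intro!: exI[of _ "Suc (int_encode n)"])
  ultimately show ?thesis using LIMSEQ_unique by blast
qed

section \<open>Density of trigonometric polynomials and uniqueness of Fourier coefficients\<close>

inductive trig :: "(real \<Rightarrow> complex) \<Rightarrow> bool" where
  monom: "trig (\<lambda>\<theta>. c * ex n \<theta>)"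
| add: "trig P \<Longrightarrow> trig R \<Longrightarrow> trig (\<lambda>\<theta>. P \<theta> + R \<theta>)"

lemma trig_mult: "trig P \<Longrightarrow> trig R \<Longrightarrow> trig (\<lambda>\<theta>. P \<theta> * R \<theta>)"
proof (induction P rule: trig.induct)
  case (monom c n)
  then show ?case
  proof (induction R rule: trig.induct)
    case (monom d p)
    have "(\<lambda>\<theta>. c * ex n \<theta> * (d * ex p \<theta>)) = (\<lambda>\<theta>. (c * d) * ex (n + p) \<theta>)"
      by (simp add: ex_mult[symmetric] mult_ac)
    then show ?case using trig.monom by simp
  next
    case (add P R)
    then show ?case using trig.add[OF add.IH] by (simp add: distrib_left)
  qed
next
  case (add P R')
  then show ?case using trig.add[OF add.IH] by (simp add: distrib_right)
qed

lemma trig_cont: "trig P \<Longrightarrow> continuous_on A P"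
  by (induction rule: trig.induct) (auto intro!: continuous_intros cont_ex)

lemma trig_const: "trig (\<lambda>_. c)"
  using trig.monom[of c 0] by simp

text \<open>Polynomials on the plane are generated by real-linear forms and constants; on the circle
  a real-linear form is a combination of \<open>ex 1\<close> and \<open>ex (-1)\<close>.\<close>

lemma trig_polynomial:
  fixes p :: "complex \<Rightarrow> real"
  assumes "real_polynomial_function p" shows "trig (\<lambda>\<theta>. of_real (p (cis \<theta>)))"
  using assms
proof (induction rule: real_polynomial_function.induct)
  case (linear f)
  then interpret bounded_linear f .
  have "trig (\<lambda>\<theta>. (of_real (f 1) / 2 - \<i> / 2 * of_real (f \<i>)) * ex (-1) \<theta>
       + (of_real (f 1) / 2 + \<i> / 2 * of_real (f \<i>)) * ex 1 \<theta>)"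
    by (intro trig.intros)
  moreover have "of_real (f (cis \<theta>)) = (of_real (f 1) / 2 - \<i> / 2 * of_real (f \<i>)) * ex (-1) \<theta>
       + (of_real (f 1) / 2 + \<i> / 2 * of_real (f \<i>)) * ex 1 \<theta>" for \<theta>
  proof -
    have "cis \<theta> = cos \<theta> *\<^sub>R 1 + sin \<theta> *\<^sub>R \<i>" by (simp add: complex_eq_iff)
    then have "f (cis \<theta>) = cos \<theta> * f 1 + sin \<theta> * f \<i>" by (simp add: add scale)
    then show ?thesis by (simp add: complex_eq_iff ex_def)
  qed
  ultimately show ?case by simp
next
  case (mult f g)
  then show ?case using trig_mult by simp
next
  case (add f g)
  then show ?case using trig.add by simp
qed (rule trig_const)

lemma trig_orthogonal:
  assumes "trig P" "continuous_on UNIV F" "\<And>n. fc F n = 0"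
  shows "integral {0..2*pi} (\<lambda>\<theta>. F \<theta> * P \<theta>) = 0"
  using assms(1)
proof (induction rule: trig.induct)
  case (monom c n)
  have "integral {0..2*pi} (\<lambda>\<theta>. F \<theta> * ex n \<theta>) = 0"
    using assms(3)[of "-n"] by (simp add: fc_def)
  then show ?case by (simp add: mult.left_commute)
next
  case (add P R)
  have "(\<lambda>\<theta>. F \<theta> * P \<theta>) integrable_on {0..2*pi}" "(\<lambda>\<theta>. F \<theta> * R \<theta>) integrable_on {0..2*pi}"
    by (intro integrable_continuous_real continuous_intros trig_cont add
       continuous_on_subset[OF assms(2)] subset_UNIV)+
  then show ?case using add.IH by (simp add: distrib_left integral_add)
qed

text \<open>Stone-Weierstrass on the unit circle, to which \<open>F\<close> is transported by
  \<open>Arg\<close>.\<close>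

lemma trig_dense:
  assumes "per F" "continuous_on UNIV F" "e > 0"
  obtains P where "trig P" "\<And>\<theta>. norm (F \<theta> - P \<theta>) < e"
proof -
  define h where "h = (\<lambda>z. F (Arg z))"
  have iF: "isCont F x" for x using assms(2) by (simp add: continuous_on_eq_continuous_at)
  have "continuous_on (sphere 0 1) h"
  proof (intro continuous_at_imp_continuous_on ballI)
    fix z :: complex assume z: "z \<in> sphere 0 1"
    show "isCont h z"
    proof (cases "z \<in> \<real>\<^sub>\<le>\<^sub>0")
      case False
      then show ?thesis unfolding h_def
        by (intro isCont_o2[OF continuous_at_Arg iF])
    next
      case True
      \<comment> \<open>\<open>Arg\<close> jumps across the negative real axis. There
        \<open>h\<close> is rewritten through \<open>Arg (- w)\<close>, which is continuous at such
        points; periodicity of \<open>F\<close> absorbs the difference between the angles.\<close>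
      have eq: "h w = F (pi + Arg (- w))" if "w \<noteq> 0" for w
      proof -
        have "cis (Arg w) = cis (pi + Arg (- w))"
          using that by (simp add: cis_Arg sgn_minus cis_mult[symmetric])
        then show ?thesis unfolding h_def by (rule per_cis[OF assms(1)])
      qed
      have "- z \<notin> \<real>\<^sub>\<le>\<^sub>0" using True z
        by (metis complex_nonpos_Reals_iff complex_eq_iff dist_0_norm mem_sphere neg_le_0_iff_le norm_zero
            order_antisym uminus_complex.simps(1) zero_complex.simps zero_neq_one)
      then have "isCont (\<lambda>w. F (pi + Arg (- w))) z"
        by (intro isCont_o2[OF _ iF]) (auto intro!: continuous_intros isCont_o2[OF _ continuous_at_Arg])
      moreover have "\<forall>\<^sub>F w in nhds z. h w = F (pi + Arg (- w))"
      proof -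
        have "\<forall>\<^sub>F w in nhds z. w \<noteq> 0" using z by (intro t1_space_nhds) auto
        then show ?thesis by eventually_elim (rule eq)
      qed
      ultimately show ?thesis by (subst isCont_cong)
    qed
  qed
  then obtain g where g: "polynomial_function g" "\<And>z. z \<in> sphere 0 1 \<Longrightarrow> norm (h z - g z) < e"
    using Stone_Weierstrass_polynomial_function[of "sphere (0::complex) 1" h e] assms(3) by auto
  have "real_polynomial_function (Re \<circ> g)" "real_polynomial_function (Im \<circ> g)"
    using g(1) bounded_linear_Re bounded_linear_Im unfolding polynomial_function_def by blast+
  then have "trig (\<lambda>\<theta>. of_real ((Re \<circ> g) (cis \<theta>)) + \<i> * of_real ((Im \<circ> g) (cis \<theta>)))"
    by (intro trig.add trig_mult trig_const trig_polynomial)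
  moreover have "of_real ((Re \<circ> g) (cis \<theta>)) + \<i> * of_real ((Im \<circ> g) (cis \<theta>)) = g (cis \<theta>)" for \<theta>
    by (simp add: complex_eq_iff)
  ultimately have "trig (\<lambda>\<theta>. g (cis \<theta>))" by simp
  moreover have "norm (F \<theta> - g (cis \<theta>)) < e" for \<theta>
  proof -
    have "h (cis \<theta>) = F \<theta>" unfolding h_def by (intro per_cis[OF assms(1)]) (simp add: cis_Arg sgn_cis)
    then show ?thesis using g(2)[of "cis \<theta>"] by simp
  qed
  ultimately show ?thesis using that by blast
qed

text \<open>\<open>F\<close> is orthogonal to every trigonometric polynomial, and its conjugate is a
  uniform limit of such polynomials. Hence the integral of |F|^2 vanishes, and so does the
  continuous function \<open>F\<close>.\<close>

lemma fc_unique0: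
  assumes "per F" "continuous_on UNIV F" "\<And>n. fc F n = 0" shows "F \<theta> = 0"
proof -
  have perc: "per (\<lambda>\<theta>. cnj (F \<theta>))" using assms(1) by (simp add: per_def)
  have contc: "continuous_on UNIV (\<lambda>\<theta>. cnj (F \<theta>))" by (intro continuous_intros assms)
  obtain B where B: "\<And>x. norm (F x) \<le> B"
    using per_cont_bounded[OF assms(1,2)] by (auto simp: bounded_iff)
  have ci: "continuous_on A F" for A using assms(2) continuous_on_subset by blast
  let ?I = "integral {0..2*pi} (\<lambda>\<theta>. F \<theta> * cnj (F \<theta>))"
  have "norm ?I \<le> (B * e) * (2 * pi - 0)" if "e > 0" for e
  proof -
    obtain P where P: "trig P" "\<And>\<theta>. norm (cnj (F \<theta>) - P \<theta>) < e"
      using trig_dense[OF perc contc \<open>e > 0\<close>] by blast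
    have "?I = integral {0..2*pi} (\<lambda>\<theta>. F \<theta> * cnj (F \<theta>)) - integral {0..2*pi} (\<lambda>\<theta>. F \<theta> * P \<theta>)"
      using trig_orthogonal[OF P(1) assms(2,3)] by simp
    also have "\<dots> = integral {0..2*pi} (\<lambda>\<theta>. F \<theta> * (cnj (F \<theta>) - P \<theta>))"
      unfolding right_diff_distrib
      by (rule integral_diff[symmetric])
         (auto intro!: integrable_continuous_real continuous_intros ci trig_cont[OF P(1)])
    also have "norm \<dots> \<le> (B * e) * (2 * pi - 0)"
    proof (rule integral_bound)
      show "norm (F t * (cnj (F t) - P t)) \<le> B * e" for t
        unfolding norm_mult using B[of t] P(2)[of t] order_trans[OF norm_ge_zero B[of t]]
        by (intro mult_mono) (auto simp: less_imp_le)
    qed (auto intro!: continuous_intros ci trig_cont[OF P(1)])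
    finally show ?thesis .
  qed
  moreover have Bn: "B \<ge> 0" using B[of 0] norm_ge_zero order_trans by blast
  have "?I = 0"
  proof (rule ccontr)
    assume "?I \<noteq> 0"
    \<comment> \<open>With this value the bound above is less than half of |I|. Taking B + 1 instead
      of B keeps the denominator positive when B = 0.\<close>
    let ?e = "norm ?I / (2 * (B + 1) * (2 * pi))"
    have e: "?e > 0" using \<open>?I \<noteq> 0\<close> Bn by (simp add: add_nonneg_pos)
    have "norm ?I \<le> (B * ?e) * (2 * pi - 0)" by (rule calculation[OF e])
    also have "\<dots> = norm ?I * (B / (2 * (B + 1)))"
    proof -
      have eq: "B * (x / (q * p)) * (p - 0) = x * (B / q)" if "p \<noteq> 0" "q \<noteq> 0" for x p q :: real
        using that by (simp add: field_simps)
      show ?thesis by (rule eq) (use Bn in auto)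
    qed
    also have "\<dots> < norm ?I * 1" using \<open>?I \<noteq> 0\<close> Bn by (intro mult_strict_left_mono) (auto simp: field_simps)
    finally show False by simp
  qed
  moreover have "((\<lambda>\<theta>. F \<theta> * cnj (F \<theta>)) has_integral ?I) {0..2*pi}"
    by (intro integrable_integral integrable_continuous_real continuous_intros ci)
  ultimately have hi: "((\<lambda>\<theta>. of_real ((norm (F \<theta>))\<^sup>2) :: complex) has_integral 0) {0..2*pi}"
    by (simp add: complex_norm_square del: of_real_power)
  have hi': "((\<lambda>\<theta>. (norm (F \<theta>))\<^sup>2) has_integral 0) (cbox 0 (2*pi))"
    using has_integral_Re[OF hi] by simp
  obtain t where t: "t \<in> {0..2*pi}" "F t = F \<theta>" using per_reduce[of \<theta>] assms(1) by metis
  have "(norm (F t))\<^sup>2 = 0"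
    by (rule has_integral_0_cbox_imp_0[OF _ _ hi']) (use t pi_gt_zero in \<open>auto intro!: continuous_intros ci simp del: pi_gt_zero\<close>)
  then show ?thesis using t by simp
qed

lemma fc_unique:
  assumes "SP F" "SP G" "\<And>n. fc F n = fc G n" shows "F = G"
proof
  fix \<theta>
  have "F \<theta> - G \<theta> = 0"
    by (rule fc_unique0[of "\<lambda>\<theta>. F \<theta> - G \<theta>"])
       (use assms SP_diff[OF assms(1,2)] in \<open>auto simp: SP_def fc_diff smooth_cont0\<close>)
  then show "F \<theta> = G \<theta>" by simp
qed

lemma ser_fc: assumes "SP F" shows "ser (fc F) = F"
  by (rule fc_unique) (auto simp: SP_ser rd_fc fc_ser assms)

lemma SP_sums: assumes "SP F"
  shows "uniform_limit UNIV (\<lambda>N \<theta>. \<Sum>j<N. fc F (int_decode j) * ex (int_decode j) \<theta>) F sequentially"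
  using ser_uniform[OF rd_fc[OF assms]] by (simp add: ser_fc[OF assms])

subsection \<open>The action in the coordinate of K\<close>

text \<open>\<open>G/N\<close> is the punctured plane: \<open>extend \<mu> \<phi> g\<close> depends only on the first column of \<open>g\<close>, encoded
  as the complex number \<open>col g\<close>, and \<open>g\<close> acts on columns by the real-linear map \<open>lin g\<close>.\<close>

definition col :: "mat2 \<Rightarrow> complex" where
  "col A = Complex (A $ 1 $ 1) (A $ 2 $ 1)"

definition lin :: "mat2 \<Rightarrow> complex \<Rightarrow> complex" where
  "lin A z = Complex (A $ 1 $ 1 * Re z + A $ 1 $ 2 * Im z) (A $ 2 $ 1 * Re z + A $ 2 $ 2 * Im z)"

definition ext :: "complex \<Rightarrow> (real \<Rightarrow> complex) \<Rightarrow> complex \<Rightarrow> complex" where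
  "ext \<mu> F z = exp (- (2 * \<mu> + 1) * of_real (ln (norm z))) * F (- Arg z)"

lemmas mat_simps = vec_eq_iff forall_2 matrix_matrix_mult_def sum_2 rot_def diagA_def upperN_def lowerN_def

lemma rot_nth [simp]: "rot t $ 1 $ 1 = cos t" "rot t $ 1 $ 2 = sin t" "rot t $ 2 $ 1 = - sin t" "rot t $ 2 $ 2 = cos t"
  by (simp_all add: rot_def)

lemma rot_mult: "rot a ** rot b = rot (a + b)"
  by (simp add: mat_simps cos_add sin_add algebra_simps)

lemma rot_0 [simp]: "rot 0 = mat 1"
  by (simp add: mat_simps mat_def)

lemma rot_2pi [simp]: "rot (t + 2 * pi) = rot t"
  by (simp add: mat_simps)

lemma rot_pi: "rot (t + pi) = rot t ** (- mat 1)"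
  by (simp add: mat_simps mat_def)

lemma rot_SO2 [simp]: "rot t \<in> SO2" by (simp add: SO2_def)

lemma per_rot: "per (\<lambda>\<theta>. \<phi> (rot \<theta>))" by (simp add: per_def)

lemma det_rot: "det (rot t) = 1" by (simp add: det_2 power2_eq_square[symmetric])
lemma det_diagA: "det (diagA t) = 1" by (simp add: det_2 diagA_def mult_exp_exp)
lemma det_upperN: "det (upperN t) = 1" by (simp add: det_2 upperN_def)
lemma det_lowerN: "det (lowerN t) = 1" by (simp add: det_2 lowerN_def)

lemma SL2_rot [simp]: "rot t \<in> SL2" by (simp add: SL2_def det_rot)
lemma SL2_diagA [simp]: "diagA t \<in> SL2" by (simp add: SL2_def det_diagA)
lemma SL2_upperN [simp]: "upperN t \<in> SL2" by (simp add: SL2_def det_upperN)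
lemma SL2_lowerN [simp]: "lowerN t \<in> SL2" by (simp add: SL2_def det_lowerN)
lemma SL2_mult [simp]: "A \<in> SL2 \<Longrightarrow> B \<in> SL2 \<Longrightarrow> A ** B \<in> SL2" by (simp add: SL2_def det_mul)

lemma matrix_inv_unique: assumes "A ** B = mat 1" shows "matrix_inv A = (B :: mat2)"
proof -
  have BA: "B ** A = mat 1" using assms by (simp add: matrix_left_right_inverse)
  have "A ** matrix_inv A = mat 1 \<and> matrix_inv A ** A = mat 1"
    unfolding matrix_inv_def by (rule someI_ex) (use assms BA in blast)
  moreover have "matrix_inv A = (B ** A) ** matrix_inv A" using BA by simp
  ultimately show ?thesis by (simp add: matrix_mul_assoc[symmetric])
qed

lemma matrix_inv_SL2 [simp]: assumes "A \<in> SL2" shows "matrix_inv A \<in> SL2"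
proof -
  have "invertible A" using assms by (simp add: SL2_def invertible_det_nz)
  then obtain B where B: "A ** B = mat 1" "B ** A = mat 1" unfolding invertible_def by blast
  then have "det A * det B = 1" by (metis det_I det_mul)
  then show ?thesis using assms matrix_inv_unique[OF B(1)] by (simp add: SL2_def)
qed

lemma matrix_inv_rot: "matrix_inv (rot t) = rot (- t)"
  by (rule matrix_inv_unique) (simp add: rot_mult)

lemma matrix_inv_diagA: "matrix_inv (diagA t) = diagA (- t)"
  by (rule matrix_inv_unique) (simp add: mat_simps mat_def mult_exp_exp)

lemma col_mult: "col (A ** B) = lin A (col B)"
  by (simp add: col_def lin_def matrix_matrix_mult_def sum_2)

lemma col_rot: "col (rot t) = cis (- t)" by (simp add: col_def complex_eq_iff)

lemma lin_mult: "lin (A ** B) z = lin A (lin B z)"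
  by (simp add: lin_def matrix_matrix_mult_def sum_2 complex_eq_iff algebra_simps)

lemma lin_rot: "lin (rot t) z = cis (- t) * z"
  by (simp add: lin_def complex_eq_iff algebra_simps)

lemma lin_scale: "lin A (of_real r * z) = of_real r * lin A z"
  by (simp add: lin_def complex_eq_iff algebra_simps)

lemma lin_diagA: "lin (diagA t) z = Complex (exp t * Re z) (exp (- t) * Im z)"
  by (simp add: lin_def diagA_def)

lemma col_KAN: "col (rot g ** diagA t ** upperN x) = of_real (exp t) * cis (- g)"
  by (simp add: col_def matrix_matrix_mult_def sum_2 diagA_def upperN_def complex_eq_iff)

lemma polar: assumes "z \<noteq> 0" shows "z = of_real (norm z) * cis (- (- Arg z))"
  using assms by (simp add: cis_Arg sgn_div_norm scaleR_conv_of_real)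

lemma col_nonzero: assumes "A \<in> SL2" shows "col A \<noteq> 0"
  using assms by (auto simp: SL2_def det_2 col_def complex_eq_iff)

text \<open>Rotating the first column onto the positive real axis leaves an upper triangular matrix,
  whose lower right entry is fixed by the determinant.\<close>

lemma Iwasawa:
  assumes "A \<in> SL2"
  obtains x where "A = rot (- Arg (col A)) ** diagA (ln (norm (col A))) ** upperN x"
proof -
  let ?z = "col A" let ?g = "- Arg (col A)" let ?r = "norm ?z"
  have r: "?r > 0" using col_nonzero[OF assms] by simp
  define B where "B = rot (- ?g) ** A"
  have "col B = of_real ?r"
    using polar[OF col_nonzero[OF assms]] unfolding B_def col_mult lin_rot
    by (metis add.right_neutral cis_mult cis_zero minus_minus mult.commute mult.left_commute mult.right_neutral ab_left_minus)
  then have B1: "B $ 1 $ 1 = ?r" "B $ 2 $ 1 = 0" by (auto simp: col_def complex_eq_iff)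
  have "det B = 1" using assms unfolding B_def by (simp add: det_mul det_rot SL2_def)
  then have B2: "B $ 2 $ 2 = 1 / ?r" using B1 r by (simp add: det_2 field_simps)
  have "B = diagA (ln ?r) ** upperN (B $ 1 $ 2 / ?r)"
    using r B1 B2 by (simp add: mat_simps exp_minus field_simps)
  then have "rot ?g ** B = rot ?g ** diagA (ln ?r) ** upperN (B $ 1 $ 2 / ?r)"
    by (metis matrix_mul_assoc)
  moreover have "rot ?g ** B = A" unfolding B_def by (simp add: matrix_mul_assoc rot_mult)
  ultimately show ?thesis using that by metis
qed

lemma cis_eq_rot: "cis a = cis b \<Longrightarrow> rot a = rot b"
  by (simp add: complex_eq_iff mat_simps)

lemma KAN_unique:
  assumes "A = rot g ** diagA t ** upperN x" shows "rot g = rot (- Arg (col A))" "t = ln (norm (col A))"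
proof -
  have z: "col A = of_real (exp t) * cis (- g)" using assms col_KAN by simp
  then show "t = ln (norm (col A))" by (simp add: norm_mult)
  have "cis (Arg (col A)) = cis (- g)" using z
    by (metis Arg_times_of_real cis_Arg exp_gt_zero norm_cis norm_zero sgn_cis zero_neq_one)
  then have "cis g = cis (- Arg (col A))" by (metis cis_cnj minus_minus)
  then show "rot g = rot (- Arg (col A))" by (rule cis_eq_rot)
qed

lemma kappa_eq: assumes "A \<in> SL2" shows "kappa A = rot (- Arg (col A))"
  unfolding kappa_def
proof (rule the_equality)
  show "rot (- Arg (col A)) \<in> SO2 \<and> (\<exists>t x. A = rot (- Arg (col A)) ** diagA t ** upperN x)"
    using Iwasawa[OF assms] by (metis rot_SO2)
next
  fix k assume "k \<in> SO2 \<and> (\<exists>t x. A = k ** diagA t ** upperN x)"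
  then show "k = rot (- Arg (col A))" using KAN_unique unfolding SO2_def by blast
qed

lemma logA_eq: assumes "A \<in> SL2" shows "logA A = ln (norm (col A))"
  unfolding logA_def
proof (rule the_equality)
  show "\<exists>k\<in>SO2. \<exists>x. A = k ** diagA (ln (norm (col A))) ** upperN x"
    using Iwasawa[OF assms] by (metis rot_SO2)
next
  fix t assume "\<exists>k\<in>SO2. \<exists>x. A = k ** diagA t ** upperN x"
  then show "t = ln (norm (col A))" using KAN_unique(2) unfolding SO2_def by blast
qed

text \<open>The passage from the group to the plane of first columns. \<open>a_pow\<close> contains
  the factor 2 of \<alpha>(diag(t,-t)) = 2 t, so -(\<mu> + \<rho>) becomes the exponent -(2 \<mu> +
  1) of the norm.\<close>

lemma extend_eq: "A \<in> SL2 \<Longrightarrow> extend \<mu> \<phi> A = ext \<mu> (\<lambda>\<theta>. \<phi> (rot \<theta>)) (col A)"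
proof -
  have "- (\<mu> + rho) * (2 * x) = - (2 * \<mu> + 1) * x" for x by (simp add: rho_def field_simps)
  then show "A \<in> SL2 \<Longrightarrow> ?thesis" by (simp only: extend_def ext_def a_pow_def kappa_eq logA_eq)
qed

lemma ext_polar:
  assumes "per F" "r > 0" "z = of_real r * cis (- g)"
  shows "ext \<mu> F z = exp (- (2 * \<mu> + 1) * of_real (ln r)) * F g"
proof -
  have z0: "z \<noteq> 0" using assms by auto
  have "cis (Arg z) = cis (- g)" using z0 assms
    by (simp add: cis_Arg sgn_mult sgn_of_real sgn_cis)
  then have "cis (- Arg z) = cis g" by (metis cis_cnj minus_minus)
  then have "F (- Arg z) = F g" by (rule per_cis[OF assms(1)])
  then show ?thesis using assms by (simp add: ext_def norm_mult)
qed

lemma ext_scale: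
  assumes "per F" "r > 0" "z \<noteq> 0"
  shows "ext \<mu> F (of_real r * z) = exp (- (2 * \<mu> + 1) * of_real (ln r)) * ext \<mu> F z"
proof -
  have "of_real r * z = of_real (r * norm z) * cis (- (- Arg z))"
    using polar[OF assms(3)] by (simp add: mult.assoc)
  then show ?thesis using assms
    by (subst ext_polar[OF assms(1), of "r * norm z"])
       (auto simp: ext_def ln_mult mult_exp_exp algebra_simps)
qed

text \<open>The operator \<open>act\<close> on functions of the angle; the first column of
  \<open>rot \<theta>\<close> is \<open>cis (- \<theta>)\<close>.\<close>

definition actF :: "complex \<Rightarrow> mat2 \<Rightarrow> (real \<Rightarrow> complex) \<Rightarrow> real \<Rightarrow> complex" where
  "actF \<mu> g F \<theta> = ext \<mu> F (lin (matrix_inv g) (cis (- \<theta>)))"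

lemma act_rot: "g \<in> SL2 \<Longrightarrow> act \<mu> g \<phi> (rot \<theta>) = actF \<mu> g (\<lambda>\<theta>. \<phi> (rot \<theta>)) \<theta>"
  by (simp add: act_def extend_eq actF_def col_mult col_rot)

lemma act_off [simp]: "k \<notin> SO2 \<Longrightarrow> act \<mu> g \<phi> k = 0"
  by (simp add: act_def)

lemma actF_rot: assumes "per F" shows "actF \<mu> (rot t) F \<theta> = F (\<theta> - t)"
  unfolding actF_def
  by (subst ext_polar[OF assms, of 1 _ "\<theta> - t"]) (auto simp: matrix_inv_rot lin_rot cis_mult)

text \<open>The real-linear map \<open>lin A\<close> is \<open>z \<mapsto> al A * z + be A * cnj z\<close>.\<close>

definition al :: "mat2 \<Rightarrow> complex" where
  "al A = Complex ((A $ 1 $ 1 + A $ 2 $ 2) / 2) ((A $ 2 $ 1 - A $ 1 $ 2) / 2)"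

definition be :: "mat2 \<Rightarrow> complex" where
  "be A = Complex ((A $ 1 $ 1 - A $ 2 $ 2) / 2) ((A $ 2 $ 1 + A $ 1 $ 2) / 2)"

lemma lin_al_be: "lin A z = al A * z + be A * cnj z"
  by (simp add: lin_def al_def be_def complex_eq_iff field_simps)

lemma al_be_det: assumes "A \<in> SL2" shows "(norm (al A))\<^sup>2 = (norm (be A))\<^sup>2 + 1"
proof -
  have "(norm (al A))\<^sup>2 - (norm (be A))\<^sup>2 = A $ 1 $ 1 * A $ 2 $ 2 - A $ 1 $ 2 * A $ 2 $ 1"
    unfolding cmod_power2 by (simp add: al_def be_def power2_eq_square field_simps)
  then show ?thesis using assms by (simp add: SL2_def det_2)
qed

lemma al_nz: "A \<in> SL2 \<Longrightarrow> al A \<noteq> 0"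
  using al_be_det[of A] by (auto simp: sum_power2_eq_zero_iff) (smt (verit) zero_le_power2)

lemma be_al_less: assumes "A \<in> SL2" shows "norm (be A / al A) < 1"
proof -
  have "(norm (be A))\<^sup>2 < (norm (al A))\<^sup>2" using al_be_det[OF assms] by simp
  then have "norm (be A) < norm (al A)" by (rule power2_less_imp_less) simp
  moreover have "0 < norm (al A)" using al_nz[OF assms] by simp
  ultimately show ?thesis by (simp add: norm_divide)
qed

text \<open>A branch of the logarithm of \<open>lin A (cis (- \<theta>)) / cis (- \<theta>)\<close>:
  the real part is the logarithm of the stretching, the imaginary part the displacement of the
  angle. Determinant 1 gives |be / al| < 1, so the argument of the second logarithm stays in the
  right half plane and meets no cut.\<close>

definition lam :: "mat2 \<Rightarrow> real \<Rightarrow> complex" where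
  "lam A \<theta> = Ln (al A) + Ln (1 + be A / al A * cis (2 * \<theta>))"

lemma one_plus_nz: assumes "norm (c :: complex) < 1" "norm z \<le> 1" shows "1 + c * z \<notin> \<real>\<^sub>\<le>\<^sub>0"
proof -
  have "norm (c * z) < 1" using assms by (metis mult_le_one mult_less_cancel_right2 norm_ge_zero norm_mult order_le_less_trans mult.commute mult_left_le)
  then have "Re (1 + c * z) > 0" using abs_Re_le_cmod[of "c * z"] by simp
  then show ?thesis by (auto simp: complex_nonpos_Reals_iff)
qed

lemma lin_lam:
  assumes "A \<in> SL2"
  shows "lin A (cis (- \<theta>)) = of_real (exp (Re (lam A \<theta>))) * cis (- (\<theta> - Im (lam A \<theta>)))"
proof -
  let ?c = "be A / al A"
  have nz: "1 + ?c * cis (2 * \<theta>) \<noteq> 0" using one_plus_nz[OF be_al_less[OF assms], of "cis (2 * \<theta>)"] by auto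
  have "of_real (exp (Re (lam A \<theta>))) * cis (- (\<theta> - Im (lam A \<theta>))) =
     of_real (exp (Re (lam A \<theta>))) * cis (Im (lam A \<theta>)) * cis (- \<theta>)"
    by (simp add: cis_mult algebra_simps)
  also have "\<dots> = exp (lam A \<theta>) * cis (- \<theta>)"
    by (simp add: exp_eq_polar)
  also have "exp (lam A \<theta>) = al A * (1 + ?c * cis (2 * \<theta>))"
    using nz al_nz[OF assms] by (simp add: lam_def exp_add)
  also have "\<dots> * cis (- \<theta>) = al A * cis (- \<theta>) + be A * cis \<theta>"
    using al_nz[OF assms] by (simp add: distrib_left distrib_right cis_mult mult.assoc)
  finally show ?thesis by (simp add: lin_al_be cis_cnj)
qed

text \<open>The action as a multiplier times a change of variable. \<open>Arg\<close> has
  disappeared, so smoothness in \<theta> and holomorphy in \<mu> can be read off.\<close>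

lemma actF_lam:
  assumes "per F" "g \<in> SL2"
  shows "actF \<mu> g F \<theta> = exp (- (2 * \<mu> + 1) * of_real (Re (lam (matrix_inv g) \<theta>))) *
     F (\<theta> - Im (lam (matrix_inv g) \<theta>))"
  unfolding actF_def
  by (subst ext_polar[OF assms(1) _ lin_lam[OF matrix_inv_SL2[OF assms(2)]]]) simp_all

subsection \<open>Holomorphic families\<close>

text \<open>Holomorphy into the Frechet space \<open>Hinf \<sigma>\<close> is equivalent to pointwise holomorphy with local
  bounds, uniform in the angle, on all angular derivatives (\<open>hol_into_iff_fam\<close>).\<close>

definition gd0 :: "complex set \<Rightarrow> (complex \<Rightarrow> real \<Rightarrow> complex) \<Rightarrow> bool" where
  "gd0 U \<Phi> \<longleftrightarrow> (\<forall>\<theta>. (\<lambda>\<mu>. \<Phi> \<mu> \<theta>) holomorphic_on U) \<and>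
     (\<forall>\<mu>\<in>U. \<exists>r>0. cball \<mu> r \<subseteq> U \<and> (\<exists>B. \<forall>\<mu>'\<in>cball \<mu> r. \<forall>\<theta>. norm (\<Phi> \<mu>' \<theta>) \<le> B))"

text \<open>The condition \<open>gd0\<close> for n successive angular derivatives. The derivative is
  existential, so closure under sums, products and compositions follows by induction from the
  first-order rules alone.\<close>

primrec gd :: "nat \<Rightarrow> complex set \<Rightarrow> (complex \<Rightarrow> real \<Rightarrow> complex) \<Rightarrow> bool" where
  "gd 0 U \<Phi> = gd0 U \<Phi>"
| "gd (Suc n) U \<Phi> = (gd0 U \<Phi> \<and> (\<exists>\<Phi>'. (\<forall>\<mu>\<in>U. \<forall>\<theta>. (\<Phi> \<mu> has_vector_derivative \<Phi>' \<mu> \<theta>) (at \<theta>)) \<and> gd n U \<Phi>'))"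

lemma gd_gd0: "gd n U \<Phi> \<Longrightarrow> gd0 U \<Phi>"
  by (cases n) auto

lemma gd_SucI: "gd0 U \<Phi> \<Longrightarrow> (\<And>\<mu> \<theta>. \<mu> \<in> U \<Longrightarrow> (\<Phi> \<mu> has_vector_derivative \<Phi>' \<mu> \<theta>) (at \<theta>)) \<Longrightarrow> gd n U \<Phi>' \<Longrightarrow> gd (Suc n) U \<Phi>"
  by auto

lemma gd_SucE:
  assumes "gd (Suc n) U \<Phi>"
  obtains \<Phi>' where "gd0 U \<Phi>" "\<And>\<mu> \<theta>. \<mu> \<in> U \<Longrightarrow> (\<Phi> \<mu> has_vector_derivative \<Phi>' \<mu> \<theta>) (at \<theta>)" "gd n U \<Phi>'"
  using assms by auto

lemma gd_Suc_mono: "gd (Suc n) U \<Phi> \<Longrightarrow> gd n U \<Phi>"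
proof (induction n arbitrary: \<Phi>)
  case (Suc n)
  from Suc.prems obtain \<Phi>' where "gd0 U \<Phi>"
    "\<And>\<mu> \<theta>. \<mu> \<in> U \<Longrightarrow> (\<Phi> \<mu> has_vector_derivative \<Phi>' \<mu> \<theta>) (at \<theta>)" "gd (Suc n) U \<Phi>'" by auto
  then show ?case using Suc.IH by (intro gd_SucI)
qed simp

lemma gd0_cong: "(\<And>\<mu> \<theta>. \<mu> \<in> U \<Longrightarrow> \<Phi> \<mu> \<theta> = \<Psi> \<mu> \<theta>) \<Longrightarrow> gd0 U \<Phi> \<Longrightarrow> gd0 U \<Psi>"
  unfolding gd0_def
proof (elim conjE, intro conjI allI ballI)
  assume eq: "\<And>\<mu> \<theta>. \<mu> \<in> U \<Longrightarrow> \<Phi> \<mu> \<theta> = \<Psi> \<mu> \<theta>"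
  show "(\<lambda>\<mu>. \<Psi> \<mu> \<theta>) holomorphic_on U" if "\<forall>\<theta>. (\<lambda>\<mu>. \<Phi> \<mu> \<theta>) holomorphic_on U" for \<theta>
    using that holomorphic_cong[of U U "\<lambda>\<mu>. \<Phi> \<mu> \<theta>" "\<lambda>\<mu>. \<Psi> \<mu> \<theta>"] eq by simp
  fix \<mu> assume "\<mu> \<in> U" "\<forall>\<mu>\<in>U. \<exists>r>0. cball \<mu> r \<subseteq> U \<and> (\<exists>B. \<forall>\<mu>'\<in>cball \<mu> r. \<forall>\<theta>. norm (\<Phi> \<mu>' \<theta>) \<le> B)"
  then obtain r B where "r > 0" and r: "cball \<mu> r \<subseteq> U" "\<forall>\<mu>'\<in>cball \<mu> r. \<forall>\<theta>. norm (\<Phi> \<mu>' \<theta>) \<le> B" by blast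
  moreover have "\<forall>\<mu>'\<in>cball \<mu> r. \<forall>\<theta>. norm (\<Psi> \<mu>' \<theta>) \<le> B"
    using r eq by (simp add: subset_iff)
  ultimately show "\<exists>r>0. cball \<mu> r \<subseteq> U \<and> (\<exists>B. \<forall>\<mu>'\<in>cball \<mu> r. \<forall>\<theta>. norm (\<Psi> \<mu>' \<theta>) \<le> B)"
    by blast
qed

lemma gd_cong: assumes "\<And>\<mu> \<theta>. \<mu> \<in> U \<Longrightarrow> \<Phi> \<mu> \<theta> = \<Psi> \<mu> \<theta>" "gd n U \<Phi>" shows "gd n U \<Psi>"
proof (cases n)
  case 0
  then show ?thesis using gd0_cong[OF assms(1)] assms(2) by simp
next
  case (Suc k)
  with assms(2) obtain \<Phi>' where *: "gd0 U \<Phi>"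
    "\<And>\<mu> \<theta>. \<mu> \<in> U \<Longrightarrow> (\<Phi> \<mu> has_vector_derivative \<Phi>' \<mu> \<theta>) (at \<theta>)" "gd k U \<Phi>'" by auto
  have "\<And>\<mu>. \<mu> \<in> U \<Longrightarrow> \<Phi> \<mu> = \<Psi> \<mu>" using assms(1) by blast
  then show ?thesis unfolding Suc using * gd0_cong[OF assms(1) *(1)] by (intro gd_SucI[of U \<Psi> \<Phi>']) auto
qed

lemma gd0_add: assumes "gd0 U \<Phi>" "gd0 U \<Psi>" shows "gd0 U (\<lambda>\<mu> \<theta>. \<Phi> \<mu> \<theta> + \<Psi> \<mu> \<theta>)"
  unfolding gd0_def
proof (intro conjI allI ballI)
  fix \<mu> assume "\<mu> \<in> U"
  then obtain r s B C where "r > 0" "s > 0" "cball \<mu> r \<subseteq> U"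
    "\<forall>\<mu>'\<in>cball \<mu> r. \<forall>\<theta>. norm (\<Phi> \<mu>' \<theta>) \<le> B" "\<forall>\<mu>'\<in>cball \<mu> s. \<forall>\<theta>. norm (\<Psi> \<mu>' \<theta>) \<le> C"
    using assms unfolding gd0_def by metis
  then show "\<exists>r>0. cball \<mu> r \<subseteq> U \<and> (\<exists>B. \<forall>\<mu>'\<in>cball \<mu> r. \<forall>\<theta>. norm (\<Phi> \<mu>' \<theta> + \<Psi> \<mu>' \<theta>) \<le> B)"
    by (intro exI[of _ "min r s"] conjI exI[of _ "B + C"] ballI allI norm_triangle_mono) (auto simp: subset_iff)
qed (use assms in \<open>auto simp: gd0_def intro!: holomorphic_intros\<close>)

lemma gd0_mult: assumes "gd0 U \<Phi>" "gd0 U \<Psi>" shows "gd0 U (\<lambda>\<mu> \<theta>. \<Phi> \<mu> \<theta> * \<Psi> \<mu> \<theta>)"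
  unfolding gd0_def
proof (intro conjI allI ballI)
  fix \<mu> assume "\<mu> \<in> U"
  then obtain r s B C where *: "r > 0" "s > 0" "cball \<mu> r \<subseteq> U"
    "\<forall>\<mu>'\<in>cball \<mu> r. \<forall>\<theta>. norm (\<Phi> \<mu>' \<theta>) \<le> B" "\<forall>\<mu>'\<in>cball \<mu> s. \<forall>\<theta>. norm (\<Psi> \<mu>' \<theta>) \<le> C"
    using assms unfolding gd0_def by metis
  have B: "B \<ge> 0" using *(1,4) by (metis centre_in_cball less_imp_le norm_ge_zero order_trans)
  show "\<exists>r>0. cball \<mu> r \<subseteq> U \<and> (\<exists>B. \<forall>\<mu>'\<in>cball \<mu> r. \<forall>\<theta>. norm (\<Phi> \<mu>' \<theta> * \<Psi> \<mu>' \<theta>) \<le> B)"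
    unfolding norm_mult
    by (intro exI[of _ "min r s"] conjI exI[of _ "B * C"] ballI allI mult_mono) (use * B in \<open>auto simp: subset_iff\<close>)
qed (use assms in \<open>auto simp: gd0_def intro!: holomorphic_intros\<close>)

lemma gd_add: "gd n U \<Phi> \<Longrightarrow> gd n U \<Psi> \<Longrightarrow> gd n U (\<lambda>\<mu> \<theta>. \<Phi> \<mu> \<theta> + \<Psi> \<mu> \<theta>)"
proof (induction n arbitrary: \<Phi> \<Psi>)
  case (Suc n)
  obtain \<Phi>' where *:
    "\<And>\<mu> \<theta>. \<mu> \<in> U \<Longrightarrow> (\<Phi> \<mu> has_vector_derivative \<Phi>' \<mu> \<theta>) (at \<theta>)" "gd n U \<Phi>'"
    using gd_SucE[OF Suc.prems(1)] by metis
  obtain \<Psi>' where **: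
    "\<And>\<mu> \<theta>. \<mu> \<in> U \<Longrightarrow> (\<Psi> \<mu> has_vector_derivative \<Psi>' \<mu> \<theta>) (at \<theta>)" "gd n U \<Psi>'"
    using gd_SucE[OF Suc.prems(2)] by metis
  show ?case using Suc.prems * **
    by (intro gd_SucI[where \<Phi>' = "\<lambda>\<mu> \<theta>. \<Phi>' \<mu> \<theta> + \<Psi>' \<mu> \<theta>"] gd0_add Suc.IH has_vector_derivative_add) auto
qed (simp add: gd0_add)

lemma gd_mult: "gd n U \<Phi> \<Longrightarrow> gd n U \<Psi> \<Longrightarrow> gd n U (\<lambda>\<mu> \<theta>. \<Phi> \<mu> \<theta> * \<Psi> \<mu> \<theta>)"
proof (induction n arbitrary: \<Phi> \<Psi>)
  case (Suc n)
  obtain \<Phi>' where *: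
    "\<And>\<mu> \<theta>. \<mu> \<in> U \<Longrightarrow> (\<Phi> \<mu> has_vector_derivative \<Phi>' \<mu> \<theta>) (at \<theta>)" "gd n U \<Phi>'"
    using gd_SucE[OF Suc.prems(1)] by metis
  obtain \<Psi>' where **:
    "\<And>\<mu> \<theta>. \<mu> \<in> U \<Longrightarrow> (\<Psi> \<mu> has_vector_derivative \<Psi>' \<mu> \<theta>) (at \<theta>)" "gd n U \<Psi>'"
    using gd_SucE[OF Suc.prems(2)] by metis
  show ?case using Suc.prems * ** gd_Suc_mono[OF Suc.prems(1)] gd_Suc_mono[OF Suc.prems(2)]
    by (intro gd_SucI[where \<Phi>' = "\<lambda>\<mu> \<theta>. \<Phi> \<mu> \<theta> * \<Psi>' \<mu> \<theta> + \<Phi>' \<mu> \<theta> * \<Psi> \<mu> \<theta>"] gd0_mult gd_add Suc.IH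
       has_vector_derivative_mult) auto
qed (simp add: gd0_mult)

lemma gd0_hol: assumes "open U" "f holomorphic_on U" shows "gd0 U (\<lambda>\<mu> \<theta>. f \<mu>)"
  unfolding gd0_def
proof (intro conjI allI ballI)
  fix \<mu> assume "\<mu> \<in> U"
  then obtain r where r: "r > 0" "cball \<mu> r \<subseteq> U" using assms(1) open_contains_cball by blast
  have "bounded (f ` cball \<mu> r)"
    by (intro compact_imp_bounded compact_continuous_image holomorphic_on_imp_continuous_on
        holomorphic_on_subset[OF assms(2) r(2)]) auto
  then obtain B where "\<forall>x\<in>cball \<mu> r. norm (f x) \<le> B" by (auto simp: bounded_iff)
  then show "\<exists>r>0. cball \<mu> r \<subseteq> U \<and> (\<exists>B. \<forall>\<mu>'\<in>cball \<mu> r. \<forall>\<theta>::real. norm (f \<mu>') \<le> B)" using r by blast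
qed (use assms in auto)

lemma gd_hol: "open U \<Longrightarrow> f holomorphic_on U \<Longrightarrow> gd n U (\<lambda>\<mu> \<theta>. f \<mu>)"
proof (induction n arbitrary: f)
  case (Suc n)
  show ?case using Suc
    by (intro gd_SucI[where \<Phi>' = "\<lambda>\<mu> \<theta>. 0"] gd0_hol) (auto intro: has_vector_derivative_const)
qed (simp add: gd0_hol)

lemma gd_const: "open U \<Longrightarrow> gd n U (\<lambda>\<mu> \<theta>. c)"
  by (rule gd_hol) auto

lemma gd0_bounded: assumes "open U" "\<And>\<theta>. norm (u \<theta>) \<le> B" shows "gd0 U (\<lambda>\<mu> \<theta>. u \<theta>)"
  unfolding gd0_def
proof (intro conjI allI ballI)
  fix \<mu> assume "\<mu> \<in> U"
  then obtain r where r: "r > 0" "cball \<mu> r \<subseteq> U" using assms(1) open_contains_cball by blast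
  then show "\<exists>r>0. cball \<mu> r \<subseteq> U \<and> (\<exists>B. \<forall>\<mu>'\<in>cball \<mu> r. \<forall>\<theta>. norm (u \<theta>) \<le> B)" using assms(2) by blast
qed auto

lemma gd_SP: "open U \<Longrightarrow> SP F \<Longrightarrow> gd n U (\<lambda>\<mu>. F)"
proof (induction n arbitrary: F)
  case 0
  then show ?case using gd0_bounded[OF _ sn_upper0] by simp
next
  case (Suc n)
  have "gd0 U (\<lambda>\<mu>. F)" using Suc.prems gd0_bounded[OF _ sn_upper0] by simp
  moreover have "(F has_vector_derivative vderiv F \<theta>) (at \<theta>)" for \<theta>
    using Suc.prems smooth_real_vd[of F 0 \<theta>] by (simp add: SP_def)
  ultimately show ?case using Suc.IH[OF Suc.prems(1) SP_vderiv[OF Suc.prems(2)]]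
    by (intro gd_SucI)
qed

lemma gd0_compose: "gd0 U \<Phi> \<Longrightarrow> gd0 U (\<lambda>\<mu> \<theta>. \<Phi> \<mu> (\<gamma> \<theta>))"
  unfolding gd0_def by blast

lemma gd_compose:
  assumes "open U" "\<And>\<theta>. (\<gamma> has_real_derivative \<rho> \<theta>) (at \<theta>)" "\<And>n. gd n U (\<lambda>\<mu> \<theta>. of_real (\<rho> \<theta>))"
  shows "gd n U \<Phi> \<Longrightarrow> gd n U (\<lambda>\<mu> \<theta>. \<Phi> \<mu> (\<gamma> \<theta>))"
proof (induction n arbitrary: \<Phi>)
  case (Suc n)
  from Suc.prems obtain \<Phi>' where *: "gd0 U \<Phi>"
    "\<And>\<mu> \<theta>. \<mu> \<in> U \<Longrightarrow> (\<Phi> \<mu> has_vector_derivative \<Phi>' \<mu> \<theta>) (at \<theta>)" "gd n U \<Phi>'" by auto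
  have "((\<lambda>\<theta>. \<Phi> \<mu> (\<gamma> \<theta>)) has_vector_derivative of_real (\<rho> \<theta>) * \<Phi>' \<mu> (\<gamma> \<theta>)) (at \<theta>)" if "\<mu> \<in> U" for \<mu> \<theta>
    using vector_diff_chain_at[OF _ *(2)[OF that], of \<gamma> "\<rho> \<theta>" \<theta>] assms(2)[of \<theta>]
    by (simp add: o_def scaleR_conv_of_real has_real_derivative_iff_has_vector_derivative)
  then show ?case
    by (rule gd_SucI[OF gd0_compose[OF *(1)] _ gd_mult[OF assms(3) Suc.IH[OF *(3)]]])
qed (simp add: gd0_compose)

lemma gd_exp:
  assumes "open U" "\<And>\<theta>. (l has_real_derivative \<rho> \<theta>) (at \<theta>)" "\<And>n. gd n U (\<lambda>\<mu> \<theta>. of_real (\<rho> \<theta>))"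
    "\<And>\<theta>. \<bar>l \<theta>\<bar> \<le> B" "f holomorphic_on U"
  shows "gd n U (\<lambda>\<mu> \<theta>. exp (f \<mu> * of_real (l \<theta>)))"
proof -
  have 0: "gd0 U (\<lambda>\<mu> \<theta>. exp (f \<mu> * of_real (l \<theta>)))"
    unfolding gd0_def
  proof (intro conjI allI ballI)
    fix \<mu> assume "\<mu> \<in> U"
    then obtain r C where r: "r > 0" "cball \<mu> r \<subseteq> U" and C: "\<And>\<mu>'. \<mu>' \<in> cball \<mu> r \<Longrightarrow> norm (f \<mu>') \<le> C"
      using gd0_hol[OF assms(1,5)] unfolding gd0_def by metis
    have C0: "C \<ge> 0" using C[of \<mu>] r norm_ge_zero order_trans by (metis centre_in_cball less_imp_le)
    have "norm (exp (f \<mu>' * of_real (l \<theta>))) \<le> exp (C * B)" if "\<mu>' \<in> cball \<mu> r" for \<mu>' \<theta>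
    proof -
      have "norm (exp (f \<mu>' * of_real (l \<theta>))) \<le> exp (norm (f \<mu>' * of_real (l \<theta>)))"
        by (rule norm_exp)
      also have "\<dots> \<le> exp (C * B)"
        using C[OF that] assms(4)[of \<theta>] C0 by (auto simp: norm_mult intro!: mult_mono)
      finally show ?thesis .
    qed
    then show "\<exists>r>0. cball \<mu> r \<subseteq> U \<and> (\<exists>B. \<forall>\<mu>'\<in>cball \<mu> r. \<forall>\<theta>. norm (exp (f \<mu>' * of_real (l \<theta>))) \<le> B)"
      using r by blast
  qed (intro holomorphic_intros assms)
  show ?thesis
  proof (induction n)
    case (Suc n)
    have d: "((\<lambda>\<theta>. exp (f \<mu> * of_real (l \<theta>))) has_vector_derivative
        (f \<mu> * of_real (\<rho> \<theta>)) * exp (f \<mu> * of_real (l \<theta>))) (at \<theta>)" for \<mu> \<theta>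
    proof -
      have "((\<lambda>x. f \<mu> * of_real x) has_vector_derivative f \<mu>) (at (l \<theta>))"
        using has_vector_derivative_mult_right[OF has_vector_derivative_of_real[OF DERIV_ident], of "f \<mu>" "at (l \<theta>)"]
        by simp
      moreover have "(l has_vector_derivative \<rho> \<theta>) (at \<theta>)"
        using assms(2)[of \<theta>] by (simp add: has_real_derivative_iff_has_vector_derivative)
      ultimately have "((\<lambda>\<theta>. f \<mu> * of_real (l \<theta>)) has_vector_derivative (f \<mu> * of_real (\<rho> \<theta>))) (at \<theta>)"
        using vector_diff_chain_at[of l "\<rho> \<theta>" \<theta> "\<lambda>x. f \<mu> * of_real x" "f \<mu>"]
        by (simp add: o_def scaleR_conv_of_real mult.commute)
      from field_vector_diff_chain_at[OF this DERIV_exp] show ?thesis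
        by (simp add: o_def)
    qed
    show ?case
      by (intro gd_SucI[where \<Phi>' = "\<lambda>\<mu> \<theta>. (f \<mu> * of_real (\<rho> \<theta>)) * exp (f \<mu> * of_real (l \<theta>))"] 0 d
          gd_mult gd_hol assms Suc)
  qed (simp add: 0)
qed

text \<open>For u = 1 / (1 + c \<open>ex n\<close>) the derivative is i n (u - u^2), a polynomial in
  u, so the induction on the order closes on u itself.\<close>

lemma gd_inverse:
  assumes "open U" "norm c < 1"
  shows "gd n' U (\<lambda>\<mu> \<theta>. 1 / (1 + c * ex n \<theta>))"
proof -
  have lb: "1 - norm c \<le> norm (1 + c * ex n \<theta>)" for \<theta>
    using norm_triangle_ineq2[of 1 "- c * ex n \<theta>"] by (simp add: norm_mult)
  have nz: "1 + c * ex n \<theta> \<noteq> 0" for \<theta> using lb[of \<theta>] assms(2) by auto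
  have 0: "gd0 U (\<lambda>\<mu> \<theta>. 1 / (1 + c * ex n \<theta>))"
  proof (rule gd0_bounded[OF assms(1)])
    show "norm (1 / (1 + c * ex n \<theta>)) \<le> 1 / (1 - norm c)" for \<theta>
      using lb[of \<theta>] assms(2) by (simp add: norm_divide frac_le)
  qed
  let ?u = "\<lambda>\<theta>. 1 / (1 + c * ex n \<theta>)"
  have d: "(?u has_vector_derivative \<i> * of_int n * (?u \<theta> + (-1) * (?u \<theta> * ?u \<theta>))) (at \<theta>)" for \<theta>
  proof -
    have "((\<lambda>\<theta>. 1 + c * ex n \<theta>) has_vector_derivative 0 + c * ((- \<i> * of_int n) * ex n \<theta>)) (at \<theta>)"
      by (intro has_vector_derivative_add has_vector_derivative_const has_vector_derivative_mult_right ex_deriv)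
    from field_vector_diff_chain_at[OF this, of inverse "- (inverse (1 + c * ex n \<theta>) ^ 2)"]
    have "((\<lambda>\<theta>. inverse (1 + c * ex n \<theta>)) has_vector_derivative
      (c * ((- \<i> * of_int n) * ex n \<theta>)) * - (inverse (1 + c * ex n \<theta>) ^ 2)) (at \<theta>)"
      using DERIV_inverse[OF nz[of \<theta>]] by (simp add: o_def numeral_2_eq_2)
    moreover have "(c * ((- \<i> * of_int n) * ex n \<theta>)) * - (inverse (1 + c * ex n \<theta>) ^ 2) =
        \<i> * of_int n * (?u \<theta> + (-1) * (?u \<theta> * ?u \<theta>))"
    proof -
      have eq: "(c * ((- \<i> * of_int n) * e)) * - (inverse D ^ 2) = \<i> * of_int n * (1 / D + (-1) * (1 / D * (1 / D)))"
        if "D \<noteq> 0" "D = 1 + c * e" for D e :: complex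
      proof -
        have "(c * ((- \<i> * of_int n) * e)) * - (inverse D ^ 2) = \<i> * of_int n * ((D - 1) * inverse D ^ 2)"
          using that(2) by simp
        also have "(D - 1) * inverse D ^ 2 = 1 / D + (-1) * (1 / D * (1 / D))"
          using that(1) by (simp add: field_simps power2_eq_square)
        finally show ?thesis .
      qed
      show ?thesis by (rule eq[OF nz refl])
    qed
    ultimately show ?thesis by (simp only: inverse_eq_divide)
  qed
  show ?thesis
  proof (induction n')
    case (Suc k)
    show ?case
      by (rule gd_SucI[where \<Phi>' = "\<lambda>\<mu> \<theta>. \<i> * of_int n * (?u \<theta> + (-1) * (?u \<theta> * ?u \<theta>))"])
         (intro 0 d gd_mult gd_const gd_add assms Suc)+
  qed (simp add: 0)
qed

section \<open>Smooth vectors of the principal series as functions of the angle\<close>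

definition sg :: "mhat \<Rightarrow> complex" where "sg \<sigma> = (case \<sigma> of Plus \<Rightarrow> 1 | Minus \<Rightarrow> - 1)"

lemma mat1_neq: "(mat 1 :: mat2) \<noteq> - mat 1"
  by (simp add: vec_eq_iff forall_2 mat_def)

lemma Hinf_iff:
  "\<phi> \<in> Hinf \<sigma> \<longleftrightarrow> (\<forall>k. k \<notin> SO2 \<longrightarrow> \<phi> k = 0) \<and> smooth_real (\<lambda>\<theta>. \<phi> (rot \<theta>)) \<and>
     (\<forall>\<theta>. \<phi> (rot (\<theta> + pi)) = sg \<sigma> * \<phi> (rot \<theta>))"
proof -
  have "(\<forall>k\<in>SO2. \<forall>x\<in>Mgrp. \<phi> (k ** x) = inverse (mchar \<sigma> x) * \<phi> k) \<longleftrightarrow>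
     (\<forall>\<theta>. \<phi> (rot (\<theta> + pi)) = sg \<sigma> * \<phi> (rot \<theta>))"
    unfolding rot_pi Mgrp_def SO2_def using mat1_neq
    by (cases \<sigma>) (auto simp: sg_def)
  then show ?thesis by (auto simp: Hinf_def)
qed

lemma Hinf_SP: "\<phi> \<in> Hinf \<sigma> \<Longrightarrow> SP (\<lambda>\<theta>. \<phi> (rot \<theta>))"
  by (simp add: Hinf_iff SP_def per_rot)

lemma Hinf_off: "\<phi> \<in> Hinf \<sigma> \<Longrightarrow> k \<notin> SO2 \<Longrightarrow> \<phi> k = 0"
  by (simp add: Hinf_iff)

lemma Hinf_0: "(\<lambda>k. 0) \<in> Hinf \<sigma>"
  using SP_0 by (simp add: Hinf_iff SP_def)

lemma Hinf_add: "f \<in> Hinf \<sigma> \<Longrightarrow> h \<in> Hinf \<sigma> \<Longrightarrow> (\<lambda>k. f k + h k) \<in> Hinf \<sigma>"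
  by (auto simp: Hinf_iff smooth_add distrib_left)
lemma Hinf_diff: "f \<in> Hinf \<sigma> \<Longrightarrow> h \<in> Hinf \<sigma> \<Longrightarrow> (\<lambda>k. f k - h k) \<in> Hinf \<sigma>"
  by (auto simp: Hinf_iff smooth_diff right_diff_distrib)
lemma Hinf_scale: "f \<in> Hinf \<sigma> \<Longrightarrow> (\<lambda>k. c * f k) \<in> Hinf \<sigma>"
  by (auto simp: Hinf_iff smooth_scale)

lemma Hinf_eqI:
  assumes "f \<in> Hinf \<sigma>" "h \<in> Hinf \<sigma>" "\<And>\<theta>. f (rot \<theta>) = h (rot \<theta>)" shows "f = h"
proof
  fix k show "f k = h k"
    using assms by (cases "k \<in> SO2") (auto simp: SO2_def Hinf_off)
qed

text \<open>The second-order Taylor remainder. Cauchy's inequality for the second derivative is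
  applied on disks of radius r about points of the disk of radius r, hence the bound on the disk of
  radius 2 r. The estimate depends on \<open>f\<close> only through \<open>B\<close>, which makes it
  uniform in the angle when \<open>f\<close> belongs to a family.\<close>

lemma taylor_quotient:
  assumes "f holomorphic_on U" "cball \<mu> (2 * r) \<subseteq> U" "r > 0"
    "\<And>x. x \<in> cball \<mu> (2 * r) \<Longrightarrow> norm (f x) \<le> B" "norm h \<le> r" "h \<noteq> 0"
  shows "norm ((f (\<mu> + h) - f \<mu>) / h - deriv f \<mu>) \<le> 2 * B / r ^ 2 * norm h"
proof -
  have hol: "f holomorphic_on ball \<mu> (2 * r)"
    by (rule holomorphic_on_subset[OF assms(1)]) (use assms(2) in auto)
  have sub: "cball \<mu> r \<subseteq> ball \<mu> (2 * r)" using assms(3) by auto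
  have "norm ((deriv ^^ 0) f (\<mu> + h) - (\<Sum>i\<le>1. (deriv ^^ i) f \<mu> * ((\<mu> + h) - \<mu>) ^ i / fact i))
      \<le> (2 * B / r ^ 2) * norm ((\<mu> + h) - \<mu>) ^ Suc 1 / fact 1"
  proof (rule complex_Taylor[where S = "cball \<mu> r"])
    fix i x assume "x \<in> cball \<mu> r" "i \<le> (1::nat)"
    then have "x \<in> ball \<mu> (2 * r)" using sub by blast
    then have "((deriv ^^ i) f has_field_derivative deriv ((deriv ^^ i) f) x) (at x)"
      by (intro holomorphic_derivI[of _ "ball \<mu> (2 * r)"] holomorphic_higher_deriv hol) auto
    then show "((deriv ^^ i) f has_field_derivative (deriv ^^ Suc i) f x) (at x within cball \<mu> r)"
      by (simp add: has_field_derivative_at_within)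
  next
    fix x assume x: "x \<in> cball \<mu> r"
    have cb: "cball x r \<subseteq> cball \<mu> (2 * r)"
    proof
      fix y assume "y \<in> cball x r"
      then show "y \<in> cball \<mu> (2 * r)" using x dist_triangle[of \<mu> y x] by simp
    qed
    have "norm ((deriv ^^ 2) f x) \<le> fact 2 * B / r ^ 2"
    proof (rule Cauchy_inequality)
      show "f holomorphic_on ball x r" "continuous_on (cball x r) f"
        using subset_trans[OF cb assms(2)] subset_trans[OF ball_subset_cball subset_trans[OF cb assms(2)]]
        by (auto intro!: holomorphic_on_subset[OF assms(1)] holomorphic_on_imp_continuous_on)
      show "norm (f y) \<le> B" if "norm (x - y) = r" for y
        using cb that by (intro assms(4)) (auto simp: dist_norm)
    qed fact
    then show "norm ((deriv ^^ Suc 1) f x) \<le> 2 * B / r ^ 2" by (simp add: numeral_2_eq_2)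
  qed (use assms in \<open>auto simp: dist_norm\<close>)
  then have "norm (f (\<mu> + h) - f \<mu> - deriv f \<mu> * h) \<le> (2 * B / r ^ 2) * norm h ^ 2"
    by (simp add: algebra_simps numeral_2_eq_2)
  then have "norm (f (\<mu> + h) - f \<mu> - deriv f \<mu> * h) / norm h \<le> (2 * B / r ^ 2) * norm h"
    using assms(6) by (simp add: field_simps power2_eq_square)
  moreover have "(f (\<mu> + h) - f \<mu>) / h - deriv f \<mu> = (f (\<mu> + h) - f \<mu> - deriv f \<mu> * h) / h"
    using assms(6) by (simp add: field_simps)
  ultimately show ?thesis by (simp add: norm_divide)
qed

definition pd :: "(complex \<Rightarrow> real \<Rightarrow> complex) \<Rightarrow> complex \<Rightarrow> real \<Rightarrow> complex" where
  "pd \<Phi> \<mu> \<theta> = deriv (\<lambda>\<mu>. \<Phi> \<mu> \<theta>) \<mu>"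

lemma gd0_ball:
  assumes "gd0 U \<Phi>" "\<mu> \<in> U"
  obtains r B where "r > 0" "cball \<mu> (2 * r) \<subseteq> U" "\<And>\<mu>' \<theta>. \<mu>' \<in> cball \<mu> (2 * r) \<Longrightarrow> norm (\<Phi> \<mu>' \<theta>) \<le> B"
proof -
  obtain r B where "r > 0" "cball \<mu> r \<subseteq> U" "\<forall>\<mu>'\<in>cball \<mu> r. \<forall>\<theta>. norm (\<Phi> \<mu>' \<theta>) \<le> B"
    using assms unfolding gd0_def by blast
  then show ?thesis using that[of "r / 2" B] by simp
qed

lemma gd0_deriv:
  assumes "open U" "gd0 U \<Phi>" shows "gd0 U (pd \<Phi>)"
  unfolding gd0_def
proof (intro conjI allI ballI)
  have hol: "(\<lambda>\<mu>. \<Phi> \<mu> \<theta>) holomorphic_on U" for \<theta> using assms(2) by (simp add: gd0_def)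
  show "(\<lambda>\<mu>. pd \<Phi> \<mu> \<theta>) holomorphic_on U" for \<theta>
    unfolding pd_def using holomorphic_deriv[OF hol assms(1)] by simp
  fix \<mu> assume "\<mu> \<in> U"
  then obtain r B where r: "r > 0" "cball \<mu> (2 * r) \<subseteq> U"
    and B: "\<And>\<mu>' \<theta>. \<mu>' \<in> cball \<mu> (2 * r) \<Longrightarrow> norm (\<Phi> \<mu>' \<theta>) \<le> B" using gd0_ball[OF assms(2)] by metis
  have "norm (pd \<Phi> \<mu>' \<theta>) \<le> fact 1 * B / r ^ 1" if "\<mu>' \<in> cball \<mu> r" for \<mu>' \<theta>
  proof -
    have cb: "cball \<mu>' r \<subseteq> cball \<mu> (2 * r)"
    proof
      fix y assume "y \<in> cball \<mu>' r"
      then show "y \<in> cball \<mu> (2 * r)" using that dist_triangle[of \<mu> y \<mu>'] by simp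
    qed
    have "norm ((deriv ^^ 1) (\<lambda>\<mu>. \<Phi> \<mu> \<theta>) \<mu>') \<le> fact 1 * B / r ^ 1"
    proof (rule Cauchy_inequality)
      show "(\<lambda>\<mu>. \<Phi> \<mu> \<theta>) holomorphic_on ball \<mu>' r" "continuous_on (cball \<mu>' r) (\<lambda>\<mu>. \<Phi> \<mu> \<theta>)"
        using subset_trans[OF cb r(2)] subset_trans[OF ball_subset_cball subset_trans[OF cb r(2)]]
        by (auto intro!: holomorphic_on_subset[OF hol] holomorphic_on_imp_continuous_on)
      show "norm (\<Phi> y \<theta>) \<le> B" if "norm (\<mu>' - y) = r" for y
        using cb that by (intro B) (auto simp: dist_norm)
    qed fact
    then show ?thesis by (simp add: pd_def)
  qed
  then show "\<exists>r>0. cball \<mu> r \<subseteq> U \<and> (\<exists>B. \<forall>\<mu>'\<in>cball \<mu> r. \<forall>\<theta>. norm (pd \<Phi> \<mu>' \<theta>) \<le> B)"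
    using r by (intro exI[of _ r] conjI exI[of _ "fact 1 * B / r ^ 1"] subset_trans[OF subset_cball[of r "2 * r"]]) auto
qed

text \<open>The difference quotients in the parameter converge pointwise, and by
  \<open>taylor_quotient\<close> their angular derivatives converge uniformly in the angle. Hence
  the limit may be differentiated in the angle.\<close>

lemma pd_commute:
  assumes "open U" "gd0 U \<Phi>" "gd0 U \<Phi>'" "\<mu> \<in> U"
    "\<And>\<mu> \<theta>. \<mu> \<in> U \<Longrightarrow> (\<Phi> \<mu> has_vector_derivative \<Phi>' \<mu> \<theta>) (at \<theta>)"
  shows "(pd \<Phi> \<mu> has_vector_derivative pd \<Phi>' \<mu> \<theta>) (at \<theta>)"
proof -
  obtain r B where r: "r > 0" "cball \<mu> (2 * r) \<subseteq> U"
    and B: "\<And>\<mu>' \<theta>. \<mu>' \<in> cball \<mu> (2 * r) \<Longrightarrow> norm (\<Phi>' \<mu>' \<theta>) \<le> B" using gd0_ball[OF assms(3,4)] by metis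
  have hol: "(\<lambda>\<mu>. \<Phi> \<mu> \<theta>) holomorphic_on U" "(\<lambda>\<mu>. \<Phi>' \<mu> \<theta>) holomorphic_on U" for \<theta>
    using assms(2,3) by (auto simp: gd0_def)
  define h where "h = (\<lambda>j. of_real (r / real (Suc j)) :: complex)"
  have h: "h j \<noteq> 0" "norm (h j) = r / real (Suc j)" for j
    unfolding h_def norm_of_real of_real_eq_0_iff using r(1) by auto
  have hr: "norm (h j) \<le> r" for j unfolding h using r(1) by (simp add: field_simps)
  have inU: "\<mu> + h j \<in> U" for j
    using r hr[of j] by (auto simp: subset_iff dist_norm)
  have h0: "h \<longlonglongrightarrow> 0"
  proof -
    have "(\<lambda>j. r * inverse (real (Suc j))) \<longlonglongrightarrow> r * 0"
      by (intro tendsto_mult_left LIMSEQ_inverse_real_of_nat)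
    then have "(\<lambda>j. complex_of_real (r / real (Suc j))) \<longlonglongrightarrow> of_real 0"
      by (intro tendsto_of_real) (simp add: divide_inverse)
    then show ?thesis unfolding h_def by simp
  qed
  define f where "f = (\<lambda>j \<theta>. (\<Phi> (\<mu> + h j) \<theta> - \<Phi> \<mu> \<theta>) / h j)"
  have flim: "(\<lambda>j. f j \<theta>) \<longlonglongrightarrow> pd \<Phi> \<mu> \<theta>" for \<theta>
  proof -
    have "((\<lambda>\<mu>. \<Phi> \<mu> \<theta>) has_field_derivative pd \<Phi> \<mu> \<theta>) (at \<mu>)"
      unfolding pd_def by (rule holomorphic_derivI[OF hol(1) assms(1,4)])
    then have "((\<lambda>h. (\<Phi> (\<mu> + h) \<theta> - \<Phi> \<mu> \<theta>) / h) \<longlongrightarrow> pd \<Phi> \<mu> \<theta>) (at 0)" by (simp add: DERIV_def)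
    moreover have "filterlim h (at 0) sequentially" using h0 h(1) by (simp add: filterlim_at)
    ultimately show ?thesis unfolding f_def by (rule filterlim_compose)
  qed
  have "\<exists>g. \<forall>x\<in>UNIV. (\<lambda>j. f j x) \<longlonglongrightarrow> g x \<and> (g has_derivative (\<lambda>t. t *\<^sub>R pd \<Phi>' \<mu> x)) (at x within UNIV)"
  proof (rule has_derivative_sequence[where ?x0.0 = 0 and
     f' = "\<lambda>j x t. t *\<^sub>R ((\<Phi>' (\<mu> + h j) x - \<Phi>' \<mu> x) / h j)"])
    show "(f j has_derivative (\<lambda>t. t *\<^sub>R ((\<Phi>' (\<mu> + h j) x - \<Phi>' \<mu> x) / h j))) (at x within UNIV)" for j x
      using has_vector_derivative_mult_right[OF has_vector_derivative_diff[OF assms(5)[OF inU[of j]] assms(5)[OF assms(4)]], of "inverse (h j)" x]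
      unfolding f_def by (simp add: has_vector_derivative_def divide_inverse mult.commute)
  next
    fix e :: real assume "e > 0"
    have "(\<lambda>j. 2 * B / r ^ 2 * norm (h j)) \<longlonglongrightarrow> 2 * B / r ^ 2 * norm (0::complex)"
      by (intro tendsto_intros h0)
    then have "\<forall>\<^sub>F j in sequentially. 2 * B / r ^ 2 * norm (h j) < e"
      using \<open>e > 0\<close> by (auto dest: order_tendstoD(2))
    then show "\<forall>\<^sub>F j in sequentially. \<forall>x\<in>UNIV. \<forall>t.
        norm (t *\<^sub>R ((\<Phi>' (\<mu> + h j) x - \<Phi>' \<mu> x) / h j) - t *\<^sub>R pd \<Phi>' \<mu> x) \<le> e * norm t"
    proof eventually_elim
      case (elim j)
      show ?case
      proof (intro ballI allI)
        fix x t
        have "norm ((\<Phi>' (\<mu> + h j) x - \<Phi>' \<mu> x) / h j - pd \<Phi>' \<mu> x) \<le> 2 * B / r ^ 2 * norm (h j)"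
          unfolding pd_def by (rule taylor_quotient[OF hol(2) r(2,1) B hr h(1)])
        then show "norm (t *\<^sub>R ((\<Phi>' (\<mu> + h j) x - \<Phi>' \<mu> x) / h j) - t *\<^sub>R pd \<Phi>' \<mu> x) \<le> e * norm t"
          unfolding scaleR_diff_right[symmetric] norm_scaleR real_norm_def mult.commute[of e] using elim
          by (intro mult_left_mono) linarith+
      qed
    qed
  qed (use flim in auto)
  then obtain g where g: "\<And>x. (\<lambda>j. f j x) \<longlonglongrightarrow> g x" "\<And>x. (g has_derivative (\<lambda>t. t *\<^sub>R pd \<Phi>' \<mu> x)) (at x)"
    by blast
  have "g = pd \<Phi> \<mu>" using LIMSEQ_unique[OF g(1) flim] by blast
  then show ?thesis using g(2) by (simp add: has_vector_derivative_def)
qed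

lemma gd_deriv: assumes "open U" shows "gd n U \<Phi> \<Longrightarrow> gd n U (pd \<Phi>)"
proof (induction n arbitrary: \<Phi>)
  case (Suc n)
  then obtain \<Phi>' where *: "gd0 U \<Phi>"
    "\<And>\<mu> \<theta>. \<mu> \<in> U \<Longrightarrow> (\<Phi> \<mu> has_vector_derivative \<Phi>' \<mu> \<theta>) (at \<theta>)" "gd n U \<Phi>'" by auto
  show ?case
    by (rule gd_SucI[OF gd0_deriv[OF assms *(1)] pd_commute[OF assms *(1) gd_gd0[OF *(3)] _ *(2)] Suc.IH[OF *(3)]])
qed (simp add: gd0_deriv assms)

lemma gd_vderiv: "gd (k + n) U \<Phi> \<Longrightarrow> gd n U (\<lambda>\<mu>. (vderiv ^^ k) (\<Phi> \<mu>))"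
proof (induction k arbitrary: \<Phi>)
  case (Suc k)
  then obtain \<Phi>' where *: "\<And>\<mu> \<theta>. \<mu> \<in> U \<Longrightarrow> (\<Phi> \<mu> has_vector_derivative \<Phi>' \<mu> \<theta>) (at \<theta>)" "gd (k + n) U \<Phi>'" by auto
  have "vderiv (\<Phi> \<mu>) = \<Phi>' \<mu>" if "\<mu> \<in> U" for \<mu>
    using *(1)[OF that] by (auto simp: vderiv_def vector_derivative_at)
  then show ?case
    by (intro gd_cong[OF _ Suc.IH[OF *(2)]]) (simp add: funpow_Suc_right del: funpow.simps)
qed simp

lemma gd_smooth: assumes "\<And>n. gd n U \<Phi>" "\<mu> \<in> U" shows "smooth_real (\<Phi> \<mu>)"
  unfolding smooth_real_def
proof (intro allI)
  fix k \<theta>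
  have "gd (Suc 0) U (\<lambda>\<mu>. (vderiv ^^ k) (\<Phi> \<mu>))" by (rule gd_vderiv) (rule assms)
  then show "(vderiv ^^ k) (\<Phi> \<mu>) differentiable (at \<theta>)"
    using assms(2) by (auto intro: differentiableI_vector)
qed

lemma pd_vderiv:
  assumes "open U" "\<And>n. gd n U \<Phi>" "\<mu> \<in> U"
  shows "(vderiv ^^ i) (pd \<Phi> \<mu>) = pd (\<lambda>\<mu>. (vderiv ^^ i) (\<Phi> \<mu>)) \<mu>"
proof -
  have gn: "gd n U (\<lambda>\<mu>. (vderiv ^^ i) (\<Phi> \<mu>))" for n i by (rule gd_vderiv) (rule assms)
  have "(pd (\<lambda>\<mu>. (vderiv ^^ i) (\<Phi> \<mu>)) \<mu> has_vector_derivative pd (\<lambda>\<mu>. (vderiv ^^ Suc i) (\<Phi> \<mu>)) \<mu> \<theta>) (at \<theta>)" for i \<theta>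
    by (rule pd_commute[OF assms(1) gd_gd0[OF gn] gd_gd0[OF gn] assms(3)])
       (rule smooth_real_vd[OF gd_smooth[OF assms(2)]])
  then show ?thesis
    by (intro smooth_realI(2)[where G = "\<lambda>i. pd (\<lambda>\<mu>. (vderiv ^^ i) (\<Phi> \<mu>)) \<mu>"]) auto
qed

definition pdn :: "nat \<Rightarrow> (complex \<Rightarrow> real \<Rightarrow> complex) \<Rightarrow> complex \<Rightarrow> real \<Rightarrow> complex" where
  "pdn j \<Phi> \<mu> \<theta> = (deriv ^^ j) (\<lambda>\<mu>. \<Phi> \<mu> \<theta>) \<mu>"

lemma pdn_Suc: "pdn (Suc j) \<Phi> = pd (pdn j \<Phi>)"
  unfolding pdn_def[abs_def] pd_def[abs_def] by (simp add: fun_eq_iff)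

lemma pdn_vderiv:
  assumes "open U" "\<And>n. gd n U \<Phi>" "\<mu> \<in> U"
  shows "gd n U (pdn j \<Phi>)" "(vderiv ^^ i) (pdn j \<Phi> \<mu>) = pdn j (\<lambda>\<mu>. (vderiv ^^ i) (\<Phi> \<mu>)) \<mu>"
proof -
  have g: "gd n U (pdn j \<Phi>)" for n j
  proof (induction j)
    case 0 then show ?case using assms(2) by (simp add: pdn_def[abs_def])
  next
    case (Suc j) then show ?case unfolding pdn_Suc by (rule gd_deriv[OF assms(1)])
  qed
  then show "gd n U (pdn j \<Phi>)" .
  have "\<forall>\<mu>\<in>U. (vderiv ^^ i) (pdn j \<Phi> \<mu>) = pdn j (\<lambda>\<mu>. (vderiv ^^ i) (\<Phi> \<mu>)) \<mu>"
  proof (induction j)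
    case 0 show ?case by (simp add: pdn_def[abs_def])
  next
    case (Suc j)
    show ?case
    proof
      fix \<mu> assume \<mu>: "\<mu> \<in> U"
      have "(vderiv ^^ i) (pdn (Suc j) \<Phi> \<mu>) \<theta> = pdn (Suc j) (\<lambda>\<mu>. (vderiv ^^ i) (\<Phi> \<mu>)) \<mu> \<theta>" for \<theta>
      proof -
        have "\<forall>\<^sub>F x in nhds \<mu>. x \<in> U" by (rule eventually_nhds_in_open[OF assms(1) \<mu>])
        then have "\<forall>\<^sub>F x in nhds \<mu>. (vderiv ^^ i) (pdn j \<Phi> x) \<theta> = pdn j (\<lambda>\<mu>. (vderiv ^^ i) (\<Phi> \<mu>)) x \<theta>"
          by eventually_elim (use Suc in simp)
        then show ?thesis unfolding pdn_Suc pd_vderiv[OF assms(1) g \<mu>]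
          unfolding pd_def by (rule deriv_cong_ev) simp
      qed
      then show "(vderiv ^^ i) (pdn (Suc j) \<Phi> \<mu>) = pdn (Suc j) (\<lambda>\<mu>. (vderiv ^^ i) (\<Phi> \<mu>)) \<mu>" by blast
    qed
  qed
  then show "(vderiv ^^ i) (pdn j \<Phi> \<mu>) = pdn j (\<lambda>\<mu>. (vderiv ^^ i) (\<Phi> \<mu>)) \<mu>" using assms(3) by blast
qed

definition fam :: "mhat \<Rightarrow> complex set \<Rightarrow> (complex \<Rightarrow> mat2 \<Rightarrow> complex) \<Rightarrow> bool" where
  "fam \<sigma> U \<phi> \<longleftrightarrow> (\<forall>\<mu>\<in>U. \<phi> \<mu> \<in> Hinf \<sigma>) \<and> (\<forall>n. gd n U (\<lambda>\<mu> \<theta>. \<phi> \<mu> (rot \<theta>)))"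

text \<open>The seminorm of index n is a supremum over the angle. Convergence of the difference
  quotients in it gives both the complex derivative at each angle and a local bound uniform in the
  angle.\<close>

lemma hol_into_imp_gd0:
  assumes "open U" "hol_into \<sigma> U \<phi>"
  shows "gd0 U (\<lambda>\<mu>. (vderiv ^^ n) (\<lambda>\<theta>. \<phi> \<mu> (rot \<theta>)))"
proof -
  let ?F = "\<lambda>\<mu> \<theta>. \<phi> \<mu> (rot \<theta>)"
  have H: "\<phi> \<mu> \<in> Hinf \<sigma>" if "\<mu> \<in> U" for \<mu> using assms(2) that by (simp add: hol_into_def)
  have main: "\<exists>\<eta>\<in>Hinf \<sigma>. \<forall>e>0. \<exists>d>0. \<forall>h. h \<noteq> 0 \<and> norm h < d \<longrightarrow> \<mu> + h \<in> U \<and> (\<forall>\<theta>. norm (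
      ((vderiv ^^ n) (?F (\<mu> + h)) \<theta> - (vderiv ^^ n) (?F \<mu>) \<theta>) / h - (vderiv ^^ n) (\<lambda>\<theta>. \<eta> (rot \<theta>)) \<theta>) < e)"
    if \<mu>: "\<mu> \<in> U" for \<mu>
  proof -
    obtain \<eta> where \<eta>: "\<eta> \<in> Hinf \<sigma>" and
      lim: "((\<lambda>h. snorm n (\<lambda>k. (\<phi> (\<mu> + h) k - \<phi> \<mu> k) / h - \<eta> k)) \<longlongrightarrow> 0) (at 0)"
      using assms(2) \<mu> unfolding hol_into_def by blast
    obtain d0 where d0: "d0 > 0" "ball \<mu> d0 \<subseteq> U" using assms(1) \<mu> openE by blast
    show ?thesis
    proof (intro bexI[OF _ \<eta>] allI impI)
      fix e :: real assume "e > 0"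
      then obtain d where "d > 0" "\<forall>h. h \<noteq> 0 \<and> norm (h - 0) < d \<longrightarrow> norm (snorm n (\<lambda>k. (\<phi> (\<mu> + h) k - \<phi> \<mu> k) / h - \<eta> k) - 0) < e"
        using lim[unfolded LIM_eq] by blast
      then have d: "d > 0" "\<And>h. h \<noteq> 0 \<Longrightarrow> norm h < d \<Longrightarrow> \<bar>snorm n (\<lambda>k. (\<phi> (\<mu> + h) k - \<phi> \<mu> k) / h - \<eta> k)\<bar> < e"
        by simp_all
      show "\<exists>d>0. \<forall>h. h \<noteq> 0 \<and> norm h < d \<longrightarrow> \<mu> + h \<in> U \<and> (\<forall>\<theta>. norm (
        ((vderiv ^^ n) (?F (\<mu> + h)) \<theta> - (vderiv ^^ n) (?F \<mu>) \<theta>) / h - (vderiv ^^ n) (\<lambda>\<theta>. \<eta> (rot \<theta>)) \<theta>) < e)"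
      proof (intro exI[of _ "min d d0"] conjI allI impI)
        fix h :: complex assume "h \<noteq> 0 \<and> norm h < min d d0"
        then have h: "h \<noteq> 0" "norm h < d" "norm h < d0" by auto
        then show U: "\<mu> + h \<in> U" using d0 by (auto simp: dist_norm subset_iff)
        fix \<theta>
        have S: "SP (?F (\<mu> + h))" "SP (?F \<mu>)" "SP (\<lambda>\<theta>. \<eta> (rot \<theta>))" using H U \<mu> \<eta> Hinf_SP by blast+
        let ?D = "\<lambda>\<theta>. inverse h * (?F (\<mu> + h) \<theta> - ?F \<mu> \<theta>) - \<eta> (rot \<theta>)"
        have "(vderiv ^^ n) ?D \<theta> = inverse h * ((vderiv ^^ n) (?F (\<mu> + h)) \<theta> - (vderiv ^^ n) (?F \<mu>) \<theta>) - (vderiv ^^ n) (\<lambda>\<theta>. \<eta> (rot \<theta>)) \<theta>"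
          using S by (simp add: SP_def smooth_diff smooth_scale)
        moreover have "norm ((vderiv ^^ n) ?D \<theta>) \<le> sn n ?D"
          by (intro sn_upper SP_diff SP_scale S)
        moreover have "sn n ?D < e" using d(2)[OF h(1,2)]
          by (simp add: snorm_sn divide_inverse mult.commute)
        ultimately show "norm (((vderiv ^^ n) (?F (\<mu> + h)) \<theta> - (vderiv ^^ n) (?F \<mu>) \<theta>) / h - (vderiv ^^ n) (\<lambda>\<theta>. \<eta> (rot \<theta>)) \<theta>) < e"
          by (simp add: divide_inverse mult.commute)
      qed (use d d0 in auto)
    qed
  qed
  show ?thesis unfolding gd0_def
  proof (intro conjI allI ballI)
    fix \<theta>
    show "(\<lambda>\<mu>. (vderiv ^^ n) (?F \<mu>) \<theta>) holomorphic_on U"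
      unfolding holomorphic_on_open[OF assms(1)]
    proof (intro ballI)
      fix \<mu> assume "\<mu> \<in> U"
      from main[OF this] obtain \<eta> where \<eta>: "\<forall>e>0. \<exists>d>0. \<forall>h. h \<noteq> 0 \<and> norm h < d \<longrightarrow> \<mu> + h \<in> U \<and> (\<forall>\<theta>. norm (
      ((vderiv ^^ n) (?F (\<mu> + h)) \<theta> - (vderiv ^^ n) (?F \<mu>) \<theta>) / h - (vderiv ^^ n) (\<lambda>\<theta>. \<eta> (rot \<theta>)) \<theta>) < e)" by blast
      have "((\<lambda>\<mu>. (vderiv ^^ n) (?F \<mu>) \<theta>) has_field_derivative (vderiv ^^ n) (\<lambda>\<theta>. \<eta> (rot \<theta>)) \<theta>) (at \<mu>)"
        unfolding DERIV_def LIM_eq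
      proof (intro allI impI)
        fix e :: real assume "e > 0"
        from \<eta>[THEN spec, THEN mp, OF this] obtain d where d: "d > 0 \<and> (\<forall>h. h \<noteq> 0 \<and> norm h < d \<longrightarrow> \<mu> + h \<in> U \<and> (\<forall>\<theta>. norm (
      ((vderiv ^^ n) (?F (\<mu> + h)) \<theta> - (vderiv ^^ n) (?F \<mu>) \<theta>) / h - (vderiv ^^ n) (\<lambda>\<theta>. \<eta> (rot \<theta>)) \<theta>) < e))" ..
        show "\<exists>s>0. \<forall>h. h \<noteq> 0 \<and> norm (h - 0) < s \<longrightarrow> norm (
      ((vderiv ^^ n) (?F (\<mu> + h)) \<theta> - (vderiv ^^ n) (?F \<mu>) \<theta>) / h - (vderiv ^^ n) (\<lambda>\<theta>. \<eta> (rot \<theta>)) \<theta>) < e"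
          by (intro exI[of _ d]) (use d in auto)
      qed
      then show "\<exists>f'. ((\<lambda>\<mu>. (vderiv ^^ n) (?F \<mu>) \<theta>) has_field_derivative f') (at \<mu>)" by blast
    qed
  next
    fix \<mu> assume \<mu>: "\<mu> \<in> U"
    from main[OF this] obtain \<eta> d where \<eta>: "\<eta> \<in> Hinf \<sigma>" and d: "d > 0" "\<And>h \<theta>. h \<noteq> 0 \<Longrightarrow> norm h < d \<Longrightarrow> \<mu> + h \<in> U" "\<And>h \<theta>. h \<noteq> 0 \<Longrightarrow> norm h < d \<Longrightarrow> norm (
      ((vderiv ^^ n) (?F (\<mu> + h)) \<theta> - (vderiv ^^ n) (?F \<mu>) \<theta>) / h - (vderiv ^^ n) (\<lambda>\<theta>. \<eta> (rot \<theta>)) \<theta>) < 1"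
      by (metis zero_less_one)
    let ?B = "sn n (?F \<mu>) + d * (1 + sn n (\<lambda>\<theta>. \<eta> (rot \<theta>)))"
    have pos: "0 \<le> sn n (\<lambda>\<theta>. \<eta> (rot \<theta>))" by (rule sn_nonneg[OF Hinf_SP[OF \<eta>]])
    have "norm ((vderiv ^^ n) (?F \<mu>') \<theta>) \<le> ?B" if "\<mu>' \<in> cball \<mu> (d/2)" for \<mu>' \<theta>
    proof (cases "\<mu>' = \<mu>")
      case True
      then show ?thesis using sn_upper[OF Hinf_SP[OF H[OF \<mu>]], of n \<theta>] d(1) pos
        by (simp add: add_increasing2)
    next
      case False
      define h where "h = \<mu>' - \<mu>"
      have h: "h \<noteq> 0" "norm h < d" "\<mu>' = \<mu> + h"
        using False that d(1) by (auto simp: h_def dist_norm norm_minus_commute)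
      define X where "X = ((vderiv ^^ n) (?F (\<mu> + h)) \<theta> - (vderiv ^^ n) (?F \<mu>) \<theta>) / h"
      have "norm X \<le> norm (X - (vderiv ^^ n) (\<lambda>\<theta>. \<eta> (rot \<theta>)) \<theta>) + norm ((vderiv ^^ n) (\<lambda>\<theta>. \<eta> (rot \<theta>)) \<theta>)"
        using norm_triangle_ineq[of "X - (vderiv ^^ n) (\<lambda>\<theta>. \<eta> (rot \<theta>)) \<theta>" "(vderiv ^^ n) (\<lambda>\<theta>. \<eta> (rot \<theta>)) \<theta>"] by simp
      also have "\<dots> \<le> 1 + sn n (\<lambda>\<theta>. \<eta> (rot \<theta>))"
        using d(3)[OF h(1,2), of \<theta>] sn_upper[OF Hinf_SP[OF \<eta>], of n \<theta>] unfolding X_def by simp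
      finally have X: "norm X \<le> 1 + sn n (\<lambda>\<theta>. \<eta> (rot \<theta>))" .
      have "(vderiv ^^ n) (?F \<mu>') \<theta> = (vderiv ^^ n) (?F \<mu>) \<theta> + h * X"
        using h unfolding X_def by simp
      then have "norm ((vderiv ^^ n) (?F \<mu>') \<theta>) \<le> norm ((vderiv ^^ n) (?F \<mu>) \<theta>) + norm h * norm X"
        by (metis norm_mult norm_triangle_ineq)
      also have "\<dots> \<le> ?B"
        using X h(2) pos d(1) by (intro add_mono mult_mono sn_upper[OF Hinf_SP[OF H[OF \<mu>]]]) auto
      finally show ?thesis .
    qed
    moreover have "cball \<mu> (d/2) \<subseteq> U"
    proof
      fix x assume "x \<in> cball \<mu> (d/2)"
      then show "x \<in> U" using d(1) d(2)[of "x - \<mu>"] \<mu> by (cases "x = \<mu>") (auto simp: dist_norm norm_minus_commute)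
    qed
    ultimately show "\<exists>r>0. cball \<mu> r \<subseteq> U \<and> (\<exists>B. \<forall>\<mu>'\<in>cball \<mu> r. \<forall>\<theta>. norm ((vderiv ^^ n) (?F \<mu>') \<theta>) \<le> B)"
      using d(1) by (intro exI[of _ "d/2"] conjI exI[of _ ?B]) auto
  qed
qed

lemma hol_into_imp_fam:
  assumes "open U" "hol_into \<sigma> U \<phi>" shows "fam \<sigma> U \<phi>"
proof -
  have H: "\<phi> \<mu> \<in> Hinf \<sigma>" if "\<mu> \<in> U" for \<mu> using assms(2) that by (simp add: hol_into_def)
  have "gd k U (\<lambda>\<mu>. (vderiv ^^ n) (\<lambda>\<theta>. \<phi> \<mu> (rot \<theta>)))" for k n
  proof (induction k arbitrary: n)
    case 0 show ?case using hol_into_imp_gd0[OF assms] by simp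
  next
    case (Suc k)
    show ?case
    proof (rule gd_SucI[OF hol_into_imp_gd0[OF assms] _ Suc[of "Suc n"]])
      show "((vderiv ^^ n) (\<lambda>\<theta>. \<phi> \<mu> (rot \<theta>)) has_vector_derivative (vderiv ^^ Suc n) (\<lambda>\<theta>. \<phi> \<mu> (rot \<theta>)) \<theta>) (at \<theta>)"
        if "\<mu> \<in> U" for \<mu> \<theta>
        by (rule smooth_real_vd) (use Hinf_SP[OF H[OF that]] in \<open>simp add: SP_def\<close>)
    qed
  qed
  from this[of _ 0] H show ?thesis by (simp add: fam_def)
qed

lemma deriv_zero_ev: "(\<forall>\<^sub>F x in nhds \<mu>. f x = 0) \<Longrightarrow> deriv f (\<mu>::complex) = (0::complex)"
  using deriv_cong_ev[of f "\<lambda>_. 0" \<mu> \<mu>] by simp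

lemma fam_deriv:
  assumes "open U" "fam \<sigma> U \<phi>" shows "fam \<sigma> U (\<lambda>\<mu> k. deriv (\<lambda>\<mu>. \<phi> \<mu> k) \<mu>)"
  unfolding fam_def
proof (intro conjI ballI allI)
  let ?F = "\<lambda>\<mu> \<theta>. \<phi> \<mu> (rot \<theta>)"
  have g: "\<And>n. gd n U ?F" and H: "\<And>\<mu>. \<mu> \<in> U \<Longrightarrow> \<phi> \<mu> \<in> Hinf \<sigma>" using assms(2) by (auto simp: fam_def)
  have gp: "gd n U (pd ?F)" for n by (rule gd_deriv[OF assms(1) g])
  then show "gd n U (\<lambda>\<mu> \<theta>. deriv (\<lambda>\<mu>. \<phi> \<mu> (rot \<theta>)) \<mu>)" for n by (simp add: pd_def[abs_def])
  fix \<mu> assume \<mu>: "\<mu> \<in> U"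
  have ev: "\<forall>\<^sub>F x in nhds \<mu>. x \<in> U" by (rule eventually_nhds_in_open[OF assms(1) \<mu>])
  show "(\<lambda>k. deriv (\<lambda>\<mu>. \<phi> \<mu> k) \<mu>) \<in> Hinf \<sigma>" unfolding Hinf_iff
  proof (intro conjI allI impI)
    show "smooth_real (\<lambda>\<theta>. deriv (\<lambda>\<mu>. \<phi> \<mu> (rot \<theta>)) \<mu>)"
      using gd_smooth[OF gp \<mu>] by (simp add: pd_def[abs_def])
    show "deriv (\<lambda>\<mu>. \<phi> \<mu> k) \<mu> = 0" if "k \<notin> SO2" for k
      by (rule deriv_zero_ev) (rule eventually_mono[OF ev], use H that Hinf_off in blast)
    show "deriv (\<lambda>\<mu>. \<phi> \<mu> (rot (\<theta> + pi))) \<mu> = sg \<sigma> * deriv (\<lambda>\<mu>. \<phi> \<mu> (rot \<theta>)) \<mu>" for \<theta>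
    proof -
      have "deriv (\<lambda>\<mu>. \<phi> \<mu> (rot (\<theta> + pi))) \<mu> = deriv (\<lambda>\<mu>. sg \<sigma> * \<phi> \<mu> (rot \<theta>)) \<mu>"
        by (rule deriv_cong_ev[OF eventually_mono[OF ev]]) (use H Hinf_iff in auto)
      also have "\<dots> = sg \<sigma> * deriv (\<lambda>\<mu>. \<phi> \<mu> (rot \<theta>)) \<mu>"
        using gd_gd0[OF g] \<mu> assms(1) holomorphic_on_imp_differentiable_at
        by (intro deriv_cmult) (auto simp: gd0_def)
      finally show ?thesis .
    qed
  qed
qed

text \<open>The derivative in the Frechet space is the pointwise parameter derivative.
  \<open>pd_vderiv\<close> moves it past the angular derivatives, so that
  \<open>taylor_quotient\<close> estimates each seminorm.\<close>

lemma fam_imp_hol_into: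
  assumes "open U" "fam \<sigma> U \<phi>" shows "hol_into \<sigma> U \<phi>"
  unfolding hol_into_def
proof (intro conjI ballI)
  let ?F = "\<lambda>\<mu> \<theta>. \<phi> \<mu> (rot \<theta>)"
  have g: "\<And>n. gd n U ?F" and H: "\<And>\<mu>. \<mu> \<in> U \<Longrightarrow> \<phi> \<mu> \<in> Hinf \<sigma>" using assms(2) by (auto simp: fam_def)
  then show "\<And>\<mu>. \<mu> \<in> U \<Longrightarrow> \<phi> \<mu> \<in> Hinf \<sigma>" by blast
  fix \<mu> assume \<mu>: "\<mu> \<in> U"
  define \<eta> where "\<eta> = (\<lambda>k. deriv (\<lambda>\<mu>. \<phi> \<mu> k) \<mu>)"
  have \<eta>: "\<eta> \<in> Hinf \<sigma>" using fam_deriv[OF assms] \<mu> by (simp add: fam_def \<eta>_def)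
  show "\<exists>\<eta>\<in>Hinf \<sigma>. \<forall>n. ((\<lambda>h. snorm n (\<lambda>k. (\<phi> (\<mu> + h) k - \<phi> \<mu> k) / h - \<eta> k)) \<longlongrightarrow> 0) (at 0)"
  proof (intro bexI[OF _ \<eta>] allI)
    fix n
    have gn: "gd0 U (\<lambda>\<mu>. (vderiv ^^ n) (?F \<mu>))" by (rule gd_gd0[of 0], rule gd_vderiv, rule g)
    obtain r B where r: "r > 0" "cball \<mu> (2 * r) \<subseteq> U"
      and B: "\<And>\<mu>' \<theta>. \<mu>' \<in> cball \<mu> (2 * r) \<Longrightarrow> norm ((vderiv ^^ n) (?F \<mu>') \<theta>) \<le> B" using gd0_ball[OF gn \<mu>] by metis
    have hol: "(\<lambda>\<mu>. (vderiv ^^ n) (?F \<mu>) \<theta>) holomorphic_on U" for \<theta> using gn by (simp add: gd0_def)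
    have b: "norm (snorm n (\<lambda>k. (\<phi> (\<mu> + h) k - \<phi> \<mu> k) / h - \<eta> k)) \<le> 2 * B / r ^ 2 * norm h"
      if h: "h \<noteq> 0" "norm h < r" for h
    proof -
      have U: "\<mu> + h \<in> U" using h r by (auto simp: subset_iff dist_norm)
      have S: "SP (?F (\<mu> + h))" "SP (?F \<mu>)" "SP (\<lambda>\<theta>. \<eta> (rot \<theta>))" using H U \<mu> \<eta> Hinf_SP by blast+
      let ?D = "\<lambda>\<theta>. inverse h * (?F (\<mu> + h) \<theta> - ?F \<mu> \<theta>) - \<eta> (rot \<theta>)"
      have SD: "SP ?D" by (intro SP_diff SP_scale S)
      have eq: "(vderiv ^^ n) ?D \<theta> = ((vderiv ^^ n) (?F (\<mu> + h)) \<theta> - (vderiv ^^ n) (?F \<mu>) \<theta>) / h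
           - deriv (\<lambda>\<mu>. (vderiv ^^ n) (?F \<mu>) \<theta>) \<mu>" for \<theta>
      proof -
        have "(vderiv ^^ n) (\<lambda>\<theta>. \<eta> (rot \<theta>)) \<theta> = deriv (\<lambda>\<mu>. (vderiv ^^ n) (?F \<mu>) \<theta>) \<mu>"
          using fun_cong[OF pd_vderiv[OF assms(1) g \<mu>, of n], of \<theta>] by (simp add: \<eta>_def pd_def[abs_def])
        then show ?thesis
          using S by (simp add: SP_def smooth_diff smooth_scale divide_inverse mult.commute)
      qed
      have "sn n ?D \<le> 2 * B / r ^ 2 * norm h"
        by (rule sn_least, unfold eq, rule taylor_quotient[OF hol r(2,1) B])
           (use h in auto)
      moreover have "snorm n (\<lambda>k. (\<phi> (\<mu> + h) k - \<phi> \<mu> k) / h - \<eta> k) = sn n ?D"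
        by (simp add: snorm_sn divide_inverse mult.commute)
      ultimately show ?thesis using sn_nonneg[OF SD, of n] by simp
    qed
    have ev: "\<forall>\<^sub>F h in at 0. norm (snorm n (\<lambda>k. (\<phi> (\<mu> + h) k - \<phi> \<mu> k) / h - \<eta> k)) \<le> 2 * B / r ^ 2 * norm h"
      unfolding eventually_at using r(1) b by (intro exI[of _ r]) simp
    have "((\<lambda>h::complex. 2 * B / r ^ 2 * norm h) \<longlongrightarrow> 2 * B / r ^ 2 * norm (0::complex)) (at 0)"
      by (intro tendsto_intros)
    then have "((\<lambda>h::complex. 2 * B / r ^ 2 * norm h) \<longlongrightarrow> 0) (at 0)" by simp
    then show "((\<lambda>h. snorm n (\<lambda>k. (\<phi> (\<mu> + h) k - \<phi> \<mu> k) / h - \<eta> k)) \<longlongrightarrow> 0) (at 0)"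
      by (rule Lim_null_comparison[OF ev])
  qed
qed

lemma hol_into_iff_fam: "open U \<Longrightarrow> hol_into \<sigma> U \<phi> \<longleftrightarrow> fam \<sigma> U \<phi>"
  using hol_into_imp_fam fam_imp_hol_into by blast

text \<open>Cauchy's inequality in the parameter: smallness on a disk controls the Taylor
  coefficients that define the topology of jets.\<close>

lemma snorm_deriv_bound:
  assumes "open U" "fam \<sigma> U D" "r > 0" "cball \<nu> r \<subseteq> U" "\<And>\<mu>. \<mu> \<in> cball \<nu> r \<Longrightarrow> snorm i (D \<mu>) \<le> B"
  shows "snorm i (\<lambda>k. (deriv ^^ j) (\<lambda>\<mu>. D \<mu> k) \<nu>) \<le> fact j * B / r ^ j"
proof -
  let ?F = "\<lambda>\<mu> \<theta>. D \<mu> (rot \<theta>)"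
  have g: "\<And>n. gd n U ?F" and H: "\<And>\<mu>. \<mu> \<in> U \<Longrightarrow> D \<mu> \<in> Hinf \<sigma>" using assms(2) by (auto simp: fam_def)
  have \<nu>: "\<nu> \<in> U" using assms by auto
  have "gd0 U (\<lambda>\<mu>. (vderiv ^^ i) (?F \<mu>))" by (rule gd_gd0[of 0], rule gd_vderiv, rule g)
  then have hol: "(\<lambda>\<mu>. (vderiv ^^ i) (?F \<mu>) \<theta>) holomorphic_on U" for \<theta> by (simp add: gd0_def)
  have "sn i (pdn j ?F \<nu>) \<le> fact j * B / r ^ j"
  proof (rule sn_least)
    fix \<theta>
    show "norm ((vderiv ^^ i) (pdn j ?F \<nu>) \<theta>) \<le> fact j * B / r ^ j"
      unfolding pdn_vderiv(2)[OF assms(1) g \<nu>] unfolding pdn_def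
    proof (rule Cauchy_inequality)
      show "(\<lambda>\<mu>. (vderiv ^^ i) (?F \<mu>) \<theta>) holomorphic_on ball \<nu> r"
        "continuous_on (cball \<nu> r) (\<lambda>\<mu>. (vderiv ^^ i) (?F \<mu>) \<theta>)"
        using assms(4) subset_trans[OF ball_subset_cball assms(4)]
        by (auto intro!: holomorphic_on_subset[OF hol] holomorphic_on_imp_continuous_on)
      show "norm ((vderiv ^^ i) (?F x) \<theta>) \<le> B" if "norm (\<nu> - x) = r" for x
      proof -
        have x: "x \<in> cball \<nu> r" using that by (simp add: dist_norm)
        then show ?thesis using sn_upper[OF Hinf_SP[OF H], of x i \<theta>] assms(5)[OF x] assms(4)
          by (auto simp: snorm_sn intro: order_trans)
      qed
    qed fact
  qed
  then show ?thesis by (simp add: snorm_sn pdn_def[abs_def])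
qed

lemma fam_Hinf: "fam \<sigma> U \<phi> \<Longrightarrow> \<mu> \<in> U \<Longrightarrow> \<phi> \<mu> \<in> Hinf \<sigma>"
  by (simp add: fam_def)

lemma fam_add: "fam \<sigma> U \<phi> \<Longrightarrow> fam \<sigma> U \<psi> \<Longrightarrow> fam \<sigma> U (\<lambda>\<mu> k. \<phi> \<mu> k + \<psi> \<mu> k)"
  by (auto simp: fam_def Hinf_add gd_add)

lemma fam_mult: "open U \<Longrightarrow> f holomorphic_on U \<Longrightarrow> fam \<sigma> U \<phi> \<Longrightarrow> fam \<sigma> U (\<lambda>\<mu> k. f \<mu> * \<phi> \<mu> k)"
  unfolding fam_def by (intro conjI ballI allI gd_mult gd_hol Hinf_scale) auto

lemma fam_scale: "open U \<Longrightarrow> fam \<sigma> U \<phi> \<Longrightarrow> fam \<sigma> U (\<lambda>\<mu> k. c * \<phi> \<mu> k)"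
  by (rule fam_mult) auto

lemma fam_diff: assumes "open U" "fam \<sigma> U \<phi>" "fam \<sigma> U \<psi>" shows "fam \<sigma> U (\<lambda>\<mu> k. \<phi> \<mu> k - \<psi> \<mu> k)"
  using fam_add[OF assms(2) fam_scale[OF assms(1,3), of "-1"]] by simp

lemma fam_const: "open U \<Longrightarrow> f \<in> Hinf \<sigma> \<Longrightarrow> fam \<sigma> U (\<lambda>\<mu>. f)"
  unfolding fam_def using gd_SP[OF _ Hinf_SP] by blast

lemma fam_subset_gd0: "gd0 U \<Phi> \<Longrightarrow> V \<subseteq> U \<Longrightarrow> open V \<Longrightarrow> gd0 V \<Phi>"
  unfolding gd0_def
proof (elim conjE, intro conjI allI ballI)
  fix \<theta> assume "V \<subseteq> U" "\<forall>\<theta>. (\<lambda>\<mu>. \<Phi> \<mu> \<theta>) holomorphic_on U"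
  then show "(\<lambda>\<mu>. \<Phi> \<mu> \<theta>) holomorphic_on V" using holomorphic_on_subset by blast
next
  fix \<mu> assume V: "V \<subseteq> U" "open V" "\<mu> \<in> V" and "\<forall>\<mu>\<in>U. \<exists>r>0. cball \<mu> r \<subseteq> U \<and> (\<exists>B. \<forall>\<mu>'\<in>cball \<mu> r. \<forall>\<theta>. norm (\<Phi> \<mu>' \<theta>) \<le> B)"
  then obtain r B where r: "r > 0" "\<forall>\<mu>'\<in>cball \<mu> r. \<forall>\<theta>. norm (\<Phi> \<mu>' \<theta>) \<le> B" by blast
  obtain s where s: "s > 0" "cball \<mu> s \<subseteq> V" using V open_contains_cball by blast
  have "cball \<mu> (min r s) \<subseteq> V" "\<forall>\<mu>'\<in>cball \<mu> (min r s). \<forall>\<theta>. norm (\<Phi> \<mu>' \<theta>) \<le> B" using r s by auto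
  then show "\<exists>r>0. cball \<mu> r \<subseteq> V \<and> (\<exists>B. \<forall>\<mu>'\<in>cball \<mu> r. \<forall>\<theta>. norm (\<Phi> \<mu>' \<theta>) \<le> B)"
    using r(1) s(1) by (metis min_less_iff_conj)
qed

lemma gd_subset: "gd n U \<Phi> \<Longrightarrow> V \<subseteq> U \<Longrightarrow> open V \<Longrightarrow> gd n V \<Phi>"
  by (induction n arbitrary: \<Phi>) (auto intro: fam_subset_gd0 | meson subsetD)+

lemma fam_subset: "fam \<sigma> U \<phi> \<Longrightarrow> V \<subseteq> U \<Longrightarrow> open V \<Longrightarrow> fam \<sigma> V \<phi>"
  unfolding fam_def using gd_subset by blast

lemma fam_cong: "(\<And>\<mu>. \<mu> \<in> U \<Longrightarrow> \<phi> \<mu> = \<psi> \<mu>) \<Longrightarrow> fam \<sigma> U \<phi> \<Longrightarrow> fam \<sigma> U \<psi>"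
  unfolding fam_def using gd_cong[of U "\<lambda>\<mu> \<theta>. \<phi> \<mu> (rot \<theta>)" "\<lambda>\<mu> \<theta>. \<psi> \<mu> (rot \<theta>)"] by auto

section \<open>K-types and Fourier expansion in the principal series\<close>

definition ee :: "int \<Rightarrow> mat2 \<Rightarrow> complex" where
  "ee n k = (if k \<in> SO2 then inverse (delta n k) else 0)"

definition par :: "mhat \<Rightarrow> int \<Rightarrow> bool" where
  "par \<sigma> n \<longleftrightarrow> (case \<sigma> of Plus \<Rightarrow> even n | Minus \<Rightarrow> odd n)"

lemma delta_rot: "delta n (rot \<theta>) = cis (of_int n * \<theta>)"
proof -
  have "delta n (rot \<theta>) = cis \<theta> powi n" by (simp add: delta_def cis.ctr)
  also have "\<dots> = cis (of_int n * \<theta>)" by (rule cis_power_int)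
  finally show ?thesis .
qed

lemma ee_rot [simp]: "ee n (rot \<theta>) = ex n \<theta>"
  by (simp add: ee_def delta_rot ex_def cis_inverse)

lemma ex_pi: "ex n pi = (if even n then 1 else - 1)"
  using sin_npi_int[of n] cos_npi_int[of n] by (auto simp: ex_def complex_eq_iff mult.commute)

lemma ee_Hinf: assumes "par \<sigma> n" shows "ee n \<in> Hinf \<sigma>"
  unfolding Hinf_iff using assms
  by (cases \<sigma>) (auto simp: ex_vd ex_add ex_pi sg_def par_def ee_def[of n])

abbreviation fcm :: "(mat2 \<Rightarrow> complex) \<Rightarrow> int \<Rightarrow> complex" where
  "fcm f \<equiv> fc (\<lambda>\<theta>. f (rot \<theta>))"

text \<open>Translation by pi multiplies the coefficient n by (-1)^n, while the transformation law
  under M multiplies the function by the sign of \<sigma>. For the wrong parity the coefficient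
  equals its own negative.\<close>

lemma Hinf_par: assumes "f \<in> Hinf \<sigma>" "\<not> par \<sigma> n" shows "fcm f n = 0"
proof -
  let ?F = "\<lambda>\<theta>. f (rot \<theta>)"
  have S: "SP ?F" by (rule Hinf_SP[OF assms(1)])
  have rd: "rd (\<lambda>n. (sg \<sigma> * ex n pi) * fc ?F n)"
    by (rule rd_mult_poly[OF rd_fc[OF S], of _ 1 0]) (simp add: norm_mult sg_def split: mhat.split)
  have "?F = ser (\<lambda>n. (sg \<sigma> * ex n pi) * fc ?F n)"
  proof
    fix \<theta>
    have "?F \<theta> = sg \<sigma> * ?F (\<theta> + pi)" using assms(1) by (cases \<sigma>) (auto simp: Hinf_iff sg_def)
    also have "?F (\<theta> + pi) = ser (fc ?F) (\<theta> + pi)" by (simp add: ser_fc[OF S])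
    also have "sg \<sigma> * \<dots> = (\<Sum>j. sg \<sigma> * (fc ?F (int_decode j) * ex (int_decode j) (\<theta> + pi)))"
      unfolding ser_def by (rule suminf_mult[OF ser_summable(3)[OF rd_fc[OF S]], symmetric])
    also have "\<dots> = ser (\<lambda>n. (sg \<sigma> * ex n pi) * fc ?F n) \<theta>"
      unfolding ser_def by (simp add: ex_add mult_ac)
    finally show "?F \<theta> = ser (\<lambda>n. (sg \<sigma> * ex n pi) * fc ?F n) \<theta>" .
  qed
  then have "fc ?F n = (sg \<sigma> * ex n pi) * fc ?F n" using fc_ser[OF rd, of n] by simp
  moreover have "sg \<sigma> * ex n pi = - 1" using assms(2) by (cases \<sigma>) (auto simp: sg_def ex_pi par_def)
  ultimately show ?thesis by simp
qed

definition sers :: "(int \<Rightarrow> complex) \<Rightarrow> mat2 \<Rightarrow> complex" where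
  "sers a k = (if k \<in> SO2 then (\<Sum>j. a (int_decode j) * ee (int_decode j) k) else 0)"

lemma sers_rot [simp]: "sers a (rot \<theta>) = ser a \<theta>"
  by (simp add: sers_def ser_def)

lemma sers_Hinf:
  assumes "rd a" "\<And>n. \<not> par \<sigma> n \<Longrightarrow> a n = 0" shows "sers a \<in> Hinf \<sigma>"
proof -
  have eq: "a n * ex n (\<theta> + pi) = sg \<sigma> * (a n * ex n \<theta>)" for n \<theta>
    using assms(2)[of n] by (cases \<sigma>) (auto simp: sg_def ex_add ex_pi par_def)
  have "ser a (\<theta> + pi) = sg \<sigma> * ser a \<theta>" for \<theta>
    unfolding ser_def eq by (rule suminf_mult[OF ser_summable(3)[OF assms(1)]])
  then show ?thesis using SP_ser[OF assms(1)] by (simp add: Hinf_iff SP_def sers_def[of a k for k])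
qed

lemma sers_fcm: assumes "f \<in> Hinf \<sigma>" shows "sers (fcm f) = f"
proof (rule Hinf_eqI)
  show "sers (fcm f) \<in> Hinf \<sigma>"
    using Hinf_par[OF assms] by (intro sers_Hinf rd_fc Hinf_SP[OF assms]) auto
qed (use assms ser_fc[OF Hinf_SP[OF assms]] in auto)

lemma Hinf_fcm_eqI: "f \<in> Hinf \<sigma> \<Longrightarrow> h \<in> Hinf \<sigma> \<Longrightarrow> (\<And>n. fcm f n = fcm h n) \<Longrightarrow> f = h"
  by (metis sers_fcm ext)

lemma fcm_ee: "fcm (ee p) n = (if n = p then 1 else 0)"
  by (simp add: fc_ex[unfolded ex_def] ex_def[abs_def])

text \<open>Derivatives of \<open>lam\<close> expressed through \<open>u = 1 / (1 + c cis (2 \<theta>))\<close> and its conjugate.\<close>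

lemma lam_deriv:
  assumes "A \<in> SL2"
  defines "c \<equiv> be A / al A"
  shows "((\<lambda>\<theta>. Re (lam A \<theta>)) has_real_derivative Re (2 * \<i> * (1 - 1 / (1 + c * ex (-2) \<theta>)))) (at \<theta>)"
    "((\<lambda>\<theta>. Im (lam A \<theta>)) has_real_derivative Im (2 * \<i> * (1 - 1 / (1 + c * ex (-2) \<theta>)))) (at \<theta>)"
proof -
  have e: "ex (-2) \<theta> = cis (2 * \<theta>)" for \<theta> by (simp add: ex_def)
  have c: "norm c < 1" unfolding c_def by (rule be_al_less[OF assms(1)])
  have nz: "1 + c * ex (-2) \<theta> \<notin> \<real>\<^sub>\<le>\<^sub>0" by (rule one_plus_nz[OF c]) simp
  then have nz0: "1 + c * ex (-2) \<theta> \<noteq> 0" by auto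
  have "((\<lambda>\<theta>. 1 + c * ex (-2) \<theta>) has_vector_derivative 0 + c * ((- \<i> * of_int (-2)) * ex (-2) \<theta>)) (at \<theta>)"
    by (intro has_vector_derivative_add has_vector_derivative_const has_vector_derivative_mult_right ex_deriv)
  from field_vector_diff_chain_at[OF this has_field_derivative_Ln[OF nz]]
  have "((\<lambda>\<theta>. Ln (1 + c * ex (-2) \<theta>)) has_vector_derivative c * (2 * \<i> * ex (-2) \<theta>) * inverse (1 + c * ex (-2) \<theta>)) (at \<theta>)"
    by (simp add: o_def mult_ac)
  then have "((\<lambda>\<theta>. Ln (al A) + Ln (1 + c * ex (-2) \<theta>)) has_vector_derivative 0 + c * (2 * \<i> * ex (-2) \<theta>) * inverse (1 + c * ex (-2) \<theta>)) (at \<theta>)"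
    by (intro has_vector_derivative_add has_vector_derivative_const)
  moreover have "0 + c * (2 * \<i> * ex (-2) \<theta>) * inverse (1 + c * ex (-2) \<theta>) = 2 * \<i> * (1 - 1 / (1 + c * ex (-2) \<theta>))"
    using nz0 by (simp add: field_simps)
  ultimately have d: "(lam A has_vector_derivative 2 * \<i> * (1 - 1 / (1 + c * ex (-2) \<theta>))) (at \<theta>)"
    by (simp add: lam_def[abs_def] e c_def)
  show "((\<lambda>\<theta>. Re (lam A \<theta>)) has_real_derivative Re (2 * \<i> * (1 - 1 / (1 + c * ex (-2) \<theta>)))) (at \<theta>)"
    "((\<lambda>\<theta>. Im (lam A \<theta>)) has_real_derivative Im (2 * \<i> * (1 - 1 / (1 + c * ex (-2) \<theta>)))) (at \<theta>)"
    using bounded_linear.has_vector_derivative[OF bounded_linear_Re d] bounded_linear.has_vector_derivative[OF bounded_linear_Im d]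
    by (simp_all add: has_real_derivative_iff_has_vector_derivative)
qed

lemma cnj_ex: "cnj (ex n \<theta>) = ex (- n) \<theta>"
  by (simp add: ex_def cis_cnj)

lemma lam_gd:
  assumes "A \<in> SL2" "open U"
  defines "c \<equiv> be A / al A"
  shows "gd n U (\<lambda>\<mu> \<theta>. of_real (Re (2 * \<i> * (1 - 1 / (1 + c * ex (-2) \<theta>)))))"
    "gd n U (\<lambda>\<mu> \<theta>. of_real (1 - Im (2 * \<i> * (1 - 1 / (1 + c * ex (-2) \<theta>)))))"
proof -
  have c: "norm c < 1" unfolding c_def by (rule be_al_less[OF assms(1)])
  then have c': "norm (cnj c) < 1" by simp
  define u where "u = (\<lambda>\<theta>. 1 / (1 + c * ex (-2) \<theta>))"
  define v where "v = (\<lambda>\<theta>. 1 / (1 + cnj c * ex 2 \<theta>))"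
  have cu: "cnj (u \<theta>) = v \<theta>" for \<theta> by (simp add: u_def v_def cnj_ex)
  have gu: "gd n U (\<lambda>\<mu>. u)" "gd n U (\<lambda>\<mu>. v)"
    using gd_inverse[OF assms(2) c, of n "-2"] gd_inverse[OF assms(2) c', of n 2]
    by (simp_all add: u_def[abs_def] v_def[abs_def])
  have "gd n U (\<lambda>\<mu> \<theta>. \<i> * (v \<theta> + (-1) * u \<theta>))" "gd n U (\<lambda>\<mu> \<theta>. (-1) + (u \<theta> + v \<theta>))"
    by (intro gd_mult gd_add gd_const gu assms(2))+
  moreover have "of_real (Re (2 * \<i> * (1 - u \<theta>))) = \<i> * (v \<theta> + (-1) * u \<theta>)"
    "of_real (1 - Im (2 * \<i> * (1 - u \<theta>))) = (-1) + (u \<theta> + v \<theta>)" for \<theta>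
    unfolding cu[symmetric] by (simp_all add: complex_eq_iff)
  ultimately show "gd n U (\<lambda>\<mu> \<theta>. of_real (Re (2 * \<i> * (1 - 1 / (1 + c * ex (-2) \<theta>)))))"
    "gd n U (\<lambda>\<mu> \<theta>. of_real (1 - Im (2 * \<i> * (1 - 1 / (1 + c * ex (-2) \<theta>)))))"
    by (simp_all add: u_def)
qed

lemma lam_bounded:
  assumes "A \<in> SL2" obtains B where "\<And>\<theta>. \<bar>Re (lam A \<theta>)\<bar> \<le> B"
proof -
  have "per (\<lambda>\<theta>. of_real (Re (lam A \<theta>)))" unfolding per_def lam_def
    by (simp add: cis_mult[symmetric] distrib_left cis_multiple_2pi[of 2, simplified] mult.assoc[symmetric])
  moreover have "continuous_on UNIV (\<lambda>\<theta>. complex_of_real (Re (lam A \<theta>)))"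
    using lam_deriv(1)[OF assms]
    by (intro continuous_intros continuous_at_imp_continuous_on ballI) (meson DERIV_isCont)
  ultimately have "bounded (range (\<lambda>\<theta>. complex_of_real (Re (lam A \<theta>))))" by (rule per_cont_bounded)
  then show ?thesis using that by (auto simp: bounded_iff)
qed

lemma act_gd:
  assumes "g \<in> SL2" "open U" "\<And>n. gd n U \<Phi>" "\<And>\<mu>. per (\<Phi> \<mu>)"
  shows "gd n U (\<lambda>\<mu>. actF \<mu> g (\<Phi> \<mu>))"
proof -
  let ?A = "matrix_inv g"
  have A: "?A \<in> SL2" using assms(1) by simp
  obtain B where B: "\<And>\<theta>. \<bar>Re (lam ?A \<theta>)\<bar> \<le> B" using lam_bounded[OF A] by blast
  have "gd n U (\<lambda>\<mu> \<theta>. exp (- (2 * \<mu> + 1) * of_real (Re (lam ?A \<theta>))))"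
    by (rule gd_exp[OF assms(2) lam_deriv(1)[OF A] lam_gd(1)[OF A assms(2)] B]) (intro holomorphic_intros)
  moreover have "gd n U (\<lambda>\<mu> \<theta>. \<Phi> \<mu> (\<theta> - Im (lam ?A \<theta>)))"
  proof (rule gd_compose[OF assms(2) _ lam_gd(2)[OF A assms(2)] assms(3)])
    show "((\<lambda>\<theta>. \<theta> - Im (lam ?A \<theta>)) has_real_derivative
      1 - Im (2 * \<i> * (1 - 1 / (1 + be ?A / al ?A * ex (-2) \<theta>)))) (at \<theta>)" for \<theta>
      by (intro DERIV_diff lam_deriv(2)[OF A] DERIV_ident)
  qed
  ultimately have "gd n U (\<lambda>\<mu> \<theta>. exp (- (2 * \<mu> + 1) * of_real (Re (lam ?A \<theta>))) * \<Phi> \<mu> (\<theta> - Im (lam ?A \<theta>)))"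
    by (rule gd_mult)
  then show ?thesis
    by (rule gd_cong[rotated]) (simp add: actF_lam[OF assms(4) assms(1)])
qed

lemma lam_pi: "lam A (\<theta> + pi) = lam A \<theta>"
  by (simp add: lam_def distrib_left cis_mult[symmetric])

lemma fam_act:
  assumes "g \<in> SL2" "open U" "fam \<sigma> U \<phi>" shows "fam \<sigma> U (act_germ g \<phi>)"
proof -
  let ?F = "\<lambda>\<mu> \<theta>. \<phi> \<mu> (rot \<theta>)"
  have H: "\<And>\<mu>. \<mu> \<in> U \<Longrightarrow> \<phi> \<mu> \<in> Hinf \<sigma>" using assms(3) by (auto simp: fam_def)
  have rot: "act_germ g \<phi> \<mu> (rot \<theta>) = actF \<mu> g (?F \<mu>) \<theta>" for \<mu> \<theta>
    by (simp add: act_germ_def act_rot assms(1))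
  have g: "gd n U (\<lambda>\<mu> \<theta>. act_germ g \<phi> \<mu> (rot \<theta>))" for n
    unfolding rot by (rule act_gd[OF assms(1,2)]) (use assms(3) per_rot in \<open>auto simp: fam_def\<close>)
  have "act_germ g \<phi> \<mu> \<in> Hinf \<sigma>" if \<mu>: "\<mu> \<in> U" for \<mu>
    unfolding Hinf_iff
  proof (intro conjI allI impI)
    show "act_germ g \<phi> \<mu> k = 0" if "k \<notin> SO2" for k using that by (simp add: act_germ_def)
    show "smooth_real (\<lambda>\<theta>. act_germ g \<phi> \<mu> (rot \<theta>))" by (rule gd_smooth[OF g \<mu>])
    show "act_germ g \<phi> \<mu> (rot (\<theta> + pi)) = sg \<sigma> * act_germ g \<phi> \<mu> (rot \<theta>)" for \<theta>
    proof -
      have "\<phi> \<mu> (rot (\<theta> + pi - x)) = sg \<sigma> * \<phi> \<mu> (rot (\<theta> - x))" for x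
        using H[OF \<mu>] unfolding Hinf_iff by (metis add_diff_eq add.commute diff_add_eq)
      then show ?thesis unfolding rot
        by (simp add: actF_lam[OF per_rot assms(1)] lam_pi)
    qed
  qed
  then show ?thesis using g by (simp add: fam_def)
qed

lemma act_Hinf: "g \<in> SL2 \<Longrightarrow> f \<in> Hinf \<sigma> \<Longrightarrow> act \<mu> g f \<in> Hinf \<sigma>"
  using fam_Hinf[OF fam_act[OF _ open_UNIV fam_const[OF open_UNIV]]] by (simp add: act_germ_def)

lemma SP_actF: assumes "SP F" "g \<in> SL2" shows "SP (actF \<mu> g F)"
proof -
  have p: "per F" using assms(1) by (simp add: SP_def)
  have "smooth_real (actF \<mu> g F)"
    using gd_smooth[OF act_gd[OF assms(2) open_UNIV gd_SP[OF open_UNIV assms(1)]], of \<mu>] p by simp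
  moreover have "per (actF \<mu> g F)"
    unfolding per_def
  proof
    fix \<theta>
    have "lam A (\<theta> + 2 * pi) = lam A \<theta>" for A
      using lam_pi[of A "\<theta> + pi"] lam_pi[of A \<theta>] by (simp add: algebra_simps)
    moreover have "F (\<theta> + 2 * pi - x) = F (\<theta> - x)" for x
      using p unfolding per_def by (metis add_diff_eq add.commute diff_add_eq)
    ultimately show "actF \<mu> g F (\<theta> + 2 * pi) = actF \<mu> g F \<theta>"
      by (simp add: actF_lam[OF p assms(2)])
  qed
  ultimately show ?thesis by (simp add: SP_def)
qed

text \<open>The constant is independent of \<open>F\<close>. This continuity in the supremum norm
  allows the action to be applied term by term to a Fourier series.\<close>

lemma actF_bound:
  assumes "g \<in> SL2" obtains C where "\<And>F B \<theta>. per F \<Longrightarrow> (\<And>\<theta>. norm (F \<theta>) \<le> B) \<Longrightarrow> norm (actF \<mu> g F \<theta>) \<le> C * B" "C > 0"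
proof -
  have A: "matrix_inv g \<in> SL2" using assms by simp
  obtain B0 where B0: "\<And>\<theta>. \<bar>Re (lam (matrix_inv g) \<theta>)\<bar> \<le> B0" using lam_bounded[OF A] by blast
  show ?thesis
  proof (rule that[of "exp (norm (2 * \<mu> + 1) * B0)"])
    fix F B \<theta> assume F: "per F" "\<And>\<theta>. norm (F \<theta>) \<le> (B :: real)"
    have "norm (exp (- (2 * \<mu> + 1) * of_real (Re (lam (matrix_inv g) \<theta>)))) \<le> exp (norm (- (2 * \<mu> + 1) * of_real (Re (lam (matrix_inv g) \<theta>))))"
      by (rule norm_exp)
    also have "\<dots> \<le> exp (norm (2 * \<mu> + 1) * B0)"
      using B0[of \<theta>] unfolding norm_mult norm_minus_cancel norm_of_real
      by (simp add: mult_left_mono)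
    finally show "norm (actF \<mu> g F \<theta>) \<le> exp (norm (2 * \<mu> + 1) * B0) * B"
      unfolding actF_lam[OF F(1) assms] norm_mult by (intro mult_mono F(2)) auto
  qed simp
qed

lemma actF_sum:
  "actF \<mu> g (\<lambda>\<theta>. \<Sum>j\<in>J. c j * F j \<theta>) \<theta> = (\<Sum>j\<in>J. c j * actF \<mu> g (F j) \<theta>)"
  unfolding actF_def ext_def sum_distrib_left by (rule sum.cong) (simp_all add: mult_ac)

lemma SP_sum: "finite J \<Longrightarrow> (\<And>j. j \<in> J \<Longrightarrow> SP (F j)) \<Longrightarrow> SP (\<lambda>\<theta>. \<Sum>j\<in>J. F j \<theta>)"
  by (induction J rule: finite_induct) (simp_all add: SP_0 SP_add)

lemma actF_diff: "actF \<mu> g (\<lambda>\<theta>. F \<theta> - G \<theta>) \<theta> = actF \<mu> g F \<theta> - actF \<mu> g G \<theta>"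
  by (simp add: actF_def ext_def right_diff_distrib)

subsection \<open>Matrix coefficients and submodules given by K-types\<close>

text \<open>Matrix coefficient of \<open>g\<close> from the K-type \<open>p\<close> to the K-type
  \<open>n\<close>, an entire function of the parameter (\<open>Mc_hol\<close>). Statements about
  submodules and intertwining operators become scalar identities between these.\<close>

definition Mc :: "mat2 \<Rightarrow> int \<Rightarrow> int \<Rightarrow> complex \<Rightarrow> complex" where
  "Mc g n p \<mu> = fc (actF \<mu> g (ex p)) n"

lemma fc_actF_sums:
  assumes "SP F" "g \<in> SL2"
  shows "(\<lambda>j. fc F (int_decode j) * Mc g n (int_decode j) \<mu>) sums fc (actF \<mu> g F) n"
proof -
  let ?P = "\<lambda>N \<theta>. \<Sum>j<N. fc F (int_decode j) * ex (int_decode j) \<theta>"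
  have SPP: "SP (?P N)" for N
    by (intro SP_sum SP_scale SP_ex) simp
  obtain C where C: "\<And>F B \<theta>. per F \<Longrightarrow> (\<And>\<theta>. norm (F \<theta>) \<le> B) \<Longrightarrow> norm (actF \<mu> g F \<theta>) \<le> C * B" "C > 0"
    using actF_bound[OF assms(2)] by metis
  have "uniform_limit UNIV (\<lambda>N. actF \<mu> g (?P N)) (actF \<mu> g F) sequentially"
    unfolding uniform_limit_iff
  proof (intro allI impI)
    fix e :: real assume "e > 0"
    then have "e / (2 * C) > 0" using C(2) by simp
    then have "\<forall>\<^sub>F N in sequentially. \<forall>x\<in>UNIV. dist (?P N x) (F x) < e / (2 * C)"
      using SP_sums[OF assms(1)] unfolding uniform_limit_iff by blast
    then show "\<forall>\<^sub>F N in sequentially. \<forall>x\<in>UNIV. dist (actF \<mu> g (?P N) x) (actF \<mu> g F x) < e"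
    proof eventually_elim
      case (elim N)
      show ?case
      proof
        fix x
        have "norm (actF \<mu> g (\<lambda>\<theta>. ?P N \<theta> - F \<theta>) x) \<le> C * (e / (2 * C))"
          using SP_diff[OF SPP[of N] assms(1)] elim
          by (intro C(1)) (auto simp: SP_def dist_norm less_imp_le)
        also have "\<dots> < e" using C(2) \<open>e > 0\<close> by simp
        finally show "dist (actF \<mu> g (?P N) x) (actF \<mu> g F x) < e"
          by (simp add: actF_diff dist_norm)
      qed
    qed
  qed
  then have "(\<lambda>N. fc (actF \<mu> g (?P N)) n) \<longlonglongrightarrow> fc (actF \<mu> g F) n"
    by (intro fc_uniform_limit SP_cont SP_actF SPP assms)
  moreover have "fc (actF \<mu> g (?P N)) n = (\<Sum>j<N. fc F (int_decode j) * Mc g n (int_decode j) \<mu>)" for N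
  proof -
    have "actF \<mu> g (?P N) = (\<lambda>\<theta>. \<Sum>j<N. fc F (int_decode j) * actF \<mu> g (ex (int_decode j)) \<theta>)"
      by (rule HOL.ext) (rule actF_sum)
    then show ?thesis
      by (simp add: fc_sum continuous_on_mult_left SP_cont SP_actF assms(2) fc_scale Mc_def)
  qed
  ultimately show ?thesis by (simp add: sums_def)
qed

lemma fcm_act_sums:
  assumes "f \<in> Hinf \<sigma>" "g \<in> SL2"
  shows "(\<lambda>j. fcm f (int_decode j) * Mc g n (int_decode j) \<mu>) sums fcm (act \<mu> g f) n"
  using fc_actF_sums[OF Hinf_SP[OF assms(1)] assms(2), of n \<mu>] by (simp add: act_rot assms(2))

lemma fcm_act_ee: "g \<in> SL2 \<Longrightarrow> fcm (act \<mu> g (ee p)) n = Mc g n p \<mu>"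
  by (simp add: act_rot Mc_def)

section \<open>Vanishing of matrix coefficients at integral parameters\<close>

text \<open>Because \<open>cis (- \<theta>) ^ n = ex n \<theta>\<close>, the power series of
  \<open>H\<close> is a Fourier series without negative indices; R > 1 gives absolute convergence on
  the unit circle.\<close>

lemma fc_holomorphic_zero:
  assumes "H holomorphic_on ball 0 R" "R > 1" "m < 0"
  shows "fc (\<lambda>\<theta>. H (cis (- \<theta>))) m = 0"
proof -
  define c where "c = (\<lambda>n. (deriv ^^ n) H 0 / fact n)"
  have sums: "(\<lambda>n. c n * w ^ n) sums H w" if "norm w < R" for w
    using holomorphic_power_series[OF assms(1), of w] that by (simp add: c_def)
  define x :: complex where "x = of_real ((1 + R) / 2)"
  have x: "norm x < R" "norm (1::complex) < norm x" using assms(2) by (auto simp: x_def simp del: of_real_divide of_real_add)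
  have s: "summable (\<lambda>n. norm (c n))"
    using powser_insidea[OF sums_summable[OF sums[OF x(1)]] x(2)] by simp
  have ex: "cis (- \<theta>) ^ n = ex (int n) \<theta>" for n \<theta> by (simp add: ex_def Complex.DeMoivre)
  have ul: "uniform_limit UNIV (\<lambda>N \<theta>. \<Sum>n<N. c n * ex (int n) \<theta>) (\<lambda>\<theta>. \<Sum>n. c n * ex (int n) \<theta>) sequentially"
    by (rule Weierstrass_m_test[OF _ s]) (simp add: norm_mult)
  have eq: "(\<lambda>\<theta>. \<Sum>n. c n * ex (int n) \<theta>) = (\<lambda>\<theta>. H (cis (- \<theta>)))"
    using sums[of "cis (- \<theta>)" for \<theta>] assms(2) by (auto simp: ex sums_iff)
  have "(\<lambda>N. fc (\<lambda>\<theta>. \<Sum>n<N. c n * ex (int n) \<theta>) m) \<longlonglongrightarrow> fc (\<lambda>\<theta>. H (cis (- \<theta>))) m"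
  proof (rule fc_uniform_limit)
    show "continuous_on UNIV (\<lambda>\<theta>. H (cis (- \<theta>)))"
      by (rule continuous_on_compose2[OF holomorphic_on_imp_continuous_on[OF assms(1)]])
         (use assms(2) in \<open>auto intro!: continuous_intros\<close>)
  qed (use ul eq in \<open>auto intro!: continuous_intros cont_ex\<close>)
  moreover have "fc (\<lambda>\<theta>. \<Sum>n<N. c n * ex (int n) \<theta>) m = 0" for N
    using assms(3) by (subst fc_sum) (auto intro!: continuous_intros cont_ex simp: fc_scale fc_ex)
  ultimately show ?thesis by (simp add: LIMSEQ_const_iff)
qed

lemma fc_shift: "fc (\<lambda>\<theta>. ex s \<theta> * F \<theta>) n = fc F (n - s)"
  by (simp add: fc_def mult.assoc mult.left_commute[of "ex s _"] ex_mult)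

text \<open>At integral 2 \<mu> + 1 the homogeneous extension of a K-type is a monomial in z and its
  conjugate: the degrees add up to -(2 \<mu> + 1) and differ by p.\<close>

lemma ext_ex_int:
  assumes "2 * \<mu> + 1 = of_int (- (a + b))" "p = a - b" "z \<noteq> 0"
  shows "ext \<mu> (ex p) z = z powi a * cnj z powi b"
proof -
  define r where "r = complex_of_real (norm z)"
  define u where "u = cis (Arg z)"
  have r0: "r \<noteq> 0" and u0: "u \<noteq> 0" using assms(3) by (auto simp: r_def u_def)
  have z: "z = r * u" using polar[OF assms(3)] by (simp add: r_def u_def)
  have cz: "cnj z = r * inverse u" unfolding z by (simp add: r_def u_def cis_cnj cis_inverse)
  have "exp (of_int (a + b) * complex_of_real (ln (norm z))) = exp (complex_of_real (ln (norm z))) powi (a + b)"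
    by (simp add: exp_power_int)
  also have "exp (complex_of_real (ln (norm z))) = r" using assms(3) by (simp add: r_def exp_of_real)
  finally have 1: "exp (- (2 * \<mu> + 1) * of_real (ln (norm z))) = r powi (a + b)"
    unfolding assms(1) of_int_minus minus_minus .
  have 2: "ex p (- Arg z) = u powi p" by (simp add: ex_def u_def cis_power_int)
  show ?thesis unfolding ext_def 1 2 cz unfolding z assms(2)
    using r0 u0 by (simp add: power_int_mult_distrib power_int_add power_int_diff power_int_inverse power_int_divide_distrib field_simps)
qed

text \<open>The translate of the monomial is \<open>ex s\<close> times a function \<open>H\<close>
  of w = \<open>cis (- \<theta>)\<close>. Its first factor is a polynomial because p \<ge> s makes
  the exponent \<open>a\<close> nonnegative; the base of the second has no zero near the closed unit
  disk, so its exponent may be negative. Hence only K-types \<ge> s occur.\<close>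

lemma Mc_zero_lower:
  assumes "g \<in> SL2" "2 * \<mu> + 1 = of_int s" "s \<le> p" "even (p - s)" "n < s"
  shows "Mc g n p \<mu> = 0"
proof -
  let ?A = "matrix_inv g"
  define \<alpha> \<beta> where "\<alpha> = al ?A" and "\<beta> = be ?A"
  have A: "?A \<in> SL2" using assms(1) by simp
  have \<alpha>: "\<alpha> \<noteq> 0" unfolding \<alpha>_def by (rule al_nz[OF A])
  have c: "norm (\<beta> / \<alpha>) < 1" unfolding \<alpha>_def \<beta>_def by (rule be_al_less[OF A])
  define a where "a = (p - s) div 2"
  define b where "b = - s - a"
  have ab: "s = - (a + b)" "p = a - b" "a \<ge> 0" using assms(3,4) by (auto simp: a_def b_def)
  \<comment> \<open>Required are R > 1 and R^2 t < 1 for t = |\<beta> / \<alpha>|; this choice gives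
    R^2 t = 2 t / (1 + t).\<close>
  define R where "R = sqrt (2 / (1 + norm (\<beta> / \<alpha>)))"
  have R: "R > 1" "R\<^sup>2 * norm (\<beta> / \<alpha>) < 1"
  proof -
    define t where "t = norm (\<beta> / \<alpha>)"
    have t: "0 \<le> t" "t < 1" using c by (auto simp: t_def)
    show "R > 1" unfolding R_def t_def[symmetric] using t by (simp add: field_simps)
    show "R\<^sup>2 * norm (\<beta> / \<alpha>) < 1" unfolding R_def t_def[symmetric] using t by (simp add: field_simps)
  qed
  define H where "H = (\<lambda>w. (\<alpha> * w\<^sup>2 + \<beta>) powi a * (cnj \<alpha> + cnj \<beta> * w\<^sup>2) powi b)"
  have nz: "cnj \<alpha> + cnj \<beta> * w\<^sup>2 \<noteq> 0" if "w \<in> ball 0 R" for w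
  proof
    assume 0: "cnj \<alpha> + cnj \<beta> * w\<^sup>2 = 0"
    then have "norm (cnj \<alpha>) = norm (cnj \<beta> * w\<^sup>2)" by (metis add_eq_0_iff norm_minus_cancel)
    then have "norm \<alpha> = norm \<beta> * (norm w)\<^sup>2" by (simp add: norm_mult norm_power)
    then have "norm (\<beta> / \<alpha>) * (norm w)\<^sup>2 = norm \<alpha> / norm \<alpha>" by (simp add: norm_divide)
    then have "norm (\<beta> / \<alpha>) * (norm w)\<^sup>2 = 1" using \<alpha> by simp
    moreover have "norm (\<beta> / \<alpha>) * (norm w)\<^sup>2 \<le> norm (\<beta> / \<alpha>) * R\<^sup>2"
      using that by (intro mult_left_mono power_mono) auto
    ultimately show False using R(2) by (simp add: mult.commute)
  qed
  have hol: "H holomorphic_on ball 0 R"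
    unfolding H_def using nz ab(3) by (intro holomorphic_intros) auto
  have "actF \<mu> g (ex p) \<theta> = ex s \<theta> * H (cis (- \<theta>))" for \<theta>
  proof -
    define w where "w = cis (- \<theta>)"
    have w0: "w \<noteq> 0" and cw: "cnj w = inverse w" by (auto simp: w_def cis_cnj cis_inverse)
    define z where "z = lin ?A w"
    have z0: "z \<noteq> 0" unfolding z_def w_def lin_lam[OF A] by simp
    have z: "z = inverse w * (\<alpha> * w\<^sup>2 + \<beta>)" using w0
      by (simp add: z_def lin_al_be cw \<alpha>_def \<beta>_def field_simps power2_eq_square)
    have cz: "cnj z = inverse w * (cnj \<alpha> + cnj \<beta> * w\<^sup>2)" using w0
      by (simp add: z_def lin_al_be cw \<alpha>_def \<beta>_def field_simps power2_eq_square)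
    have "actF \<mu> g (ex p) \<theta> = z powi a * cnj z powi b"
      unfolding actF_def z_def[unfolded w_def, symmetric]
      using assms(2) ab z0 by (intro ext_ex_int) simp_all
    also have "\<dots> = (inverse w powi a * inverse w powi b) * H w"
      unfolding cz unfolding z H_def by (simp add: power_int_mult_distrib mult_ac)
    also have "inverse w powi a * inverse w powi b = w powi s"
      using w0 ab(1) by (simp add: power_int_add[symmetric] power_int_inverse power_int_minus[symmetric])
    also have "w powi s = ex s \<theta>" by (simp add: w_def ex_def cis_power_int)
    finally show ?thesis by (simp add: w_def)
  qed
  then have "actF \<mu> g (ex p) = (\<lambda>\<theta>. ex s \<theta> * H (cis (- \<theta>)))" by (rule HOL.ext)
  then have "Mc g n p \<mu> = fc (\<lambda>\<theta>. ex s \<theta> * H (cis (- \<theta>))) n" by (simp only: Mc_def)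
  also have "\<dots> = 0" unfolding fc_shift using fc_holomorphic_zero[OF hol R(1)] assms(5) by simp
  finally show ?thesis .
qed

lemma fc_cnj: "continuous_on UNIV F \<Longrightarrow> fc (\<lambda>\<theta>. cnj (F \<theta>)) n = cnj (fc F (- n))"
proof -
  assume "continuous_on UNIV F"
  have "(\<lambda>\<theta>. cnj (F \<theta>) * ex (-n) \<theta>) = (\<lambda>\<theta>. cnj (F \<theta> * ex n \<theta>))" by (simp add: cnj_ex)
  then show ?thesis by (simp add: fc_def integral_cnj)
qed

text \<open>Conjugating functions on the circle exchanges K-types with their negatives and thus
  yields the mirror image of \<open>Mc_zero_lower\<close>.\<close>

lemma Mc_cnj: assumes "g \<in> SL2" shows "Mc g (- n) (- p) \<mu> = cnj (Mc g n p (cnj \<mu>))"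
proof -
  have "actF \<mu> g (ex (- p)) = (\<lambda>\<theta>. cnj (actF (cnj \<mu>) g (ex p) \<theta>))"
    by (simp add: actF_def ext_def exp_cnj cnj_ex fun_eq_iff)
  then show ?thesis
    using fc_cnj[OF SP_cont[OF SP_actF[OF SP_ex assms]], of "cnj \<mu>" p "- n"] by (simp add: Mc_def)
qed

lemma Mc_zero_upper:
  assumes "g \<in> SL2" "2 * \<mu> + 1 = of_int s" "p \<le> - s" "even (p - s)" "n > - s"
  shows "Mc g n p \<mu> = 0"
proof -
  have "Mc g (- n) (- p) (cnj \<mu>) = 0"
  proof (rule Mc_zero_lower[OF assms(1), of _ s])
    have "cnj (2 * \<mu> + 1) = of_int s" unfolding assms(2) by simp
    then show "2 * cnj \<mu> + 1 = of_int s" by simp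
  qed (use assms in auto)
  then show ?thesis using Mc_cnj[OF assms(1), of "n" "p" "cnj \<mu>"] by simp
qed

definition kset :: "mhat \<Rightarrow> int set \<Rightarrow> (mat2 \<Rightarrow> complex) set" where
  "kset \<sigma> N = {f \<in> Hinf \<sigma>. \<forall>n. fcm f n \<noteq> 0 \<longrightarrow> n \<in> N}"

lemma ksetD: "f \<in> kset \<sigma> N \<Longrightarrow> f \<in> Hinf \<sigma>" "f \<in> kset \<sigma> N \<Longrightarrow> n \<notin> N \<Longrightarrow> fcm f n = 0"
  by (auto simp: kset_def)

lemma fcm_add: "f \<in> Hinf \<sigma> \<Longrightarrow> h \<in> Hinf \<sigma> \<Longrightarrow> fcm (\<lambda>k. f k + h k) n = fcm f n + fcm h n"
  by (rule fc_add) (auto intro: SP_cont Hinf_SP)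
lemma fcm_diff: "f \<in> Hinf \<sigma> \<Longrightarrow> h \<in> Hinf \<sigma> \<Longrightarrow> fcm (\<lambda>k. f k - h k) n = fcm f n - fcm h n"
  by (rule fc_diff) (auto intro: SP_cont Hinf_SP)

lemma fcm_bound: "f \<in> Hinf \<sigma> \<Longrightarrow> norm (fcm f n) \<le> snorm 0 f"
  unfolding snorm_sn by (intro fc_bound SP_cont sn_upper0 Hinf_SP)

lemma fcm_limit_eq:
  assumes "f \<in> Hinf \<sigma>" "\<And>e. e > 0 \<Longrightarrow> \<exists>h\<in>Hinf \<sigma>. snorm 0 (\<lambda>k. f k - h k) < e \<and> fcm h n = 0"
  shows "fcm f n = 0"
proof (rule ccontr)
  assume "fcm f n \<noteq> 0"
  then obtain h where h: "h \<in> Hinf \<sigma>" "snorm 0 (\<lambda>k. f k - h k) < norm (fcm f n)" "fcm h n = 0"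
    using assms(2)[of "norm (fcm f n)"] by auto
  then show False using fcm_bound[OF Hinf_diff[OF assms(1) h(1)], of n] fcm_diff[OF assms(1) h(1), of n] by simp
qed

text \<open>Each Fourier coefficient of a translate is a convergent sum over matrix coefficients, so
  invariance can be tested on the latter. Closedness holds because Fourier coefficients are
  continuous.\<close>

lemma kset_closed_submodule:
  assumes "\<And>g n p. g \<in> SL2 \<Longrightarrow> par \<sigma> n \<Longrightarrow> par \<sigma> p \<Longrightarrow> p \<in> N \<Longrightarrow> n \<notin> N \<Longrightarrow> Mc g n p \<nu> = 0"
  shows "closed_submodule \<sigma> \<nu> (kset \<sigma> N)"
  unfolding closed_submodule_def
proof (intro conjI ballI allI impI)
  show "kset \<sigma> N \<subseteq> Hinf \<sigma>" by (auto simp: kset_def)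
  show "(\<lambda>k. 0) \<in> kset \<sigma> N" using Hinf_0 by (simp add: kset_def fc_def)
  show "(\<lambda>k. f k + h k) \<in> kset \<sigma> N" if "f \<in> kset \<sigma> N" "h \<in> kset \<sigma> N" for f h
    using that by (force simp: kset_def Hinf_add fcm_add)
  show "(\<lambda>k. c * f k) \<in> kset \<sigma> N" if "f \<in> kset \<sigma> N" for c f
    using that by (auto simp: kset_def Hinf_scale fc_scale)
  show "act \<nu> g f \<in> kset \<sigma> N" if g: "g \<in> SL2" and f: "f \<in> kset \<sigma> N" for g f
    unfolding kset_def
  proof (intro CollectI conjI allI impI)
    have fH: "f \<in> Hinf \<sigma>" by (rule ksetD(1)[OF f])
    then show aH: "act \<nu> g f \<in> Hinf \<sigma>" by (rule act_Hinf[OF g])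
    fix n assume n: "fcm (act \<nu> g f) n \<noteq> 0"
    then have pn: "par \<sigma> n" using Hinf_par[OF aH] by blast
    show "n \<in> N"
    proof (rule ccontr)
      assume "n \<notin> N"
      then have eq: "fcm f p * Mc g n p \<nu> = 0" for p
        using assms[OF g pn, of p] Hinf_par[OF fH, of p] ksetD(2)[OF f, of p] by fastforce
      have "(\<lambda>j. 0) sums fcm (act \<nu> g f) n" using fcm_act_sums[OF fH g, of n \<nu>] by (simp only: eq)
      then show False using n sums_unique2 sums_zero by blast
    qed
  qed
  show "f \<in> kset \<sigma> N" if f: "f \<in> Hinf \<sigma>" and lim: "\<forall>K. \<forall>\<epsilon>>0. \<exists>h\<in>kset \<sigma> N. \<forall>n\<le>K. snorm n (\<lambda>k. f k - h k) < \<epsilon>" for f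
    unfolding kset_def
  proof (intro CollectI conjI allI impI)
    fix n assume n: "fcm f n \<noteq> 0"
    show "n \<in> N"
    proof (rule ccontr)
      assume "n \<notin> N"
      have "fcm f n = 0"
      proof (rule fcm_limit_eq[OF f])
        fix e :: real assume "e > 0"
        then obtain h where "h \<in> kset \<sigma> N" "snorm 0 (\<lambda>k. f k - h k) < e" using lim by blast
        then show "\<exists>h\<in>Hinf \<sigma>. snorm 0 (\<lambda>k. f k - h k) < e \<and> fcm h n = 0"
          using \<open>n \<notin> N\<close> ksetD by blast
      qed
      then show False using n by simp
    qed
  qed fact
qed

text \<open>The \<open>K\<close>-types reachable from \<open>m\<close> inside the principal series with parameter \<open>(s - 1)/2\<close>.\<close>

definition Nset :: "int \<Rightarrow> int \<Rightarrow> int set" where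
  "Nset s m = {n. (m \<ge> s \<longrightarrow> n \<ge> s) \<and> (m \<le> - s \<longrightarrow> n \<le> - s)}"

lemma par_even: "par \<sigma> m \<Longrightarrow> par \<sigma> n \<longleftrightarrow> even (n - m)"
  by (cases \<sigma>) (auto simp: par_def)

lemma Nset_submodule:
  assumes "2 * \<nu> + 1 = of_int s" "par \<sigma> s"
  shows "closed_submodule \<sigma> \<nu> (kset \<sigma> (Nset s m))"
proof (rule kset_closed_submodule)
  fix g n p assume "g \<in> SL2" "par \<sigma> n" "par \<sigma> p" "p \<in> Nset s m" "n \<notin> Nset s m"
  then show "Mc g n p \<nu> = 0"
    using Mc_zero_lower[OF _ assms(1), of g p n] Mc_zero_upper[OF _ assms(1), of g p n] par_even[OF assms(2)]
    by (auto simp: Nset_def not_le)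
qed

section \<open>Integrals over the real line\<close>

lemma integral_FTC_real:
  fixes F f :: "real \<Rightarrow> complex"
  assumes "\<And>x. (F has_vector_derivative f x) (at x)" "continuous_on UNIV f" "integrable lborel f"
    "(F \<longlongrightarrow> A) at_bot" "(F \<longlongrightarrow> B) at_top"
  shows "(LINT x|lborel. f x) = B - A"
proof -
  have "(LBINT x=-\<infinity>..\<infinity>. f x) = B - A"
  proof (rule interval_integral_FTC_integrable)
    show "isCont f x" for x using assms(2) by (simp add: continuous_on_eq_continuous_at)
    show "set_integrable lborel (einterval (-\<infinity>) \<infinity>) f"
      using assms(3) by (simp add: set_integrable_def)
  qed (use assms in \<open>auto simp: ereal_tendsto_simps\<close>)
  then show ?thesis by (simp add: interval_lebesgue_integral_def set_lebesgue_integral_def)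
qed

lemma exp_half_ln: "x > 0 \<Longrightarrow> exp (ln x / 2) = sqrt x"
  using exp_ln[of "sqrt x"] by (simp add: ln_sqrt)

lemma cexp: "complex_of_real (exp x) = exp (of_real x)"
  by (simp add: exp_of_real)

lemma integrable_inverse_square: "integrable lborel (\<lambda>x::real. 1 / (1 + x\<^sup>2))"
proof -
  have "set_integrable lborel (einterval (-\<infinity>) \<infinity>) (\<lambda>x. 1 / (1 + x\<^sup>2))"
  proof (rule interval_integral_FTC_nonneg(1)[where F = arctan and A = "- (pi/2)" and B = "pi/2"])
    show "DERIV arctan x :> 1 / (1 + x\<^sup>2)" for x
      using DERIV_arctan[of x] by (simp add: inverse_eq_divide)
    show "isCont (\<lambda>x. 1 / (1 + x\<^sup>2)) x" for x :: real
      by (intro continuous_intros) (smt (verit) zero_le_power2)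
  qed (auto simp: ereal_tendsto_simps tendsto_arctan_at_top tendsto_arctan_at_bot)
  then show ?thesis by (simp add: set_integrable_def)
qed

lemma integrable_gauss: "integrable lborel (\<lambda>x::real. exp (- x\<^sup>2))"
proof (rule Bochner_Integration.integrable_bound[OF integrable_inverse_square])
  show "AE x in lborel. norm (exp (- x\<^sup>2)) \<le> norm (1 / (1 + x\<^sup>2) :: real)"
  proof (rule AE_I2)
    fix x :: real
    have "1 + x\<^sup>2 \<le> exp (x\<^sup>2)" by (rule exp_ge_add_one_self)
    then show "norm (exp (- x\<^sup>2)) \<le> norm (1 / (1 + x\<^sup>2))"
      by (simp add: exp_minus inverse_eq_divide frac_le add_pos_nonneg)
  qed
qed simp

subsection \<open>The c-function and the Knapp-Stein operator\<close>

text \<open>The value \<open>sqrt \<pi>\<close> of the Gauss integral is never needed: it cancels from (2.a).\<close>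

definition gaussK :: real where "gaussK = (LINT x|lborel. exp (- x\<^sup>2))"

lemma gaussK_pos: "gaussK > 0"
proof -
  have i: "integrable lborel (\<lambda>x::real. indicator {0..1} x * exp (-1) :: real)"
    by (rule integrable_mult_left) simp
  have "exp (-1) = (LINT x|lborel. indicator {0..1::real} x * exp (-1) :: real)" by simp
  also have "\<dots> \<le> gaussK" unfolding gaussK_def
  proof (rule integral_mono[OF i integrable_gauss])
    show "indicator {0..1} x * exp (-1) \<le> exp (- x\<^sup>2)" for x :: real
      by (auto simp: indicator_def power_le_one)
  qed
  finally show ?thesis by (meson exp_gt_zero less_le_trans)
qed

lemma gauss_scale:
  assumes "t > 0"
  shows "integrable lborel (\<lambda>x. exp (- t * x\<^sup>2))" "(LINT x|lborel. exp (- t * x\<^sup>2)) = gaussK / sqrt t"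
proof -
  have eq: "exp (- t * x\<^sup>2) = exp (- (0 + sqrt t * x)\<^sup>2)" for x
    using assms by (simp add: power_mult_distrib)
  show "integrable lborel (\<lambda>x. exp (- t * x\<^sup>2))"
    unfolding eq using lborel_integrable_real_affine[OF integrable_gauss, of "sqrt t" 0] assms by simp
  have "gaussK = \<bar>sqrt t\<bar> *\<^sub>R (LINT x|lborel. exp (- (0 + sqrt t * x)\<^sup>2))"
    unfolding gaussK_def using assms by (intro lborel_integral_real_affine) auto
  then show "(LINT x|lborel. exp (- t * x\<^sup>2)) = gaussK / sqrt t"
    unfolding eq using assms by (simp add: field_simps)
qed

text \<open>The integrand t^(s-1) exp(-t) of the Gamma function, extended by 0 so that Fubini
  applies on a product of two full lines.\<close>

definition gI :: "complex \<Rightarrow> real \<Rightarrow> complex" where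
  "gI s t = (if t > 0 then exp ((s - 1) * of_real (ln t) - of_real t) else 0)"

lemma gI_measurable [measurable]: "gI s \<in> borel_measurable borel"
  unfolding gI_def by measurable

lemma gI_integral:
  assumes "Re s > 0"
  shows "integrable lborel (gI s)" "(LINT t|lborel. gI s t) = Gamma s"
proof -
  have eq: "indicator {0<..} t *\<^sub>R (complex_of_real t powr (s - 1) / of_real (exp t)) = gI s t" for t
    by (simp add: gI_def powr_def Ln_of_real exp_diff exp_of_real)
  have "integrable lebesgue (gI s)"
    using absolutely_integrable_Gamma_integral'[OF assms] unfolding set_integrable_def eq .
  then show int: "integrable lborel (gI s)"
    by (subst (asm) integrable_completion) auto
  have "((\<lambda>t. complex_of_real t powr (s - 1) / of_real (exp t)) has_integral Gamma s) {0<..}"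
    by (rule Gamma_integral_complex'[OF assms])
  then have "((\<lambda>t. if t \<in> {0<..} then complex_of_real t powr (s - 1) / of_real (exp t) else 0) has_integral Gamma s) UNIV"
    by (simp only: has_integral_restrict_UNIV)
  also have "(\<lambda>t. if t \<in> {0<..} then complex_of_real t powr (s - 1) / of_real (exp t) else 0) = gI s"
    unfolding eq[symmetric] by (auto simp: fun_eq_iff)
  finally have "(gI s has_integral Gamma s) UNIV" .
  moreover have "(gI s has_integral (LINT t|lborel. gI s t)) UNIV"
    by (rule has_integral_integral_lborel[OF int])
  ultimately show "(LINT t|lborel. gI s t) = Gamma s" by (metis has_integral_unique)
qed

text \<open>The power (1 + x^2)^(-s). For s = \<mu> + 1/2 it is the contribution of A in the Iwasawa
  decomposition of \<open>lowerN x\<close> (\<open>c_integrand\<close>).\<close>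

definition kI :: "complex \<Rightarrow> real \<Rightarrow> complex" where
  "kI s x = exp (- s * of_real (ln (1 + x\<^sup>2)))"

lemma kI_cont: "continuous_on A (kI s)"
  unfolding kI_def by (intro continuous_intros) (smt (verit) zero_le_power2)+

lemma kI_measurable [measurable]: "kI s \<in> borel_measurable borel"
  by (rule borel_measurable_continuous_onI[OF kI_cont])

text \<open>Fubini for t^(s-1) exp(-t (1 + x^2)): integrating over t produces (1 + x^2)^(-s) times
  Gamma(s), integrating over x first produces the Gauss integral and Gamma(s - 1/2).\<close>

lemma kI_integral:
  assumes "Re s > 1/2"
  shows "integrable lborel (kI s)" "(LINT x|lborel. kI s x) = of_real gaussK * Gamma (s - 1/2) / Gamma s"
proof -
  define f where "f = (\<lambda>t x. gI s t * complex_of_real (exp (- t * x\<^sup>2)))"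
  have s0: "Re s > 0" and s1: "Re (s - 1/2) > 0" using assms by simp_all
  have fx: "(LINT x|lborel. f t x) = of_real gaussK * gI (s - 1/2) t" for t
  proof (cases "t > 0")
    case True
    have "(LINT x|lborel. f t x) = gI s t * complex_of_real (gaussK / sqrt t)"
      unfolding f_def using gauss_scale[OF True] by simp
    also have "complex_of_real (gaussK / sqrt t) = of_real gaussK * exp (- of_real (ln t) / 2)"
    proof -
      have "gaussK / sqrt t = gaussK * exp (- (ln t) / 2)"
        by (simp only: minus_divide_left[symmetric] exp_minus exp_half_ln[OF True] divide_inverse[of gaussK])
      then have "complex_of_real (gaussK / sqrt t) = of_real gaussK * of_real (exp (- (ln t) / 2))"
        by (simp only: of_real_mult)
      also have "complex_of_real (exp (- (ln t) / 2)) = exp (- of_real (ln t) / 2)"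
        by (simp only: cexp of_real_minus of_real_divide of_real_numeral)
      finally show ?thesis .
    qed
    also have "gI s t * (of_real gaussK * exp (- of_real (ln t) / 2)) = of_real gaussK * gI (s - 1/2) t"
      using True by (simp add: gI_def mult_exp_exp algebra_simps)
    finally show ?thesis .
  next
    case False then show ?thesis by (simp add: f_def gI_def)
  qed
  have ft: "integrable lborel (\<lambda>t. f t x)" "(LINT t|lborel. f t x) = kI s x * Gamma s" for x
  proof -
    define c where "c = 1 + x\<^sup>2"
    have c: "c > 0" unfolding c_def by (simp add: add_pos_nonneg)
    have eq: "f t x = exp (- (s - 1) * of_real (ln c)) * gI s (0 + c * t)" for t
    proof (cases "t > 0")
      case True
      then have "0 < c * t" "ln (c * t) = ln c + ln t" using c by (simp_all add: ln_mult)
      then show ?thesis using True unfolding f_def gI_def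
        unfolding cexp by (simp add: mult_exp_exp c_def algebra_simps)
    next
      case False
      then have "\<not> 0 < c * t" using c by (simp add: zero_less_mult_iff)
      then show ?thesis using False by (simp add: f_def gI_def)
    qed
    have "integrable lborel (\<lambda>t. gI s (0 + c * t))"
      using c by (intro lborel_integrable_real_affine gI_integral s0) auto
    then show "integrable lborel (\<lambda>t. f t x)" unfolding eq by simp
    have "Gamma s = \<bar>c\<bar> *\<^sub>R (LINT t|lborel. gI s (0 + c * t))"
      unfolding gI_integral(2)[OF s0, symmetric] using c by (intro lborel_integral_real_affine) auto
    then have "(LINT t|lborel. gI s (0 + c * t)) = Gamma s / of_real c"
      using c by (simp add: scaleR_conv_of_real)
    also have "of_real c = exp (complex_of_real (ln c))" using c by (simp add: exp_of_real)
    finally have "(LINT t|lborel. f t x) = exp (- (s - 1) * of_real (ln c)) * (Gamma s / exp (complex_of_real (ln c)))"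
      unfolding eq by simp
    also have "\<dots> = kI s x * Gamma s"
      unfolding kI_def c_def[symmetric] by (simp add: exp_diff exp_minus field_simps mult_exp_exp)
    finally show "(LINT t|lborel. f t x) = kI s x * Gamma s" .
  qed
  have int: "integrable (lborel \<Otimes>\<^sub>M lborel) (case_prod f)"
  proof (rule lborel_pair.Fubini_integrable)
    show "case_prod f \<in> borel_measurable (lborel \<Otimes>\<^sub>M lborel)"
      unfolding f_def case_prod_beta by measurable
    have "norm (f t x) = norm (gI s t) * exp (- t * x\<^sup>2)" for t x by (simp add: f_def norm_mult)
    have eq: "(LINT x|lborel. norm (case_prod f (t, x))) = gaussK * norm (gI (s - 1/2) t)" for t
    proof (cases "t > 0")
      case True
      have "(LINT x|lborel. norm (f t x)) = norm (gI s t) * (gaussK / sqrt t)"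
        using gauss_scale[OF True] by (simp add: f_def norm_mult)
      moreover have "norm (LINT x|lborel. f t x) = norm (gI s t) * (gaussK / sqrt t)"
        unfolding f_def using gauss_scale[OF True] gaussK_pos True by (simp add: norm_mult norm_divide)
      ultimately show ?thesis using fx[of t] gaussK_pos by (simp add: norm_mult)
    next
      case False then show ?thesis by (simp add: f_def gI_def)
    qed
    show "integrable lborel (\<lambda>t. LINT x|lborel. norm (case_prod f (t, x)))"
      unfolding eq using gI_integral(1)[OF s1] by simp
    have "integrable lborel (f t)" for t
    proof (cases "t > 0")
      case True
      then show ?thesis unfolding f_def using gauss_scale(1)[OF True] by simp
    next
      case False then show ?thesis by (simp add: f_def gI_def)
    qed
    then show "AE t in lborel. integrable lborel (\<lambda>x. case_prod f (t, x))" by simp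
  qed
  have "(LINT x|lborel. (LINT t|lborel. f t x)) = (LINT t|lborel. (LINT x|lborel. f t x))"
    by (rule lborel_pair.Fubini_integral[OF int])
  then have "(LINT x|lborel. kI s x * Gamma s) = of_real gaussK * Gamma (s - 1/2)"
    unfolding ft fx using gI_integral(2)[OF s1] by simp
  moreover have G0: "Gamma s \<noteq> 0" using s0 by (auto simp: Gamma_eq_zero_iff elim!: nonpos_Ints_cases)
  ultimately show "(LINT x|lborel. kI s x) = of_real gaussK * Gamma (s - 1/2) / Gamma s"
    by (simp add: field_simps)
  have "integrable lborel (\<lambda>x. LINT t|lborel. f t x)"
    using lborel_pair.integrable_snd[OF int] by simp
  then have "integrable lborel (\<lambda>x. (kI s x * Gamma s) * inverse (Gamma s))"
    unfolding ft by (rule integrable_mult_left)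
  then show "integrable lborel (kI s)" using G0 by (simp add: mult.assoc)
qed

lemma norm_kI: "norm (kI s x) = exp (- Re s * ln (1 + x\<^sup>2))"
  by (simp add: kI_def)

text \<open>The defining integral of \<open>c_fun n\<close> for Re \<mu> > 0, with the angle of
  \<open>lowerN x\<close> written through arctan x.\<close>

definition cI :: "int \<Rightarrow> complex \<Rightarrow> complex" where
  "cI n \<mu> = (LINT x|lborel. kI (\<mu> + 1/2) x * ex n (arctan x)) / of_real pi"

lemma ex_measurable [measurable]: "ex n \<in> borel_measurable borel"
  by (rule borel_measurable_continuous_onI[OF cont_ex])

lemma arctan_measurable [measurable]: "arctan \<in> borel_measurable borel"
  by (intro borel_measurable_continuous_onI continuous_intros)

lemma cI_integrable:
  assumes "Re \<mu> > 0" shows "integrable lborel (\<lambda>x. kI (\<mu> + 1/2) x * ex n (arctan x))"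
proof (rule Bochner_Integration.integrable_bound)
  show "integrable lborel (kI (\<mu> + 1/2))" using assms by (intro kI_integral) auto
qed (auto simp: norm_mult)

lemma cI_uminus: "cI (- n) \<mu> = cI n \<mu>"
proof -
  have "(LINT x|lborel. kI (\<mu> + 1/2) x * ex n (arctan x)) =
     \<bar>-1\<bar> *\<^sub>R (LINT x|lborel. kI (\<mu> + 1/2) (0 + (-1) * x) * ex n (arctan (0 + (-1) * x)))"
    by (rule lborel_integral_real_affine) simp
  then show ?thesis by (simp add: cI_def kI_def arctan_minus ex_def)
qed

text \<open>The entire factor of \<open>c_fun n\<close>; all poles are in \<open>cpre\<close>, which does not depend on \<open>n\<close>.\<close>

definition gf :: "int \<Rightarrow> complex \<Rightarrow> complex" where
  "gf n \<mu> = rGamma (\<mu> + (1 + of_int n) / 2) * rGamma (\<mu> + (1 - of_int n) / 2)"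

lemma gf_uminus: "gf (- n) \<mu> = gf n \<mu>"
  by (simp add: gf_def)

lemma gf_rec: "(\<mu> + (of_int n + 1) / 2) * gf (n + 2) \<mu> = (\<mu> - (of_int n + 1) / 2) * gf n \<mu>"
proof -
  have 1: "rGamma (\<mu> + (1 + of_int n) / 2) = (\<mu> + (1 + of_int n) / 2) * rGamma (\<mu> + (1 + of_int (n + 2)) / 2)"
    using rGamma_plus1[of "\<mu> + (1 + of_int n) / 2"] by (simp add: field_simps)
  have 2: "rGamma (\<mu> + (1 - of_int (n + 2)) / 2) = (\<mu> - (1 + of_int n) / 2) * rGamma (\<mu> + (1 - of_int n) / 2)"
    using rGamma_plus1[of "\<mu> + (1 - of_int (n + 2)) / 2"] by (simp add: field_simps)
  show ?thesis unfolding gf_def 1 2 by (simp add: mult_ac add.commute)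
qed

text \<open>The primitive \<open>P\<close> vanishes at both ends because Re \<mu> > 0, so the
  integral of its derivative is 0. With cis(arctan x) = (1 + i x) / sqrt(1 + x^2) this derivative is
  a combination of the integrands for n and n + 2.\<close>

lemma cI_rec:
  assumes "Re \<mu> > 0"
  shows "(\<mu> + (of_int n + 1) / 2) * cI (n + 2) \<mu> = (\<mu> - (of_int n + 1) / 2) * cI n \<mu>"
proof -
  define P where "P = (\<lambda>x. kI \<mu> x * ex (n + 1) (arctan x))"
  \<comment> \<open>\<open>A\<close> and \<open>B\<close> solve A (1 + i x) + B (1 - i x) = - i (n +
    1) - 2 \<mu> x, the numerator of the logarithmic derivative of \<open>P\<close>.\<close>
  define A where "A = \<i> * (\<mu> - (of_int n + 1) / 2)"
  define B where "B = - \<i> * (\<mu> + (of_int n + 1) / 2)"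
  define f where "f = (\<lambda>x. A * (kI (\<mu> + 1/2) x * ex n (arctan x)) + B * (kI (\<mu> + 1/2) x * ex (n + 2) (arctan x)))"
  have deriv: "(P has_vector_derivative f x) (at x)" for x
  proof -
    have pos: "1 + x\<^sup>2 > 0" by (simp add: add_pos_nonneg)
    have d1: "((\<lambda>x. - \<mu> * of_real (ln (1 + x\<^sup>2))) has_vector_derivative - \<mu> * of_real (2 * x / (1 + x\<^sup>2))) (at x)"
      using pos by (intro has_vector_derivative_mult_right has_vector_derivative_of_real)
        (auto intro!: derivative_eq_intros simp: field_simps)
    have dk: "(kI \<mu> has_vector_derivative (- \<mu> * of_real (2 * x / (1 + x\<^sup>2))) * kI \<mu> x) (at x)"
      using field_vector_diff_chain_at[OF d1 DERIV_exp] by (simp add: kI_def[abs_def] o_def)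
    have da: "(arctan has_vector_derivative 1 / (1 + x\<^sup>2)) (at x)"
      using DERIV_arctan[of x] by (simp add: has_real_derivative_iff_has_vector_derivative inverse_eq_divide)
    have de: "((\<lambda>x. ex (n + 1) (arctan x)) has_vector_derivative
        (1 / (1 + x\<^sup>2)) *\<^sub>R ((- \<i> * of_int (n + 1)) * ex (n + 1) (arctan x))) (at x)"
      by (rule vector_diff_chain_at[OF da ex_deriv, unfolded o_def])
    have "(P has_vector_derivative kI \<mu> x * ((1 / (1 + x\<^sup>2)) *\<^sub>R ((- \<i> * of_int (n + 1)) * ex (n + 1) (arctan x)))
       + ((- \<mu> * of_real (2 * x / (1 + x\<^sup>2))) * kI \<mu> x) * ex (n + 1) (arctan x)) (at x)"
      unfolding P_def by (rule has_vector_derivative_mult[OF dk de])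
    moreover have "kI \<mu> x * ((1 / (1 + x\<^sup>2)) *\<^sub>R ((- \<i> * of_int (n + 1)) * ex (n + 1) (arctan x)))
       + ((- \<mu> * of_real (2 * x / (1 + x\<^sup>2))) * kI \<mu> x) * ex (n + 1) (arctan x) = f x"
    proof -
      define D where "D = complex_of_real (1 + x\<^sup>2)"
      have D0: "D \<noteq> 0" using pos unfolding D_def by (metis of_real_eq_0_iff less_irrefl)
      define q where "q = complex_of_real (sqrt (1 + x\<^sup>2))"
      have qq: "q * q = D" unfolding q_def D_def using pos by (simp flip: of_real_mult)
      have q0: "q \<noteq> 0" using qq D0 by auto
      have k: "kI (\<mu> + 1/2) x = kI \<mu> x / q"
      proof -
        have "kI (\<mu> + 1/2) x = kI \<mu> x * exp (- complex_of_real (ln (1 + x\<^sup>2) / 2))"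
          by (simp add: kI_def mult_exp_exp algebra_simps add_divide_distrib diff_divide_distrib)
        also have "exp (- complex_of_real (ln (1 + x\<^sup>2) / 2)) = inverse q"
        proof -
          have "exp (ln (1 + x\<^sup>2) / 2) = sqrt (1 + x\<^sup>2)" by (rule exp_half_ln[OF pos])
          then have "exp (of_real (ln (1 + x\<^sup>2) / 2)) = q" by (simp only: cexp[symmetric] q_def)
          then show ?thesis by (simp only: exp_minus)
        qed
        finally show ?thesis by (simp only: divide_inverse)
      qed
      have c1: "complex_of_real (cos (arctan x)) = 1 / q" by (simp add: cos_arctan q_def)
      have s1: "complex_of_real (sin (arctan x)) = of_real x / q" by (simp add: sin_arctan q_def)
      have "cis (arctan x) = of_real (cos (arctan x)) + \<i> * of_real (sin (arctan x))"
        by (simp add: complex_eq_iff)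
      then have cs: "cis (arctan x) = (1 + \<i> * of_real x) / q"
        unfolding c1 s1 by (simp add: add_divide_distrib)
      have e1: "ex n (arctan x) = ex (n + 1) (arctan x) * ((1 + \<i> * of_real x) / q)"
        unfolding cs[symmetric] by (simp add: ex_def cis_mult algebra_simps)
      have "cis (- arctan x) = of_real (cos (arctan x)) - \<i> * of_real (sin (arctan x))"
        by (simp add: complex_eq_iff)
      then have cm: "cis (- arctan x) = (1 - \<i> * of_real x) / q"
        unfolding c1 s1 by (simp add: diff_divide_distrib)
      have e2: "ex (n + 2) (arctan x) = ex (n + 1) (arctan x) * ((1 - \<i> * of_real x) / q)"
        using ex_mult[of "n + 1" "arctan x" 1] unfolding cm[symmetric]
        by (simp add: ex_def[of 1] add.assoc)
      have "f x = kI \<mu> x * ex (n + 1) (arctan x) * (A * (1 + \<i> * of_real x) + B * (1 - \<i> * of_real x)) / (q * q)"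
        unfolding f_def k e1 e2 using q0 by (simp add: field_simps)
      also have "A * (1 + \<i> * of_real x) + B * (1 - \<i> * of_real x) = - \<i> * of_int (n + 1) - 2 * \<mu> * of_real x"
        by (simp add: A_def B_def field_simps)
      finally have f: "f x = kI \<mu> x * ex (n + 1) (arctan x) * (- \<i> * of_int (n + 1) - 2 * \<mu> * of_real x) / D"
        unfolding qq .
      have sc: "(1 / (1 + x\<^sup>2)) *\<^sub>R v = v / D" for v :: complex
        by (simp add: scaleR_conv_of_real D_def divide_inverse mult.commute)
      have sd: "complex_of_real (2 * x / (1 + x\<^sup>2)) = 2 * of_real x / D" by (simp add: D_def)
      show ?thesis unfolding f sc sd using D0 by (simp add: field_simps)
    qed
    ultimately show ?thesis by simp
  qed
  have normP: "norm (P x) = exp (- Re \<mu> * ln (1 + x\<^sup>2))" for x by (simp add: P_def norm_mult norm_kI)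
  have lim: "(P \<longlongrightarrow> 0) at_bot" "(P \<longlongrightarrow> 0) at_top"
  proof -
    have t: "filterlim (\<lambda>x::real. 1 + x\<^sup>2) at_top at_top" "filterlim (\<lambda>x::real. 1 + x\<^sup>2) at_top at_bot"
      by (intro filterlim_tendsto_add_at_top[OF tendsto_const] filterlim_pow_at_top filterlim_pow_at_bot_even
          filterlim_ident; simp)+
    have "filterlim (\<lambda>x::real. - Re \<mu> * ln (1 + x\<^sup>2)) at_bot F" if "filterlim (\<lambda>x::real. 1 + x\<^sup>2) at_top F" for F
      using assms that
      by (intro filterlim_tendsto_neg_mult_at_bot[OF tendsto_const] filterlim_compose[OF ln_at_top]) auto
    then have "((\<lambda>x. exp (- Re \<mu> * ln (1 + x\<^sup>2))) \<longlongrightarrow> 0) F" if "filterlim (\<lambda>x::real. 1 + x\<^sup>2) at_top F" for F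
      using that filterlim_compose[OF exp_at_bot] by blast
    then have "((\<lambda>x. norm (P x)) \<longlongrightarrow> 0) at_bot" "((\<lambda>x. norm (P x)) \<longlongrightarrow> 0) at_top"
      unfolding normP using t by blast+
    then show "(P \<longlongrightarrow> 0) at_bot" "(P \<longlongrightarrow> 0) at_top" by (simp_all add: tendsto_norm_zero_iff)
  qed
  have cont: "continuous_on UNIV f" unfolding f_def
    by (intro continuous_intros kI_cont continuous_on_compose2[OF cont_ex[of UNIV]]) auto
  have "(LINT x|lborel. f x) = 0 - 0"
    by (rule integral_FTC_real[OF deriv cont _ lim])
       (unfold f_def, intro Bochner_Integration.integrable_add integrable_mult_right cI_integrable assms)
  moreover have "(LINT x|lborel. f x) = A * (LINT x|lborel. kI (\<mu> + 1/2) x * ex n (arctan x))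
     + B * (LINT x|lborel. kI (\<mu> + 1/2) x * ex (n + 2) (arctan x))"
    unfolding f_def using cI_integrable[OF assms] by simp
  ultimately have "A * cI n \<mu> + B * cI (n + 2) \<mu> = 0"
    unfolding cI_def by (simp add: field_simps)
  then have "- \<i> * (A * cI n \<mu>) = - \<i> * (- B * cI (n + 2) \<mu>)" by (simp add: add_eq_0_iff)
  then show ?thesis by (simp add: A_def B_def mult.assoc[symmetric])
qed

definition cpre :: "complex \<Rightarrow> complex" where
  "cpre \<mu> = of_real (gaussK / pi) * Gamma \<mu> * Gamma (\<mu> + 1/2)"

lemma Gamma_nz: "Re z > 0 \<Longrightarrow> Gamma z \<noteq> (0 :: complex)"
  by (auto simp: Gamma_eq_zero_iff elim!: nonpos_Ints_cases)

text \<open>Both sides are even in n and satisfy the same recursion with step 2, so n = 0 and n = 1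
  remain. The integrands for 1 and -1 add up to one with the factor 2 cos(arctan x) = 2 (1 +
  x^2)^(-1/2), to which \<open>kI_integral\<close> applies again.\<close>

lemma cI_eq: assumes "Re \<mu> > 0" shows "cI n \<mu> = cpre \<mu> * gf n \<mu>"
proof -
  have nz: "Gamma \<mu> \<noteq> 0" "Gamma (\<mu> + 1/2) \<noteq> 0" "Gamma (\<mu> + 1) \<noteq> 0"
    using assms by (intro Gamma_nz; simp)+
  have 0: "cI 0 \<mu> = cpre \<mu> * gf 0 \<mu>"
  proof -
    have "cI 0 \<mu> = of_real gaussK * Gamma \<mu> / Gamma (\<mu> + 1/2) / of_real pi"
      using kI_integral(2)[of "\<mu> + 1/2"] assms by (simp add: cI_def)
    then show ?thesis using nz by (simp add: cpre_def gf_def rGamma_inverse_Gamma field_simps)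
  qed
  have 1: "cI 1 \<mu> = cpre \<mu> * gf 1 \<mu>"
  proof -
    have "kI (\<mu> + 1/2) x * ex 1 (arctan x) + kI (\<mu> + 1/2) x * ex (-1) (arctan x) = 2 * kI (\<mu> + 1) x" for x
    proof -
      have pos: "1 + x\<^sup>2 > 0" by (simp add: add_pos_nonneg)
      have "ex 1 (arctan x) + ex (-1) (arctan x) = 2 * of_real (cos (arctan x))"
        by (simp add: ex_def complex_eq_iff)
      also have "cos (arctan x) = exp (- (ln (1 + x\<^sup>2) / 2))"
      proof -
        have "exp (ln (1 + x\<^sup>2) / 2) = sqrt (1 + x\<^sup>2)" by (rule exp_half_ln[OF pos])
        then show ?thesis by (simp add: cos_arctan exp_minus inverse_eq_divide)
      qed
      also have "kI (\<mu> + 1/2) x * (2 * of_real (exp (- (ln (1 + x\<^sup>2) / 2)))) = 2 * kI (\<mu> + 1) x"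
      proof -
        have "- (\<mu> + 1/2) * L + - (L / 2) = - (\<mu> + 1) * L" for L by (simp add: field_simps)
        then show ?thesis unfolding cexp kI_def of_real_minus of_real_divide of_real_numeral
          by (simp only: mult.left_commute[of _ 2] mult_exp_exp)
      qed
      finally show ?thesis by (simp add: distrib_left)
    qed
    then have "(LINT x|lborel. kI (\<mu> + 1/2) x * ex 1 (arctan x)) + (LINT x|lborel. kI (\<mu> + 1/2) x * ex (-1) (arctan x)) =
      2 * (LINT x|lborel. kI (\<mu> + 1) x)"
      using Bochner_Integration.integral_add[OF cI_integrable[OF assms, of 1] cI_integrable[OF assms, of "-1"]] by simp
    also have "(LINT x|lborel. kI (\<mu> + 1) x) = of_real gaussK * Gamma (\<mu> + 1/2) / Gamma (\<mu> + 1)"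
      using kI_integral(2)[of "\<mu> + 1"] assms by (simp add: add_diff_eq[symmetric])
    finally have "cI 1 \<mu> + cI (-1) \<mu> = 2 * (of_real gaussK * Gamma (\<mu> + 1/2) / Gamma (\<mu> + 1)) / of_real pi"
      by (simp only: cI_def add_divide_distrib[symmetric])
    then have "cI 1 \<mu> = of_real gaussK * Gamma (\<mu> + 1/2) / Gamma (\<mu> + 1) / of_real pi"
      unfolding cI_uminus[of 1 \<mu>] by (simp only: mult_2[symmetric] times_divide_eq_right[symmetric] mult_cancel_left) simp
    then show ?thesis using nz by (simp add: cpre_def gf_def rGamma_inverse_Gamma field_simps)
  qed
  have step: "cI (n + 2) \<mu> = cpre \<mu> * gf (n + 2) \<mu>" if "n \<ge> 0" "cI n \<mu> = cpre \<mu> * gf n \<mu>" for n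
  proof -
    \<comment> \<open>For n \<ge> 0 the coefficient of \<open>cI (n + 2) \<mu>\<close> in the
      recursion cannot vanish, so it can be cancelled.\<close>
    have "Re (\<mu> + (of_int n + 1) / 2) > 0" using assms that(1) by (simp add: add_pos_nonneg)
    then have nz': "\<mu> + (of_int n + 1) / 2 \<noteq> 0" by (metis less_irrefl zero_complex.sel(1))
    have "(\<mu> + (of_int n + 1) / 2) * cI (n + 2) \<mu> = (\<mu> + (of_int n + 1) / 2) * (cpre \<mu> * gf (n + 2) \<mu>)"
      unfolding cI_rec[OF assms] that(2) using gf_rec[of \<mu> n] by (simp add: mult.left_commute)
    then show ?thesis using nz' by (simp only: mult_cancel_left) simp
  qed
  have nat: "cI (int k) \<mu> = cpre \<mu> * gf (int k) \<mu> \<and> cI (int k + 1) \<mu> = cpre \<mu> * gf (int k + 1) \<mu>" for k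
  proof (induction k)
    case (Suc k)
    then show ?case using step[of "int k"] by (simp add: add.commute add.left_commute)
  qed (use 0 1 in simp)
  show ?thesis
  proof (cases "n \<ge> 0")
    case True then show ?thesis using nat[of "nat n"] by simp
  next
    case False then show ?thesis using nat[of "nat (- n)"] cI_uminus[of n] gf_uminus[of n] by simp
  qed
qed

lemma gf_hol: "gf n holomorphic_on A"
  unfolding gf_def by (intro holomorphic_intros)

text \<open>This keeps sequences rapidly decreasing when they are multiplied by \<open>gf n\<close>,
  uniformly for parameters in a disk. By \<open>gf_rec\<close> the step from p to p + 2 multiplies
  the norm by at most (h + R') / (h - R') with h = (p + 1) / 2, and products of such ratios grow
  like a power of n.\<close>

lemma gf_growth:
  obtains C K where "C \<ge> 0" "\<And>n \<mu>. norm \<mu> \<le> R \<Longrightarrow> norm (gf n \<mu>) \<le> C * (1 + \<bar>of_int n\<bar>) ^ K"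
proof -
  define R' where "R' = max R 0"
  define K where "K = nat \<lceil>4 * R'\<rceil>"
  \<comment> \<open>For p > K this gives 2 R' \<le> h and a ratio of at most 1 + 2 K / (p + 1),
    which Bernoulli's inequality bounds by ((1 + n) / (1 + p))^K with n = p + 2.\<close>
  have K: "real K \<ge> 4 * R'" unfolding K_def by linarith
  have R': "R' \<ge> 0" "R \<le> R'" by (auto simp: R'_def)
  have "\<exists>B. \<forall>\<mu>\<in>cball 0 R'. norm (gf n \<mu>) \<le> B" for n
  proof -
    have "bounded (gf n ` cball 0 R')"
      by (intro compact_imp_bounded compact_continuous_image holomorphic_on_imp_continuous_on gf_hol) simp
    then show ?thesis by (auto simp: bounded_iff)
  qed
  then obtain B where B: "\<And>n \<mu>. \<mu> \<in> cball 0 R' \<Longrightarrow> norm (gf n \<mu>) \<le> B n" by metis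
  have B0: "B n \<ge> 0" for n using B[of 0 n] R' norm_ge_zero[of "gf n 0"] by (simp del: norm_ge_zero)
  define C where "C = (\<Sum>n\<le>K + 2. B (int n))"
  have C0: "C \<ge> 0" unfolding C_def by (intro sum_nonneg B0)
  have main: "norm (gf (int n) \<mu>) \<le> C * (1 + real n) ^ K" if \<mu>: "norm \<mu> \<le> R'" for n \<mu>
  proof (induction n rule: less_induct)
    case (less n)
    show ?case
    proof (cases "n \<le> K + 2")
      case True
      have "norm (gf (int n) \<mu>) \<le> B (int n)" using B \<mu> by simp
      also have "\<dots> \<le> C" unfolding C_def using True by (intro member_le_sum B0) auto
      also have "\<dots> \<le> C * (1 + real n) ^ K" using C0 by (simp add: mult_le_cancel_left1)
      finally show ?thesis .
    next
      case False
      then obtain p where p: "n = p + 2" "p > K" by (metis add_less_cancel_right add.commute le_add_diff_inverse not_le nat_le_linear trans_le_add2)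
      define h where "h = (real p + 1) / 2"
      have h: "h > 0" "2 * R' \<le> h" using p K by (auto simp: h_def)
      have low: "h - R' \<le> norm (\<mu> + of_real h)" using norm_diff_ineq[of "of_real h" \<mu>] \<mu> h by (simp add: add.commute)
      have up: "norm (\<mu> - of_real h) \<le> h + R'" using norm_triangle_ineq4[of \<mu> "of_real h"] \<mu> h by simp
      have hR: "h - R' > 0" using h R' by (smt (verit) mult_2)
      have hc: "complex_of_real h = (of_int (int p) + 1) / 2" by (simp add: h_def)
      have rec: "norm (\<mu> + of_real h) * norm (gf (int n) \<mu>) = norm (\<mu> - of_real h) * norm (gf (int p) \<mu>)"
        using arg_cong[OF gf_rec[of \<mu> "int p"], of norm] p(1) unfolding hc norm_mult by (simp add: add.commute)
      have "(h - R') * norm (gf (int n) \<mu>) \<le> (h + R') * norm (gf (int p) \<mu>)"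
        using mult_right_mono[OF low norm_ge_zero[of "gf (int n) \<mu>"]] mult_right_mono[OF up norm_ge_zero[of "gf (int p) \<mu>"]] rec by linarith
      also have "\<dots> \<le> (h + R') * (C * (1 + real p) ^ K)"
        using less[of p] p(1) h R' by (intro mult_left_mono) auto
      finally have 1: "norm (gf (int n) \<mu>) \<le> (h + R') / (h - R') * (C * (1 + real p) ^ K)"
        using hR by (simp add: field_simps)
      have "(h + R') / (h - R') \<le> 1 + real K * (2 / (real p + 1))"
      proof -
        have "(h + R') / (h - R') = 1 + 2 * R' / (h - R')" using hR by (simp add: field_simps)
        also have "2 * R' / (h - R') \<le> 2 * R' / (h / 2)"
          using h R' by (intro divide_left_mono) auto
        also have "\<dots> = 4 * R' * (2 / (real p + 1))" by (simp add: h_def field_simps)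
        also have "\<dots> \<le> real K * (2 / (real p + 1))" using K by (intro mult_right_mono) auto
        finally show ?thesis by simp
      qed
      also have "\<dots> \<le> (1 + 2 / (real p + 1)) ^ K"
        by (rule Bernoulli_inequality) (auto intro: order_trans[of _ 0])
      also have "1 + 2 / (real p + 1) = (1 + real n) / (1 + real p)" using p(1) by (simp add: field_simps)
      finally have "(h + R') / (h - R') * (C * (1 + real p) ^ K) \<le> ((1 + real n) / (1 + real p)) ^ K * (C * (1 + real p) ^ K)"
        using C0 by (intro mult_right_mono) auto
      also have "\<dots> = C * (1 + real n) ^ K" by (simp add: power_divide)
      finally show ?thesis using 1 by linarith
    qed
  qed
  show ?thesis
  proof (rule that[OF C0])
    fix n :: int and \<mu> :: complex assume "norm \<mu> \<le> R"
    then have \<mu>: "norm \<mu> \<le> R'" using R' by simp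
    show "norm (gf n \<mu>) \<le> C * (1 + \<bar>of_int n\<bar>) ^ K"
    proof (cases "n \<ge> 0")
      case True then show ?thesis using main[OF \<mu>, of "nat n"] by simp
    next
      case False then show ?thesis using main[OF \<mu>, of "nat (- n)"] gf_uminus[of n] by simp
    qed
  qed
qed

lemma rd_gf: assumes "rd a" shows "rd (\<lambda>n. gf n \<mu> * a n)"
proof -
  obtain C K where "\<And>n \<mu>'. norm \<mu>' \<le> norm \<mu> \<Longrightarrow> norm (gf n \<mu>') \<le> C * (1 + \<bar>of_int n\<bar>) ^ K"
    using gf_growth[of "norm \<mu>"] by metis
  then show ?thesis by (intro rd_mult_poly[OF assms, of _ C K]) simp
qed

lemma gf_ser_hol: assumes "rd a" shows "(\<lambda>\<mu>. ser (\<lambda>n. gf n \<mu> * a n) \<theta>) holomorphic_on UNIV"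
proof (rule holomorphic_uniform_sequence[OF open_UNIV])
  let ?t = "\<lambda>j \<mu>. gf (int_decode j) \<mu> * a (int_decode j) * ex (int_decode j) \<theta>"
  show "(\<lambda>\<mu>. \<Sum>j<N. ?t j \<mu>) holomorphic_on UNIV" for N by (intro holomorphic_intros gf_hol)
  fix x :: complex
  obtain C K where C: "C \<ge> 0" "\<And>n \<mu>. norm \<mu> \<le> norm x + 1 \<Longrightarrow> norm (gf n \<mu>) \<le> C * (1 + \<bar>of_int n\<bar>) ^ K"
    using gf_growth[of "norm x + 1"] by metis
  obtain D where D: "\<And>j. (1 + \<bar>of_int (int_decode j)\<bar>) ^ K * norm (a (int_decode j)) \<le> D * wt j"
    using rdD2[OF assms, of K] by metis
  have "uniform_limit (cball x 1) (\<lambda>N \<mu>. \<Sum>j<N. ?t j \<mu>) (\<lambda>\<mu>. \<Sum>j. ?t j \<mu>) sequentially"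
  proof (rule Weierstrass_m_test[OF _ summable_mult[OF summable_wt, of "C * D"]])
    fix j \<mu> assume "\<mu> \<in> cball x 1"
    then have \<mu>: "norm \<mu> \<le> norm x + 1" using norm_triangle_sub[of \<mu> x] by (simp add: dist_norm norm_minus_commute)
    have "norm (?t j \<mu>) \<le> (C * (1 + \<bar>of_int (int_decode j)\<bar>) ^ K) * norm (a (int_decode j))"
      unfolding norm_mult norm_ex using C(2)[OF \<mu>] by (simp add: mult_right_mono)
    also have "\<dots> \<le> C * (D * wt j)" unfolding mult.assoc using C(1) D by (intro mult_left_mono)
    finally show "norm (?t j \<mu>) \<le> C * D * wt j" by simp
  qed
  then show "\<exists>d. 0 < d \<and> cball x d \<subseteq> UNIV \<and> uniform_limit (cball x d) (\<lambda>N \<mu>. \<Sum>j<N. ?t j \<mu>) (\<lambda>\<mu>. ser (\<lambda>n. gf n \<mu> * a n) \<theta>) sequentially"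
    unfolding ser_def by (intro exI[of _ 1]) auto
qed

section \<open>Meromorphic continuation from the right half plane\<close>

text \<open>The difference vanishes near 1, hence off a discrete set. At the exceptional points the
  conventions (value 0 at a pole, the limit elsewhere) force equality, so the description in
  \<open>mero_cont\<close> determines a single function.\<close>

lemma nicely_meromorphic_unique:
  assumes "F nicely_meromorphic_on UNIV" "H nicely_meromorphic_on UNIV" "\<And>\<nu>. Re \<nu> > 0 \<Longrightarrow> F \<nu> = H \<nu>"
  shows "F = H"
proof
  fix z
  define D where "D = (\<lambda>z. F z - H z)"
  have mero: "F meromorphic_on UNIV" "H meromorphic_on UNIV" using assms by (auto simp: nicely_meromorphic_on_def)
  then have D: "D meromorphic_on UNIV" unfolding D_def by (intro meromorphic_intros)
  have iso: "isolated_singularity_at D w" for w using D meromorphic_on_isolated_singularity meromorphic_on_subset by blast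
  have nice: "remove_sings D nicely_meromorphic_on UNIV" by (rule remove_sings_nicely_meromorphic[OF D])
  have "open {\<nu>. Re \<nu> > 0}" by (simp add: open_halfspace_Re_gt)
  then have "\<forall>\<^sub>F w in nhds 1. w \<in> {\<nu>. Re \<nu> > 0}" by (rule eventually_nhds_in_open) simp
  then have "\<forall>\<^sub>F w in at 1. D w = 0" using assms(3) by (auto simp: D_def eventually_at_filter elim: eventually_mono)
  then have "\<forall>\<^sub>F w in at 1. remove_sings D w = 0"
    using eventually_remove_sings_eq_at[OF iso[of 1]] by eventually_elim simp
  then have "\<exists>\<^sub>F w in at 1. remove_sings D w = 0" by (rule eventually_frequently[rotated]) simp
  then have D0: "remove_sings D w = 0" for w
    by (rule frequently_eq_meromorphic_imp_constant[OF _ nice open_UNIV connected_UNIV UNIV_I UNIV_I])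
  have ev: "\<forall>\<^sub>F w in at z. F w = H w"
    using eventually_remove_sings_eq_at[OF iso[of z]] by eventually_elim (use D0 in \<open>simp add: D_def\<close>)
  have pole: "is_pole F z \<longleftrightarrow> is_pole H z" by (rule is_pole_cong[OF ev refl])
  have F: "(is_pole F z \<and> F z = 0) \<or> F \<midarrow>z\<rightarrow> F z" and H: "(is_pole H z \<and> H z = 0) \<or> H \<midarrow>z\<rightarrow> H z"
    using assms(1,2) by (auto simp: nicely_meromorphic_on_def)
  show "F z = H z"
  proof (cases "is_pole F z")
    case True
    then have "\<not> F \<midarrow>z\<rightarrow> F z" "\<not> H \<midarrow>z\<rightarrow> H z"
      using pole not_tendsto_and_filterlim_at_infinity[OF at_neq_bot] unfolding is_pole_def by blast+
    then show ?thesis using F H by auto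
  next
    case False
    then have "F \<midarrow>z\<rightarrow> F z" "H \<midarrow>z\<rightarrow> H z" using F H pole by auto
    moreover have "F \<midarrow>z\<rightarrow> H z" using calculation(2) 
      by (rule Lim_transform_eventually) (use ev in eventually_elim, simp)
    ultimately show ?thesis using LIM_unique by blast
  qed
qed

lemma mero_cont_eq:
  assumes "F meromorphic_on UNIV" "\<And>\<nu>. Re \<nu> > 0 \<Longrightarrow> F analytic_on {\<nu>}" "\<And>\<nu>. Re \<nu> > 0 \<Longrightarrow> F \<nu> = f \<nu>" "F analytic_on {z}"
  shows "mero_cont f z = F z"
proof -
  have nice: "remove_sings F nicely_meromorphic_on UNIV" by (rule remove_sings_nicely_meromorphic[OF assms(1)])
  have "mero_cont f = remove_sings F" unfolding mero_cont_def
  proof (rule the_equality)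
    show *: "remove_sings F nicely_meromorphic_on UNIV \<and> (\<forall>\<nu>. 0 < Re \<nu> \<longrightarrow> remove_sings F \<nu> = f \<nu>)"
      using nice assms(2,3) by simp
    show "H = remove_sings F" if "H nicely_meromorphic_on UNIV \<and> (\<forall>\<nu>. 0 < Re \<nu> \<longrightarrow> H \<nu> = f \<nu>)" for H
      using that * by (intro nicely_meromorphic_unique) auto
  qed
  then show ?thesis using assms(4) by simp
qed

lemma Gamma_mero: assumes "f holomorphic_on UNIV" shows "(\<lambda>z. Gamma (f z :: complex)) meromorphic_on UNIV"
proof -
  have "(\<lambda>z. inverse (rGamma (f z))) meromorphic_on UNIV"
    by (intro meromorphic_on_inverse analytic_on_imp_meromorphic_on)
       (simp add: analytic_on_open holomorphic_intros assms)
  then show ?thesis by (simp add: rGamma_inverse_Gamma)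
qed

lemma cpre_mero: "cpre meromorphic_on UNIV"
  unfolding cpre_def[abs_def] by (intro meromorphic_on_mult meromorphic_on_const Gamma_mero holomorphic_intros)

lemma cpre_analytic: "Re \<nu> > 0 \<Longrightarrow> cpre analytic_on {\<nu>}"
proof -
  assume \<nu>: "Re \<nu> > 0"
  have "cpre holomorphic_on {\<nu>. Re \<nu> > 0}"
    unfolding cpre_def[abs_def]
    by (intro holomorphic_intros) (auto elim!: nonpos_Ints_cases dest!: arg_cong[of _ _ Re])
  then show ?thesis
    using \<nu> open_halfspace_Re_gt[of 0] analytic_at by blast
qed

lemma cpre_nz: "Re \<nu> > 0 \<Longrightarrow> cpre \<nu> \<noteq> 0"
  using gaussK_pos Gamma_nz[of \<nu>] Gamma_nz[of "\<nu> + 1/2"] by (simp add: cpre_def)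

text \<open>All continued quantities are \<open>cpre\<close> times an entire function. The points
  where \<open>cpre\<close> is not analytic form a discrete set, which an identity of meromorphic
  functions such as (2.a) tolerates.\<close>

lemma mero_cont_cpre:
  assumes "h holomorphic_on UNIV" "\<And>\<nu>. Re \<nu> > 0 \<Longrightarrow> f \<nu> = cpre \<nu> * h \<nu>" "cpre analytic_on {z}"
  shows "mero_cont f z = cpre z * h z"
proof -
  have h: "h analytic_on A" for A using assms(1) analytic_on_open[of UNIV h] analytic_on_subset by blast
  show ?thesis
  proof (rule mero_cont_eq[where F = "\<lambda>\<nu>. cpre \<nu> * h \<nu>"])
    show "(\<lambda>\<nu>. cpre \<nu> * h \<nu>) meromorphic_on UNIV"
      by (intro meromorphic_on_mult cpre_mero analytic_on_imp_meromorphic_on h)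
  qed (use assms cpre_analytic h in \<open>auto intro!: analytic_on_mult\<close>)
qed

section \<open>The c-function and the Knapp-Stein integral in the coordinate of the angle\<close>

lemma sqrt1x: "sqrt (1 + x\<^sup>2) > 0" by (simp add: add_pos_nonneg)

lemma cis_arctan: "of_real (sqrt (1 + x\<^sup>2)) * cis (arctan x) = 1 + \<i> * of_real x"
  using sqrt1x[of x] by (simp add: complex_eq_iff cos_arctan sin_arctan)

lemma exp_kI: "exp (- (2 * \<mu> + 1) * of_real (ln (sqrt (1 + x\<^sup>2)))) = kI (\<mu> + 1/2) x"
proof -
  have "1 + x\<^sup>2 > 0" by (simp add: add_pos_nonneg)
  then have "ln (sqrt (1 + x\<^sup>2)) = ln (1 + x\<^sup>2) / 2" by (simp add: ln_sqrt)
  moreover have "- (2 * \<mu> + 1) * of_real (L / 2) = - (\<mu> + 1/2) * of_real L" for L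
    by (simp add: field_simps)
  ultimately show ?thesis unfolding kI_def by (simp only:)
qed

lemma c_integrand:
  "a_pow (- (\<nu> + rho)) (lowerN x) * delta m (kappa (lowerN x)) = kI (\<nu> + 1/2) x * ex m (arctan x)"
proof -
  have col: "col (lowerN x) = of_real (sqrt (1 + x\<^sup>2)) * cis (- (- arctan x))"
    using cis_arctan[of x] by (simp add: col_def lowerN_def complex_eq_iff)
  have "ext \<nu> (ex (-m)) (col (lowerN x)) = exp (- (2 * \<nu> + 1) * of_real (ln (sqrt (1 + x\<^sup>2)))) * ex (-m) (- arctan x)"
    by (rule ext_polar[OF per_ex sqrt1x col])
  also have "ex (-m) (- arctan x) = ex m (arctan x)" by (simp add: ex_def)
  finally have 1: "ext \<nu> (ex (-m)) (col (lowerN x)) = kI (\<nu> + 1/2) x * ex m (arctan x)" unfolding exp_kI .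
  have "delta m (rot t) = ex (-m) t" for t by (simp add: delta_rot ex_def)
  then have "a_pow (- (\<nu> + rho)) (lowerN x) * delta m (kappa (lowerN x)) = ext \<nu> (ex (-m)) (col (lowerN x))"
    using extend_eq[of "lowerN x" \<nu> "delta m"] by (simp add: extend_def)
  then show ?thesis using 1 by simp
qed

lemma c_fun_eq: assumes "cpre analytic_on {\<nu>}" shows "c_fun m \<nu> = cpre \<nu> * gf m \<nu>"
  unfolding c_fun_def c_integrand
  by (rule mero_cont_cpre[OF gf_hol _ assms]) (use cI_eq cI_def in simp)

text \<open>Comparing upper left entries for \<open>diagA 1\<close> forces cos t = 0, so the
  representative is a rotation by pi / 2 or -pi / 2.\<close>

lemma represents_w_rot:
  assumes "represents_w mw" obtains s :: int where "s = 1 \<or> s = -1" "mw = rot (of_int s * pi / 2)"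
proof -
  obtain t where t: "mw = rot t" using assms by (auto simp: represents_w_def SO2_def)
  have "rot t ** diagA 1 ** rot (- t) = diagA (- 1)"
    using assms by (simp add: represents_w_def t matrix_inv_rot)
  then have "(rot t ** diagA 1 ** rot (- t)) $ 1 $ 1 = exp (- 1)" by (simp add: diagA_def)
  then have "cos t * exp 1 * cos t + sin t * exp (- 1) * sin t = exp (- 1)"
    by (simp add: matrix_matrix_mult_def sum_2 diagA_def)
  then have "(cos t)\<^sup>2 * exp 1 + (sin t)\<^sup>2 * exp (- 1) = exp (- 1)"
    by (simp add: power2_eq_square mult_ac)
  then have "(cos t)\<^sup>2 * (exp 1 - exp (- 1)) = 0" unfolding sin_squared_eq by (simp add: algebra_simps)
  moreover have "exp (- 1) < exp (1::real)" by simp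
  ultimately have c: "cos t = 0" by simp
  then have "(sin t)\<^sup>2 = 1" by (simp add: sin_squared_eq)
  then have s: "sin t = 1 \<or> sin t = - 1" by (simp add: power2_eq_1_iff)
  define s' :: int where "s' = (if sin t = 1 then 1 else -1)"
  have "mw = rot (of_int s' * pi / 2)" unfolding t using c s by (auto simp: mat_simps s'_def)
  moreover have "s' = 1 \<or> s' = -1" by (simp add: s'_def)
  ultimately show ?thesis using that by blast
qed

text \<open>As a complex number the first column of the product has norm sqrt(1 + x^2), and its
  angle is displaced by the constant s pi / 2 and by arctan x. The Knapp-Stein integral is therefore
  a convolution in the angle.\<close>

lemma J_integrand:
  assumes "s = 1 \<or> s = (-1 :: int)"
  shows "extend \<mu> \<phi> (rot \<theta> ** upperN x ** rot (of_int s * pi / 2)) =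
     kI (\<mu> + 1/2) x * \<phi> (rot (\<theta> + of_int s * pi / 2 + arctan x))"
proof -
  let ?A = "rot \<theta> ** upperN x ** rot (of_int s * pi / 2)"
  have cs: "cis (of_int s * pi / 2) = of_int s * \<i>" using assms by (auto simp: complex_eq_iff)
  have cs': "cis (- (of_int s * pi / 2)) = - of_int s * \<i>" using assms by (auto simp: complex_eq_iff)
  have "cnj (of_real (sqrt (1 + x\<^sup>2)) * cis (arctan x)) = cnj (1 + \<i> * of_real x)" unfolding cis_arctan ..
  then have ca: "of_real (sqrt (1 + x\<^sup>2)) * cis (- arctan x) = 1 - \<i> * of_real x" by (simp add: cis_cnj)
  have "col ?A = cis (- \<theta>) * lin (upperN x) (- of_int s * \<i>)"
    by (simp add: col_mult[of _ "rot (of_int s * pi / 2)"] lin_mult lin_rot col_rot cs'[simplified])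
  also have "lin (upperN x) (- of_int s * \<i>) = - of_int s * \<i> * (1 - \<i> * of_real x)"
    by (simp add: lin_def upperN_def complex_eq_iff)
  also have "\<dots> = cis (- (of_int s * pi / 2)) * (of_real (sqrt (1 + x\<^sup>2)) * cis (- arctan x))"
    unfolding ca cs' ..
  also have "cis (- \<theta>) * \<dots> = of_real (sqrt (1 + x\<^sup>2)) * (cis (- \<theta>) * cis (- (of_int s * pi / 2)) * cis (- arctan x))"
    by (simp only: mult_ac)
  also have "cis (- \<theta>) * cis (- (of_int s * pi / 2)) * cis (- arctan x) = cis (- (\<theta> + of_int s * pi / 2 + arctan x))"
    unfolding cis_mult by (rule arg_cong[of _ _ cis]) simp
  finally have col: "col ?A = of_real (sqrt (1 + x\<^sup>2)) * cis (- (\<theta> + of_int s * pi / 2 + arctan x))" .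
  have "extend \<mu> \<phi> ?A = ext \<mu> (\<lambda>\<theta>. \<phi> (rot \<theta>)) (col ?A)" by (rule extend_eq) simp
  also have "\<dots> = exp (- (2 * \<mu> + 1) * of_real (ln (sqrt (1 + x\<^sup>2)))) * \<phi> (rot (\<theta> + of_int s * pi / 2 + arctan x))"
    by (rule ext_polar[OF per_rot sqrt1x col])
  finally show ?thesis unfolding exp_kI .
qed

text \<open>The Knapp-Stein integral without the rotation by s pi / 2. It commutes with rotations
  and is therefore diagonal on the K-types (\<open>Jop_ser\<close>).\<close>

definition Jop :: "complex \<Rightarrow> (real \<Rightarrow> complex) \<Rightarrow> real \<Rightarrow> complex" where
  "Jop \<mu> F \<theta> = (LINT x|lborel. kI (\<mu> + 1/2) x * F (\<theta> + arctan x)) / of_real pi"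

text \<open>Dominated convergence along the Fourier series of \<open>F\<close>: the partial sums are
  bounded by the sum of the norms of the coefficients.\<close>

lemma Jop_ser:
  assumes "SP F" "Re \<mu> > 0"
  shows "Jop \<mu> F \<theta> = cpre \<mu> * ser (\<lambda>n. gf n \<mu> * fc F n) \<theta>"
proof -
  let ?a = "fc F"
  have rd: "rd ?a" by (rule rd_fc[OF assms(1)])
  let ?t = "\<lambda>j \<theta>. ?a (int_decode j) * ex (int_decode j) \<theta>"
  define M where "M = (\<Sum>j. norm (?a (int_decode j)))"
  have sm: "summable (\<lambda>j. norm (?a (int_decode j)))" by (rule ser_summable(1)[OF rd])
  have int: "integrable lborel (\<lambda>x. kI (\<mu> + 1/2) x * (\<Sum>j<N. ?t j (\<theta> + arctan x)))" for N
  proof -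
    have "integrable lborel (\<lambda>x. \<Sum>j<N. (?a (int_decode j) * ex (int_decode j) \<theta>) * (kI (\<mu> + 1/2) x * ex (int_decode j) (arctan x)))"
      by (intro Bochner_Integration.integrable_sum integrable_mult_right cI_integrable assms)
    then show ?thesis by (simp add: sum_distrib_left ex_add mult_ac)
  qed
  have Fm: "F \<in> borel_measurable borel" by (intro borel_measurable_continuous_onI SP_cont assms)
  have lim: "(\<lambda>N. LINT x|lborel. kI (\<mu> + 1/2) x * (\<Sum>j<N. ?t j (\<theta> + arctan x))) \<longlonglongrightarrow>
     (LINT x|lborel. kI (\<mu> + 1/2) x * F (\<theta> + arctan x))"
  proof (rule integral_dominated_convergence[where w = "\<lambda>x. norm (kI (\<mu> + 1/2) x) * M"])
    show "integrable lborel (\<lambda>x. norm (kI (\<mu> + 1/2) x) * M)"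
      using kI_integral(1)[of "\<mu> + 1/2"] assms(2) by (intro integrable_mult_left integrable_norm) simp
    show "AE x in lborel. (\<lambda>N. kI (\<mu> + 1/2) x * (\<Sum>j<N. ?t j (\<theta> + arctan x))) \<longlonglongrightarrow> kI (\<mu> + 1/2) x * F (\<theta> + arctan x)"
    proof (intro AE_I2 tendsto_mult_left)
      fix x
      have "(\<lambda>j. ?t j (\<theta> + arctan x)) sums ser ?a (\<theta> + arctan x)"
        unfolding ser_def by (rule summable_sums[OF ser_summable(3)[OF rd]])
      then show "(\<lambda>N. \<Sum>j<N. ?t j (\<theta> + arctan x)) \<longlonglongrightarrow> F (\<theta> + arctan x)"
        unfolding ser_fc[OF assms(1)] sums_def .
    qed
    show "AE x in lborel. norm (kI (\<mu> + 1/2) x * (\<Sum>j<N. ?t j (\<theta> + arctan x))) \<le> norm (kI (\<mu> + 1/2) x) * M" for N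
    proof (intro AE_I2)
      fix x
      have "norm (\<Sum>j<N. ?t j (\<theta> + arctan x)) \<le> (\<Sum>j<N. norm (?a (int_decode j)))"
        by (rule order_trans[OF norm_sum]) (simp add: norm_mult)
      also have "\<dots> \<le> M" unfolding M_def by (rule sum_le_suminf[OF sm]) auto
      finally show "norm (kI (\<mu> + 1/2) x * (\<Sum>j<N. ?t j (\<theta> + arctan x))) \<le> norm (kI (\<mu> + 1/2) x) * M"
        unfolding norm_mult by (intro mult_left_mono) auto
    qed
    show "(\<lambda>x. kI (\<mu> + 1/2) x * F (\<theta> + arctan x)) \<in> borel_measurable lborel"
      using Fm by measurable
  qed (use int in \<open>auto intro: borel_measurable_integrable\<close>)
  have eqN: "(LINT x|lborel. kI (\<mu> + 1/2) x * (\<Sum>j<N. ?t j (\<theta> + arctan x))) = of_real pi * (\<Sum>j<N. cpre \<mu> * (gf (int_decode j) \<mu> * ?a (int_decode j) * ex (int_decode j) \<theta>))" for N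
  proof -
    have "(LINT x|lborel. kI (\<mu> + 1/2) x * (\<Sum>j<N. ?t j (\<theta> + arctan x))) =
      (LINT x|lborel. (\<Sum>j<N. (?a (int_decode j) * ex (int_decode j) \<theta>) * (kI (\<mu> + 1/2) x * ex (int_decode j) (arctan x))))"
      by (simp add: sum_distrib_left ex_add mult_ac)
    also have "\<dots> = (\<Sum>j<N. (?a (int_decode j) * ex (int_decode j) \<theta>) * (of_real pi * cI (int_decode j) \<mu>))"
      by (subst Bochner_Integration.integral_sum) (auto intro!: integrable_mult_right cI_integrable assms simp: cI_def)
    finally show ?thesis by (simp add: cI_eq[OF assms(2)] sum_distrib_left mult_ac)
  qed
  have lim2: "(\<lambda>N. of_real pi * (\<Sum>j<N. cpre \<mu> * (gf (int_decode j) \<mu> * ?a (int_decode j) * ex (int_decode j) \<theta>))) \<longlonglongrightarrow>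
      of_real pi * (cpre \<mu> * ser (\<lambda>n. gf n \<mu> * ?a n) \<theta>)"
  proof (intro tendsto_mult_left)
    have "(\<lambda>j. gf (int_decode j) \<mu> * ?a (int_decode j) * ex (int_decode j) \<theta>) sums ser (\<lambda>n. gf n \<mu> * ?a n) \<theta>"
      unfolding ser_def by (rule summable_sums[OF ser_summable(3)[OF rd_gf[OF rd]]])
    from sums_mult[OF this, of "cpre \<mu>"]
    show "(\<lambda>N. \<Sum>j<N. cpre \<mu> * (gf (int_decode j) \<mu> * ?a (int_decode j) * ex (int_decode j) \<theta>)) \<longlonglongrightarrow> cpre \<mu> * ser (\<lambda>n. gf n \<mu> * ?a n) \<theta>"
      by (simp add: sums_def)
  qed
  have "(LINT x|lborel. kI (\<mu> + 1/2) x * F (\<theta> + arctan x)) = of_real pi * (cpre \<mu> * ser (\<lambda>n. gf n \<mu> * ?a n) \<theta>)"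
    by (rule LIMSEQ_unique[OF lim[unfolded eqN] lim2])
  then show ?thesis by (simp add: Jop_def)
qed

lemma J_w_eq:
  assumes "s = 1 \<or> s = (-1 :: int)" "mw = rot (of_int s * pi / 2)" "\<phi> \<in> Hinf \<sigma>" "cpre analytic_on {\<nu>}"
  shows "J_w mw \<nu> \<phi> (rot \<theta>) = cpre \<nu> * ser (\<lambda>n. gf n \<nu> * fcm \<phi> n) (\<theta> + of_int s * pi / 2)"
proof -
  have S: "SP (\<lambda>\<theta>. \<phi> (rot \<theta>))" by (rule Hinf_SP[OF assms(3)])
  have "J_w mw \<nu> \<phi> (rot \<theta>) = mero_cont (\<lambda>\<mu>. Jop \<mu> (\<lambda>\<theta>. \<phi> (rot \<theta>)) (\<theta> + of_int s * pi / 2)) \<nu>"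
    by (simp add: J_w_def assms(2) J_integrand[OF assms(1)] Jop_def)
  also have "\<dots> = cpre \<nu> * ser (\<lambda>n. gf n \<nu> * fcm \<phi> n) (\<theta> + of_int s * pi / 2)"
    by (rule mero_cont_cpre[OF gf_ser_hol[OF rd_fc[OF S]] Jop_ser[OF S] assms(4)])
  finally show ?thesis .
qed

lemma entire_eqI:
  assumes "f holomorphic_on UNIV" "h holomorphic_on UNIV" "\<And>\<nu>. Re \<nu> > 0 \<Longrightarrow> f \<nu> = h \<nu>"
  shows "f \<nu> = h \<nu>"
  by (rule analytic_continuation_open[of "{\<nu>. Re \<nu> > 0}" UNIV f h \<nu>])
     (use assms in \<open>auto simp: open_halfspace_Re_gt intro: exI[of _ 1]\<close>)

lemma fam_fc_hol: assumes "fam \<sigma> UNIV \<phi>" shows "(\<lambda>\<mu>. fcm (\<phi> \<mu>) n) holomorphic_on UNIV"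
  unfolding holomorphic_on_open[OF open_UNIV]
proof (intro ballI)
  fix \<mu> :: complex
  have H: "\<phi> \<mu> \<in> Hinf \<sigma>" for \<mu> using assms by (simp add: fam_def)
  obtain \<eta> where \<eta>: "\<eta> \<in> Hinf \<sigma>" and lim: "((\<lambda>h. snorm 0 (\<lambda>k. (\<phi> (\<mu> + h) k - \<phi> \<mu> k) / h - \<eta> k)) \<longlongrightarrow> 0) (at 0)"
    using fam_imp_hol_into[OF open_UNIV assms] unfolding hol_into_def by blast
  have eq: "(fcm (\<phi> (\<mu> + h)) n - fcm (\<phi> \<mu>) n) / h - fcm \<eta> n = fcm (\<lambda>k. (\<phi> (\<mu> + h) k - \<phi> \<mu> k) / h - \<eta> k) n" for h
    using fcm_diff[OF Hinf_scale[OF Hinf_diff[OF H H], of "inverse h"] \<eta>, of "\<mu> + h" \<mu> n]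
      fcm_diff[OF H H, of "\<mu> + h" \<mu> n] fc_scale[of "inverse h" "\<lambda>\<theta>. \<phi> (\<mu> + h) (rot \<theta>) - \<phi> \<mu> (rot \<theta>)" n]
    by (simp add: divide_inverse mult.commute)
  have b: "norm ((fcm (\<phi> (\<mu> + h)) n - fcm (\<phi> \<mu>) n) / h - fcm \<eta> n) \<le> snorm 0 (\<lambda>k. (\<phi> (\<mu> + h) k - \<phi> \<mu> k) / h - \<eta> k)" for h
    unfolding eq using fcm_bound[OF Hinf_diff[OF Hinf_scale[OF Hinf_diff[OF H H], of "inverse h"] \<eta>], of "\<mu> + h" \<mu> n]
    by (simp add: divide_inverse mult.commute)
  have "((\<lambda>h. (fcm (\<phi> (\<mu> + h)) n - fcm (\<phi> \<mu>) n) / h - fcm \<eta> n) \<longlongrightarrow> 0) (at 0)"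
    by (rule Lim_null_comparison[OF always_eventually lim]) (use b in blast)
  then have "((\<lambda>h. (fcm (\<phi> (\<mu> + h)) n - fcm (\<phi> \<mu>) n) / h) \<longlongrightarrow> fcm \<eta> n) (at 0)"
    by (rule LIM_zero_cancel)
  then show "\<exists>f'. ((\<lambda>\<mu>. fcm (\<phi> \<mu>) n) has_field_derivative f') (at \<mu>)"
    unfolding DERIV_def by blast
qed

lemma par_restrM [simp]: "par (restrM p) p" by (simp add: par_def restrM_def)

lemma fam_ee: "par \<sigma> p \<Longrightarrow> fam \<sigma> UNIV (\<lambda>\<mu>. ee p)"
  by (intro fam_const ee_Hinf open_UNIV)

lemma Mc_hol: assumes "g \<in> SL2" shows "Mc g n p holomorphic_on UNIV"
proof -
  have "(\<lambda>\<mu>. fcm (act_germ g (\<lambda>\<mu>. ee p) \<mu>) n) holomorphic_on UNIV"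
    by (rule fam_fc_hol[OF fam_act[OF assms open_UNIV fam_ee[OF par_restrM]]])
  then show ?thesis by (simp add: act_germ_def fcm_act_ee[OF assms])
qed

section \<open>Equivariance of the Knapp-Stein operator on matrix coefficients\<close>

lemma ext_actF:
  assumes "per F" "z \<noteq> 0" "g \<in> SL2" shows "ext \<mu> (actF \<mu> g F) z = ext \<mu> F (lin (matrix_inv g) z)"
proof -
  have A: "matrix_inv g \<in> SL2" using assms(3) by simp
  have nz: "lin (matrix_inv g) (cis (- \<theta>)) \<noteq> 0" for \<theta> unfolding lin_lam[OF A] by simp
  have "ext \<mu> F (lin (matrix_inv g) (of_real (norm z) * cis (- (- Arg z)))) =
      exp (- (2 * \<mu> + 1) * of_real (ln (norm z))) * ext \<mu> F (lin (matrix_inv g) (cis (- (- Arg z))))"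
    unfolding lin_scale by (rule ext_scale[OF assms(1)]) (use nz[of "- Arg z"] assms(2) in auto)
  then show ?thesis using polar[OF assms(2)] by (simp add: ext_def[of \<mu> "actF \<mu> g F"] actF_def)
qed

text \<open>The Knapp-Stein operator for the representative \<open>rot (pi / 2)\<close> of w. It
  serves to derive relations between matrix coefficients, in which no representative occurs.\<close>

definition Kop :: "complex \<Rightarrow> (real \<Rightarrow> complex) \<Rightarrow> real \<Rightarrow> complex" where
  "Kop \<mu> F \<theta> = Jop \<mu> F (\<theta> + pi / 2)"

text \<open>\<open>Kop\<close> as a function on the group. There equivariance under left translation
  is evident, and the transformation law from the right remains to be shown
  (\<open>Jv_KAN\<close>).\<close>

definition Jv :: "complex \<Rightarrow> (real \<Rightarrow> complex) \<Rightarrow> mat2 \<Rightarrow> complex" where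
  "Jv \<mu> F A = (LINT x|lborel. ext \<mu> F (col (A ** upperN x ** rot (pi / 2)))) / of_real pi"

lemma ext_col_integrand:
  assumes "per F"
  shows "ext \<mu> F (col (rot \<theta> ** upperN x ** rot (pi / 2))) = kI (\<mu> + 1/2) x * F (\<theta> + pi / 2 + arctan x)"
proof -
  \<comment> \<open>A function on matrices with the prescribed values on rotations, consistent by
    periodicity, so that \<open>J_integrand\<close> can be reused.\<close>
  define \<phi> where "\<phi> = (\<lambda>k :: mat2. F (SOME t. k = rot t))"
  have \<phi>: "\<phi> (rot t) = F t" for t
  proof -
    have "rot t = rot (SOME u. rot t = rot u)" by (rule someI[of _ t]) simp
    then have "cis t = cis (SOME u. rot t = rot u)"
      by (metis rot_nth(1,2) cis.ctr)
    then show ?thesis unfolding \<phi>_def using per_cis[OF assms] by metis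
  qed
  show ?thesis
    using J_integrand[of 1 \<mu> \<phi> \<theta> x] extend_eq[of "rot \<theta> ** upperN x ** rot (pi / 2)" \<mu> \<phi>] \<phi> by simp
qed

lemma Jv_rot: "per F \<Longrightarrow> Jv \<mu> F (rot \<theta>) = Kop \<mu> F \<theta>"
  by (simp add: Jv_def ext_col_integrand Kop_def Jop_def)

lemma diag_upper: "diagA t ** upperN x = upperN (exp (2 * t) * x) ** diagA t"
  by (simp add: mat_simps mult_exp_exp mult.commute mult.left_commute)

lemma upper_add: "upperN x ** upperN y = upperN (x + y)"
  by (simp add: mat_simps)

text \<open>Moving \<open>diagA t\<close> to the right substitutes exp(2 t) (y + x) for x, which
  costs the Jacobian exp(-2 t). The exponent becomes (2 \<mu> + 1) t - 2 t = -(2 (-\<mu>) + 1) t,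
  the law for the parameter -\<mu>.\<close>

lemma Jv_KAN:
  assumes "per F"
  shows "Jv \<mu> F (rot g ** diagA t ** upperN y) = exp (- (2 * (- \<mu>) + 1) * of_real t) * Kop \<mu> F g"
proof -
  let ?h = "\<lambda>x. ext \<mu> F (col (rot g ** upperN x ** rot (pi / 2)))"
  have "ext \<mu> F (col (rot g ** diagA t ** upperN y ** upperN x ** rot (pi / 2))) =
     exp ((2 * \<mu> + 1) * of_real t) * ?h (exp (2 * t) * y + exp (2 * t) * x)" for x
  proof -
    have "rot g ** diagA t ** upperN y ** upperN x ** rot (pi / 2) =
       rot g ** (diagA t ** upperN (y + x)) ** rot (pi / 2)"
      by (simp add: matrix_mul_assoc[symmetric] upper_add[symmetric])
    also have "\<dots> = (rot g ** upperN (exp (2 * t) * (y + x))) ** (diagA t ** rot (pi / 2))"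
      unfolding diag_upper by (simp add: matrix_mul_assoc)
    finally have "col (rot g ** diagA t ** upperN y ** upperN x ** rot (pi / 2)) =
       lin (rot g ** upperN (exp (2 * t) * (y + x))) (lin (diagA t) (cis (- (pi / 2))))"
      by (simp add: col_mult col_rot)
    also have "lin (diagA t) (cis (- (pi / 2))) = of_real (exp (- t)) * cis (- (pi / 2))"
      by (simp add: lin_diagA complex_eq_iff)
    also have "lin (rot g ** upperN (exp (2 * t) * (y + x))) \<dots> =
       of_real (exp (- t)) * col (rot g ** upperN (exp (2 * t) * (y + x)) ** rot (pi / 2))"
      unfolding lin_scale col_mult[of _ "rot (pi / 2)"] col_rot ..
    finally have col: "col (rot g ** diagA t ** upperN y ** upperN x ** rot (pi / 2)) =
       of_real (exp (- t)) * col (rot g ** upperN (exp (2 * t) * (y + x)) ** rot (pi / 2))" .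
    have e: "- (2 * \<mu> + 1) * of_real (ln (exp (- t))) = (2 * \<mu> + 1) * of_real t"
      unfolding ln_exp of_real_minus minus_mult_minus ..
    have "ext \<mu> F (of_real (exp (- t)) * z) = exp ((2 * \<mu> + 1) * of_real t) * ext \<mu> F z" if "z \<noteq> 0" for z
      using ext_scale[OF assms _ that, of "exp (- t)" \<mu>] unfolding e by simp
    then show ?thesis unfolding col by (simp add: col_nonzero distrib_left)
  qed
  then have "Jv \<mu> F (rot g ** diagA t ** upperN y) =
     exp ((2 * \<mu> + 1) * of_real t) * (LINT x|lborel. ?h (exp (2 * t) * y + exp (2 * t) * x)) / of_real pi"
    by (simp add: Jv_def)
  also have "(LINT x|lborel. ?h (exp (2 * t) * y + exp (2 * t) * x)) = exp (- 2 * of_real t) * (LINT x|lborel. ?h x)"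
  proof -
    have "(LINT x|lborel. ?h x) = \<bar>exp (2 * t)\<bar> *\<^sub>R (LINT x|lborel. ?h (exp (2 * t) * y + exp (2 * t) * x))"
      by (rule lborel_integral_real_affine) simp
    then have eq: "(LINT x|lborel. ?h x) = exp (2 * of_real t) * (LINT x|lborel. ?h (exp (2 * t) * y + exp (2 * t) * x))"
      unfolding abs_exp_cancel scaleR_conv_of_real cexp of_real_mult of_real_numeral .
    have gen: "b = exp (- c) * a" if "a = exp c * b" for a b c :: complex
      using that by (simp add: mult.assoc[symmetric] mult_exp_exp)
    show ?thesis using gen[OF eq] by (simp only: mult_minus_left)
  qed
  also have "exp ((2 * \<mu> + 1) * of_real t) * (exp (- 2 * of_real t) * (LINT x|lborel. ?h x)) / of_real pi =
     exp (- (2 * (- \<mu>) + 1) * of_real t) * Jv \<mu> F (rot g)"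
  proof -
    have e: "(2 * \<mu> + 1) * of_real t + (- 2 * of_real t) = - (2 * (- \<mu>) + 1) * of_real t"
      by (simp add: algebra_simps)
    show ?thesis unfolding Jv_def
      by (simp only: mult.assoc[symmetric] mult_exp_exp times_divide_eq_right e)
  qed
  finally show ?thesis by (simp only: Jv_rot[OF assms])
qed

lemma Jv_ext:
  assumes "per F" "A \<in> SL2" shows "Jv \<mu> F A = ext (- \<mu>) (Kop \<mu> F) (col A)"
proof -
  obtain x where "A = rot (- Arg (col A)) ** diagA (ln (norm (col A))) ** upperN x"
    using Iwasawa[OF assms(2)] .
  then have "Jv \<mu> F A = Jv \<mu> F (rot (- Arg (col A)) ** diagA (ln (norm (col A))) ** upperN x)" by simp
  then show ?thesis unfolding Jv_KAN[OF assms(1)] by (simp add: ext_def)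
qed

lemma Kop_equivariant:
  assumes "SP F" "g \<in> SL2" shows "Kop \<mu> (actF \<mu> g F) = actF (- \<mu>) g (Kop \<mu> F)"
proof
  fix \<theta>
  have p: "per F" "per (actF \<mu> g F)" using assms SP_actF by (auto simp: SP_def)
  have "Kop \<mu> (actF \<mu> g F) \<theta> = Jv \<mu> (actF \<mu> g F) (rot \<theta>)" by (simp add: Jv_rot p)
  also have "\<dots> = Jv \<mu> F (matrix_inv g ** rot \<theta>)"
  proof -
    have "ext \<mu> (actF \<mu> g F) (col (rot \<theta> ** upperN x ** rot (pi / 2))) =
        ext \<mu> F (col (matrix_inv g ** rot \<theta> ** upperN x ** rot (pi / 2)))" for x
      by (subst ext_actF[OF p(1) _ assms(2)])
         (simp_all add: col_nonzero col_mult[symmetric] matrix_mul_assoc)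
    then show ?thesis by (simp add: Jv_def)
  qed
  also have "\<dots> = actF (- \<mu>) g (Kop \<mu> F) \<theta>"
    using assms(2) by (subst Jv_ext[OF p(1)]) (simp_all add: actF_def col_mult col_rot)
  finally show "Kop \<mu> (actF \<mu> g F) \<theta> = actF (- \<mu>) g (Kop \<mu> F) \<theta>" .
qed

lemma Kop_ser:
  assumes "SP F" "Re \<mu> > 0"
  shows "Kop \<mu> F = ser (\<lambda>n. cpre \<mu> * ex n (pi / 2) * (gf n \<mu> * fc F n))" (is ?A)
    "fc (Kop \<mu> F) n = cpre \<mu> * ex n (pi / 2) * (gf n \<mu> * fc F n)" (is ?B)
proof -
  have rd: "rd (\<lambda>n. gf n \<mu> * fc F n)" by (rule rd_gf[OF rd_fc[OF assms(1)]])
  have rd': "rd (\<lambda>n. cpre \<mu> * ex n (pi / 2) * (gf n \<mu> * fc F n))"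
    by (rule rd_mult_poly[OF rd, of _ "norm (cpre \<mu>)" 0]) (simp add: norm_mult)
  show ?A
  proof
    fix \<theta>
    have "Kop \<mu> F \<theta> = cpre \<mu> * ser (\<lambda>n. gf n \<mu> * fc F n) (\<theta> + pi / 2)"
      by (simp add: Kop_def Jop_ser[OF assms])
    also have "\<dots> = (\<Sum>j. cpre \<mu> * (gf (int_decode j) \<mu> * fc F (int_decode j) * ex (int_decode j) (\<theta> + pi / 2)))"
      unfolding ser_def by (rule suminf_mult[OF ser_summable(3)[OF rd], symmetric])
    also have "\<dots> = ser (\<lambda>n. cpre \<mu> * ex n (pi / 2) * (gf n \<mu> * fc F n)) \<theta>"
      by (simp add: ser_def ex_add mult_ac)
    finally show "Kop \<mu> F \<theta> = ser (\<lambda>n. cpre \<mu> * ex n (pi / 2) * (gf n \<mu> * fc F n)) \<theta>" .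
  qed
  then show ?B by (simp add: fc_ser[OF rd'])
qed

text \<open>Equivariance of \<open>Kop\<close> between K-types. For Re \<mu> > 0 the nonzero factor
  \<open>cpre\<close> cancels; what remains is an identity between entire functions and holds
  everywhere.\<close>

lemma Mc_gf: assumes "g \<in> SL2"
  shows "ex n (pi / 2) * gf n \<mu> * Mc g n p \<mu> = ex p (pi / 2) * gf p \<mu> * Mc g n p (- \<mu>)"
proof (rule entire_eqI[of "\<lambda>\<mu>. ex n (pi / 2) * gf n \<mu> * Mc g n p \<mu>" "\<lambda>\<mu>. ex p (pi / 2) * gf p \<mu> * Mc g n p (- \<mu>)"])
  show "(\<lambda>\<mu>. ex n (pi / 2) * gf n \<mu> * Mc g n p \<mu>) holomorphic_on UNIV"
    by (intro holomorphic_intros gf_hol Mc_hol assms)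
  have "(\<lambda>\<mu>. Mc g n p (- \<mu>)) holomorphic_on UNIV"
    by (rule holomorphic_on_compose_gen[OF _ Mc_hol[OF assms], unfolded o_def]) (auto intro: holomorphic_intros)
  then show "(\<lambda>\<mu>. ex p (pi / 2) * gf p \<mu> * Mc g n p (- \<mu>)) holomorphic_on UNIV"
    by (intro holomorphic_intros gf_hol)
  fix \<nu> :: complex assume \<nu>: "Re \<nu> > 0"
  define c where "c = cpre \<nu> * ex p (pi / 2) * gf p \<nu>"
  have "Kop \<nu> (ex p) = (\<lambda>\<theta>. c * ex p \<theta>)"
  proof (rule fc_unique)
    show "SP (Kop \<nu> (ex p))" unfolding Kop_ser(1)[OF SP_ex \<nu>]
      by (rule SP_ser, rule rd_mult_poly[OF rd_gf[OF rd_fc[OF SP_ex]], of _ "norm (cpre \<nu>)" 0]) (simp add: norm_mult)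
    show "fc (Kop \<nu> (ex p)) k = fc (\<lambda>\<theta>. c * ex p \<theta>) k" for k
      unfolding Kop_ser(2)[OF SP_ex \<nu>] fc_scale fc_ex by (simp add: c_def)
  qed (intro SP_scale SP_ex)
  then have "actF (- \<nu>) g (Kop \<nu> (ex p)) = (\<lambda>\<theta>. c * actF (- \<nu>) g (ex p) \<theta>)"
    by (simp add: actF_def ext_def fun_eq_iff)
  then have "fc (actF (- \<nu>) g (Kop \<nu> (ex p))) n = c * Mc g n p (- \<nu>)"
    by (simp only: fc_scale Mc_def)
  moreover have "fc (Kop \<nu> (actF \<nu> g (ex p))) n = cpre \<nu> * ex n (pi / 2) * (gf n \<nu> * Mc g n p \<nu>)"
    unfolding Kop_ser(2)[OF SP_actF[OF SP_ex assms] \<nu>] Mc_def ..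
  ultimately have "cpre \<nu> * ex n (pi / 2) * (gf n \<nu> * Mc g n p \<nu>) = c * Mc g n p (- \<nu>)"
    unfolding Kop_equivariant[OF SP_ex assms] by simp
  then have "cpre \<nu> * (ex n (pi / 2) * gf n \<nu> * Mc g n p \<nu>) = cpre \<nu> * (ex p (pi / 2) * gf p \<nu> * Mc g n p (- \<nu>))"
    unfolding c_def by (simp only: mult_ac)
  then show "ex n (pi / 2) * gf n \<nu> * Mc g n p \<nu> = ex p (pi / 2) * gf p \<nu> * Mc g n p (- \<nu>)"
    using cpre_nz[OF \<nu>] by simp
qed

section \<open>The polynomials Q and their relation to the gamma factors\<close>

definition Qup :: "int \<Rightarrow> nat \<Rightarrow> complex \<Rightarrow> complex" where
  "Qup p i \<mu> = (\<Prod>l<i. \<mu> + (1 + of_int p) / 2 + of_nat l)"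

text \<open>Lowering from n multiplies by \<mu> + (1 - n) / 2, which is the raising coefficient with
  -n in place of n. Hence both directions use the product \<open>Qup\<close>, the second one for
  \<open>- p\<close>.\<close>

definition Q :: "int \<Rightarrow> int \<Rightarrow> complex \<Rightarrow> complex" where
  "Q p n = (if p \<le> n then Qup p (nat ((n - p) div 2)) else Qup (- p) (nat ((p - n) div 2)))"

lemma Qup_Suc: "Qup p (Suc i) \<mu> = Qup p i \<mu> * (\<mu> + (1 + of_int (p + 2 * int i)) / 2)"
  by (simp add: Qup_def field_simps)

lemma Q_up: "Q p (p + 2 * int i) = Qup p i"
  by (auto simp: Q_def)

lemma Q_down: "Q p (p - 2 * int i) = Qup (- p) i"
  by (cases i) (auto simp: Q_def Qup_def nat_add_distrib)

lemma even_cases: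
  assumes "even (n - p :: int)" obtains i where "n = p + 2 * int i" | i where "n = p - 2 * int i"
proof (cases "n \<ge> p")
  case True
  then have "n = p + 2 * int (nat ((n - p) div 2))" using assms by auto
  then show ?thesis using that by blast
next
  case False
  then have "n = p - 2 * int (nat ((p - n) div 2))" using assms by auto
  then show ?thesis using that by blast
qed

lemma ex_half_step: "ex (n + 2) (pi / 2) = - ex n (pi / 2)"
  using ex_mult[of n "pi / 2" 2] by (simp add: ex_def[of 2] complex_eq_iff)

lemma Qup_gf:
  "ex (p + 2 * int i) (pi / 2) * gf (p + 2 * int i) \<mu> * Qup p i \<mu> = ex p (pi / 2) * gf p \<mu> * Qup p i (- \<mu>)"
proof (induction i)
  case (Suc i)
  let ?n = "p + 2 * int i"
  define h where "h = (of_int ?n + 1) / (2 :: complex)"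
  have r: "(\<mu> + h) * gf (?n + 2) \<mu> = (\<mu> - h) * gf ?n \<mu>" unfolding h_def by (rule gf_rec)
  have q: "Qup p (Suc i) \<nu> = Qup p i \<nu> * (\<nu> + h)" for \<nu>
    unfolding Qup_Suc h_def by (simp add: add.commute)
  have n2: "p + 2 * int (Suc i) = ?n + 2" by simp
  have "ex (?n + 2) (pi / 2) * gf (?n + 2) \<mu> * (Qup p i \<mu> * (\<mu> + h)) =
     - ex ?n (pi / 2) * Qup p i \<mu> * ((\<mu> + h) * gf (?n + 2) \<mu>)"
    unfolding ex_half_step by (simp add: mult_ac)
  also have "\<dots> = (ex ?n (pi / 2) * gf ?n \<mu> * Qup p i \<mu>) * (- \<mu> + h)"
    unfolding r by (simp add: algebra_simps)
  finally show ?case unfolding n2 q Suc by (simp add: mult_ac)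
qed (simp add: Qup_def)

text \<open>Downwards, the identity for the negatives of p and n is used together with
  \<open>gf_uminus\<close>. The factors \<open>ex\<close> match because \<open>ex n pi\<close>
  depends only on the parity of n.\<close>

lemma Q_gf:
  assumes "even (n - p)"
  shows "ex n (pi / 2) * gf n \<mu> * Q p n \<mu> = ex p (pi / 2) * gf p \<mu> * Q p n (- \<mu>)"
  using assms
proof (cases rule: even_cases)
  case (1 i)
  then show ?thesis using Qup_gf[of p i \<mu>] by (simp add: Q_up)
next
  case (2 i)
  have n: "- n = - p + 2 * int i" using 2 by simp
  have c: "ex (- k) (pi / 2) = cnj (ex k (pi / 2))" for k by (simp add: cnj_ex)
  have "ex n (pi / 2) * ex n (pi / 2) = ex p (pi / 2) * ex p (pi / 2)"
  proof -
    have "ex n (pi / 2) * ex n (pi / 2) = ex n pi" for n using ex_add[of n "pi/2" "pi/2"] by simp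
    then show ?thesis using assms by (simp add: ex_pi)
  qed
  then have sq: "ex n (pi / 2) = ex p (pi / 2) * ex p (pi / 2) * ex (- n) (pi / 2)"
    by (metis ex_mult mult.assoc mult.right_neutral ex_0 add.right_inverse)
  have pp: "ex p (pi / 2) * ex (- p) (pi / 2) = 1" by (simp add: ex_mult)
  have "ex (- n) (pi / 2) * gf n \<mu> * Q p n \<mu> = ex (- p) (pi / 2) * gf p \<mu> * Q p n (- \<mu>)"
    using Qup_gf[of "- p" i \<mu>] unfolding n[symmetric] gf_uminus using 2 by (simp add: Q_down)
  then have "ex p (pi / 2) * ex p (pi / 2) * (ex (- n) (pi / 2) * gf n \<mu> * Q p n \<mu>) =
     ex p (pi / 2) * (ex p (pi / 2) * ex (- p) (pi / 2)) * gf p \<mu> * Q p n (- \<mu>)" by (simp add: mult_ac)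
  then show ?thesis unfolding pp by (subst sq) (simp add: mult_ac)
qed

lemma Qup_hol: "Qup p i holomorphic_on A"
  unfolding Qup_def by (intro holomorphic_intros)

lemma Q_hol: "Q p n holomorphic_on A"
  by (simp add: Q_def Qup_hol)

lemma hol_minus: assumes "f holomorphic_on UNIV" shows "(\<lambda>z. f (- z)) holomorphic_on UNIV"
  by (rule holomorphic_on_compose_gen[OF _ assms, unfolded o_def]) (auto intro: holomorphic_intros)

lemma gf_nz: "gf p (of_int \<bar>p\<bar> + 1) \<noteq> 0"
proof -
  have "Re (of_int \<bar>p\<bar> + 1 + (1 + of_int p) / 2 :: complex) > 0" "Re (of_int \<bar>p\<bar> + 1 + (1 - of_int p) / 2 :: complex) > 0"
    by (simp_all add: field_simps)
  then have "rGamma (of_int \<bar>p\<bar> + 1 + (1 + of_int p) / 2 :: complex) \<noteq> 0" "rGamma (of_int \<bar>p\<bar> + 1 + (1 - of_int p) / 2 :: complex) \<noteq> 0"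
    unfolding rGamma_eq_zero_iff by (auto elim!: nonpos_Ints_cases dest!: arg_cong[of _ _ Re])
  then show ?thesis by (simp add: gf_def)
qed

text \<open>Entire functions have no zero divisors. This permits cancelling gamma factors and
  polynomials at parameters where they vanish.\<close>

lemma entire_mult_cancel:
  assumes "f holomorphic_on UNIV" "h holomorphic_on UNIV" "f a \<noteq> 0" "\<And>z. f z * h z = 0"
  shows "h z = (0 :: complex)"
proof -
  have "isCont f a" using holomorphic_on_imp_continuous_on[OF assms(1)] by (simp add: continuous_on_eq_continuous_at)
  then obtain e where "e > 0" "\<And>y. dist a y < e \<Longrightarrow> f y \<noteq> 0"
    using continuous_at_avoid[of a f 0] assms(3) by auto
  then show ?thesis
    by (intro analytic_continuation_open[of "ball a e" UNIV h "\<lambda>_. 0" z])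
       (use assms in \<open>auto\<close>)
qed

text \<open>The quotient of the two gamma factors is \<open>Q(-\<mu>)/Q(\<mu>)\<close>, so gamma factors can be replaced
  by polynomials.\<close>

lemma functional_eq_Q:
  assumes "even (n - p)" "f holomorphic_on UNIV"
    "\<And>\<nu>. Re \<nu> > 0 \<Longrightarrow> ex n (pi / 2) * gf n \<nu> * f \<nu> = ex p (pi / 2) * gf p \<nu> * f (- \<nu>)"
  shows "Q p n (- \<nu>) * f \<nu> = Q p n \<nu> * f (- \<nu>)"
proof -
  have hm: "(\<lambda>\<nu>. f (- \<nu>)) holomorphic_on UNIV" "(\<lambda>\<nu>. Q p n (- \<nu>)) holomorphic_on UNIV"
    using hol_minus[OF assms(2)] hol_minus[OF Q_hol] by auto
  have all: "ex n (pi / 2) * gf n \<nu> * f \<nu> = ex p (pi / 2) * gf p \<nu> * f (- \<nu>)" for \<nu>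
    by (rule entire_eqI[of "\<lambda>\<nu>. ex n (pi / 2) * gf n \<nu> * f \<nu>" "\<lambda>\<nu>. ex p (pi / 2) * gf p \<nu> * f (- \<nu>)"])
       (use assms hm in \<open>auto intro!: holomorphic_intros gf_hol\<close>)
  have z: "gf p \<nu> * (Q p n (- \<nu>) * f \<nu> - Q p n \<nu> * f (- \<nu>)) = 0" for \<nu>
  proof -
    have "ex p (pi / 2) * gf p \<nu> * Q p n (- \<nu>) * f \<nu> = (ex n (pi / 2) * gf n \<nu> * Q p n \<nu>) * f \<nu>"
      unfolding Q_gf[OF assms(1)] ..
    also have "\<dots> = Q p n \<nu> * (ex n (pi / 2) * gf n \<nu> * f \<nu>)" by (simp add: mult_ac)
    also have "\<dots> = Q p n \<nu> * (ex p (pi / 2) * gf p \<nu> * f (- \<nu>))" unfolding all ..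
    finally have "ex p (pi / 2) * (gf p \<nu> * (Q p n (- \<nu>) * f \<nu> - Q p n \<nu> * f (- \<nu>))) = 0"
      by (simp add: algebra_simps)
    moreover have "ex p (pi / 2) \<noteq> 0" using norm_ex[of p "pi / 2"] by (metis norm_zero zero_neq_one)
    ultimately show ?thesis by (metis mult_eq_0_iff)
  qed
  have h: "(\<lambda>\<nu>. Q p n (- \<nu>) * f \<nu> - Q p n \<nu> * f (- \<nu>)) holomorphic_on UNIV"
    by (intro holomorphic_on_diff holomorphic_on_mult hm assms(2) Q_hol)
  have "Q p n (- \<nu>) * f \<nu> - Q p n \<nu> * f (- \<nu>) = 0"
    by (rule entire_mult_cancel[OF gf_hol h gf_nz z])
  then show ?thesis by simp
qed

lemma Mc_Q:
  assumes "g \<in> SL2" "even (n - p)"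
  shows "Q p n (- \<mu>) * Mc g n p \<mu> = Q p n \<mu> * Mc g n p (- \<mu>)"
  by (rule functional_eq_Q[OF assms(2) Mc_hol[OF assms(1)] Mc_gf[OF assms(1)]])

section \<open>Closed invariant families of entire sections\<close>

definition fe :: "(complex \<Rightarrow> complex) \<Rightarrow> int \<Rightarrow> complex \<Rightarrow> mat2 \<Rightarrow> complex" where
  "fe f n = (\<lambda>\<mu> k. f \<mu> * ee n k)"

text \<open>\<open>f\<close> times the section \<open>ee n\<close> is \<open>fe f n\<close>. Closedness refers to convergence uniformly on disks in the
  parameter, which controls all jets by the Cauchy estimates.\<close>

definition inv_closed :: "mhat \<Rightarrow> (complex \<Rightarrow> mat2 \<Rightarrow> complex) set \<Rightarrow> bool" where
  "inv_closed \<sigma> S \<longleftrightarrow> (\<forall>\<phi>\<in>S. fam \<sigma> UNIV \<phi>)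
     \<and> (\<forall>\<phi>\<in>S. \<forall>\<psi>\<in>S. (\<lambda>\<mu> k. \<phi> \<mu> k + \<psi> \<mu> k) \<in> S)
     \<and> (\<forall>c. \<forall>\<phi>\<in>S. (\<lambda>\<mu> k. c * \<phi> \<mu> k) \<in> S)
     \<and> (\<forall>g\<in>SL2. \<forall>\<phi>\<in>S. act_germ g \<phi> \<in> S)
     \<and> (\<forall>\<phi>. fam \<sigma> UNIV \<phi> \<longrightarrow>
          (\<forall>R i. \<forall>\<epsilon>>0. \<exists>\<psi>\<in>S. \<forall>\<mu>\<in>cball 0 R. \<forall>j\<le>i. snorm j (\<lambda>k. \<phi> \<mu> k - \<psi> \<mu> k) < \<epsilon>) \<longrightarrow> \<phi> \<in> S)"

lemma
  assumes "inv_closed \<sigma> S"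
  shows inv_fam: "\<phi> \<in> S \<Longrightarrow> fam \<sigma> UNIV \<phi>"
    and inv_add: "\<phi> \<in> S \<Longrightarrow> \<psi> \<in> S \<Longrightarrow> (\<lambda>\<mu> k. \<phi> \<mu> k + \<psi> \<mu> k) \<in> S"
    and inv_scale: "\<phi> \<in> S \<Longrightarrow> (\<lambda>\<mu> k. c * \<phi> \<mu> k) \<in> S"
    and inv_act: "\<phi> \<in> S \<Longrightarrow> g \<in> SL2 \<Longrightarrow> act_germ g \<phi> \<in> S"
    and inv_lim: "fam \<sigma> UNIV \<phi> \<Longrightarrow> (\<And>R i \<epsilon>. \<epsilon> > 0 \<Longrightarrow> \<exists>\<psi>\<in>S. \<forall>\<mu>\<in>cball 0 R. \<forall>j\<le>i. snorm j (\<lambda>k. \<phi> \<mu> k - \<psi> \<mu> k) < \<epsilon>) \<Longrightarrow> \<phi> \<in> S"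
  using assms unfolding inv_closed_def by blast+

lemma inv_zero: "inv_closed \<sigma> S \<Longrightarrow> \<phi> \<in> S \<Longrightarrow> (\<lambda>\<mu> k. 0) \<in> S"
  using inv_scale[of \<sigma> S \<phi> 0] by simp

lemma inv_sum:
  assumes "inv_closed \<sigma> S" "\<phi>0 \<in> S" "finite J" "\<And>j. j \<in> J \<Longrightarrow> \<phi> j \<in> S"
  shows "(\<lambda>\<mu> k. \<Sum>j\<in>J. \<phi> j \<mu> k) \<in> S"
  using assms(3,4)
proof (induction J rule: finite_induct)
  case empty then show ?case using inv_zero[OF assms(1,2)] by simp
next
  case (insert x F)
  then show ?case using inv_add[OF assms(1), of "\<phi> x" "\<lambda>\<mu> k. \<Sum>j\<in>F. \<phi> j \<mu> k"] by simp
qed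

subsection \<open>Raising and lowering operators\<close>

lemma Ln_bound: obtains B where "B \<ge> 0" "\<And>u. norm u \<le> 9/10 \<Longrightarrow> norm (Ln (1 - u)) \<le> B"
proof -
  have "continuous_on (cball 0 (9/10)) (\<lambda>u::complex. Ln (1 - u))"
  proof (intro continuous_intros)
    fix u :: complex assume "u \<in> cball 0 (9/10)"
    then have "norm u < 1" by simp
    then have "Re (1 - u) > 0" using abs_Re_le_cmod[of u] by simp
    then show "1 - u \<notin> \<real>\<^sub>\<le>\<^sub>0" by (auto simp: complex_nonpos_Reals_iff)
  qed
  then have "bounded ((\<lambda>u. Ln (1 - u)) ` cball 0 (9/10 :: real))"
    by (intro compact_imp_bounded compact_continuous_image) auto
  then obtain B where B: "\<forall>u\<in>cball 0 (9/10). norm (Ln (1 - u)) \<le> B" by (auto simp: bounded_iff)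
  have "norm (Ln (1 - 0)) \<le> B" using B by (metis centre_in_cball divide_nonneg_nonneg zero_le_numeral)
  then have "0 \<le> B" by simp
  then show ?thesis using that B by simp
qed

text \<open>\<open>EE n \<mu> z t\<close> is \<open>act \<mu> (diagA s) (ee n)\<close> at the complex angle \<open>z\<close> with \<open>t = tanh s\<close>, and \<open>XX n \<mu> z\<close> is its
  derivative at \<open>t = 0\<close>. Holomorphy in \<open>t\<close> and \<open>z\<close> turns bounds on \<open>EE\<close> into convergence of the
  difference quotients in all seminorms.\<close>

definition EE :: "int \<Rightarrow> complex \<Rightarrow> complex \<Rightarrow> complex \<Rightarrow> complex" where
  "EE n \<mu> z t = exp (- \<i> * of_int n * z) *
     exp ((\<mu> + 1/2) * Ln (1 - t\<^sup>2) + (of_int n - (2 * \<mu> + 1)) / 2 * Ln (1 - t * exp (2 * \<i> * z))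
        + (- of_int n - (2 * \<mu> + 1)) / 2 * Ln (1 - t * exp (- 2 * \<i> * z)))"

definition XX :: "int \<Rightarrow> complex \<Rightarrow> complex \<Rightarrow> complex" where
  "XX n \<mu> z = (\<mu> + (1 + of_int n) / 2) * exp (- \<i> * of_int (n + 2) * z) + (\<mu> + (1 - of_int n) / 2) * exp (- \<i> * of_int (n - 2) * z)"

text \<open>The source of the constants below: for |Im z| \<le> 1 the factors exp(2 i z) and exp(-2
  i z) have norm at most 9, so |t| \<le> 1/10 keeps their products with t within 9/10, away from the
  singularity of Ln(1 - u) at u = 1.\<close>

lemma exp2_le: "exp (2::real) \<le> 9"
proof -
  have "exp (2::real) = exp 1 * exp 1" by (simp add: mult_exp_exp)
  also have "\<dots> \<le> 3 * 3" using exp_le by (intro mult_mono) auto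
  finally show ?thesis by simp
qed

lemma strip_norm:
  assumes "\<bar>Im z\<bar> \<le> 1" shows "norm (exp (2 * \<i> * z)) \<le> 9" "norm (exp (- 2 * \<i> * z)) \<le> 9"
proof -
  have "exp (2 * Im z) \<le> exp 2" "exp (- 2 * Im z) \<le> exp 2" using assms by auto
  then have "exp (2 * Im z) \<le> 9" "exp (- 2 * Im z) \<le> 9" using exp2_le by linarith+
  then show "norm (exp (2 * \<i> * z)) \<le> 9" "norm (exp (- 2 * \<i> * z)) \<le> 9" by simp_all
qed

lemma small_norm:
  assumes "\<bar>Im z\<bar> \<le> 1" "norm t \<le> 1/10"
  shows "norm (t\<^sup>2) \<le> 9/10" "norm (t * exp (2 * \<i> * z)) \<le> 9/10" "norm (t * exp (- 2 * \<i> * z)) \<le> 9/10"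
proof -
  have "norm t * norm t \<le> 1/10 * 1" using assms(2) by (intro mult_mono) auto
  then show "norm (t\<^sup>2) \<le> 9/10" unfolding power2_eq_square norm_mult by linarith
  have "norm t * norm (exp (2 * \<i> * z)) \<le> 1/10 * 9" "norm t * norm (exp (- 2 * \<i> * z)) \<le> 1/10 * 9"
    by (rule mult_mono[OF assms(2) strip_norm(1)[OF assms(1)]]; simp)
       (rule mult_mono[OF assms(2) strip_norm(2)[OF assms(1)]]; simp)
  then show "norm (t * exp (2 * \<i> * z)) \<le> 9/10" "norm (t * exp (- 2 * \<i> * z)) \<le> 9/10"
    unfolding norm_mult by linarith+
qed

lemma one_minus_nz: assumes "norm (u :: complex) \<le> 9/10" shows "1 - u \<notin> \<real>\<^sub>\<le>\<^sub>0"
proof -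
  have "Re (1 - u) > 0" using assms abs_Re_le_cmod[of u] by simp
  then show ?thesis by (auto simp: complex_nonpos_Reals_iff)
qed

lemma EE_bound:
  obtains B where "\<And>\<mu> z t. norm \<mu> \<le> R \<Longrightarrow> \<bar>Im z\<bar> \<le> 1 \<Longrightarrow> norm t \<le> 1/10 \<Longrightarrow> norm (EE n \<mu> z t) \<le> B"
proof -
  obtain L where L: "L \<ge> 0" "\<And>u. norm u \<le> 9/10 \<Longrightarrow> norm (Ln (1 - u)) \<le> L" using Ln_bound by metis
  define C where "C = R + \<bar>of_int n\<bar> + 1"
  show ?thesis
  proof (rule that[of "exp \<bar>of_int n\<bar> * exp (C * L + C * L + C * L)"])
    fix \<mu> z t :: complex assume a: "norm \<mu> \<le> R" "\<bar>Im z\<bar> \<le> 1" "norm t \<le> 1/10"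
    note s = small_norm[OF a(2,3)]
    have "norm (exp (- \<i> * of_int n * z)) = exp (of_int n * Im z)" by simp
    also have "\<dots> \<le> exp \<bar>of_int n\<bar>"
    proof -
      have "of_int n * Im z \<le> \<bar>of_int n\<bar> * \<bar>Im z\<bar>" by (metis abs_ge_self abs_mult)
      also have "\<dots> \<le> \<bar>of_int n\<bar> * 1" using a(2) by (intro mult_left_mono) auto
      finally show ?thesis by simp
    qed
    finally have 1: "norm (exp (- \<i> * of_int n * z)) \<le> exp \<bar>of_int n\<bar>" .
    have c1: "norm (\<mu> + 1/2) \<le> C" using norm_triangle_ineq[of \<mu> "1/2"] a(1) by (simp add: C_def)
    have eq: "(2 * \<mu> + 1) / 2 = \<mu> + 1/2" by (simp add: add_divide_distrib)
    have nm: "norm ((2 * \<mu> + 1) / 2) \<le> R + 1/2" unfolding eq using norm_triangle_ineq[of \<mu> "1/2"] a(1) by simp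
    have nn: "norm (of_int n / 2 :: complex) \<le> \<bar>of_int n\<bar>" by (simp add: norm_divide)
    have c2: "norm ((of_int n - (2 * \<mu> + 1)) / 2) \<le> C"
      using norm_triangle_ineq4[of "of_int n / 2" "(2 * \<mu> + 1) / 2"] nm nn unfolding C_def diff_divide_distrib by linarith
    have c3: "norm ((- of_int n - (2 * \<mu> + 1)) / 2) \<le> C"
      using norm_triangle_ineq4[of "- (of_int n / 2)" "(2 * \<mu> + 1) / 2"] nm nn unfolding C_def diff_divide_distrib minus_divide_left[symmetric] norm_minus_cancel by linarith
    have C0: "C \<ge> 0" using c1 norm_ge_zero order_trans by blast
    have "norm ((\<mu> + 1/2) * Ln (1 - t\<^sup>2) + (of_int n - (2 * \<mu> + 1)) / 2 * Ln (1 - t * exp (2 * \<i> * z))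
        + (- of_int n - (2 * \<mu> + 1)) / 2 * Ln (1 - t * exp (- 2 * \<i> * z))) \<le> C * L + C * L + C * L"
      using c1 c2 c3 C0 L(1) L(2)[OF s(1)] L(2)[OF s(2)] L(2)[OF s(3)]
      by (intro order_trans[OF norm_triangle_ineq] add_mono) (auto simp only: norm_mult intro!: mult_mono norm_ge_zero)
    then have "norm (exp ((\<mu> + 1/2) * Ln (1 - t\<^sup>2) + (of_int n - (2 * \<mu> + 1)) / 2 * Ln (1 - t * exp (2 * \<i> * z))
        + (- of_int n - (2 * \<mu> + 1)) / 2 * Ln (1 - t * exp (- 2 * \<i> * z)))) \<le> exp (C * L + C * L + C * L)"
      by (intro order_trans[OF norm_exp]) simp
    then show "norm (EE n \<mu> z t) \<le> exp \<bar>of_int n\<bar> * exp (C * L + C * L + C * L)"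
      unfolding EE_def norm_mult using 1 by (intro mult_mono) auto
  qed
qed

lemma EE_0: "EE n \<mu> z 0 = exp (- \<i> * of_int n * z)"
  by (simp add: EE_def)

lemma Ln_one_minus_deriv:
  assumes "(h has_field_derivative d) (at 0)" "h 0 = (0 :: complex)"
  shows "((\<lambda>t. Ln (1 - h t)) has_field_derivative - d) (at 0)"
proof -
  have "((\<lambda>t. 1 - h t) has_field_derivative 0 - d) (at 0)"
    by (intro DERIV_diff DERIV_const assms(1))
  moreover have "(Ln has_field_derivative inverse 1) (at (1 - h 0))"
    unfolding assms(2) using has_field_derivative_Ln[of 1] by simp
  ultimately show ?thesis using DERIV_chain2[of Ln "inverse 1" "\<lambda>t. 1 - h t" 0 "0 - d" UNIV] by simp
qed

lemma EE_deriv: "(EE n \<mu> z has_field_derivative XX n \<mu> z) (at 0)"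
proof -
  define p q A B where "p = exp (2 * \<i> * z)" and "q = exp (- 2 * \<i> * z)"
    and "A = (of_int n - (2 * \<mu> + 1)) / 2" and "B = (- of_int n - (2 * \<mu> + 1)) / 2"
  define E0 where "E0 = exp (- \<i> * of_int n * z)"
  define G where "G = (\<lambda>t. (\<mu> + 1/2) * Ln (1 - t\<^sup>2) + A * Ln (1 - t * p) + B * Ln (1 - t * q))"
  have "((\<lambda>t::complex. t\<^sup>2) has_field_derivative 0) (at 0)"
    using DERIV_power[OF DERIV_ident, of 2 0 UNIV] by simp
  moreover have "((\<lambda>t. t * c) has_field_derivative c) (at 0)" for c :: complex
    using DERIV_cmult_right[OF DERIV_ident, of c 0 UNIV] by simp
  ultimately have "(G has_field_derivative (\<mu> + 1/2) * (- 0) + A * (- p) + B * (- q)) (at 0)"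
    unfolding G_def by (intro DERIV_add DERIV_cmult Ln_one_minus_deriv) auto
  then have "((\<lambda>t. exp (G t)) has_field_derivative exp (G 0) * ((\<mu> + 1/2) * (- 0) + A * (- p) + B * (- q))) (at 0)"
    by (rule DERIV_chain2[OF DERIV_exp])
  from DERIV_cmult[OF this, of E0]
  have "((\<lambda>t. E0 * exp (G t)) has_field_derivative E0 * (- A * p - B * q)) (at 0)"
    by (simp add: G_def)
  moreover have "(\<lambda>t. E0 * exp (G t)) = EE n \<mu> z"
    by (simp only: E0_def G_def EE_def[abs_def] p_def q_def A_def B_def)
  moreover have "E0 * (- A * p - B * q) = XX n \<mu> z"
  proof -
    have e: "E0 * p = exp (- \<i> * of_int (n - 2) * z)" "E0 * q = exp (- \<i> * of_int (n + 2) * z)"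
      unfolding E0_def p_def q_def mult_exp_exp by (rule arg_cong[of _ _ exp], simp add: algebra_simps)+
    have "E0 * (- A * p - B * q) = - A * (E0 * p) + - B * (E0 * q)" by (simp add: algebra_simps)
    moreover have "- A = \<mu> + (1 - of_int n) / 2" "- B = \<mu> + (1 + of_int n) / 2"
      unfolding A_def B_def by (simp_all add: field_simps)
    ultimately show ?thesis unfolding e XX_def by simp
  qed
  ultimately show ?thesis by simp
qed

definition strip :: "complex set" where "strip = {z. \<bar>Im z\<bar> < 1}"

lemma open_strip: "open strip"
proof -
  have eq: "strip = {z. Im z < 1} \<inter> {z. Im z > -1}" by (auto simp: strip_def)
  show ?thesis unfolding eq by (intro open_Int open_halfspace_Im_lt open_halfspace_Im_gt)
qed

lemma strip_vderiv:
  assumes "H holomorphic_on strip"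
  shows "(vderiv ^^ j) (\<lambda>\<theta>. H (of_real \<theta>)) = (\<lambda>\<theta>. (deriv ^^ j) H (of_real \<theta>))"
proof (rule smooth_realI(2))
  fix j \<theta>
  have "(of_real \<theta> :: complex) \<in> strip" by (simp add: strip_def)
  then have "((deriv ^^ j) H has_field_derivative deriv ((deriv ^^ j) H) (of_real \<theta>)) (at (of_real \<theta>))"
    by (intro holomorphic_derivI[OF holomorphic_higher_deriv[OF assms open_strip] open_strip])
  then show "((\<lambda>\<theta>. (deriv ^^ j) H (of_real \<theta>)) has_vector_derivative (deriv ^^ Suc j) H (of_real \<theta>)) (at \<theta>)"
    using has_vector_derivative_real_field[of "(deriv ^^ j) H" "(deriv ^^ Suc j) H (of_real \<theta>)" \<theta>] by simp
qed simp

text \<open>Disks of radius 1/2 about real points lie in the strip, so Cauchy's inequality bounds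
  every angular derivative by the supremum on the strip.\<close>

lemma strip_sn:
  assumes "H holomorphic_on strip" "\<And>z. z \<in> strip \<Longrightarrow> norm (H z) \<le> B"
  shows "sn j (\<lambda>\<theta>. H (of_real \<theta>)) \<le> fact j * B / (1/2) ^ j"
proof (rule sn_least)
  fix \<theta> :: real
  have sub: "cball (of_real \<theta>) (1/2) \<subseteq> strip"
  proof
    fix y assume "y \<in> cball (complex_of_real \<theta>) (1/2)"
    then show "y \<in> strip" using abs_Im_le_cmod[of "of_real \<theta> - y"] by (simp add: strip_def dist_norm)
  qed
  show "norm ((vderiv ^^ j) (\<lambda>\<theta>. H (of_real \<theta>)) \<theta>) \<le> fact j * B / (1/2) ^ j"
    unfolding strip_vderiv[OF assms(1)]
  proof (rule Cauchy_inequality)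
    show "H holomorphic_on ball (of_real \<theta>) (1/2)"
      by (rule holomorphic_on_subset[OF assms(1)]) (use sub ball_subset_cball in blast)
    show "continuous_on (cball (of_real \<theta>) (1/2)) H"
      by (rule continuous_on_subset[OF holomorphic_on_imp_continuous_on[OF assms(1)] sub])
    show "norm (H x) \<le> B" if "norm (of_real \<theta> - x) = 1/2" for x
      using sub that by (intro assms(2)) (auto simp: dist_norm)
  qed simp
qed

text \<open>For \<open>diagA (- s)\<close> the quotient be / al is -tanh s, and 1 / cosh^2 s = 1 -
  tanh^2 s. Writing real and imaginary part of the logarithm through \<open>L\<close> and its
  conjugate gives an expression holomorphic in t and in the angle.\<close>

lemma EE_act:
  "act \<mu> (diagA s) (ee n) (rot \<theta>) = EE n \<mu> (of_real \<theta>) (of_real (tanh s))"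
proof -
  define t where "t = tanh s"
  have assms: "\<bar>t\<bar> < 1" unfolding t_def using tanh_real_lt_1[of s] tanh_real_gt_neg1[of s] by linarith
  let ?A = "diagA (- s)"
  have A: "?A \<in> SL2" by simp
  have th: "tanh s = t" by (simp add: t_def)
  have ch: "cosh s > 0" by (simp add: cosh_real_pos)
  have ch2: "(cosh s)\<^sup>2 = 1 / (1 - t\<^sup>2)"
  proof -
    have "1 - t\<^sup>2 = 1 / (cosh s)\<^sup>2"
    proof -
      have "1 - t\<^sup>2 = ((cosh s)\<^sup>2 - (sinh s)\<^sup>2) / (cosh s)\<^sup>2"
        using ch unfolding th[symmetric] tanh_def by (simp add: power_divide diff_divide_distrib)
      also have "(cosh s)\<^sup>2 - (sinh s)\<^sup>2 = 1" by (rule hyperbolic_pythagoras)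
      finally show ?thesis .
    qed
    then show ?thesis by simp
  qed
  have al: "al ?A = of_real (cosh s)" by (simp add: al_def diagA_def complex_eq_iff cosh_field_def)
  have be: "be ?A = - of_real (sinh s)" by (simp add: be_def diagA_def complex_eq_iff sinh_field_def field_simps)
  have q: "be ?A / al ?A = - of_real t" unfolding al be th[symmetric] tanh_def by simp
  define L where "L = Ln (1 - of_real t * exp (2 * \<i> * of_real \<theta>))"
  have nz: "1 - of_real t * exp (2 * \<i> * of_real \<theta>) \<notin> \<real>\<^sub>\<le>\<^sub>0"
    using one_plus_nz[of "- of_real t" "exp (2 * \<i> * of_real \<theta>)"] assms by simp
  have cnjL: "cnj L = Ln (1 - of_real t * exp (- 2 * \<i> * of_real \<theta>))"
    unfolding L_def using nz by (subst cnj_Ln) (auto simp: exp_cnj)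
  have t1: "1 - t\<^sup>2 > 0" using assms by (simp add: abs_square_less_1)
  have lnch: "2 * ln (cosh s) = - ln (1 - t\<^sup>2)"
  proof -
    have "2 * ln (cosh s) = ln ((cosh s)\<^sup>2)" using ch by (simp add: ln_realpow)
    then show ?thesis unfolding ch2 using t1 by (simp add: ln_div)
  qed
  have lam: "lam ?A \<theta> = of_real (ln (cosh s)) + L"
    unfolding lam_def q unfolding al L_def using ch by (simp add: Ln_of_real cis_conv_exp mult_ac)
  have Ln: "Ln (1 - (of_real t)\<^sup>2) = of_real (ln (1 - t\<^sup>2))"
    using t1 by (simp add: Ln_of_real[symmetric])
  have "act \<mu> (diagA s) (ee n) (rot \<theta>) = actF \<mu> (diagA s) (ex n) \<theta>" by (simp add: act_rot)
  also have "\<dots> = exp (- (2 * \<mu> + 1) * of_real (Re (lam ?A \<theta>))) * ex n (\<theta> - Im (lam ?A \<theta>))"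
    using actF_lam[OF per_ex SL2_diagA, of \<mu> s n \<theta>] by (simp add: matrix_inv_diagA)
  also have "Re (lam ?A \<theta>) = ln (cosh s) + Re L" by (simp add: lam)
  also have "Im (lam ?A \<theta>) = Im L" by (simp add: lam)
  also have "ex n (\<theta> - Im L) = exp (- \<i> * of_int n * of_real \<theta>) * exp (\<i> * of_int n * of_real (Im L))"
    by (simp add: ex_def cis_conv_exp mult_exp_exp algebra_simps)
  also have "of_real (Im L) = (L - cnj L) / (2 * \<i>)" by (simp add: complex_eq_iff)
  also have "- (2 * \<mu> + 1) * of_real (ln (cosh s) + Re L) = (\<mu> + 1/2) * of_real (ln (1 - t\<^sup>2)) + - (2 * \<mu> + 1) * ((L + cnj L) / 2)"
  proof -
    have "ln (cosh s) = - ln (1 - t\<^sup>2) / 2" using lnch by linarith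
    then have "complex_of_real (ln (cosh s)) = of_real (- ln (1 - t\<^sup>2) / 2)" by (simp only:)
    then have e1: "complex_of_real (ln (cosh s)) = - of_real (ln (1 - t\<^sup>2)) / 2"
      by (simp only: of_real_minus of_real_divide of_real_numeral)
    have e2: "of_real (Re L) = (L + cnj L) / 2" by (simp add: complex_eq_iff)
    have "- (2 * \<mu> + 1) * (- x / 2 + y) = (\<mu> + 1/2) * x + - (2 * \<mu> + 1) * y" for x y
      by (simp add: field_simps)
    then show ?thesis unfolding of_real_add e1 e2 .
  qed
  finally have main: "act \<mu> (diagA s) (ee n) (rot \<theta>) = exp (- \<i> * of_int n * of_real \<theta>) *
     exp ((\<mu> + 1/2) * of_real (ln (1 - t\<^sup>2)) + - (2 * \<mu> + 1) * ((L + cnj L) / 2) + \<i> * of_int n * ((L - cnj L) / (2 * \<i>)))"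
    by (simp only: mult_exp_exp ac_simps)
  have ab: "- (2 * \<mu> + 1) * ((L + cnj L) / 2) + \<i> * of_int n * ((L - cnj L) / (2 * \<i>)) =
     (of_int n - (2 * \<mu> + 1)) / 2 * L + (- of_int n - (2 * \<mu> + 1)) / 2 * cnj L"
  proof -
    have "- (2 * \<mu> + 1) * ((x + y) / 2) + \<i> * of_int n * ((x - y) / (2 * \<i>)) =
      (of_int n - (2 * \<mu> + 1)) / 2 * x + (- of_int n - (2 * \<mu> + 1)) / 2 * y" for x y
      by (simp add: field_simps)
    then show ?thesis .
  qed
  show ?thesis unfolding main add.assoc ab unfolding th EE_def Ln cnjL L_def[symmetric]
    by (simp only: add.assoc)
qed

lemma EE_hol_t: "\<bar>Im z\<bar> \<le> 1 \<Longrightarrow> EE n \<mu> z holomorphic_on ball 0 (1/10)"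
  unfolding EE_def[abs_def]
  by (intro holomorphic_intros one_minus_nz small_norm) auto

lemma EE_hol_z: "norm t \<le> 1/10 \<Longrightarrow> (\<lambda>z. EE n \<mu> z t) holomorphic_on strip"
  unfolding EE_def
  by (intro holomorphic_intros one_minus_nz small_norm) (auto simp: strip_def)

lemma XX_hol_z: "XX n \<mu> holomorphic_on A"
  unfolding XX_def[abs_def] by (intro holomorphic_intros)

text \<open>The derivative of \<open>act \<mu> (diagA s) (ee n)\<close> at s = 0, split into its two
  K-types.\<close>

definition xx :: "int \<Rightarrow> complex \<Rightarrow> mat2 \<Rightarrow> complex" where
  "xx n \<mu> k = (\<mu> + (1 + of_int n) / 2) * ee (n + 2) k + (\<mu> + (1 - of_int n) / 2) * ee (n - 2) k"

lemma ex_exp: "ex n \<theta> = exp (- \<i> * of_int n * of_real \<theta>)"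
  by (simp add: ex_def cis_conv_exp mult.assoc)

lemma act_derivative:
  obtains C where "\<And>s \<mu>. norm \<mu> \<le> R \<Longrightarrow> 0 < \<bar>tanh s\<bar> \<Longrightarrow> \<bar>tanh s\<bar> \<le> 1/40 \<Longrightarrow>
    snorm j (\<lambda>k. (act \<mu> (diagA s) (ee n) k - ee n k) / of_real (tanh s) - xx n \<mu> k) \<le> C * \<bar>tanh s\<bar>"
proof -
  obtain B where B: "\<And>\<mu> z t. norm \<mu> \<le> R \<Longrightarrow> \<bar>Im z\<bar> \<le> 1 \<Longrightarrow> norm t \<le> 1/10 \<Longrightarrow> norm (EE n \<mu> z t) \<le> B"
    using EE_bound[of R n] by metis
  \<comment> \<open>This is the constant of \<open>taylor_quotient\<close> for r = 1/40; the disk of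
    radius 2 r lies in |t| < 1/10, where \<open>EE\<close> is holomorphic and bounded by
    \<open>B\<close>.\<close>
  define D where "D = 2 * B / (1/40)\<^sup>2"
  show ?thesis
  proof (rule that[of "fact j * D / (1/2) ^ j"])
    fix s :: real and \<mu> :: complex assume a: "norm \<mu> \<le> R" "0 < \<bar>tanh s\<bar>" "\<bar>tanh s\<bar> \<le> 1/40"
    define t where "t = complex_of_real (tanh s)"
    have t: "t \<noteq> 0" "norm t \<le> 1/40" "norm t = \<bar>tanh s\<bar>" using a by (auto simp: t_def)
    define H where "H = (\<lambda>z. (EE n \<mu> z t - EE n \<mu> z 0) / t - XX n \<mu> z)"
    have "H holomorphic_on strip"
      unfolding H_def using t by (intro holomorphic_intros EE_hol_z XX_hol_z) auto
    moreover have "norm (H z) \<le> D * \<bar>tanh s\<bar>" if z: "z \<in> strip" for z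
    proof -
      have z1: "\<bar>Im z\<bar> \<le> 1" using z by (simp add: strip_def)
      have "norm ((EE n \<mu> z (0 + t) - EE n \<mu> z 0) / t - deriv (EE n \<mu> z) 0) \<le> 2 * B / (1/40)\<^sup>2 * norm t"
      proof (rule taylor_quotient[OF EE_hol_t[OF z1]])
        show "cball 0 (2 * (1/40)) \<subseteq> ball (0::complex) (1/10)" by auto
        show "norm (EE n \<mu> z x) \<le> B" if "x \<in> cball 0 (2 * (1/40))" for x
          using that by (intro B a(1) z1) auto
      qed (use t in auto)
      moreover have "deriv (EE n \<mu> z) 0 = XX n \<mu> z" by (rule DERIV_imp_deriv[OF EE_deriv])
      ultimately show ?thesis by (simp add: H_def D_def t(3))
    qed
    ultimately have "sn j (\<lambda>\<theta>. H (of_real \<theta>)) \<le> fact j * (D * \<bar>tanh s\<bar>) / (1/2) ^ j" by (rule strip_sn)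
    moreover have "H (of_real \<theta>) = (act \<mu> (diagA s) (ee n) (rot \<theta>) - ee n (rot \<theta>)) / of_real (tanh s) - xx n \<mu> (rot \<theta>)" for \<theta>
      unfolding H_def EE_0 EE_act XX_def xx_def ee_rot ex_exp t_def by simp
    ultimately show "snorm j (\<lambda>k. (act \<mu> (diagA s) (ee n) k - ee n k) / of_real (tanh s) - xx n \<mu> k) \<le> fact j * D / (1/2) ^ j * \<bar>tanh s\<bar>"
      by (simp add: snorm_sn)
  qed
qed

lemma fam_fe: "par \<sigma> n \<Longrightarrow> f holomorphic_on UNIV \<Longrightarrow> fam \<sigma> UNIV (fe f n)"
  unfolding fe_def by (intro fam_mult fam_ee open_UNIV)

lemma par_shift: "par \<sigma> (n + 2) = par \<sigma> n" "par \<sigma> (n - 2) = par \<sigma> n"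
  by (cases \<sigma>; simp add: par_def)+

lemma act_scale: "act \<mu> g (\<lambda>k. c * \<phi> k) = (\<lambda>k. c * act \<mu> g \<phi> k)"
  by (auto simp: act_def extend_def fun_eq_iff)

lemma xx_Hinf: "par \<sigma> n \<Longrightarrow> xx n \<mu> \<in> Hinf \<sigma>"
  unfolding xx_def[abs_def] by (intro Hinf_add Hinf_scale ee_Hinf) (simp_all add: par_shift)

text \<open>Difference quotients of the action of A belong to \<open>S\<close>, and by
  \<open>act_derivative\<close> they converge to \<open>f\<close> times \<open>xx n\<close> in every
  seminorm, uniformly on disks.\<close>

lemma inv_derivative:
  assumes S: "inv_closed \<sigma> S" and n: "par \<sigma> n" and f: "f holomorphic_on UNIV" and fS: "fe f n \<in> S"
  shows "(\<lambda>\<mu> k. f \<mu> * xx n \<mu> k) \<in> S"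
proof (rule inv_lim[OF S])
  have "(\<lambda>\<mu> k. (f \<mu> * (\<mu> + (1 + of_int n) / 2)) * ee (n + 2) k + (f \<mu> * (\<mu> + (1 - of_int n) / 2)) * ee (n - 2) k) = (\<lambda>\<mu> k. f \<mu> * xx n \<mu> k)"
    by (simp add: xx_def fun_eq_iff algebra_simps)
  moreover have "fam \<sigma> UNIV (\<lambda>\<mu> k. (f \<mu> * (\<mu> + (1 + of_int n) / 2)) * ee (n + 2) k + (f \<mu> * (\<mu> + (1 - of_int n) / 2)) * ee (n - 2) k)"
    by (rule fam_add; rule fam_mult[OF open_UNIV _ fam_ee])
       (simp_all only: n par_shift, (intro holomorphic_intros f)+)
  ultimately show "fam \<sigma> UNIV (\<lambda>\<mu> k. f \<mu> * xx n \<mu> k)" by simp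
next
  fix R :: real and i :: nat and e :: real assume e: "e > 0"
  let ?bd = "\<lambda>j C. \<forall>s \<mu>. norm \<mu> \<le> R \<longrightarrow> 0 < \<bar>tanh s\<bar> \<longrightarrow> \<bar>tanh s\<bar> \<le> 1/40 \<longrightarrow>
    snorm j (\<lambda>k. (act \<mu> (diagA s) (ee n) k - ee n k) / of_real (tanh s) - xx n \<mu> k) \<le> C * \<bar>tanh s\<bar>"
  have "\<forall>j. \<exists>C. ?bd j C" by (rule allI, rule act_derivative[of R _ n]) blast
  from choice[OF this] obtain C where C0: "\<forall>j. ?bd j (C j)" ..
  have C: "snorm j (\<lambda>k. (act \<mu> (diagA s) (ee n) k - ee n k) / of_real (tanh s) - xx n \<mu> k) \<le> C j * \<bar>tanh s\<bar>"
    if "norm \<mu> \<le> R" "0 < \<bar>tanh s\<bar>" "\<bar>tanh s\<bar> \<le> 1/40" for j s \<mu>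
    using C0 that by blast
  define C' where "C' = (\<Sum>j\<le>i. \<bar>C j\<bar>)"
  have C': "C j \<le> C'" if "j \<le> i" for j
  proof -
    have "C j \<le> \<bar>C j\<bar>" by (rule abs_ge_self)
    also have "\<dots> \<le> C'" unfolding C'_def by (rule member_le_sum) (use that in auto)
    finally show ?thesis .
  qed
  have "C' \<ge> 0" unfolding C'_def by (simp add: sum_nonneg)
  have "bounded (f ` cball 0 R)"
    by (intro compact_imp_bounded compact_continuous_image holomorphic_on_imp_continuous_on holomorphic_on_subset[OF f]) auto
  then obtain M0 where "\<forall>y\<in>f ` cball 0 R. norm y \<le> M0" unfolding bounded_iff by blast
  then have M0: "\<And>\<mu>. \<mu> \<in> cball 0 R \<Longrightarrow> norm (f \<mu>) \<le> M0" by blast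
  define M where "M = \<bar>M0\<bar>"
  have M: "M \<ge> 0" by (simp add: M_def)
  have Mf: "norm (f \<mu>) \<le> M" if "\<mu> \<in> cball 0 R" for \<mu>
    using M0[OF that] unfolding M_def by linarith
  \<comment> \<open>\<open>M\<close> bounds \<open>f\<close> on the disk and \<open>C'\<close> the
    constants of the seminorms up to i. The summand 1 keeps the denominator positive and makes the
    final inequality strict.\<close>
  define d where "d = min (1/40) (e / (M * C' + 1))"
  have d: "d > 0" unfolding d_def using e M \<open>C' \<ge> 0\<close> by (simp add: add_nonneg_pos)
  have "tanh \<midarrow>0\<rightarrow> tanh (0::real)" using isCont_tanh[of 0] by (simp add: isCont_def)
  then obtain r where r: "r > 0" "\<And>x::real. x \<noteq> 0 \<and> \<bar>x\<bar> < r \<Longrightarrow> \<bar>tanh x\<bar> < d"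
    using d unfolding LIM_eq by force
  define s where "s = r / 2"
  have s: "s \<noteq> 0" "\<bar>tanh s\<bar> < d" using r(2)[of s] r(1) by (auto simp: s_def)
  then have s': "0 < \<bar>tanh s\<bar>" "\<bar>tanh s\<bar> \<le> 1/40" "\<bar>tanh s\<bar> \<le> e / (M * C' + 1)" by (auto simp: d_def)
  let ?t = "complex_of_real (tanh s)"
  let ?\<psi> = "\<lambda>\<mu> k. (1 / ?t) * (act_germ (diagA s) (fe f n) \<mu> k + (-1) * fe f n \<mu> k)"
  show "\<exists>\<psi>\<in>S. \<forall>\<mu>\<in>cball 0 R. \<forall>j\<le>i. snorm j (\<lambda>k. f \<mu> * xx n \<mu> k - \<psi> \<mu> k) < e"
  proof (intro bexI ballI allI impI)
    show "?\<psi> \<in> S" by (intro inv_scale[OF S] inv_add[OF S] inv_act[OF S] fS SL2_diagA)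
    fix \<mu> :: complex and j assume \<mu>: "\<mu> \<in> cball 0 R" and j: "j \<le> i"
    let ?q = "\<lambda>k. (act \<mu> (diagA s) (ee n) k - ee n k) / ?t - xx n \<mu> k"
    have "f \<mu> * xx n \<mu> k - ?\<psi> \<mu> k = - f \<mu> * ?q k" for k
      by (simp add: act_germ_def fe_def act_scale algebra_simps diff_divide_distrib)
    then have "snorm j (\<lambda>k. f \<mu> * xx n \<mu> k - ?\<psi> \<mu> k) = sn j (\<lambda>\<theta>. - f \<mu> * ?q (rot \<theta>))"
      by (simp add: snorm_sn)
    also have "\<dots> \<le> norm (- f \<mu>) * sn j (\<lambda>\<theta>. ?q (rot \<theta>))"
    proof (rule sn_scale)
      have "(\<lambda>k. inverse ?t * (act \<mu> (diagA s) (ee n) k - ee n k) - xx n \<mu> k) \<in> Hinf \<sigma>"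
        by (intro Hinf_diff Hinf_scale act_Hinf ee_Hinf xx_Hinf n SL2_diagA)
      from Hinf_SP[OF this] show "SP (\<lambda>\<theta>. ?q (rot \<theta>))" by (simp add: divide_inverse mult.commute)
    qed
    also have "\<dots> \<le> M * (C' * \<bar>tanh s\<bar>)"
    proof (rule mult_mono)
      have "sn j (\<lambda>\<theta>. ?q (rot \<theta>)) \<le> C j * \<bar>tanh s\<bar>" using C[of \<mu> s j] s' \<mu> by (simp add: snorm_sn)
      also have "\<dots> \<le> C' * \<bar>tanh s\<bar>" using C'[OF j] by (intro mult_right_mono) auto
      finally show "sn j (\<lambda>\<theta>. ?q (rot \<theta>)) \<le> C' * \<bar>tanh s\<bar>" .
      have "(\<lambda>k. inverse ?t * (act \<mu> (diagA s) (ee n) k - ee n k) - xx n \<mu> k) \<in> Hinf \<sigma>"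
        by (intro Hinf_diff Hinf_scale act_Hinf ee_Hinf xx_Hinf n SL2_diagA)
      from sn_nonneg[OF Hinf_SP[OF this]] show "0 \<le> sn j (\<lambda>\<theta>. ?q (rot \<theta>))" by (simp add: divide_inverse mult.commute)
    qed (use Mf[OF \<mu>] M in auto)
    also have "\<dots> \<le> (M * C') * (e / (M * C' + 1))"
      unfolding mult.assoc[symmetric] using s'(3) M \<open>C' \<ge> 0\<close> by (intro mult_left_mono) auto
    also have "\<dots> < e"
    proof -
      have "x * (e / (x + 1)) < e" if "x \<ge> 0" for x :: real
      proof -
        have "x * e < e * (x + 1)" using e by (simp add: algebra_simps)
        then show ?thesis using that by (simp add: pos_divide_less_eq)
      qed
      then show ?thesis using M \<open>C' \<ge> 0\<close> by simp
    qed
    finally show "snorm j (\<lambda>k. f \<mu> * xx n \<mu> k - ?\<psi> \<mu> k) < e" .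
  qed
qed

lemma act_rot_ee: "act \<mu> (rot t) (ee n) = (\<lambda>k. ex n (- t) * ee n k)"
proof (rule Hinf_eqI[of _ "restrM n"])
  show "act \<mu> (rot t) (ee n) (rot \<theta>) = ex n (- t) * ee n (rot \<theta>)" for \<theta>
    using ex_add[of n "- t" \<theta>] by (simp add: act_rot actF_rot[OF per_ex])
qed (intro act_Hinf Hinf_scale ee_Hinf SL2_rot par_restrM)+

lemma act_add: "act \<mu> g (\<lambda>k. \<phi> k + \<psi> k) = (\<lambda>k. act \<mu> g \<phi> k + act \<mu> g \<psi> k)"
  by (auto simp: act_def extend_def fun_eq_iff algebra_simps)

text \<open>\<open>xx n\<close> has only the K-types n + 2 and n - 2. Rotation by pi / 4, normalized
  by its value on the type n, multiplies them by i and -i, so combinations of the vector with its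
  rotate isolate each component.\<close>

lemma inv_raise_lower:
  assumes S: "inv_closed \<sigma> S" and n: "par \<sigma> n" and f: "f holomorphic_on UNIV" and fS: "fe f n \<in> S"
  shows "fe (\<lambda>\<mu>. f \<mu> * (\<mu> + (1 + of_int n) / 2)) (n + 2) \<in> S" "fe (\<lambda>\<mu>. f \<mu> * (\<mu> + (1 - of_int n) / 2)) (n - 2) \<in> S"
proof -
  let ?X = "\<lambda>\<mu> k. f \<mu> * xx n \<mu> k"
  let ?p = "\<lambda>\<mu>. f \<mu> * (\<mu> + (1 + of_int n) / 2)" and ?q = "\<lambda>\<mu>. f \<mu> * (\<mu> + (1 - of_int n) / 2)"
  have X: "?X \<in> S" by (rule inv_derivative[OF assms])
  have e: "ex n (pi / 4) * ex (n + 2) (- (pi / 4)) = \<i>" "ex n (pi / 4) * ex (n - 2) (- (pi / 4)) = - \<i>"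
  proof -
    have "ex n (pi / 4) * ex (n + 2) (- (pi / 4)) = cis (pi / 2)"
      unfolding ex_def cis_mult by (rule arg_cong[of _ _ cis]) (simp add: field_simps)
    then show "ex n (pi / 4) * ex (n + 2) (- (pi / 4)) = \<i>" by (simp add: complex_eq_iff)
    have "ex n (pi / 4) * ex (n - 2) (- (pi / 4)) = cis (- (pi / 2))"
      unfolding ex_def cis_mult by (rule arg_cong[of _ _ cis]) (simp add: field_simps)
    then show "ex n (pi / 4) * ex (n - 2) (- (pi / 4)) = - \<i>" by (simp add: complex_eq_iff)
  qed
  have aX: "act_germ (rot (pi / 4)) ?X \<mu> k = ?p \<mu> * (ex (n + 2) (- (pi / 4)) * ee (n + 2) k) + ?q \<mu> * (ex (n - 2) (- (pi / 4)) * ee (n - 2) k)" for \<mu> k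
    unfolding act_germ_def act_scale xx_def[abs_def] act_add act_rot_ee by (simp add: algebra_simps)
  have Y: "(\<lambda>\<mu> k. ex n (pi / 4) * act_germ (rot (pi / 4)) ?X \<mu> k) \<in> S"
    by (intro inv_scale[OF S] inv_act[OF S] X SL2_rot)
  have Yeq: "ex n (pi / 4) * act_germ (rot (pi / 4)) ?X \<mu> k = \<i> * (?p \<mu> * ee (n + 2) k) - \<i> * (?q \<mu> * ee (n - 2) k)" for \<mu> k
  proof -
    have "ex n (pi / 4) * act_germ (rot (pi / 4)) ?X \<mu> k = (ex n (pi / 4) * ex (n + 2) (- (pi / 4))) * (?p \<mu> * ee (n + 2) k)
      + (ex n (pi / 4) * ex (n - 2) (- (pi / 4))) * (?q \<mu> * ee (n - 2) k)"
      unfolding aX by (simp add: algebra_simps)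
    then show ?thesis unfolding e by simp
  qed
  have "(\<lambda>\<mu> k. (1/2) * (?X \<mu> k + (- \<i>) * (ex n (pi / 4) * act_germ (rot (pi / 4)) ?X \<mu> k))) \<in> S"
    by (intro inv_scale[OF S] inv_add[OF S] X Y)
  also have "(\<lambda>\<mu> k. (1/2) * (?X \<mu> k + (- \<i>) * (ex n (pi / 4) * act_germ (rot (pi / 4)) ?X \<mu> k))) = fe ?p (n + 2)"
    unfolding Yeq by (simp add: fun_eq_iff fe_def xx_def field_simps)
  finally show "fe ?p (n + 2) \<in> S" .
  have "(\<lambda>\<mu> k. (1/2) * (?X \<mu> k + \<i> * (ex n (pi / 4) * act_germ (rot (pi / 4)) ?X \<mu> k))) \<in> S"
    by (intro inv_scale[OF S] inv_add[OF S] X Y)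
  also have "(\<lambda>\<mu> k. (1/2) * (?X \<mu> k + \<i> * (ex n (pi / 4) * act_germ (rot (pi / 4)) ?X \<mu> k))) = fe ?q (n - 2)"
    unfolding Yeq by (simp add: fun_eq_iff fe_def xx_def field_simps)
  finally show "fe ?q (n - 2) \<in> S" .
qed

lemma inv_reach:
  assumes S: "inv_closed \<sigma> S" and p: "par \<sigma> p" and f: "f holomorphic_on UNIV" and fS: "fe f p \<in> S" and ev: "even (n - p)"
  shows "fe (\<lambda>\<mu>. f \<mu> * Q p n \<mu>) n \<in> S"
proof -
  have par2: "par \<sigma> (p + 2 * k)" for k using p by (cases \<sigma>) (auto simp: par_def)
  have up: "fe (\<lambda>\<mu>. f \<mu> * Qup p i \<mu>) (p + 2 * int i) \<in> S" for i
  proof (induction i)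
    case 0 then show ?case using fS by (simp add: Qup_def)
  next
    case (Suc i)
    have "(\<lambda>\<mu>. f \<mu> * Qup p i \<mu>) holomorphic_on UNIV" by (intro holomorphic_intros f Qup_hol)
    moreover have "p + 2 * int i + 2 = p + 2 * int (Suc i)" by simp
    ultimately show ?case
      using inv_raise_lower(1)[OF S par2 _ Suc] unfolding Qup_Suc by (simp only: mult.assoc)
  qed
  have down: "fe (\<lambda>\<mu>. f \<mu> * Qup (- p) i \<mu>) (p - 2 * int i) \<in> S" for i
  proof (induction i)
    case 0 then show ?case using fS by (simp add: Qup_def)
  next
    case (Suc i)
    have "(\<lambda>\<mu>. f \<mu> * Qup (- p) i \<mu>) holomorphic_on UNIV" by (intro holomorphic_intros f Qup_hol)
    moreover have "par \<sigma> (p - 2 * int i)" using par2[of "- int i"] by simp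
    moreover have "(1 - of_int (p - 2 * int i)) / 2 = (1 + of_int (- p + 2 * int i)) / (2::complex)"
      "p - 2 * int i - 2 = p - 2 * int (Suc i)" by simp_all
    ultimately show ?case
      using inv_raise_lower(2)[OF S _ _ Suc] unfolding Qup_Suc by (simp only: mult.assoc)
  qed
  from ev show ?thesis
    by (cases rule: even_cases) (simp_all add: Q_up Q_down up down)
qed

text \<open>Raising and then lowering multiplies by (\<mu> + c) (\<mu> - c) with c = (1 + n) / 2;
  adding c^2 times the section leaves \<mu>^2.\<close>

lemma inv_casimir:
  assumes S: "inv_closed \<sigma> S" and n: "par \<sigma> n" and f: "f holomorphic_on UNIV" and fS: "fe f n \<in> S"
  shows "fe (\<lambda>\<mu>. f \<mu> * \<mu>\<^sup>2) n \<in> S"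
proof -
  let ?c = "(1 + of_int n) / (2 :: complex)"
  have "(\<lambda>\<mu>. f \<mu> * (\<mu> + ?c)) holomorphic_on UNIV" by (intro holomorphic_intros f)
  moreover have "par \<sigma> (n + 2)" using n by (simp add: par_shift)
  ultimately have "fe (\<lambda>\<mu>. f \<mu> * (\<mu> + ?c) * (\<mu> + (1 - of_int (n + 2)) / 2)) (n + 2 - 2) \<in> S"
    using inv_raise_lower(2)[OF S _ _ inv_raise_lower(1)[OF assms]] by blast
  then have "(\<lambda>\<mu> k. fe (\<lambda>\<mu>. f \<mu> * (\<mu> + ?c) * (\<mu> + (1 - of_int (n + 2)) / 2)) (n + 2 - 2) \<mu> k + ?c\<^sup>2 * fe f n \<mu> k) \<in> S"
    by (intro inv_add[OF S] inv_scale[OF S] fS)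
  also have "(\<lambda>\<mu> k. fe (\<lambda>\<mu>. f \<mu> * (\<mu> + ?c) * (\<mu> + (1 - of_int (n + 2)) / 2)) (n + 2 - 2) \<mu> k + ?c\<^sup>2 * fe f n \<mu> k) = fe (\<lambda>\<mu>. f \<mu> * \<mu>\<^sup>2) n"
    by (simp add: fe_def fun_eq_iff field_simps power2_eq_square)
  finally show ?thesis .
qed

lemma inv_even_poly:
  assumes S: "inv_closed \<sigma> S" and n: "par \<sigma> n" and f: "f holomorphic_on UNIV" and fS: "fe f n \<in> S"
  shows "fe (\<lambda>\<mu>. f \<mu> * poly p (\<mu>\<^sup>2)) n \<in> S"
  using f fS
proof (induction p arbitrary: f)
  case 0
  then show ?case using inv_zero[OF S] by (simp add: fe_def)
next
  case (pCons a p)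
  have "(\<lambda>\<mu>. f \<mu> * \<mu>\<^sup>2) holomorphic_on UNIV" by (intro holomorphic_intros pCons.prems)
  then have "fe (\<lambda>\<mu>. (f \<mu> * \<mu>\<^sup>2) * poly p (\<mu>\<^sup>2)) n \<in> S"
    using pCons.IH inv_casimir[OF S n pCons.prems] by blast
  then have "(\<lambda>\<mu> k. a * fe f n \<mu> k + fe (\<lambda>\<mu>. (f \<mu> * \<mu>\<^sup>2) * poly p (\<mu>\<^sup>2)) n \<mu> k) \<in> S"
    by (intro inv_add[OF S] inv_scale[OF S] pCons.prems)
  then show ?case by (simp add: fe_def algebra_simps)
qed

section \<open>Approximation by finitely many K-types\<close>

lemma fam_bounded:
  assumes "fam \<sigma> UNIV \<phi>" shows "\<exists>B. \<forall>\<mu>\<in>cball 0 R. snorm i (\<phi> \<mu>) \<le> B"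
proof -
  let ?F = "\<lambda>\<mu> \<theta>. \<phi> \<mu> (rot \<theta>)"
  have "gd0 UNIV (\<lambda>\<mu>. (vderiv ^^ i) (?F \<mu>))"
    by (rule gd_gd0[of 0], rule gd_vderiv) (use assms in \<open>simp add: fam_def\<close>)
  then have "\<forall>x\<in>UNIV. \<exists>r>0. \<exists>B. \<forall>\<mu>\<in>cball x r. \<forall>\<theta>. norm ((vderiv ^^ i) (?F \<mu>) \<theta>) \<le> B"
    unfolding gd0_def by blast
  then have "\<forall>x. \<exists>rB. fst rB > 0 \<and> (\<forall>\<mu>\<in>cball x (fst rB). \<forall>\<theta>. norm ((vderiv ^^ i) (?F \<mu>) \<theta>) \<le> snd rB)"
    by auto
  from choice[OF this] obtain rB where
    rB: "\<forall>x. fst (rB x) > 0 \<and> (\<forall>\<mu>\<in>cball x (fst (rB x)). \<forall>\<theta>. norm ((vderiv ^^ i) (?F \<mu>) \<theta>) \<le> snd (rB x))" ..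
  have comp: "compact (cball (0::complex) R)" by simp
  have cover: "cball 0 R \<subseteq> (\<Union>x\<in>cball 0 R. ball x (fst (rB x)))" using rB by force
  obtain C where C: "C \<subseteq> cball 0 R" "finite C" "cball 0 R \<subseteq> (\<Union>x\<in>C. ball x (fst (rB x)))"
    using compactE_image[OF comp _ cover] by (metis open_ball)
  have "snorm i (\<phi> \<mu>) \<le> (\<Sum>x\<in>C. \<bar>snd (rB x)\<bar>)" if \<mu>: "\<mu> \<in> cball 0 R" for \<mu>
    unfolding snorm_sn
  proof (rule sn_least)
    fix \<theta>
    obtain x where x: "x \<in> C" "\<mu> \<in> ball x (fst (rB x))" using C(3) \<mu> by blast
    then have "norm ((vderiv ^^ i) (?F \<mu>) \<theta>) \<le> snd (rB x)" using rB by (simp add: less_imp_le)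
    also have "\<dots> \<le> \<bar>snd (rB x)\<bar>" by (rule abs_ge_self)
    also have "\<dots> \<le> (\<Sum>x\<in>C. \<bar>snd (rB x)\<bar>)" by (rule member_le_sum[OF x(1) _ C(2)]) simp
    finally show "norm ((vderiv ^^ i) (?F \<mu>) \<theta>) \<le> (\<Sum>x\<in>C. \<bar>snd (rB x)\<bar>)" .
  qed
  then show ?thesis by blast
qed

lemma snorm_nonneg: "f \<in> Hinf \<sigma> \<Longrightarrow> 0 \<le> snorm i f"
  unfolding snorm_sn by (rule sn_nonneg[OF Hinf_SP])

text \<open>Dropping the K-types below M gains the factor 1 / (1 + M) at the price of one more power
  of the weight: i for the derivatives, two for summability, one for the gain.\<close>

lemma snorm_tail:
  assumes "f \<in> Hinf \<sigma>" "f0 \<in> Hinf \<sigma>" "\<And>p. fcm f p = b p * fcm f0 p" "\<And>p. norm (b p) \<le> 1"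
    "\<And>p. \<bar>p\<bar> < int M \<Longrightarrow> b p = 0"
  shows "snorm i f \<le> 2 ^ (i + 3) * (snorm 0 f0 + snorm (i + 3) f0) / (1 + real M) * wsum"
proof -
  let ?K = "2 ^ (i + 3) * (snorm 0 f0 + snorm (i + 3) f0)"
  have S: "SP (\<lambda>\<theta>. f (rot \<theta>))" "SP (\<lambda>\<theta>. f0 (rot \<theta>))" using assms Hinf_SP by blast+
  have K0: "?K \<ge> 0" using snorm_nonneg[OF assms(2)] by simp
  have "sn i (ser (fcm f)) \<le> ?K / (1 + real M) * wsum"
  proof (rule sn_ser[OF _ rd_fc[OF S(1)]])
    fix n
    define y :: real where "y = 1 + \<bar>of_int n\<bar>"
    have y: "y \<ge> 1" by (simp add: y_def)
    show "(1 + \<bar>of_int n\<bar>) ^ (i + 2) * norm (fcm f n) \<le> ?K / (1 + real M)"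
    proof (cases "\<bar>n\<bar> < int M")
      case True
      then show ?thesis using assms(3)[of n] assms(5)[OF True] K0 by simp
    next
      case False
      then have "of_int (int M) \<le> (of_int \<bar>n\<bar> :: real)" by (intro of_int_le_iff[THEN iffD2]) simp
      then have yM: "1 + real M \<le> y" by (simp add: y_def)
      have "norm (fcm f n) \<le> 1 * norm (fcm f0 n)"
        unfolding assms(3) norm_mult by (intro mult_right_mono assms(4)) simp
      then have "y ^ (i + 2) * norm (fcm f n) \<le> y ^ (i + 2) * norm (fcm f0 n)"
        using y by (intro mult_left_mono) auto
      then have "(1 + real M) * (y ^ (i + 2) * norm (fcm f n)) \<le> y * (y ^ (i + 2) * norm (fcm f0 n))"
        using yM y by (intro mult_mono) auto
      also have "\<dots> = y ^ (i + 3) * norm (fcm f0 n)" by (simp add: power_add eval_nat_numeral mult_ac)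
      also have "\<dots> \<le> ?K" unfolding y_def snorm_sn by (rule fc_decay'[OF S(2)])
      finally show ?thesis unfolding y_def by (simp add: pos_le_divide_eq mult.commute)
    qed
  qed
  then show ?thesis by (simp add: snorm_sn ser_fc[OF S(1)])
qed

text \<open>The error coefficients are dominated by those of a fixed family and vanish for |p| < L,
  so \<open>snorm_tail\<close> makes the error small, uniformly on disks, as L grows.\<close>

lemma inv_approx:
  assumes S: "inv_closed \<sigma> S" and \<phi>: "fam \<sigma> UNIV \<phi>" and \<phi>0: "fam \<sigma> UNIV \<phi>0"
    and ap: "\<And>L::nat. \<exists>\<psi>\<in>S. \<exists>b. (\<forall>\<mu> p. fcm (\<phi> \<mu>) p - fcm (\<psi> \<mu>) p = b p * fcm (\<phi>0 \<mu>) p) \<and>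
       (\<forall>p. norm (b p) \<le> 1) \<and> (\<forall>p. \<bar>p\<bar> < int L \<longrightarrow> b p = 0)"
  shows "\<phi> \<in> S"
proof (rule inv_lim[OF S \<phi>])
  fix R i and e :: real assume e: "e > 0"
  from choice[OF allI[OF fam_bounded[OF \<phi>0, of R]]] obtain B where
    B: "\<forall>i. \<forall>\<mu>\<in>cball 0 R. snorm i (\<phi>0 \<mu>) \<le> B i" ..
  define K where "K = (\<Sum>j\<le>i. \<bar>2 ^ (j + 3) * (B 0 + B (j + 3)) * wsum\<bar>)"
  have K: "2 ^ (j + 3) * (B 0 + B (j + 3)) * wsum \<le> K" if "j \<le> i" for j
  proof -
    have "2 ^ (j + 3) * (B 0 + B (j + 3)) * wsum \<le> \<bar>2 ^ (j + 3) * (B 0 + B (j + 3)) * wsum\<bar>" by (rule abs_ge_self)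
    also have "\<dots> \<le> K" unfolding K_def by (rule member_le_sum) (use that in auto)
    finally show ?thesis .
  qed
  have K0: "K \<ge> 0" unfolding K_def by (simp add: sum_nonneg)
  obtain L :: nat where L: "K / e < real L" using reals_Archimedean2 by blast
  obtain \<psi> b where \<psi>: "\<psi> \<in> S" and b: "\<And>\<mu> p. fcm (\<phi> \<mu>) p - fcm (\<psi> \<mu>) p = b p * fcm (\<phi>0 \<mu>) p"
     "\<And>p. norm (b p) \<le> 1" "\<And>p. \<bar>p\<bar> < int L \<Longrightarrow> b p = 0" using ap[of L] by blast
  show "\<exists>\<psi>\<in>S. \<forall>\<mu>\<in>cball 0 R. \<forall>j\<le>i. snorm j (\<lambda>k. \<phi> \<mu> k - \<psi> \<mu> k) < e"
  proof (intro bexI[OF _ \<psi>] ballI allI impI)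
    fix \<mu> :: complex and j assume \<mu>: "\<mu> \<in> cball 0 R" and j: "j \<le> i"
    have H: "\<phi> \<mu> \<in> Hinf \<sigma>" "\<psi> \<mu> \<in> Hinf \<sigma>" "\<phi>0 \<mu> \<in> Hinf \<sigma>"
      using fam_Hinf[OF \<phi>] fam_Hinf[OF \<phi>0] fam_Hinf[OF inv_fam[OF S \<psi>]] by auto
    have "snorm j (\<lambda>k. \<phi> \<mu> k - \<psi> \<mu> k) \<le> 2 ^ (j + 3) * (snorm 0 (\<phi>0 \<mu>) + snorm (j + 3) (\<phi>0 \<mu>)) / (1 + real L) * wsum"
      by (rule snorm_tail[OF Hinf_diff[OF H(1,2)] H(3) _ b(2,3)]) (simp_all add: fcm_diff[OF H(1,2)] b(1))
    also have "\<dots> = 2 ^ (j + 3) * (snorm 0 (\<phi>0 \<mu>) + snorm (j + 3) (\<phi>0 \<mu>)) * wsum / (1 + real L)" by simp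
    also have "\<dots> \<le> 2 ^ (j + 3) * (B 0 + B (j + 3)) * wsum / (1 + real L)"
      using B \<mu> wsum_pos by (intro divide_right_mono mult_right_mono mult_left_mono add_mono) auto
    also have "\<dots> \<le> K / (1 + real L)" using K[OF j] by (intro divide_right_mono) auto
    also have "\<dots> < e"
    proof -
      have "K < e * real L" using L e by (simp add: pos_divide_less_eq mult.commute)
      also have "\<dots> \<le> e * (1 + real L)" using e by simp
      finally show ?thesis by (simp add: pos_divide_less_eq)
    qed
    finally show "snorm j (\<lambda>k. \<phi> \<mu> k - \<psi> \<mu> k) < e" .
  qed
qed

lemma fcm_sum:
  assumes "finite J" "\<And>j. j \<in> J \<Longrightarrow> F j \<in> Hinf \<sigma>"
  shows "fcm (\<lambda>k. \<Sum>j\<in>J. F j k) n = (\<Sum>j\<in>J. fcm (F j) n)"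
  by (rule fc_sum[OF assms(1)]) (intro SP_cont Hinf_SP[OF assms(2)])

lemma fcm_fe: "fcm (fe f p \<mu>) n = (if n = p then f \<mu> else 0)"
  by (simp add: fe_def fc_scale fc_ex)

lemma fcm_0: "fcm (\<lambda>k. 0) n = 0" by (simp add: fc_def)

text \<open>Membership in \<open>S\<close> can be tested on one K-type at a time: finite sums of the
  components approximate the section.\<close>

lemma inv_series:
  assumes S: "inv_closed \<sigma> S" and z: "\<phi>1 \<in> S" and \<phi>: "fam \<sigma> UNIV \<phi>"
    and n: "\<And>n. par \<sigma> n \<Longrightarrow> fe (\<lambda>\<mu>. fcm (\<phi> \<mu>) n) n \<in> S"
  shows "\<phi> \<in> S"
proof (rule inv_approx[OF S \<phi> \<phi>])
  fix L :: nat
  define J where "J = {p \<in> {- int L..int L}. par \<sigma> p}"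
  have J: "finite J" by (rule finite_subset[of _ "{- int L..int L}"]) (auto simp: J_def)
  let ?\<psi> = "\<lambda>\<mu> k. \<Sum>p\<in>J. fe (\<lambda>\<mu>. fcm (\<phi> \<mu>) p) p \<mu> k"
  let ?b = "\<lambda>p. if p \<in> {- int L..int L} then 0 else (1::complex)"
  have \<psi>: "?\<psi> \<in> S" by (rule inv_sum[OF S z J]) (simp add: J_def n)
  have "fcm (\<phi> \<mu>) p - fcm (?\<psi> \<mu>) p = ?b p * fcm (\<phi> \<mu>) p" for \<mu> p
  proof -
    have "fcm (?\<psi> \<mu>) p = (\<Sum>q\<in>J. fcm (fe (\<lambda>\<mu>. fcm (\<phi> \<mu>) q) q \<mu>) p)"
      by (rule fcm_sum[OF J, of _ \<sigma>]) (auto simp: J_def fe_def intro!: Hinf_scale ee_Hinf)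
    also have "\<dots> = (if p \<in> J then fcm (\<phi> \<mu>) p else 0)"
      using J by (simp add: fcm_fe)
    finally show ?thesis using Hinf_par[OF fam_Hinf[OF \<phi>, of \<mu>], of p] by (auto simp: J_def)
  qed
  then show "\<exists>\<psi>\<in>S. \<exists>b. (\<forall>\<mu> p. fcm (\<phi> \<mu>) p - fcm (\<psi> \<mu>) p = b p * fcm (\<phi> \<mu>) p) \<and>
       (\<forall>p. norm (b p) \<le> 1) \<and> (\<forall>p. \<bar>p\<bar> < int L \<longrightarrow> b p = 0)"
    by (intro bexI[OF _ \<psi>] exI[of _ ?b]) auto
qed

lemma fcm_act_rot:
  assumes "f \<in> Hinf \<sigma>" shows "fcm (act \<mu> (rot a) f) n = ex n (- a) * fcm f n"
proof -
  have "Mc (rot a) n p \<mu> = (if n = p then ex p (- a) else 0)" for p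
    unfolding fcm_act_ee[OF SL2_rot, symmetric] act_rot_ee fc_scale fcm_ee by simp
  then have "(\<lambda>j. fcm f (int_decode j) * (if n = int_decode j then ex (int_decode j) (- a) else 0)) sums fcm (act \<mu> (rot a) f) n"
    using fcm_act_sums[OF assms SL2_rot, of a n \<mu>] by simp
  moreover have "fcm f (int_decode j) * (if n = int_decode j then ex (int_decode j) (- a) else 0) =
      (if j = int_encode n then ex n (- a) * fcm f n else 0)" for j by auto
  ultimately have "(\<lambda>j. if j = int_encode n then ex n (- a) * fcm f n else 0) sums fcm (act \<mu> (rot a) f) n" by simp
  then show ?thesis using sums_unique2 sums_single[of "int_encode n" "\<lambda>_. ex n (- a) * fcm f n"] by blast
qed

lemma ex_power: "ex q t ^ j = ex q (of_nat j * t)"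
  by (simp add: ex_def Complex.DeMoivre algebra_simps)

lemma root_sum:
  fixes N :: nat
  assumes "N > 0" "\<bar>q\<bar> < int N" "q \<noteq> 0" shows "(\<Sum>j<N. ex q (of_nat j * (2 * pi / N))) = 0"
proof -
  let ?x = "ex q (2 * pi / N)"
  have "?x \<noteq> 1"
  proof
    assume "?x = 1"
    then have "cos (of_int q * (2 * pi / N)) = 1" by (simp add: ex_def complex_eq_iff)
    then obtain m :: int where "of_int q * (2 * pi / N) = of_int m * 2 * pi" using cos_one_2pi_int by auto
    then have "(of_int q / real N) * (2 * pi) = of_int m * (2 * pi)" by (simp add: field_simps)
    then have "of_int q / real N = of_int m" by (rule mult_right_cancel[THEN iffD1, rotated]) simp
    then have "real_of_int q = of_int (m * int N)" using assms(1) by (simp add: divide_eq_eq)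
    then have q: "q = m * int N" by (simp only: of_int_eq_iff)
    then have "m \<noteq> 0" using assms(3) by auto
    then have "1 \<le> \<bar>m\<bar>" by simp
    then have "1 * int N \<le> \<bar>m\<bar> * int N" by (intro mult_right_mono) auto
    then have "int N \<le> \<bar>q\<bar>" unfolding q abs_mult by simp
    then show False using assms(2) by simp
  qed
  moreover have "?x ^ N = 1"
  proof -
    have "?x ^ N = ex q (2 * pi)" unfolding ex_power using assms(1) by simp
    then show ?thesis by simp
  qed
  ultimately show ?thesis
    unfolding ex_power[symmetric] by (simp add: geometric_sum)
qed

text \<open>Projection onto a K-type is an integral over K. Averages over N equally spaced rotations
  replace it; these are finite sums of translates and hence lie in \<open>S\<close>.\<close>

lemma inv_proj:
  assumes S: "inv_closed \<sigma> S" and \<phi>S: "\<phi> \<in> S"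
  shows "fe (\<lambda>\<mu>. fcm (\<phi> \<mu>) n) n \<in> S"
proof (cases "par \<sigma> n")
  case False
  have "fe (\<lambda>\<mu>. fcm (\<phi> \<mu>) n) n = (\<lambda>\<mu> k. 0)"
    using Hinf_par[OF fam_Hinf[OF inv_fam[OF S \<phi>S]] False] by (simp add: fe_def)
  then show ?thesis using inv_zero[OF S \<phi>S] by simp
next
  case True
  have \<phi>: "fam \<sigma> UNIV \<phi>" by (rule inv_fam[OF S \<phi>S])
  show ?thesis
  proof (rule inv_approx[OF S fam_fe[OF True fam_fc_hol[OF \<phi>]] \<phi>])
    fix L :: nat
    \<comment> \<open>Then |n - p| < N whenever |p| < L, so by \<open>root_sum\<close> the average
      agrees with the projection on these types.\<close>
    define N where "N = L + nat \<bar>n\<bar> + 1"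
    have N: "N > 0" by (simp add: N_def)
    define a where "a = (\<lambda>j::nat. of_nat j * (2 * pi / N))"
    let ?g = "\<lambda>j \<mu> k. ex n (a j) * act_germ (rot (a j)) \<phi> \<mu> k"
    let ?\<psi> = "\<lambda>\<mu> k. (1 / of_nat N) * (\<Sum>j<N. ?g j \<mu> k)"
    define b where "b = (\<lambda>p. (if p = n then 1 else 0) - (1 / of_nat N) * (\<Sum>j<N. ex (n - p) (a j)))"
    have \<psi>: "?\<psi> \<in> S"
      by (intro inv_scale[OF S] inv_sum[OF S \<phi>S] inv_act[OF S] \<phi>S SL2_rot) simp
    have 1: "fcm (fe (\<lambda>\<mu>. fcm (\<phi> \<mu>) n) n \<mu>) p - fcm (?\<psi> \<mu>) p = b p * fcm (\<phi> \<mu>) p" for \<mu> p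
    proof -
      have "fcm (?\<psi> \<mu>) p = (1 / of_nat N) * fcm (\<lambda>k. \<Sum>j<N. ?g j \<mu> k) p" by (rule fc_scale)
      also have "fcm (\<lambda>k. \<Sum>j<N. ?g j \<mu> k) p = (\<Sum>j<N. fcm (?g j \<mu>) p)"
        by (rule fcm_sum[of _ _ \<sigma>]) (auto intro!: Hinf_scale act_Hinf fam_Hinf[OF \<phi>] simp: act_germ_def)
      also have "(\<Sum>j<N. fcm (?g j \<mu>) p) = (\<Sum>j<N. ex (n - p) (a j) * fcm (\<phi> \<mu>) p)"
      proof (rule sum.cong[OF refl])
        fix j
        have "fcm (?g j \<mu>) p = ex n (a j) * (ex p (- a j) * fcm (\<phi> \<mu>) p)"
          unfolding fc_scale act_germ_def fcm_act_rot[OF fam_Hinf[OF \<phi> UNIV_I]] ..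
        also have "ex p (- a j) = ex (- p) (a j)" by (simp add: ex_def)
        also have "ex n (a j) * (ex (- p) (a j) * fcm (\<phi> \<mu>) p) = ex (n - p) (a j) * fcm (\<phi> \<mu>) p"
          unfolding mult.assoc[symmetric] ex_mult by simp
        finally show "fcm (?g j \<mu>) p = ex (n - p) (a j) * fcm (\<phi> \<mu>) p" .
      qed
      finally show ?thesis unfolding fcm_fe b_def by (simp add: sum_distrib_right[symmetric] left_diff_distrib)
    qed
    have bn: "b n = 0" using N by (simp add: b_def)
    have 2: "norm (b p) \<le> 1" for p
    proof (cases "p = n")
      case False
      have "norm (\<Sum>j<N. ex (n - p) (a j)) \<le> real N"
        by (rule order_trans[OF norm_sum]) simp
      then show ?thesis using False N by (simp add: b_def norm_mult norm_divide field_simps)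
    qed (simp add: bn)
    have 3: "b p = 0" if "\<bar>p\<bar> < int L" for p
    proof (cases "p = n")
      case False
      have "(\<Sum>j<N. ex (n - p) (a j)) = 0" unfolding a_def
        by (rule root_sum[OF N]) (use that False in \<open>auto simp: N_def\<close>)
      then show ?thesis using False by (simp add: b_def)
    qed (simp add: bn)
    show "\<exists>\<psi>\<in>S. \<exists>b. (\<forall>\<mu> p. fcm (fe (\<lambda>\<mu>. fcm (\<phi> \<mu>) n) n \<mu>) p - fcm (\<psi> \<mu>) p = b p * fcm (\<phi> \<mu>) p) \<and>
       (\<forall>p. norm (b p) \<le> 1) \<and> (\<forall>p. \<bar>p\<bar> < int L \<longrightarrow> b p = 0)"
      using 1 2 3 by (intro bexI[OF _ \<psi>] exI[of _ b]) blast
  qed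
qed

subsection \<open>Closed submodules are determined by their K-types\<close>

text \<open>Evaluation at \<nu> turns a closed submodule into a closed invariant family of sections.
  Raising, lowering and projection thereby become available inside submodules, applied to constant
  sections.\<close>

lemma submodule_inv_closed:
  assumes "closed_submodule \<sigma> \<nu> V"
  shows "inv_closed \<sigma> {\<phi>. fam \<sigma> UNIV \<phi> \<and> \<phi> \<nu> \<in> V}"
proof -
  have V: "V \<subseteq> Hinf \<sigma>" "\<And>f h. f \<in> V \<Longrightarrow> h \<in> V \<Longrightarrow> (\<lambda>k. f k + h k) \<in> V"
    "\<And>c f. f \<in> V \<Longrightarrow> (\<lambda>k. c * f k) \<in> V" "\<And>g f. g \<in> SL2 \<Longrightarrow> f \<in> V \<Longrightarrow> act \<nu> g f \<in> V"
    "\<And>f. f \<in> Hinf \<sigma> \<Longrightarrow> (\<And>N \<epsilon>. \<epsilon> > 0 \<Longrightarrow> \<exists>h\<in>V. \<forall>n\<le>N. snorm n (\<lambda>k. f k - h k) < \<epsilon>) \<Longrightarrow> f \<in> V"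
    using assms unfolding closed_submodule_def by blast+
  let ?S = "{\<phi>. fam \<sigma> UNIV \<phi> \<and> \<phi> \<nu> \<in> V}"
  have 1: "(\<lambda>\<mu> k. \<phi> \<mu> k + \<psi> \<mu> k) \<in> ?S" if "\<phi> \<in> ?S" "\<psi> \<in> ?S" for \<phi> \<psi>
    using that fam_add V(2) by blast
  have 2: "(\<lambda>\<mu> k. c * \<phi> \<mu> k) \<in> ?S" if "\<phi> \<in> ?S" for c \<phi>
    using that fam_scale[OF open_UNIV] V(3) by blast
  have 3: "act_germ g \<phi> \<in> ?S" if "g \<in> SL2" "\<phi> \<in> ?S" for g \<phi>
    using that fam_act[OF that(1) open_UNIV] V(4)[OF that(1), of "\<phi> \<nu>"] by (simp add: act_germ_def)
  have 4: "\<phi> \<in> ?S" if \<phi>: "fam \<sigma> UNIV \<phi>" and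
      lim: "\<forall>R i. \<forall>\<epsilon>>0. \<exists>\<psi>\<in>?S. \<forall>\<mu>\<in>cball 0 R. \<forall>j\<le>i. snorm j (\<lambda>k. \<phi> \<mu> k - \<psi> \<mu> k) < \<epsilon>" for \<phi>
  proof -
    have "\<phi> \<nu> \<in> V"
    proof (rule V(5)[OF fam_Hinf[OF \<phi> UNIV_I]])
      fix N and e :: real assume "e > 0"
      then obtain \<psi> where "\<psi> \<nu> \<in> V" "\<forall>\<mu>\<in>cball 0 (norm \<nu>). \<forall>j\<le>N. snorm j (\<lambda>k. \<phi> \<mu> k - \<psi> \<mu> k) < e"
        using lim by blast
      moreover have "\<nu> \<in> cball 0 (norm \<nu>)" by simp
      ultimately show "\<exists>h\<in>V. \<forall>n\<le>N. snorm n (\<lambda>k. \<phi> \<nu> k - h k) < e" by blast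
    qed
    then show ?thesis using \<phi> by simp
  qed
  show ?thesis unfolding inv_closed_def
    using 1 2 3 4 by (intro conjI ballI allI impI) (simp_all only: mem_Collect_eq)
qed

lemma
  assumes "closed_submodule \<sigma> \<nu> V"
  shows submodule_Hinf: "f \<in> V \<Longrightarrow> f \<in> Hinf \<sigma>"
    and submodule_0: "(\<lambda>k. 0) \<in> V"
    and submodule_scale: "f \<in> V \<Longrightarrow> (\<lambda>k. c * f k) \<in> V"
  using assms unfolding closed_submodule_def by blast+

lemma submodule_type:
  assumes V: "closed_submodule \<sigma> \<nu> V" and f: "f \<in> V" "fcm f n \<noteq> 0" shows "ee n \<in> V"
proof -
  have H: "f \<in> Hinf \<sigma>" using V f(1) unfolding closed_submodule_def by blast
  have "(\<lambda>\<mu>. f) \<in> {\<phi>. fam \<sigma> UNIV \<phi> \<and> \<phi> \<nu> \<in> V}" using f(1) fam_const[OF open_UNIV H] by simp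
  from inv_proj[OF submodule_inv_closed[OF V] this, of n]
  have "(\<lambda>k. fcm f n * ee n k) \<in> V" by (simp add: fe_def)
  then have "(\<lambda>k. inverse (fcm f n) * (fcm f n * ee n k)) \<in> V" by (rule submodule_scale[OF V])
  then show ?thesis using f(2) by (simp add: mult.assoc[symmetric])
qed

lemma submodule_reach:
  assumes V: "closed_submodule \<sigma> \<nu> V" and p: "par \<sigma> p" "ee p \<in> V" and n: "even (n - p)" "Q p n \<nu> \<noteq> 0"
  shows "ee n \<in> V"
proof -
  have "fe (\<lambda>\<mu>. 1) p \<in> {\<phi>. fam \<sigma> UNIV \<phi> \<and> \<phi> \<nu> \<in> V}" using p by (simp add: fe_def fam_ee)
  from inv_reach[OF submodule_inv_closed[OF V] p(1) _ this n(1)]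
  have "(\<lambda>k. Q p n \<nu> * ee n k) \<in> V" by (simp add: fe_def)
  then have "(\<lambda>k. inverse (Q p n \<nu>) * (Q p n \<nu> * ee n k)) \<in> V" by (rule submodule_scale[OF V])
  then show ?thesis using n(2) by (simp add: mult.assoc[symmetric])
qed

lemma submodule_contains:
  assumes V: "closed_submodule \<sigma> \<nu> V" and f: "f \<in> Hinf \<sigma>" "\<And>n. fcm f n \<noteq> 0 \<Longrightarrow> ee n \<in> V" shows "f \<in> V"
proof -
  note z = submodule_0[OF V]
  have "(\<lambda>\<mu>. f) \<in> {\<phi>. fam \<sigma> UNIV \<phi> \<and> \<phi> \<nu> \<in> V}"
  proof (rule inv_series[OF submodule_inv_closed[OF V]])
    show "(\<lambda>\<mu> k. 0) \<in> {\<phi>. fam \<sigma> UNIV \<phi> \<and> \<phi> \<nu> \<in> V}" using z fam_const[OF open_UNIV Hinf_0] by simp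
    show "fam \<sigma> UNIV (\<lambda>\<mu>. f)" by (rule fam_const[OF open_UNIV f(1)])
    fix n assume n: "par \<sigma> n"
    have "(\<lambda>k. fcm f n * ee n k) \<in> V"
    proof (cases "fcm f n = 0")
      case True then show ?thesis using z by simp
    next
      case False then show ?thesis using submodule_scale[OF V] f(2)[OF False] by blast
    qed
    then show "fe (\<lambda>\<mu>. fcm f n) n \<in> {\<phi>. fam \<sigma> UNIV \<phi> \<and> \<phi> \<nu> \<in> V}"
      using n fam_fe[OF n, of "\<lambda>\<mu>. fcm f n"] by (simp add: fe_def)
  qed
  then show ?thesis by simp
qed

lemma submodule_ksetI:
  assumes V: "closed_submodule \<sigma> \<nu> V" and N: "\<And>n. ee n \<in> V \<longleftrightarrow> par \<sigma> n \<and> n \<in> N"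
  shows "V = kset \<sigma> N"
proof (intro equalityI subsetI)
  fix f assume f: "f \<in> V"
  then have "f \<in> Hinf \<sigma>" using V unfolding closed_submodule_def by blast
  then show "f \<in> kset \<sigma> N" using submodule_type[OF V f] N by (auto simp: kset_def)
next
  fix f assume f: "f \<in> kset \<sigma> N"
  show "f \<in> V"
  proof (rule submodule_contains[OF V ksetD(1)[OF f]])
    fix n assume "fcm f n \<noteq> 0"
    then show "ee n \<in> V" using N ksetD[OF f] Hinf_par[OF ksetD(1)[OF f]] by blast
  qed
qed

lemma ee_kset: "ee n \<in> kset \<sigma> N \<longleftrightarrow> par \<sigma> n \<and> n \<in> N"
proof
  assume e: "ee n \<in> kset \<sigma> N"
  have "fcm (ee n) n \<noteq> 0" by (simp add: fc_ex)
  then show "par \<sigma> n \<and> n \<in> N" using ksetD[OF e] Hinf_par[OF ksetD(1)[OF e]] by blast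
next
  assume "par \<sigma> n \<and> n \<in> N"
  then show "ee n \<in> kset \<sigma> N" by (auto simp: kset_def ee_Hinf fc_ex split: if_splits)
qed

lemma ex_inj: assumes "\<And>t. ex p t = ex n t" shows "p = n"
proof -
  have "ex p = ex n" by (rule HOL.ext) (rule assms)
  then have "fc (ex p) n = fc (ex n) n" by simp
  then show ?thesis by (simp add: fc_ex split: if_splits)
qed

lemma ee_nz: "ee n \<noteq> (\<lambda>k. 0)"
proof
  assume "ee n = (\<lambda>k. 0)"
  then have "ee n (rot 0) = 0" by simp
  then have "ex n 0 = 0" unfolding ee_rot .
  then show False using norm_ex[of n 0] by (metis norm_zero zero_neq_one)
qed

lemma Ktype_iff:
  assumes V: "closed_submodule \<sigma> \<nu> V" shows "n \<in> Ktypes \<nu> V \<longleftrightarrow> ee n \<in> V"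
proof
  assume "n \<in> Ktypes \<nu> V"
  then obtain f where f: "f \<in> V" "f \<noteq> (\<lambda>k. 0)" "\<And>k0. k0 \<in> SO2 \<Longrightarrow> act \<nu> k0 f = (\<lambda>k. delta n k0 * f k)"
    unfolding Ktypes_def by blast
  have H: "f \<in> Hinf \<sigma>" using V f(1) unfolding closed_submodule_def by blast
  obtain p where p: "fcm f p \<noteq> 0"
  proof (rule ccontr)
    assume "\<not> thesis"
    then have "\<And>p. fcm f p = fcm (\<lambda>k. 0) p" using that fcm_0 by auto
    then have "f = (\<lambda>k. 0)" by (rule Hinf_fcm_eqI[OF H Hinf_0])
    then show False using f(2) by simp
  qed
  have "ex p t = ex n t" for t
  proof -
    have "ex p (- (- t)) * fcm f p = delta n (rot (- t)) * fcm f p"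
      unfolding fcm_act_rot[OF H, of \<nu>, symmetric] f(3)[OF rot_SO2] fc_scale ..
    then show ?thesis using p by (simp add: delta_rot ex_def)
  qed
  then have "p = n" by (rule ex_inj)
  then show "ee n \<in> V" using submodule_type[OF V f(1)] p by blast
next
  assume e: "ee n \<in> V"
  note ee_nz[of n]
  moreover have "act \<nu> k0 (ee n) = (\<lambda>k. delta n k0 * ee n k)" if k0: "k0 \<in> SO2" for k0
  proof -
    obtain t where t: "k0 = rot t" using k0 by (auto simp: SO2_def)
    have "ex n (- t) = delta n (rot t)" by (simp add: ex_def delta_rot)
    then show ?thesis unfolding t act_rot_ee by simp
  qed
  ultimately show "n \<in> Ktypes \<nu> V" unfolding Ktypes_def using e by blast
qed

lemma Ktypes_unique:
  assumes "closed_submodule \<sigma> \<nu> V" "closed_submodule \<sigma> \<nu> W" "Ktypes \<nu> V = Ktypes \<nu> W" shows "V = W"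
proof -
  have "ee n \<in> V \<longleftrightarrow> par \<sigma> n \<and> n \<in> {n. ee n \<in> V}" for n
    using assms(1) ee_kset[of n \<sigma> UNIV] unfolding closed_submodule_def kset_def by auto
  then have V: "V = kset \<sigma> {n. ee n \<in> V}" by (rule submodule_ksetI[OF assms(1)])
  have "ee n \<in> W \<longleftrightarrow> par \<sigma> n \<and> n \<in> {n. ee n \<in> W}" for n
    using assms(2) ee_kset[of n \<sigma> UNIV] unfolding closed_submodule_def kset_def by auto
  then have W: "W = kset \<sigma> {n. ee n \<in> W}" by (rule submodule_ksetI[OF assms(2)])
  have "{n. ee n \<in> V} = {n. ee n \<in> W}"
    using assms(3) Ktype_iff[OF assms(1)] Ktype_iff[OF assms(2)] by blast
  then show ?thesis using V W by simp
qed

section \<open>Irreducible submodules at the reducibility points\<close>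

lemma Qup_zero: "Qup p i \<nu> = 0 \<Longrightarrow> \<exists>l<i. \<nu> + (1 + of_int p) / 2 + of_nat l = 0"
  unfolding Qup_def by auto

text \<open>A vanishing factor marks the K-type at which the path from p to n is blocked: it is -s
  on the way up and s on the way down, and n lies beyond it.\<close>

lemma Q_zero_Nset:
  assumes "even (n - p)" "Q p n \<nu> = 0" "2 * \<nu> + 1 = of_int s" shows "n \<notin> Nset s p"
  using assms(1)
proof (cases rule: even_cases)
  case (1 i)
  then obtain l where l: "l < i" "\<nu> + (1 + of_int p) / 2 + of_nat l = 0"
    using assms(2) Qup_zero[of p i \<nu>] by (auto simp: Q_up)
  have "(2 * \<nu> + 1) + of_int p + 2 * of_nat l = 2 * (\<nu> + (1 + of_int p) / 2 + of_nat l)" by (simp add: field_simps)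
  then have "(2 * \<nu> + 1) + of_int p + 2 * of_nat l = 0" unfolding l(2) by simp
  then have "(of_int (s + p + 2 * int l) :: complex) = 0" unfolding assms(3) by simp
  then have "s + p + 2 * int l = 0" by (simp only: of_int_eq_0_iff)
  then show ?thesis using 1 l(1) by (auto simp: Nset_def)
next
  case (2 i)
  then obtain l where l: "l < i" "\<nu> + (1 + of_int (- p)) / 2 + of_nat l = 0"
    using assms(2) Qup_zero[of "- p" i \<nu>] by (auto simp: Q_down)
  have "(2 * \<nu> + 1) + of_int (- p) + 2 * of_nat l = 2 * (\<nu> + (1 + of_int (- p)) / 2 + of_nat l)" by (simp add: field_simps)
  then have "(2 * \<nu> + 1) + of_int (- p) + 2 * of_nat l = 0" unfolding l(2) by simp
  then have "(of_int (s - p + 2 * int l) :: complex) = 0" unfolding assms(3) by simp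
  then have "s - p + 2 * int l = 0" by (simp only: of_int_eq_0_iff)
  then show ?thesis using 2 l(1) by (auto simp: Nset_def)
qed

text \<open>A nonzero submodule contains some \<open>ee p\<close>. By the hypothesis on
  \<open>Nset\<close> every other type of the module is reached from p along a path on which
  \<open>Q\<close> does not vanish.\<close>

lemma kset_irreducible:
  assumes s: "2 * \<nu> + 1 = of_int s" "par \<sigma> s" and N: "\<And>n. n \<in> Nset s m \<Longrightarrow> Nset s m \<subseteq> Nset s n"
    and ne: "par \<sigma> n0" "n0 \<in> Nset s m"
  shows "irreducible_submodule \<sigma> \<nu> (kset \<sigma> (Nset s m))"
  unfolding irreducible_submodule_def
proof (intro conjI allI impI)
  show "closed_submodule \<sigma> \<nu> (kset \<sigma> (Nset s m))" by (rule Nset_submodule[OF s])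
  have "ee n0 \<in> kset \<sigma> (Nset s m)" using ne by (simp add: ee_kset)
  moreover note ee_nz[of n0]
  ultimately show "kset \<sigma> (Nset s m) \<noteq> {\<lambda>k. 0}" by blast
  fix V assume "closed_submodule \<sigma> \<nu> V \<and> V \<subseteq> kset \<sigma> (Nset s m)"
  then have V: "closed_submodule \<sigma> \<nu> V" "V \<subseteq> kset \<sigma> (Nset s m)" by auto
  show "V = {\<lambda>k. 0} \<or> V = kset \<sigma> (Nset s m)"
  proof (cases "V = {\<lambda>k. 0}")
    case False
    have z: "(\<lambda>k. 0) \<in> V" using V(1) unfolding closed_submodule_def by blast
    then obtain f where f: "f \<in> V" "f \<noteq> (\<lambda>k. 0)" using False by blast
    have H: "f \<in> Hinf \<sigma>" using V(1) f(1) unfolding closed_submodule_def by blast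
    obtain p where p: "fcm f p \<noteq> 0"
    proof (rule ccontr)
      assume "\<not> thesis"
      then have "\<And>p. fcm f p = fcm (\<lambda>k. 0) p" using that fcm_0 by auto
      then have "f = (\<lambda>k. 0)" by (rule Hinf_fcm_eqI[OF H Hinf_0])
      then show False using f(2) by simp
    qed
    have ep: "ee p \<in> V" by (rule submodule_type[OF V(1) f(1) p])
    then have pN: "par \<sigma> p" "p \<in> Nset s m" using V(2) ee_kset by blast+
    have "ee n \<in> V" if "par \<sigma> n" "n \<in> Nset s m" for n
    proof (rule submodule_reach[OF V(1) pN(1) ep])
      show ev: "even (n - p)" using that(1) par_even[OF pN(1)] by blast
      show "Q p n \<nu> \<noteq> 0" using Q_zero_Nset[OF ev _ s(1)] N[OF pN(2)] that(2) by blast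
    qed
    then have "V = kset \<sigma> (Nset s m)"
      using V(2) ee_kset by (intro submodule_ksetI[OF V(1)]) blast
    then show ?thesis by simp
  qed simp
qed

lemma irreducible_the:
  assumes "irreducible_submodule \<sigma> \<nu> W" "Ktypes \<nu> W = T"
  shows "(THE W. irreducible_submodule \<sigma> \<nu> W \<and> Ktypes \<nu> W = T) = W"
proof (rule the_equality)
  fix W' assume "irreducible_submodule \<sigma> \<nu> W' \<and> Ktypes \<nu> W' = T"
  then show "W' = W" using assms Ktypes_unique[of \<sigma> \<nu> W' W] by (auto simp: irreducible_submodule_def)
qed (use assms in simp)

text \<open>\<open>Nset (1 - int k) 0\<close> is the interval |n| \<le> k - 1. The type 0 only marks
  the middle component and may have the wrong parity for \<sigma>.\<close>

lemma Fsub_eq: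
  assumes "k \<ge> 1" "par \<sigma> (1 - int k)"
  shows "Fsub \<sigma> k = kset \<sigma> (Nset (1 - int k) 0)"
  unfolding Fsub_def
proof (rule irreducible_the)
  have N: "Nset (1 - int k) 0 = {1 - int k..int k - 1}" using assms(1) by (auto simp: Nset_def)
  have s: "2 * (- (of_nat k / 2)) + 1 = (of_int (1 - int k) :: complex)" by simp
  show irr: "irreducible_submodule \<sigma> (- (of_nat k / 2)) (kset \<sigma> (Nset (1 - int k) 0))"
  proof (rule kset_irreducible[OF s assms(2) _ assms(2)])
    show "Nset (1 - int k) 0 \<subseteq> Nset (1 - int k) n" if "n \<in> Nset (1 - int k) 0" for n
      using that unfolding N by (auto simp: Nset_def)
    show "1 - int k \<in> Nset (1 - int k) 0" unfolding N using assms(1) by simp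
  qed
  have cs: "closed_submodule \<sigma> (- (of_nat k / 2)) (kset \<sigma> (Nset (1 - int k) 0))"
    using irr by (simp add: irreducible_submodule_def)
  show "Ktypes (- (of_nat k / 2)) (kset \<sigma> (Nset (1 - int k) 0)) = {- (int k - 1) + 2 * int j |j. j < k}"
  proof (intro set_eqI)
    fix n
    have "n \<in> Ktypes (- (of_nat k / 2)) (kset \<sigma> (Nset (1 - int k) 0)) \<longleftrightarrow> even (n - (1 - int k)) \<and> 1 - int k \<le> n \<and> n \<le> int k - 1"
      unfolding Ktype_iff[OF cs] unfolding ee_kset N par_even[OF assms(2)] by auto
    also have "\<dots> \<longleftrightarrow> n \<in> {- (int k - 1) + 2 * int j |j. j < k}"
    proof
      assume a: "even (n - (1 - int k)) \<and> 1 - int k \<le> n \<and> n \<le> int k - 1"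
      then have "even (n - (1 - int k))" by blast
      then obtain c where c: "n - (1 - int k) = 2 * c" by (elim evenE)
      then have "n = - (int k - 1) + 2 * int (nat c)" "nat c < k" using a by linarith+
      then show "n \<in> {- (int k - 1) + 2 * int j |j. j < k}" by blast
    qed auto
    finally show "n \<in> Ktypes (- (of_nat k / 2)) (kset \<sigma> (Nset (1 - int k) 0)) \<longleftrightarrow> n \<in> {- (int k - 1) + 2 * int j |j. j < k}" .
  qed
qed

text \<open>The sign \<open>e\<close> treats both series together, since multiplication by it is an
  involution. The case k = 0 covers the two halves of the principal series at the parameter
  0.\<close>

lemma Dsub_eq:
  assumes e: "e = 1 \<or> e = -1" and p: "par \<sigma> (int k + 1)"
  shows "Dsub \<sigma> e k = kset \<sigma> (Nset (int k + 1) (e * (int k + 1)))"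
  unfolding Dsub_def
proof (rule irreducible_the)
  let ?N = "Nset (int k + 1) (e * (int k + 1))"
  have N: "n \<in> ?N \<longleftrightarrow> e * n \<ge> int k + 1" for n using e by (elim disjE) (auto simp: Nset_def)
  have ee: "e * (e * x) = x" for x using e by auto
  have ev: "even (e * n - c) \<longleftrightarrow> even (n - c)" for n c :: int using e by (elim disjE) auto
  have s: "2 * (of_nat k / 2) + 1 = (of_int (int k + 1) :: complex)" by simp
  have pe: "par \<sigma> (e * (int k + 1))" unfolding par_even[OF p] ev by simp
  show irr: "irreducible_submodule \<sigma> (of_nat k / 2) (kset \<sigma> ?N)"
  proof (rule kset_irreducible[OF s p _ pe])
    show "?N \<subseteq> Nset (int k + 1) n" if "n \<in> ?N" for n
    proof
      fix x assume "x \<in> ?N"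
      then show "x \<in> Nset (int k + 1) n" using that e unfolding N by (elim disjE) (auto simp: Nset_def)
    qed
    show "e * (int k + 1) \<in> ?N" unfolding N ee by simp
  qed
  have cs: "closed_submodule \<sigma> (of_nat k / 2) (kset \<sigma> ?N)" using irr by (simp add: irreducible_submodule_def)
  show "Ktypes (of_nat k / 2) (kset \<sigma> ?N) = {e * (int k + 1 + 2 * int j) |j. True}"
  proof (intro set_eqI)
    fix n
    have "n \<in> Ktypes (of_nat k / 2) (kset \<sigma> ?N) \<longleftrightarrow> even (n - (int k + 1)) \<and> e * n \<ge> int k + 1"
      unfolding Ktype_iff[OF cs] unfolding ee_kset N par_even[OF p] ..
    also have "\<dots> \<longleftrightarrow> n \<in> {e * (int k + 1 + 2 * int j) |j. True}"
    proof
      assume a: "even (n - (int k + 1)) \<and> e * n \<ge> int k + 1"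
      then have "even (e * n - (int k + 1))" unfolding ev by blast
      then obtain c where c: "e * n - (int k + 1) = 2 * c" by (elim evenE)
      then have "e * n = int k + 1 + 2 * int (nat c)" using a by linarith
      then have "e * (e * n) = e * (int k + 1 + 2 * int (nat c))" by simp
      then show "n \<in> {e * (int k + 1 + 2 * int j) |j. True}" unfolding ee by blast
    next
      assume "n \<in> {e * (int k + 1 + 2 * int j) |j. True}"
      then obtain j where n: "n = e * (int k + 1 + 2 * int j)" by blast
      have en: "e * n = int k + 1 + 2 * int j" using n ee[of "int k + 1 + 2 * int j"] by argo
      have "even (e * n - (int k + 1))" unfolding en by simp
      then have "even (n - (int k + 1))" unfolding ev .
      moreover have "e * n \<ge> int k + 1" unfolding en by simp
      ultimately show "even (n - (int k + 1)) \<and> e * n \<ge> int k + 1" ..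
    qed
    finally show "n \<in> Ktypes (of_nat k / 2) (kset \<sigma> ?N) \<longleftrightarrow> n \<in> {e * (int k + 1 + 2 * int j) |j. True}" .
  qed
qed

subsection \<open>The submodules above the finite-dimensional ones\<close>

lemma submodule_add:
  assumes "closed_submodule \<sigma> \<nu> V" "f \<in> V" "h \<in> V" shows "(\<lambda>k. f k + h k) \<in> V"
proof -
  have "\<forall>f\<in>V. \<forall>h\<in>V. (\<lambda>k. f k + h k) \<in> V" using assms(1) unfolding closed_submodule_def by (elim conjE)
  then show ?thesis using assms(2,3) by blast
qed

text \<open>Up to a constant, \<open>gq k n\<close> is the eigenvalue on the \<open>K\<close>-type \<open>n\<close> of the normalized Knapp-Stein operator
  from the parameter \<open>-k/2\<close> to \<open>k/2\<close>, whose kernel is \<open>F\<^sub>k\<close>.\<close>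

definition gq :: "nat \<Rightarrow> int \<Rightarrow> complex" where
  "gq k n = (\<Prod>i<k. of_int (n - int k + 1 + 2 * int i))"

text \<open>The factors run from n - k + 1 to n + k - 1 in steps of 2. For the given parity they are
  even, so 0 is among them exactly when it lies between the ends.\<close>

lemma gq_zero:
  assumes "even (n - (int k + 1))" shows "gq k n = 0 \<longleftrightarrow> \<bar>n\<bar> < int k"
proof
  assume "gq k n = 0"
  then obtain i where "i < k" "(of_int (n - int k + 1 + 2 * int i) :: complex) = 0" by (auto simp: gq_def simp del: of_int_add of_int_diff)
  then have "n - int k + 1 + 2 * int i = 0" "i < k" by (simp_all only: of_int_eq_0_iff)
  then show "\<bar>n\<bar> < int k" by linarith
next
  assume a: "\<bar>n\<bar> < int k"
  obtain c where c: "n - (int k + 1) = 2 * c" using assms by (elim evenE)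
  define i where "i = nat (- c - 1)"
  have i: "int i = - c - 1" "i < k" using a c by (auto simp: i_def)
  have "n - int k + 1 + 2 * int i = 0" using c i(1) by linarith
  then have "(of_int (n - int k + 1 + 2 * int i) :: complex) = 0" by (simp only: of_int_0)
  then show "gq k n = 0" unfolding gq_def using i(2) by (intro prod_zero) auto
qed

lemma gq_upper: "norm (gq k n) \<le> (1 + real k) ^ k * (1 + \<bar>of_int n\<bar>) ^ k"
proof -
  have "norm (gq k n) \<le> (\<Prod>i<k. (1 + real k) * (1 + \<bar>of_int n\<bar>))"
    unfolding gq_def
  proof (subst prod_norm[symmetric], rule prod_mono, intro conjI)
    fix i assume "i \<in> {..<k}"
    then have "\<bar>n - int k + 1 + 2 * int i\<bar> \<le> int k + \<bar>n\<bar>" by auto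
    then have "real_of_int \<bar>n - int k + 1 + 2 * int i\<bar> \<le> of_int (int k + \<bar>n\<bar>)" by (simp only: of_int_le_iff)
    also have "\<dots> \<le> (1 + real k) * (1 + \<bar>of_int n\<bar>)" by (simp add: algebra_simps)
    finally show "norm (of_int (n - int k + 1 + 2 * int i) :: complex) \<le> (1 + real k) * (1 + \<bar>of_int n\<bar>)"
      unfolding norm_of_int by simp
  qed simp
  also have "\<dots> = (1 + real k) ^ k * (1 + \<bar>of_int n\<bar>) ^ k" by (simp add: power_mult_distrib)
  finally show ?thesis .
qed

text \<open>A nonzero integer has absolute value at least 1. This bounds the inverse multiplier and
  so gives surjectivity of the quotient map.\<close>

lemma gq_lower: assumes "gq k n \<noteq> 0" shows "norm (gq k n) \<ge> 1"
proof -
  have g: "gq k n = of_int (\<Prod>i<k. n - int k + 1 + 2 * int i)" by (simp add: gq_def)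
  then have "(\<Prod>i<k. n - int k + 1 + 2 * int i) \<noteq> 0" using assms by (metis of_int_0)
  then have "\<bar>\<Prod>i<k. n - int k + 1 + 2 * int i\<bar> \<ge> 1" by linarith
  then have "real_of_int \<bar>\<Prod>i<k. n - int k + 1 + 2 * int i\<bar> \<ge> of_int 1" by (simp only: of_int_le_iff)
  then show ?thesis unfolding g norm_of_int by simp
qed

text \<open>Replacing n by n + 2 drops the first factor of the product and appends a new last
  one.\<close>

lemma gq_rec: "gq k (x + 2) * (of_int x - of_nat k + 1) = gq k x * (of_int x + of_nat k + 1)"
proof -
  let ?a = "\<lambda>i. of_int (x - int k + 1 + 2 * int i) :: complex"
  have "gq k (x + 2) = (\<Prod>i<k. ?a (Suc i))" unfolding gq_def by (intro prod.cong refl arg_cong[of _ _ of_int]) simp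
  then have "?a 0 * gq k (x + 2) = (\<Prod>i<Suc k. ?a i)" unfolding prod.lessThan_Suc_shift by simp
  also have "\<dots> = gq k x * ?a k" unfolding prod.lessThan_Suc gq_def ..
  finally show ?thesis by (simp add: algebra_simps)
qed

lemma gq_rec_half:
  "gq k (x + 2) * (- (of_nat k / 2) + (1 + of_int x) / 2) = gq k x * (of_nat k / 2 + (1 + of_int x) / 2)"
  "gq k (x - 2) * (- (of_nat k / 2) + (1 + of_int (- x)) / 2) = gq k x * (of_nat k / 2 + (1 + of_int (- x)) / 2)"
proof -
  have e: "- (of_nat k / 2) + (1 + of_int x) / 2 = (of_int x - of_nat k + 1) / (2 :: complex)"
     "of_nat k / 2 + (1 + of_int x) / 2 = (of_int x + of_nat k + 1) / (2 :: complex)"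
     "- (of_nat k / 2) + (1 + of_int (- x)) / 2 = - (of_int (x - 2) + of_nat k + 1) / (2 :: complex)"
     "of_nat k / 2 + (1 + of_int (- x)) / 2 = - (of_int (x - 2) - of_nat k + 1) / (2 :: complex)" by (simp_all add: field_simps)
  show "gq k (x + 2) * (- (of_nat k / 2) + (1 + of_int x) / 2) = gq k x * (of_nat k / 2 + (1 + of_int x) / 2)"
    unfolding e times_divide_eq_right gq_rec ..
  show "gq k (x - 2) * (- (of_nat k / 2) + (1 + of_int (- x)) / 2) = gq k x * (of_nat k / 2 + (1 + of_int (- x)) / 2)"
    unfolding e times_divide_eq_right mult_minus_right gq_rec[symmetric] by simp
qed

lemma gq_Qup:
  "gq k (p + 2 * int i) * Qup p i (- (of_nat k / 2)) = gq k p * Qup p i (of_nat k / 2)"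
  "gq k (p - 2 * int i) * Qup (- p) i (- (of_nat k / 2)) = gq k p * Qup (- p) i (of_nat k / 2)"
proof (induction i)
  case (Suc i)
  {
    case 1
    let ?x = "p + 2 * int i"
    have x: "p + 2 * int (Suc i) = ?x + 2" by simp
    have "gq k (?x + 2) * (- (of_nat k / 2) + (1 + of_int ?x) / 2) = gq k ?x * (of_nat k / 2 + (1 + of_int ?x) / 2)"
      by (rule gq_rec_half)
    then have "Qup p i (- (of_nat k / 2)) * (gq k (?x + 2) * (- (of_nat k / 2) + (1 + of_int ?x) / 2)) =
       (gq k ?x * Qup p i (- (of_nat k / 2))) * (of_nat k / 2 + (1 + of_int ?x) / 2)" by (simp only: mult_ac)
    then show ?case unfolding Qup_Suc x Suc.IH(1) by (simp only: mult_ac)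
  next
    case 2
    let ?x = "p - 2 * int i"
    have x: "p - 2 * int (Suc i) = ?x - 2" by simp
    have y: "- p + 2 * int i = - ?x" by simp
    have "gq k (?x - 2) * (- (of_nat k / 2) + (1 + of_int (- ?x)) / 2) = gq k ?x * (of_nat k / 2 + (1 + of_int (- ?x)) / 2)"
      by (rule gq_rec_half)
    then have "Qup (- p) i (- (of_nat k / 2)) * (gq k (?x - 2) * (- (of_nat k / 2) + (1 + of_int (- ?x)) / 2)) =
       (gq k ?x * Qup (- p) i (- (of_nat k / 2))) * (of_nat k / 2 + (1 + of_int (- ?x)) / 2)" by (simp only: mult_ac)
    then show ?case unfolding Qup_Suc x y Suc.IH(2) by (simp only: mult_ac)
  }
qed (simp_all add: Qup_def)

lemma gq_Q:
  assumes "even (n - p)" shows "gq k n * Q p n (- (of_nat k / 2)) = gq k p * Q p n (of_nat k / 2)"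
  using assms by (cases rule: even_cases) (simp_all only: Q_up Q_down gq_Qup)

text \<open>The intertwining relation on the types e p \<ge> 1 - k. If p is a type of the
  finite-dimensional module, then \<open>gq k p\<close> is 0, and wherever \<open>gq k n\<close> is
  not 0 no coefficient leads from p to n. If p and n both belong to the discrete series of sign
  \<open>e\<close>, then \<open>Q p n\<close> is nonzero at k / 2 and cancels from
  \<open>Mc_Q\<close> combined with \<open>gq_Q\<close>. In the remaining case both sides vanish,
  because the discrete series and the module above the finite-dimensional one are invariant.\<close>

lemma gq_Mc:
  assumes g: "g \<in> SL2" and e: "e = 1 \<or> e = -1" and p: "e * p \<ge> 1 - int k" "even (p - (int k + 1))" and n: "even (n - (int k + 1))"
  shows "gq k n * Mc g n p (- (of_nat k / 2)) = gq k p * Mc g n p (of_nat k / 2)"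
proof -
  have s: "2 * (- (of_nat k / 2)) + 1 = (of_int (1 - int k) :: complex)" "2 * (of_nat k / 2) + 1 = (of_int (int k + 1) :: complex)"
    by simp_all
  have ev: "even (n - p)" "even (p - (1 - int k))" using n p(2) by presburger+
  show ?thesis
  proof (cases "gq k p = 0")
    case True
    then have pk: "\<bar>p\<bar> < int k" using gq_zero[OF p(2)] by simp
    have "Mc g n p (- (of_nat k / 2)) = 0" if "gq k n \<noteq> 0"
    proof (cases "n < 1 - int k")
      case True
      show ?thesis by (rule Mc_zero_lower[OF g s(1)]) (use True pk ev in auto)
    next
      case False
      have "\<not> \<bar>n\<bar> < int k" using that gq_zero[OF n] by simp
      then have "n > - (1 - int k)" using False by linarith
      then show ?thesis by (intro Mc_zero_upper[OF g s(1)]) (use pk ev in auto)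
    qed
    then show ?thesis using True by (cases "gq k n = 0") auto
  next
    case False
    then have "\<not> \<bar>p\<bar> < int k" using gq_zero[OF p(2)] by simp
    then have pk: "e * p \<ge> int k + 1" using p e by (elim disjE) (simp_all, presburger+)
    show ?thesis
    proof (cases "e * n \<ge> int k + 1")
      case True
      have "n \<in> Nset (int k + 1) p" using True pk e by (elim disjE) (auto simp: Nset_def)
      then have Q: "Q p n (of_nat k / 2) \<noteq> 0" using Q_zero_Nset[OF ev(1) _ s(2)] by blast
      have "Q p n (of_nat k / 2) * Mc g n p (- (of_nat k / 2)) = Q p n (- (of_nat k / 2)) * Mc g n p (of_nat k / 2)"
        using Mc_Q[OF g ev(1), of "- (of_nat k / 2)"] by simp
      then have "Q p n (of_nat k / 2) * (gq k n * Mc g n p (- (of_nat k / 2))) = (gq k n * Q p n (- (of_nat k / 2))) * Mc g n p (of_nat k / 2)"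
        by (simp only: mult_ac)
      also have "\<dots> = Q p n (of_nat k / 2) * (gq k p * Mc g n p (of_nat k / 2))"
        unfolding gq_Q[OF ev(1)] by (simp only: mult_ac)
      finally show ?thesis using Q by simp
    next
      case F: False
      have 1: "Mc g n p (of_nat k / 2) = 0"
        using e
      proof
        assume "e = 1" then show ?thesis by (intro Mc_zero_lower[OF g s(2)]) (use pk F p in auto)
      next
        assume "e = -1" then show ?thesis by (intro Mc_zero_upper[OF g s(2)]) (use pk F p in auto)
      qed
      have "Mc g n p (- (of_nat k / 2)) = 0" if "gq k n \<noteq> 0"
      proof -
        have nn: "\<not> \<bar>n\<bar> < int k" using that gq_zero[OF n] by simp
        show ?thesis using e
        proof
          assume e1: "e = 1"
          have "n < 1 - int k" using nn F e1 n by simp presburger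
          then show ?thesis by (intro Mc_zero_lower[OF g s(1)]) (use pk e1 ev in auto)
        next
          assume e1: "e = -1"
          have "n > - (1 - int k)" using nn F e1 n by simp presburger
          then show ?thesis by (intro Mc_zero_upper[OF g s(1)]) (use pk e1 ev in auto)
        qed
      qed
      then show ?thesis using 1 by (cases "gq k n = 0") auto
    qed
  qed
qed

lemma fcm_sers: "rd a \<Longrightarrow> fcm (sers a) n = a n"
  by (simp add: fc_ser)

context
  fixes \<sigma> :: mhat and k :: nat and e :: int
  assumes k: "k \<ge> 1" and e: "e = 1 \<or> e = -1" and pk: "par \<sigma> (int k + 1)"
begin

text \<open>The normalized Knapp-Stein operator as a Fourier multiplier, the witness for
  \<open>quotient_iso\<close>.\<close>

definition Tq :: "(mat2 \<Rightarrow> complex) \<Rightarrow> mat2 \<Rightarrow> complex" where "Tq f = sers (\<lambda>n. gq k n * fcm f n)"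

lemma Tq:
  assumes "f \<in> Hinf \<sigma>"
  shows "Tq f \<in> Hinf \<sigma>" "fcm (Tq f) n = gq k n * fcm f n"
proof -
  have rd: "rd (\<lambda>n. gq k n * fcm f n)" by (rule rd_mult_poly[OF rd_fc[OF Hinf_SP[OF assms]] gq_upper])
  show "Tq f \<in> Hinf \<sigma>" unfolding Tq_def by (rule sers_Hinf[OF rd]) (simp add: Hinf_par[OF assms])
  show "fcm (Tq f) n = gq k n * fcm f n" unfolding Tq_def by (rule fcm_sers[OF rd])
qed

lemma Tq_bounded:
  assumes f: "f \<in> Hinf \<sigma>"
  shows "snorm i (Tq f) \<le> (1 + real k) ^ k * 2 ^ (i + 2 + k) * 2 * wsum * (\<Sum>j\<le>i + 2 + k. snorm j f)"
proof -
  note S = Hinf_SP[OF f]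
  let ?M = "i + 2 + k"
  let ?s = "\<Sum>j\<le>?M. snorm j f"
  have rd: "rd (\<lambda>n. gq k n * fcm f n)" by (rule rd_mult_poly[OF rd_fc[OF S] gq_upper])
  have le: "snorm j f \<le> ?s" if "j \<le> ?M" for j
    by (rule member_le_sum) (use that snorm_nonneg[OF f] in auto)
  have "sn i (ser (\<lambda>n. gq k n * fcm f n)) \<le> (1 + real k) ^ k * 2 ^ ?M * 2 * ?s * wsum"
  proof (rule sn_ser[OF _ rd])
    fix n
    define y :: real where "y = 1 + \<bar>of_int n\<bar>"
    have y: "y \<ge> 0" by (simp add: y_def)
    have "y ^ (i + 2) * norm (gq k n * fcm f n) \<le> y ^ (i + 2) * ((1 + real k) ^ k * y ^ k * norm (fcm f n))"
      unfolding norm_mult using y gq_upper[of k n] by (intro mult_left_mono mult_right_mono) (auto simp: y_def)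
    also have "\<dots> = (1 + real k) ^ k * (y ^ ?M * norm (fcm f n))" by (simp add: power_add mult_ac)
    also have "\<dots> \<le> (1 + real k) ^ k * (2 ^ ?M * (snorm 0 f + snorm ?M f))"
      unfolding y_def snorm_sn by (intro mult_left_mono fc_decay'[OF S]) simp
    also have "\<dots> \<le> (1 + real k) ^ k * (2 ^ ?M * (?s + ?s))"
      by (intro mult_left_mono add_mono le) simp_all
    also have "\<dots> = (1 + real k) ^ k * 2 ^ ?M * 2 * ?s" by (simp only: mult_2[symmetric] mult.assoc)
    finally show "(1 + \<bar>of_int n\<bar>) ^ (i + 2) * norm (gq k n * fcm f n) \<le> (1 + real k) ^ k * 2 ^ ?M * 2 * ?s"
      unfolding y_def .
  qed
  then show ?thesis unfolding snorm_sn Tq_def sers_rot by (simp only: mult_ac)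
qed

text \<open>Within the parity of \<sigma>, the three conditions single out the K-types of the
  finite-dimensional module, of the discrete series of sign \<open>e\<close>, and of the module
  whose quotient by the former is the latter.\<close>

abbreviation "NF \<equiv> {n. \<bar>n\<bar> < int k}"
abbreviation "ND \<equiv> {n. e * n \<ge> int k + 1}"
abbreviation "NW \<equiv> {n. e * n \<ge> 1 - int k}"

lemma gq_par: "par \<sigma> n \<Longrightarrow> gq k n = 0 \<longleftrightarrow> n \<in> NF"
  using gq_zero par_even[OF pk] by simp

text \<open>The values k and -k, which lie between the two ranges, are excluded by parity.\<close>

lemma NF_ND: "par \<sigma> n \<Longrightarrow> n \<in> NW \<longleftrightarrow> n \<in> NF \<or> n \<in> ND"
proof -
  assume "par \<sigma> n"
  then have "even (n - (int k + 1))" using par_even[OF pk] by blast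
  then obtain c where c: "n - (int k + 1) = 2 * c" by (elim evenE)
  then have nk: "n \<noteq> int k" "n \<noteq> - int k" by presburger+
  from e show ?thesis
  proof
    assume "e = 1" then show ?thesis using nk k by auto
  next
    assume "e = -1" then show ?thesis using nk k by auto
  qed
qed

lemma NF_ND_disjoint: "n \<in> NF \<Longrightarrow> n \<notin> ND" using e by auto

lemma Fsub_NF: "Fsub \<sigma> k = kset \<sigma> NF"
proof -
  have "par \<sigma> (1 - int k)" unfolding par_even[OF pk] by simp
  then have "Fsub \<sigma> k = kset \<sigma> (Nset (1 - int k) 0)" by (rule Fsub_eq[OF k])
  also have "Nset (1 - int k) 0 = NF" using k by (auto simp: Nset_def)
  finally show ?thesis .
qed

lemma Dsub_ND: "Dsub \<sigma> e k = kset \<sigma> ND"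
proof -
  have "Nset (int k + 1) (e * (int k + 1)) = ND" using e by (elim disjE) (auto simp: Nset_def)
  then show ?thesis using Dsub_eq[OF e pk] by simp
qed

lemma quotient_iso_Tq: "quotient_iso (- (of_nat k / 2)) (kset \<sigma> NW) (Fsub \<sigma> k) (of_nat k / 2) (Dsub \<sigma> e k)"
  unfolding quotient_iso_def
proof (intro exI[of _ Tq] conjI ballI allI)
  fix f h assume f: "f \<in> kset \<sigma> NW" and h: "h \<in> kset \<sigma> NW"
  note H = ksetD(1)[OF f] ksetD(1)[OF h]
  show "Tq (\<lambda>k. f k + h k) = (\<lambda>k. Tq f k + Tq h k)"
    by (rule Hinf_fcm_eqI[OF Tq(1)[OF Hinf_add[OF H]] Hinf_add[OF Tq(1)[OF H(1)] Tq(1)[OF H(2)]]])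
      (simp add: Tq(2)[OF H(1)] Tq(2)[OF H(2)] Tq(2)[OF Hinf_add[OF H]] fcm_add[OF H] fcm_add[OF Tq(1)[OF H(1)] Tq(1)[OF H(2)]] distrib_left)
next
  fix c f assume f: "f \<in> kset \<sigma> NW"
  note H = ksetD(1)[OF f]
  show "Tq (\<lambda>k. c * f k) = (\<lambda>k. c * Tq f k)"
    by (rule Hinf_fcm_eqI[OF Tq(1)[OF Hinf_scale[OF H]] Hinf_scale[OF Tq(1)[OF H]]])
      (simp add: Tq(2)[OF H] Tq(2)[OF Hinf_scale[OF H]] fc_scale)
next
  fix i show "\<exists>N C. \<forall>f\<in>kset \<sigma> NW. snorm i (Tq f) \<le> C * (\<Sum>j\<le>N. snorm j f)"
    using Tq_bounded ksetD(1) by blast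
next
  fix g f assume g: "g \<in> SL2" and f: "f \<in> kset \<sigma> NW"
  note H = ksetD(1)[OF f]
  note A = act_Hinf[OF g H, of "- (of_nat k / 2)"] act_Hinf[OF g Tq(1)[OF H], of "of_nat k / 2"]
  show "Tq (act (- (of_nat k / 2)) g f) = act (of_nat k / 2) g (Tq f)"
  proof (rule Hinf_fcm_eqI[OF Tq(1)[OF A(1)] A(2)])
    fix n
    show "fcm (Tq (act (- (of_nat k / 2)) g f)) n = fcm (act (of_nat k / 2) g (Tq f)) n"
    proof (cases "par \<sigma> n")
      case True
      have t: "fcm f p * (gq k n * Mc g n p (- (of_nat k / 2))) = fcm f p * (gq k p * Mc g n p (of_nat k / 2))" for p
      proof (cases "fcm f p = 0")
        case False
        then have "p \<in> NW" "par \<sigma> p" using ksetD(2)[OF f] Hinf_par[OF H] by blast+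
        then have "gq k n * Mc g n p (- (of_nat k / 2)) = gq k p * Mc g n p (of_nat k / 2)"
          using True par_even[OF pk] by (intro gq_Mc[OF g e]) auto
        then show ?thesis by simp
      qed simp
      have "(\<lambda>j. gq k n * (fcm f (int_decode j) * Mc g n (int_decode j) (- (of_nat k / 2)))) sums fcm (Tq (act (- (of_nat k / 2)) g f)) n"
        unfolding Tq(2)[OF A(1)] by (intro sums_mult fcm_act_sums[OF H g])
      moreover have "gq k n * (fcm f p * Mc g n p (- (of_nat k / 2))) = fcm (Tq f) p * Mc g n p (of_nat k / 2)" for p
        unfolding Tq(2)[OF H] using t[of p] by (simp only: mult_ac)
      ultimately have "(\<lambda>j. fcm (Tq f) (int_decode j) * Mc g n (int_decode j) (of_nat k / 2)) sums fcm (Tq (act (- (of_nat k / 2)) g f)) n"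
        by simp
      then show ?thesis using fcm_act_sums[OF Tq(1)[OF H] g] by (rule sums_unique2)
    qed (simp add: Hinf_par[OF A(2)] Hinf_par[OF Tq(1)[OF A(1)]])
  qed
next
  show "Tq ` kset \<sigma> NW = Dsub \<sigma> e k" unfolding Dsub_ND
  proof (intro equalityI subsetI)
    fix h assume "h \<in> Tq ` kset \<sigma> NW"
    then obtain f where f: "f \<in> kset \<sigma> NW" and h: "h = Tq f" by blast
    note H = ksetD(1)[OF f]
    have "n \<in> ND" if "fcm h n \<noteq> 0" for n
    proof -
      have n: "gq k n \<noteq> 0" "fcm f n \<noteq> 0" using that unfolding h Tq(2)[OF H] by auto
      then have "par \<sigma> n" "n \<in> NW" using Hinf_par[OF H] ksetD(2)[OF f] by blast+
      then show ?thesis using NF_ND gq_par n by blast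
    qed
    then show "h \<in> kset \<sigma> ND" unfolding kset_def using Tq(1)[OF H] h by blast
  next
    fix h assume h: "h \<in> kset \<sigma> ND"
    note H = ksetD(1)[OF h]
    \<comment> \<open>The preimage divides by the multiplier. Where \<open>gq k n\<close> is 0, and
      with it its \<open>inverse\<close>, the coefficient of \<open>h\<close> is 0 as well, since
      \<open>ND\<close> and \<open>NF\<close> are disjoint.\<close>
    let ?f = "sers (\<lambda>n. inverse (gq k n) * fcm h n)"
    have "norm (inverse (gq k n)) \<le> 1 * (1 + \<bar>of_int n\<bar>) ^ 0" for n
      using gq_lower[of k n] by (cases "gq k n = 0") (auto simp: norm_inverse inverse_le_1_iff)
    then have rd: "rd (\<lambda>n. inverse (gq k n) * fcm h n)" by (rule rd_mult_poly[OF rd_fc[OF Hinf_SP[OF H]]])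
    have fH: "?f \<in> Hinf \<sigma>" by (rule sers_Hinf[OF rd]) (simp add: Hinf_par[OF H])
    have W: "?f \<in> kset \<sigma> NW"
      unfolding kset_def
    proof (rule CollectI, intro conjI allI impI fH)
      fix n assume "fcm ?f n \<noteq> 0"
      then have "fcm h n \<noteq> 0" unfolding fcm_sers[OF rd] by auto
      then have "n \<in> ND" using ksetD(2)[OF h] by blast
      then show "n \<in> NW" using k by auto
    qed
    have "Tq ?f = h"
    proof (rule Hinf_fcm_eqI[OF Tq(1)[OF fH] H])
      fix n
      show "fcm (Tq ?f) n = fcm h n"
      proof (cases "fcm h n = 0")
        case False
        then have "n \<in> ND" "par \<sigma> n" using ksetD(2)[OF h] Hinf_par[OF H] by blast+
        then have "gq k n \<noteq> 0" using gq_par NF_ND_disjoint by blast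
        then show ?thesis unfolding Tq(2)[OF fH] fcm_sers[OF rd] by simp
      qed (simp add: Tq(2)[OF fH] fcm_sers[OF rd] del: sers_rot)
    qed
    then show "h \<in> Tq ` kset \<sigma> NW" using imageI[OF W, of Tq] by simp
  qed
next
  show "{f \<in> kset \<sigma> NW. Tq f = (\<lambda>k. 0)} = Fsub \<sigma> k" unfolding Fsub_NF
  proof (intro equalityI subsetI)
    fix f assume "f \<in> {f \<in> kset \<sigma> NW. Tq f = (\<lambda>k. 0)}"
    then have f: "f \<in> Hinf \<sigma>" and T: "Tq f = (\<lambda>k. 0)" by (auto simp: kset_def)
    have "n \<in> NF" if "fcm f n \<noteq> 0" for n
    proof -
      have "gq k n * fcm f n = 0" using Tq(2)[OF f, of n] unfolding T by (simp add: fcm_0)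
      then show ?thesis using that gq_par Hinf_par[OF f] by auto
    qed
    then show "f \<in> kset \<sigma> NF" unfolding kset_def using f by blast
  next
    fix f assume f: "f \<in> kset \<sigma> NF"
    note H = ksetD(1)[OF f]
    have "fcm (Tq f) n = fcm (\<lambda>k. 0) n" for n
      unfolding Tq(2)[OF H] fcm_0 using ksetD(2)[OF f, of n] gq_par[of n] Hinf_par[OF H, of n] by (cases "fcm f n = 0") auto
    then have "Tq f = (\<lambda>k. 0)" by (rule Hinf_fcm_eqI[OF Tq(1)[OF H] Hinf_0])
    moreover have "f \<in> kset \<sigma> NW" unfolding kset_def using H ksetD(2)[OF f] Hinf_par[OF H] NF_ND by blast
    ultimately show "f \<in> {f \<in> kset \<sigma> NW. Tq f = (\<lambda>k. 0)}" by blast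
  qed
qed

text \<open>Any witness \<open>T\<close> commutes with K, so \<open>T (ee n)\<close> has no K-type
  other than n. Hence each type of \<open>V\<close> is one of the kernel or one of the image.
  Conversely a type n of the image occurs in every preimage of \<open>ee n\<close>: otherwise
  \<open>T\<close> would have coefficient 0 at n on all truncations of the preimage and, by
  continuity, on the preimage itself.\<close>

lemma quotient_iso_unique:
  assumes V: "closed_submodule \<sigma> (- (of_nat k / 2)) V" "Fsub \<sigma> k \<subseteq> V"
    and q: "quotient_iso (- (of_nat k / 2)) V (Fsub \<sigma> k) (of_nat k / 2) (Dsub \<sigma> e k)"
  shows "V = kset \<sigma> NW"
proof -
  obtain T where add: "\<forall>f\<in>V. \<forall>h\<in>V. T (\<lambda>k. f k + h k) = (\<lambda>k. T f k + T h k)"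
    and scale: "\<forall>c. \<forall>f\<in>V. T (\<lambda>k. c * f k) = (\<lambda>k. c * T f k)"
    and bd: "\<forall>n. \<exists>N C. \<forall>f\<in>V. snorm n (T f) \<le> C * (\<Sum>j\<le>N. snorm j f)"
    and eqv: "\<forall>g\<in>SL2. \<forall>f\<in>V. T (act (- (of_nat k / 2)) g f) = act (of_nat k / 2) g (T f)"
    and img: "T ` V = kset \<sigma> ND" and ker: "{f \<in> V. T f = (\<lambda>k. 0)} = kset \<sigma> NF"
    using q unfolding quotient_iso_def Fsub_NF Dsub_ND by (elim exE conjE)
  note VH = submodule_Hinf[OF V(1)]
  have TD: "T f \<in> kset \<sigma> ND" if "f \<in> V" for f using img that by blast
  note TH = ksetD(1)[OF TD]
  have T0: "T (\<lambda>k. 0) = (\<lambda>k. 0)" using scale[rule_format, OF submodule_0[OF V(1)], of 0] by simp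
  have type: "p = n" if "ee n \<in> V" "fcm (T (ee n)) p \<noteq> 0" for n p
  proof (rule ex_inj)
    fix t
    have "T (act (- (of_nat k / 2)) (rot (- t)) (ee n)) = act (of_nat k / 2) (rot (- t)) (T (ee n))"
      using eqv that(1) SL2_rot by blast
    then have A: "act (of_nat k / 2) (rot (- t)) (T (ee n)) = (\<lambda>k. ex n (- (- t)) * T (ee n) k)"
      unfolding act_rot_ee scale[rule_format, OF that(1)] by (rule sym)
    have "fcm (\<lambda>k. ex n (- (- t)) * T (ee n) k) p = ex p (- (- t)) * fcm (T (ee n)) p"
      using fcm_act_rot[OF TH[OF that(1)], of "of_nat k / 2" "- t" p] unfolding A .
    then show "ex p t = ex n t" unfolding fc_scale using that(2) by simp
  qed
  show ?thesis
  proof (rule submodule_ksetI[OF V(1)])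
    fix n
    show "ee n \<in> V \<longleftrightarrow> par \<sigma> n \<and> n \<in> NW"
    proof
      assume n: "ee n \<in> V"
      have pn: "par \<sigma> n" using Hinf_par[OF VH[OF n], of n] by (auto simp: fc_ex)
      show "par \<sigma> n \<and> n \<in> NW"
      proof (cases "T (ee n) = (\<lambda>k. 0)")
        case True
        then have "ee n \<in> kset \<sigma> NF" using n ker by blast
        then show ?thesis using ee_kset NF_ND pn by blast
      next
        case False
        then obtain p where p: "fcm (T (ee n)) p \<noteq> 0"
          using Hinf_fcm_eqI[OF TH[OF n] Hinf_0] fcm_0 by metis
        then have "fcm (T (ee n)) n \<noteq> 0" using type[OF n p] by simp
        then have "n \<in> ND" using ksetD(2)[OF TD[OF n]] by blast
        then show ?thesis using NF_ND pn by blast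
      qed
    next
      assume a: "par \<sigma> n \<and> n \<in> NW"
      show "ee n \<in> V"
      proof (cases "n \<in> NF")
        case True
        then show ?thesis using V(2) ee_kset a unfolding Fsub_NF by blast
      next
        case False
        then have "ee n \<in> T ` V" unfolding img ee_kset using a NF_ND by blast
        then obtain f where f: "f \<in> V" "T f = ee n" by force
        note fH = VH[OF f(1)]
        have "fcm f n \<noteq> 0"
        proof
          assume z: "fcm f n = 0"
          have P: "(\<lambda>k. \<Sum>p\<in>J. fcm f p * ee p k) \<in> V \<and> fcm (T (\<lambda>k. \<Sum>p\<in>J. fcm f p * ee p k)) n = 0" if "finite J" for J
            using that
          proof induction
            case empty show ?case using submodule_0[OF V(1)] by (simp add: T0 fcm_0)
          next
            case (insert p J)
            let ?P = "\<lambda>k. \<Sum>p\<in>J. fcm f p * ee p k"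
            have s: "(\<lambda>k. \<Sum>p\<in>insert p J. fcm f p * ee p k) = (\<lambda>k. fcm f p * ee p k + ?P k)"
              using insert.hyps by simp
            show ?case
            proof (cases "fcm f p = 0")
              case True then show ?thesis unfolding s using insert.IH by simp
            next
              case False
              have p: "ee p \<in> V" by (rule submodule_type[OF V(1) f(1) False])
              have "p \<noteq> n" using False z by auto
              then have "fcm (T (ee p)) n = 0" using type[OF p, of n] by auto
              then have "fcm (T (\<lambda>k. fcm f p * ee p k)) n = 0" unfolding scale[rule_format, OF p] fc_scale by simp
              moreover note pV = submodule_scale[OF V(1) p, of "fcm f p"]
              moreover have "(\<lambda>k. fcm f p * ee p k + ?P k) \<in> V"
                by (rule submodule_add[OF V(1) pV conjunct1[OF insert.IH]])
              ultimately show ?thesis unfolding s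
                using insert.IH add[rule_format, OF pV, of ?P] fcm_add[OF TH[OF pV] TH, of ?P] by auto
            qed
          qed
          obtain N C where C: "\<forall>f\<in>V. snorm 0 (T f) \<le> C * (\<Sum>j\<le>N. snorm j f)" using bd by blast
          define K where "K = (\<Sum>j\<le>N. 2 ^ (j + 3) * (snorm 0 f + snorm (j + 3) f) * wsum)"
          \<comment> \<open>The difference of \<open>f\<close> and its truncation is mapped to a
            vector with coefficient 1 at n, while its seminorms are O(1 / L). Continuity of
            \<open>T\<close> gives this inequality, which fails for large L.\<close>
          have le: "1 \<le> \<bar>C\<bar> * K / (1 + real L)" for L
          proof -
            let ?J = "{- int L..int L}"
            let ?P = "\<lambda>k. \<Sum>p\<in>?J. fcm f p * ee p k"
            have P': "?P \<in> V" "fcm (T ?P) n = 0" using P[of ?J] by auto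
            have mV: "(\<lambda>k. (-1) * ?P k) \<in> V" by (rule submodule_scale[OF V(1) P'(1)])
            have dV: "(\<lambda>k. f k + (-1) * ?P k) \<in> V" by (rule submodule_add[OF V(1) f(1) mV])
            let ?b = "\<lambda>p. if p \<in> ?J then 0 else (1::complex)"
            have d: "fcm (\<lambda>k. f k + (-1) * ?P k) p = ?b p * fcm f p" for p
            proof -
              have "fcm (\<lambda>k. f k + (-1) * ?P k) p = fcm f p + fcm (\<lambda>k. (-1) * ?P k) p"
                by (rule fcm_add[OF fH VH[OF mV]])
              also have "fcm (\<lambda>k. (-1) * ?P k) p = - fcm ?P p" unfolding fc_scale by simp
              also have "fcm ?P p = (\<Sum>q\<in>?J. fc (\<lambda>\<theta>. fcm f q * ee q (rot \<theta>)) p)"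
                by (rule fc_sum) (auto intro!: SP_cont SP_scale)
              also have "\<dots> = (\<Sum>q\<in>?J. if p = q then fcm f p else 0)"
                by (intro sum.cong refl) (auto simp: fc_scale fc_ex)
              also have "\<dots> = (if p \<in> ?J then fcm f p else 0)" by (rule sum.delta') simp
              finally show ?thesis by simp
            qed
            have "fcm (T (\<lambda>k. f k + (-1) * ?P k)) n = fcm (T f) n + fcm (T (\<lambda>k. (-1) * ?P k)) n"
              using add[rule_format, OF f(1) mV] fcm_add[OF TH[OF f(1)] TH[OF mV]] by simp
            also have "fcm (T (\<lambda>k. (-1) * ?P k)) n = - fcm (T ?P) n"
              unfolding scale[rule_format, OF P'(1)] fc_scale by simp
            finally have "fcm (T (\<lambda>k. f k + (-1) * ?P k)) n = 1" using P'(2) f(2) by (simp add: fc_ex)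
            then have "1 \<le> snorm 0 (T (\<lambda>k. f k + (-1) * ?P k))" using fcm_bound[OF TH[OF dV], of n] by simp
            also have "\<dots> \<le> C * (\<Sum>j\<le>N. snorm j (\<lambda>k. f k + (-1) * ?P k))" using C dV by blast
            also have "\<dots> \<le> \<bar>C\<bar> * (\<Sum>j\<le>N. snorm j (\<lambda>k. f k + (-1) * ?P k))"
              using snorm_nonneg[OF VH[OF dV]] by (intro mult_right_mono sum_nonneg) auto
            also have "\<dots> \<le> \<bar>C\<bar> * (\<Sum>j\<le>N. 2 ^ (j + 3) * (snorm 0 f + snorm (j + 3) f) / (1 + real L) * wsum)"
              by (intro mult_left_mono sum_mono snorm_tail[OF VH[OF dV] fH d]) auto
            also have "(\<Sum>j\<le>N. 2 ^ (j + 3) * (snorm 0 f + snorm (j + 3) f) / (1 + real L) * wsum) = K / (1 + real L)"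
              unfolding K_def sum_divide_distrib by (intro sum.cong refl) simp
            finally show ?thesis by simp
          qed
          obtain L :: nat where "\<bar>C\<bar> * K < real L" using reals_Archimedean2 by blast
          then show False using le[of L] by (simp add: pos_le_divide_eq)
        qed
        then show ?thesis by (rule submodule_type[OF V(1) f(1)])
      qed
    qed
  qed
qed

lemma the_quotient_iso:
  "(THE W. closed_submodule \<sigma> (- (of_nat k / 2)) W \<and> Fsub \<sigma> k \<subseteq> W \<and>
     quotient_iso (- (of_nat k / 2)) W (Fsub \<sigma> k) (of_nat k / 2) (Dsub \<sigma> e k)) = kset \<sigma> NW"
proof (rule the_equality)
  have s: "2 * (- (of_nat k / 2)) + 1 = (of_int (1 - int k) :: complex)" by simp
  have p: "par \<sigma> (1 - int k)" unfolding par_even[OF pk] by simp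
  have "Nset (1 - int k) (e * (int k + 1)) = NW" using e by (elim disjE) (auto simp: Nset_def)
  then have "closed_submodule \<sigma> (- (of_nat k / 2)) (kset \<sigma> NW)" using Nset_submodule[OF s p] by metis
  moreover have "Fsub \<sigma> k \<subseteq> kset \<sigma> NW" unfolding Fsub_NF kset_def using NF_ND Hinf_par by blast
  ultimately show "closed_submodule \<sigma> (- (of_nat k / 2)) (kset \<sigma> NW) \<and> Fsub \<sigma> k \<subseteq> kset \<sigma> NW \<and>
     quotient_iso (- (of_nat k / 2)) (kset \<sigma> NW) (Fsub \<sigma> k) (of_nat k / 2) (Dsub \<sigma> e k)"
    using quotient_iso_Tq by blast
qed (use quotient_iso_unique in blast)

end

section \<open>The modules of (2.b) as sets of K-types\<close>

lemma red_pts_int: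
  assumes "r \<in> red_pts (restrM m)" obtains s :: int where "2 * r + 1 = of_int s" "even (s - m)"
proof (cases "even m")
  case True
  then obtain j where "r = 1 / 2 + of_int j" using assms by (auto simp: restrM_def)
  then have "2 * r + 1 = of_int (2 + 2 * j)" by simp
  then show ?thesis by (rule that) (use True in simp)
next
  case False
  then obtain j where "r = of_int j" using assms by (auto simp: restrM_def)
  then have "2 * r + 1 = of_int (1 + 2 * j)" by simp
  then show ?thesis by (rule that) (use False in simp)
qed

text \<open>The five cases differ only in which of the two barriers, s and -s, the type m lies
  beyond. \<open>Nset s m\<close> records this uniformly.\<close>

lemma Wmod_eq:
  assumes s: "2 * r + 1 = of_int s" "even (s - m)"
  shows "Wmod m r = kset (restrM m) (Nset s m)"
proof -
  let ?\<sigma> = "restrM m"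
  define k where "k = nat \<bar>s - 1\<bar>"
  have r2: "2 * r = of_int (s - 1)" using s by simp
  have "2 * \<bar>r\<bar> = \<bar>2 * r\<bar>" by (simp add: abs_mult)
  then have "2 * \<bar>r\<bar> = of_int \<bar>s - 1\<bar>" unfolding r2 by simp
  then have kr: "nat \<lfloor>2 * \<bar>r\<bar>\<rfloor> = k" unfolding k_def by (simp only: floor_of_int)
  have pm: "par ?\<sigma> n \<longleftrightarrow> even (n - m)" for n by (rule par_even) simp
  have W: "Wmod m r = (if r < 0 then
       (if int k \<ge> \<bar>m\<bar> + 1 then Fsub ?\<sigma> k
        else (THE W. closed_submodule ?\<sigma> (of_real r) W \<and> Fsub ?\<sigma> k \<subseteq> W \<and>
                quotient_iso (of_real r) W (Fsub ?\<sigma> k) (of_nat k / 2) (Dsub ?\<sigma> (sgn m) k)))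
     else if r = 0 then Dsub ?\<sigma> (sgn m) 0
     else (if int k \<ge> \<bar>m\<bar> + 1 then Hinf ?\<sigma> else Dsub ?\<sigma> (sgn m) k))"
    unfolding Wmod_def Let_def kr ..
  have rs: "r < 0 \<longleftrightarrow> s < 1" "r = 0 \<longleftrightarrow> s = 1" using r2 by linarith+
  consider (a) "s < 1" "int k \<ge> \<bar>m\<bar> + 1" | (b) "s < 1" "\<not> int k \<ge> \<bar>m\<bar> + 1" | (c) "s = 1"
    | (d) "s > 1" "int k \<ge> \<bar>m\<bar> + 1" | (f) "s > 1" "\<not> int k \<ge> \<bar>m\<bar> + 1" by linarith
  then show ?thesis
  proof cases
    case a
    then have k: "int k = 1 - s" "k \<ge> 1" by (auto simp: k_def)
    have "Fsub ?\<sigma> k = kset ?\<sigma> (Nset (1 - int k) 0)"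
      by (rule Fsub_eq[OF k(2)]) (use k(1) pm s(2) in simp)
    moreover have "Nset (1 - int k) 0 = Nset s m" using a k by (auto simp: Nset_def)
    ultimately show ?thesis using W a rs by simp
  next
    case b
    then have k: "int k = 1 - s" "k \<ge> 1" by (auto simp: k_def)
    \<comment> \<open>Parity excludes |m| = k, because s - m is even and k = 1 - s.\<close>
    have m: "\<bar>m\<bar> \<ge> int k + 1" using b(2) k(1) s(2) by presburger
    then have e: "sgn m = 1 \<or> sgn m = -1" by (auto simp: sgn_if)
    have p: "par ?\<sigma> (int k + 1)" unfolding pm using k(1) s(2) by presburger
    have "r = - (real k / 2)" using r2 k by linarith
    then have rk: "(of_real r :: complex) = - (of_nat k / 2)" by simp
    have "Wmod m r = kset ?\<sigma> {n. sgn m * n \<ge> 1 - int k}"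
      using W b rs the_quotient_iso[OF k(2) e p] unfolding rk by simp
    also have "{n. sgn m * n \<ge> 1 - int k} = Nset s m"
      using m k by (cases "m > 0") (auto simp: Nset_def sgn_if)
    finally show ?thesis .
  next
    case c
    then have k: "k = 0" by (simp add: k_def)
    \<comment> \<open>Here s = 1, so m is odd and its sign is 1 or -1.\<close>
    have m: "m \<noteq> 0" using s c by auto
    then have e: "sgn m = 1 \<or> sgn m = -1" by (auto simp: sgn_if)
    have "Dsub ?\<sigma> (sgn m) 0 = kset ?\<sigma> (Nset (int 0 + 1) (sgn m * (int 0 + 1)))"
      by (rule Dsub_eq[OF e]) (use pm s(2) c in simp)
    moreover have "Nset (int 0 + 1) (sgn m * (int 0 + 1)) = Nset s m" using m c by (auto simp: Nset_def sgn_if)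
    ultimately show ?thesis using W c rs by simp
  next
    case d
    then have "Nset s m = UNIV" by (auto simp: Nset_def k_def)
    then show ?thesis using W d rs by (simp add: kset_def)
  next
    case f
    then have k: "int k = s - 1" "k \<ge> 1" by (auto simp: k_def)
    have m: "\<bar>m\<bar> \<ge> s" using f(2) k(1) s(2) by presburger
    then have e: "sgn m = 1 \<or> sgn m = -1" using f by (auto simp: sgn_if)
    have "Dsub ?\<sigma> (sgn m) k = kset ?\<sigma> (Nset (int k + 1) (sgn m * (int k + 1)))"
      by (rule Dsub_eq[OF e]) (use pm s(2) k in simp)
    moreover have "Nset (int k + 1) (sgn m * (int k + 1)) = Nset s m"
      using m f k by (cases "m > 0") (auto simp: Nset_def sgn_if)
    ultimately show ?thesis using W f rs by simp
  qed
qed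

subsection \<open>Jets\<close>

lemma hol_germ_fam: "hol_germ \<sigma> \<nu> \<phi> \<longleftrightarrow> (\<exists>U. open U \<and> \<nu> \<in> U \<and> fam \<sigma> U \<phi>)"
  unfolding hol_germ_def using hol_into_iff_fam by blast

lemma fam_hol_germ: "fam \<sigma> UNIV \<phi> \<Longrightarrow> hol_germ \<sigma> \<nu> \<phi>"
  unfolding hol_germ_fam using open_UNIV by blast

lemma hol_germ_Hinf: "hol_germ \<sigma> \<nu> \<phi> \<Longrightarrow> \<phi> \<nu> \<in> Hinf \<sigma>"
  unfolding hol_germ_fam using fam_Hinf by blast

lemma hol_germ_both:
  assumes "hol_germ \<sigma> \<nu> \<phi>" "hol_germ \<sigma> \<nu> \<psi>"
  obtains U where "open U" "\<nu> \<in> U" "fam \<sigma> U \<phi>" "fam \<sigma> U \<psi>"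
proof -
  obtain U where U: "open U" "\<nu> \<in> U" "fam \<sigma> U \<phi>" using assms(1) unfolding hol_germ_fam by blast
  obtain V where V: "open V" "\<nu> \<in> V" "fam \<sigma> V \<psi>" using assms(2) unfolding hol_germ_fam by blast
  show ?thesis
    by (rule that[of "U \<inter> V"]) (use U V in \<open>auto intro!: open_Int fam_subset[OF U(3)] fam_subset[OF V(3)]\<close>)
qed

lemma hol_germ_add:
  assumes "hol_germ \<sigma> \<nu> \<phi>" "hol_germ \<sigma> \<nu> \<psi>" shows "hol_germ \<sigma> \<nu> (\<lambda>\<mu> k. \<phi> \<mu> k + \<psi> \<mu> k)"
proof -
  obtain U where U: "open U" "\<nu> \<in> U" "fam \<sigma> U \<phi>" "fam \<sigma> U \<psi>" by (rule hol_germ_both[OF assms])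
  show ?thesis unfolding hol_germ_fam using U fam_add[OF U(3,4)] by blast
qed

lemma hol_germ_diff:
  assumes "hol_germ \<sigma> \<nu> \<phi>" "hol_germ \<sigma> \<nu> \<psi>" shows "hol_germ \<sigma> \<nu> (\<lambda>\<mu> k. \<phi> \<mu> k - \<psi> \<mu> k)"
proof -
  obtain U where U: "open U" "\<nu> \<in> U" "fam \<sigma> U \<phi>" "fam \<sigma> U \<psi>" by (rule hol_germ_both[OF assms])
  show ?thesis unfolding hol_germ_fam using U fam_diff[OF U(1,3,4)] by blast
qed

lemma hol_germ_mult:
  assumes "t analytic_on {\<nu>}" "hol_germ \<sigma> \<nu> \<phi>" shows "hol_germ \<sigma> \<nu> (\<lambda>\<mu> k. t \<mu> * \<phi> \<mu> k)"
proof -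
  obtain U where U: "open U" "\<nu> \<in> U" "fam \<sigma> U \<phi>" using assms(2) unfolding hol_germ_fam by blast
  obtain V where V: "open V" "\<nu> \<in> V" "t holomorphic_on V"
    using assms(1) analytic_at by blast
  have W: "open (U \<inter> V)" using U V by blast
  have "fam \<sigma> (U \<inter> V) (\<lambda>\<mu> k. t \<mu> * \<phi> \<mu> k)"
    by (rule fam_mult[OF W holomorphic_on_subset[OF V(3)] fam_subset[OF U(3) _ W]]) auto
  then show ?thesis unfolding hol_germ_fam using U V W by blast
qed

lemma hol_germ_act: assumes "g \<in> SL2" "hol_germ \<sigma> \<nu> \<phi>" shows "hol_germ \<sigma> \<nu> (act_germ g \<phi>)"
proof -
  obtain U where U: "open U" "\<nu> \<in> U" "fam \<sigma> U \<phi>" using assms(2) unfolding hol_germ_fam by blast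
  show ?thesis unfolding hol_germ_fam using U fam_act[OF assms(1) U(1,3)] by blast
qed

lemma hol_germ_const: "f \<in> Hinf \<sigma> \<Longrightarrow> hol_germ \<sigma> \<nu> (\<lambda>\<mu>. f)"
  by (rule fam_hol_germ[OF fam_const[OF open_UNIV]])

lemma jet_refl: assumes "hol_germ \<sigma> \<nu> \<phi>" shows "\<phi> \<in> jet \<sigma> \<nu> d \<phi>"
  unfolding jet_def using assms hol_germ_const[OF Hinf_0, of \<sigma> \<nu>] by (intro CollectI conjI exI[of _ "\<lambda>\<mu> k. 0"]) auto

lemma jet_eqI:
  assumes h: "hol_germ \<sigma> \<nu> \<eta>"
    "\<forall>\<^sub>F \<mu> in nhds \<nu>. \<forall>k. \<phi>' \<mu> k - \<phi> \<mu> k = (\<mu> - \<nu>) ^ (d + 1) * \<eta> \<mu> k"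
  shows "jet \<sigma> \<nu> d \<phi>' = jet \<sigma> \<nu> d \<phi>"
proof (intro equalityI subsetI)
  fix x assume x: "x \<in> jet \<sigma> \<nu> d \<phi>'"
  then obtain \<eta>' where e: "hol_germ \<sigma> \<nu> x" "hol_germ \<sigma> \<nu> \<eta>'" "\<forall>\<^sub>F \<mu> in nhds \<nu>. \<forall>k. x \<mu> k - \<phi>' \<mu> k = (\<mu> - \<nu>) ^ (d + 1) * \<eta>' \<mu> k"
    unfolding jet_def by blast
  have "\<forall>\<^sub>F \<mu> in nhds \<nu>. \<forall>k. x \<mu> k - \<phi> \<mu> k = (\<mu> - \<nu>) ^ (d + 1) * (\<eta>' \<mu> k + \<eta> \<mu> k)"
    using e(3) h(2)
  proof eventually_elim
    case (elim \<mu>)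
    show ?case
    proof
      fix k show "x \<mu> k - \<phi> \<mu> k = (\<mu> - \<nu>) ^ (d + 1) * (\<eta>' \<mu> k + \<eta> \<mu> k)"
        unfolding distrib_left elim(1)[rule_format, of k, symmetric] elim(2)[rule_format, of k, symmetric] by simp
    qed
  qed
  then show "x \<in> jet \<sigma> \<nu> d \<phi>" unfolding jet_def using e(1) hol_germ_add[OF e(2) h(1)] by blast
next
  fix x assume x: "x \<in> jet \<sigma> \<nu> d \<phi>"
  then obtain \<eta>' where e: "hol_germ \<sigma> \<nu> x" "hol_germ \<sigma> \<nu> \<eta>'" "\<forall>\<^sub>F \<mu> in nhds \<nu>. \<forall>k. x \<mu> k - \<phi> \<mu> k = (\<mu> - \<nu>) ^ (d + 1) * \<eta>' \<mu> k"
    unfolding jet_def by blast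
  have "\<forall>\<^sub>F \<mu> in nhds \<nu>. \<forall>k. x \<mu> k - \<phi>' \<mu> k = (\<mu> - \<nu>) ^ (d + 1) * (\<eta>' \<mu> k - \<eta> \<mu> k)"
    using e(3) h(2)
  proof eventually_elim
    case (elim \<mu>)
    show ?case
    proof
      fix k show "x \<mu> k - \<phi>' \<mu> k = (\<mu> - \<nu>) ^ (d + 1) * (\<eta>' \<mu> k - \<eta> \<mu> k)"
        unfolding right_diff_distrib elim(1)[rule_format, of k, symmetric] elim(2)[rule_format, of k, symmetric] by simp
    qed
  qed
  then show "x \<in> jet \<sigma> \<nu> d \<phi>'" unfolding jet_def using e(1) hol_germ_diff[OF e(2) h(1)] by blast
qed

text \<open>The exponent d + 1 is positive, so representatives of a class differ by something that
  vanishes at \<nu>, and evaluation at \<nu> is well defined on classes.\<close>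

lemma jet_value:
  assumes "hol_germ \<sigma> \<nu> \<phi>" "jet \<sigma> \<nu> d \<phi> = jet \<sigma> \<nu> d \<psi>" shows "\<phi> \<nu> = \<psi> \<nu>"
proof -
  have "\<phi> \<in> jet \<sigma> \<nu> d \<psi>" using jet_refl[OF assms(1), of d] unfolding assms(2) .
  then obtain \<eta> where "\<forall>\<^sub>F \<mu> in nhds \<nu>. \<forall>k. \<phi> \<mu> k - \<psi> \<mu> k = (\<mu> - \<nu>) ^ (d + 1) * \<eta> \<mu> k"
    unfolding jet_def by blast
  from eventually_nhds_x_imp_x[OF this] have "\<phi> \<nu> k = \<psi> \<nu> k" for k by simp
  then show ?thesis by (rule HOL.ext)
qed

lemma delta_Mgrp: assumes "x \<in> Mgrp" shows "delta m x = mchar (restrM m) x"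
proof -
  have r: "- mat 1 = rot pi" using rot_pi[of 0] by simp
  have "x = rot 0 \<or> x = rot pi" using assms unfolding Mgrp_def r by auto
  then show ?thesis
  proof
    assume x: "x = rot 0"
    show ?thesis unfolding x delta_rot by (auto simp: restrM_def)
  next
    assume x: "x = rot pi"
    have "delta m x = ex (- m) pi" unfolding x delta_rot ex_def by simp
    also have "\<dots> = (if even m then 1 else - 1)" by (simp add: ex_pi)
    also have "\<dots> = mchar (restrM m) x" using mat1_neq unfolding x r[symmetric] by (auto simp: restrM_def)
    finally show ?thesis .
  qed
qed

lemma frobenius_eq: "frobenius m t v = (\<lambda>\<mu> k. t \<mu> * (v * ee m k))"
  by (intro HOL.ext) (auto simp: frobenius_def ee_def)

section \<open>Consequences of (D.2) for data with two components of order zero\<close>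

text \<open>The datum has the components (\<sigma>, a, 0) and (\<sigma>, b, 0), and t = (1, 1). A
  class of order 0 is a vector, so \<open>W\<close> amounts to a closed invariant relation
  \<open>R\<close> between the principal series at a and at b. For proper \<open>R\<close>
  containing the pair of vectors \<open>ee m\<close>, (D.2) puts the pair of values of \<psi> into
  \<open>R\<close>.\<close>

lemma D2_pair:
  assumes D2: "condition_D2 m \<psi>" and \<psi>: "fam (restrM m) UNIV \<psi>"
    and R: "\<And>f h. (f, h) \<in> R \<Longrightarrow> f \<in> Hinf (restrM m) \<and> h \<in> Hinf (restrM m)"
    and add: "\<And>f h f' h'. (f, h) \<in> R \<Longrightarrow> (f', h') \<in> R \<Longrightarrow> (\<lambda>k. f k + f' k, \<lambda>k. h k + h' k) \<in> R"
    and scale: "\<And>c f h. (f, h) \<in> R \<Longrightarrow> (\<lambda>k. c * f k, \<lambda>k. c * h k) \<in> R"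
    and act: "\<And>g f h. g \<in> SL2 \<Longrightarrow> (f, h) \<in> R \<Longrightarrow> (act a g f, act b g h) \<in> R"
    and closed: "\<And>f h. f \<in> Hinf (restrM m) \<Longrightarrow> h \<in> Hinf (restrM m) \<Longrightarrow>
      (\<And>N \<epsilon>. \<epsilon> > 0 \<Longrightarrow> \<exists>f' h'. (f', h') \<in> R \<and> (\<forall>n\<le>N. snorm n (\<lambda>k. f k - f' k) < \<epsilon> \<and> snorm n (\<lambda>k. h k - h' k) < \<epsilon>)) \<Longrightarrow> (f, h) \<in> R"
    and proper: "fx \<in> Hinf (restrM m)" "hx \<in> Hinf (restrM m)" "(fx, hx) \<notin> R"
    and ee: "(ee m, ee m) \<in> R"
  shows "(\<psi> a, \<psi> b) \<in> R"
proof -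
  let ?\<sigma> = "restrM m"
  let ?\<xi> = "[(?\<sigma>, a, 0), (?\<sigma>, b, 0)] :: xi"
  define W where "W = {jets ?\<xi> [\<phi>1, \<phi>2] |\<phi>1 \<phi>2. hol_germ ?\<sigma> a \<phi>1 \<and> hol_germ ?\<sigma> b \<phi>2 \<and> (\<phi>1 a, \<phi>2 b) \<in> R}"
  have jets: "jets ?\<xi> [\<phi>1, \<phi>2] = [jet ?\<sigma> a 0 \<phi>1, jet ?\<sigma> b 0 \<phi>2]" for \<phi>1 \<phi>2 by (simp add: jets_def)
  have WR: "jets ?\<xi> [\<phi>1, \<phi>2] \<in> W \<longleftrightarrow> (\<phi>1 a, \<phi>2 b) \<in> R" if "hol_germ ?\<sigma> a \<phi>1" "hol_germ ?\<sigma> b \<phi>2" for \<phi>1 \<phi>2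
  proof
    assume "jets ?\<xi> [\<phi>1, \<phi>2] \<in> W"
    then obtain \<phi>1' \<phi>2' where p: "jets ?\<xi> [\<phi>1, \<phi>2] = jets ?\<xi> [\<phi>1', \<phi>2']" "(\<phi>1' a, \<phi>2' b) \<in> R" unfolding W_def by blast
    have "\<phi>1 a = \<phi>1' a" by (rule jet_value[OF that(1), of 0]) (use p(1) in \<open>simp add: jets\<close>)
    moreover have "\<phi>2 b = \<phi>2' b" by (rule jet_value[OF that(2), of 0]) (use p(1) in \<open>simp add: jets\<close>)
    ultimately show "(\<phi>1 a, \<phi>2 b) \<in> R" using p(2) by simp
  qed (use that in \<open>unfold W_def, blast\<close>)
  have germs: "\<phi>s \<in> germs ?\<xi> \<longleftrightarrow> (\<exists>\<phi>1 \<phi>2. \<phi>s = [\<phi>1, \<phi>2] \<and> hol_germ ?\<sigma> a \<phi>1 \<and> hol_germ ?\<sigma> b \<phi>2)" for \<phi>s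
    by (auto simp: germs_def list_all2_Cons1)
  have sub: "W \<subseteq> Hxi ?\<xi>" unfolding W_def Hxi_def using germs by blast
  have "jets ?\<xi> [\<lambda>\<mu>. fx, \<lambda>\<mu>. hx] \<in> Hxi ?\<xi>" unfolding Hxi_def using germs hol_germ_const[OF proper(1)] hol_germ_const[OF proper(2)] by blast
  moreover have "jets ?\<xi> [\<lambda>\<mu>. fx, \<lambda>\<mu>. hx] \<notin> W" using WR[OF hol_germ_const[OF proper(1)] hol_germ_const[OF proper(2)]] proper(3) by simp
  ultimately have ne: "W \<noteq> Hxi ?\<xi>" by blast
  have "closed_subrep ?\<xi> W"
    unfolding closed_subrep_def
  proof (intro conjI ballI allI impI sub)
    have "(\<lambda>k. 0 * ee m k, \<lambda>k. 0 * ee m k) \<in> R" by (rule scale[OF ee])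
    then show "jets ?\<xi> (map (\<lambda>_ \<mu> k. 0) ?\<xi>) \<in> W"
      using WR[OF hol_germ_const[OF Hinf_0] hol_germ_const[OF Hinf_0]] by simp
  next
    fix \<phi>s \<eta>s assume "\<phi>s \<in> germs ?\<xi>" "\<eta>s \<in> germs ?\<xi>" and W: "jets ?\<xi> \<phi>s \<in> W \<and> jets ?\<xi> \<eta>s \<in> W"
    then obtain \<phi>1 \<phi>2 \<eta>1 \<eta>2 where p: "\<phi>s = [\<phi>1, \<phi>2]" "hol_germ ?\<sigma> a \<phi>1" "hol_germ ?\<sigma> b \<phi>2"
      "\<eta>s = [\<eta>1, \<eta>2]" "hol_germ ?\<sigma> a \<eta>1" "hol_germ ?\<sigma> b \<eta>2" unfolding germs by blast
    have "(\<phi>1 a, \<phi>2 b) \<in> R" "(\<eta>1 a, \<eta>2 b) \<in> R" using W WR[OF p(2,3)] WR[OF p(5,6)] unfolding p(1,4) by blast+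
    then have "(\<lambda>k. \<phi>1 a k + \<eta>1 a k, \<lambda>k. \<phi>2 b k + \<eta>2 b k) \<in> R" by (rule add)
    then show "jets ?\<xi> (map2 (\<lambda>\<phi> \<eta> \<mu> k. \<phi> \<mu> k + \<eta> \<mu> k) \<phi>s \<eta>s) \<in> W"
      using WR[OF hol_germ_add[OF p(2,5)] hol_germ_add[OF p(3,6)]] unfolding p(1,4) by simp
  next
    fix c \<phi>s assume "\<phi>s \<in> germs ?\<xi>" and W: "jets ?\<xi> \<phi>s \<in> W"
    then obtain \<phi>1 \<phi>2 where p: "\<phi>s = [\<phi>1, \<phi>2]" "hol_germ ?\<sigma> a \<phi>1" "hol_germ ?\<sigma> b \<phi>2" unfolding germs by blast
    have "(\<phi>1 a, \<phi>2 b) \<in> R" using W WR[OF p(2,3)] unfolding p(1) by blast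
    then have "(\<lambda>k. c * \<phi>1 a k, \<lambda>k. c * \<phi>2 b k) \<in> R" by (rule scale)
    then show "jets ?\<xi> (map (\<lambda>\<phi> \<mu> k. c * \<phi> \<mu> k) \<phi>s) \<in> W"
      using WR[OF hol_germ_mult[OF analytic_on_const p(2), of c] hol_germ_mult[OF analytic_on_const p(3), of c]] unfolding p(1) by simp
  next
    fix g \<phi>s assume g: "g \<in> SL2" and "\<phi>s \<in> germs ?\<xi>" and W: "jets ?\<xi> \<phi>s \<in> W"
    then obtain \<phi>1 \<phi>2 where p: "\<phi>s = [\<phi>1, \<phi>2]" "hol_germ ?\<sigma> a \<phi>1" "hol_germ ?\<sigma> b \<phi>2" unfolding germs by blast
    have "(\<phi>1 a, \<phi>2 b) \<in> R" using W WR[OF p(2,3)] unfolding p(1) by blast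
    then have "(act a g (\<phi>1 a), act b g (\<phi>2 b)) \<in> R" by (rule act[OF g])
    then show "jets ?\<xi> (map (act_germ g) \<phi>s) \<in> W"
      using WR[OF hol_germ_act[OF g p(2)] hol_germ_act[OF g p(3)]] unfolding p(1) by (simp add: act_germ_def)
  next
    fix \<phi>s assume "\<phi>s \<in> germs ?\<xi>"
      and lim: "\<forall>N. \<forall>\<epsilon>>0. \<exists>\<eta>s\<in>germs ?\<xi>. jets ?\<xi> \<eta>s \<in> W \<and> jets_close ?\<xi> N \<epsilon> \<phi>s \<eta>s"
    then obtain \<phi>1 \<phi>2 where p: "\<phi>s = [\<phi>1, \<phi>2]" "hol_germ ?\<sigma> a \<phi>1" "hol_germ ?\<sigma> b \<phi>2" unfolding germs by blast
    have "(\<phi>1 a, \<phi>2 b) \<in> R"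
    proof (rule closed[OF hol_germ_Hinf[OF p(2)] hol_germ_Hinf[OF p(3)]])
      fix N and e :: real assume "e > 0"
      then obtain \<eta>s where "\<eta>s \<in> germs ?\<xi>" and W: "jets ?\<xi> \<eta>s \<in> W" and cl: "jets_close ?\<xi> N e \<phi>s \<eta>s" using lim by blast
      then obtain \<eta>1 \<eta>2 where q: "\<eta>s = [\<eta>1, \<eta>2]" "hol_germ ?\<sigma> a \<eta>1" "hol_germ ?\<sigma> b \<eta>2" unfolding germs by blast
      have "(\<eta>1 a, \<eta>2 b) \<in> R" using W WR[OF q(2,3)] unfolding q(1) by blast
      moreover have "\<forall>n\<le>N. snorm n (\<lambda>k. \<phi>1 a k - \<eta>1 a k) < e \<and> snorm n (\<lambda>k. \<phi>2 b k - \<eta>2 b k) < e"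
        using cl unfolding jets_close_def p(1) q(1) by simp
      ultimately show "\<exists>f' h'. (f', h') \<in> R \<and> (\<forall>n\<le>N. snorm n (\<lambda>k. \<phi>1 a k - f' k) < e \<and> snorm n (\<lambda>k. \<phi>2 b k - h' k) < e)" by blast
    qed
    then show "jets ?\<xi> \<phi>s \<in> W" using WR[OF p(2,3)] unfolding p(1) by blast
  qed
  then have dat: "intertwining_datum ?\<xi> W" using ne unfolding intertwining_datum_def by blast
  let ?t = "\<lambda>\<mu>::complex. 1::complex"
  have hg: "hom_germ m ?\<sigma> \<nu> ?t" for \<nu>
    unfolding hom_germ_def by (auto simp: delta_Mgrp)
  have eH: "ee m \<in> Hinf ?\<sigma>" by (rule ee_Hinf) simp
  have ts: "[?t, ?t] \<in> D_set m ?\<xi> W"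
    unfolding D_set_def
  proof (rule CollectI, intro conjI allI)
    fix v
    have g: "hol_germ ?\<sigma> \<nu> (\<lambda>\<mu> k. v * ee m k)" for \<nu> by (rule hol_germ_const[OF Hinf_scale[OF eH]])
    have "(\<lambda>k. v * ee m k, \<lambda>k. v * ee m k) \<in> R" by (rule scale[OF ee])
    then have "jets ?\<xi> [\<lambda>\<mu> k. v * ee m k, \<lambda>\<mu> k. v * ee m k] \<in> W" using WR[OF g g] by simp
    then show "jets ?\<xi> (map (\<lambda>t. frobenius m t v) [?t, ?t]) \<in> W" by (simp add: frobenius_eq)
  qed (simp add: hg)
  have "\<not> zero_class a 0 ?t"
  proof
    assume "zero_class a 0 ?t"
    then obtain r where "\<forall>\<^sub>F \<mu> in nhds a. 1 = (\<mu> - a) ^ (0 + 1) * r \<mu>" unfolding zero_class_def by blast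
    from eventually_nhds_x_imp_x[OF this] show False by simp
  qed
  then have "nonzero_tuple ?\<xi> [?t, ?t]" unfolding nonzero_tuple_def by simp
  then have "jets ?\<xi> (map (\<lambda>t \<mu> k. t \<mu> * \<psi> \<mu> k) [?t, ?t]) \<in> W"
    by (rule D2[unfolded condition_D2_def, rule_format, OF dat ts])
  then show ?thesis using WR[OF fam_hol_germ[OF \<psi>] fam_hol_germ[OF \<psi>]] by simp
qed

text \<open>Both points are taken equal and \<open>R\<close> is the product of \<open>V\<close> with
  the whole space. The case in which \<open>V\<close> is the whole space is separate, because
  \<open>R\<close> is then not proper.\<close>

lemma D2_submodule:
  assumes D2: "condition_D2 m \<psi>" and \<psi>: "fam (restrM m) UNIV \<psi>"
    and V: "closed_submodule (restrM m) \<nu> V" and ee: "ee m \<in> V"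
  shows "\<psi> \<nu> \<in> V"
proof (cases "V = Hinf (restrM m)")
  case True then show ?thesis using fam_Hinf[OF \<psi>] by simp
next
  case False
  let ?\<sigma> = "restrM m"
  obtain f0 where f0: "f0 \<in> Hinf ?\<sigma>" "f0 \<notin> V" using submodule_Hinf[OF V] False by blast
  have act: "act \<nu> g f \<in> V" if "g \<in> SL2" "f \<in> V" for g f
    using V that unfolding closed_submodule_def by blast
  have cl: "f \<in> V" if "f \<in> Hinf ?\<sigma>" "\<And>N \<epsilon>. \<epsilon> > 0 \<Longrightarrow> \<exists>h\<in>V. \<forall>n\<le>N. snorm n (\<lambda>k. f k - h k) < \<epsilon>" for f
    using V that unfolding closed_submodule_def by blast
  have eH: "ee m \<in> Hinf ?\<sigma>" by (rule ee_Hinf) simp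
  have "(\<psi> \<nu>, \<psi> \<nu>) \<in> {(f, h). f \<in> V \<and> h \<in> Hinf ?\<sigma>}"
  proof (rule D2_pair[OF D2 \<psi>, where fx = f0 and hx = "ee m"])
    fix f h assume "(f, h) \<in> {(f, h). f \<in> V \<and> h \<in> Hinf ?\<sigma>}"
    then show "f \<in> Hinf ?\<sigma> \<and> h \<in> Hinf ?\<sigma>" using submodule_Hinf[OF V] by blast
  next
    fix f h f' h' assume "(f, h) \<in> {(f, h). f \<in> V \<and> h \<in> Hinf ?\<sigma>}" "(f', h') \<in> {(f, h). f \<in> V \<and> h \<in> Hinf ?\<sigma>}"
    then show "(\<lambda>k. f k + f' k, \<lambda>k. h k + h' k) \<in> {(f, h). f \<in> V \<and> h \<in> Hinf ?\<sigma>}"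
      using submodule_add[OF V] Hinf_add by blast
  next
    fix c f h assume "(f, h) \<in> {(f, h). f \<in> V \<and> h \<in> Hinf ?\<sigma>}"
    then show "(\<lambda>k. c * f k, \<lambda>k. c * h k) \<in> {(f, h). f \<in> V \<and> h \<in> Hinf ?\<sigma>}"
      using submodule_scale[OF V] Hinf_scale by blast
  next
    fix g f h assume "g \<in> SL2" "(f, h) \<in> {(f, h). f \<in> V \<and> h \<in> Hinf ?\<sigma>}"
    then show "(act \<nu> g f, act \<nu> g h) \<in> {(f, h). f \<in> V \<and> h \<in> Hinf ?\<sigma>}" using act act_Hinf by blast
  next
    fix f h assume fh: "f \<in> Hinf ?\<sigma>" "h \<in> Hinf ?\<sigma>" and lim: "\<And>N \<epsilon>. \<epsilon> > 0 \<Longrightarrow> \<exists>f' h'. (f', h') \<in> {(f, h). f \<in> V \<and> h \<in> Hinf ?\<sigma>} \<and>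
      (\<forall>n\<le>N. snorm n (\<lambda>k. f k - f' k) < \<epsilon> \<and> snorm n (\<lambda>k. h k - h' k) < \<epsilon>)"
    have "f \<in> V"
    proof (rule cl[OF fh(1)])
      fix N and e :: real assume "e > 0"
      then show "\<exists>h\<in>V. \<forall>n\<le>N. snorm n (\<lambda>k. f k - h k) < e" using lim[of e N] by blast
    qed
    then show "(f, h) \<in> {(f, h). f \<in> V \<and> h \<in> Hinf ?\<sigma>}" using fh by blast
  qed (use f0 eH ee in auto)
  then show ?thesis by blast
qed

text \<open>\<open>R\<close> is the graph of the Knapp-Stein operator from a to -a, scaled to be 1
  on the type m and with denominators cleared, which keeps poles away. If \<open>gf m a\<close> is
  not 0, the pair of 0 and \<open>ee m\<close> is outside \<open>R\<close>, so \<open>R\<close> is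
  proper. The other parameters follow because the identity is between entire functions.\<close>

lemma D2_functional:
  assumes D2: "condition_D2 m \<psi>" and \<psi>: "fam (restrM m) UNIV \<psi>"
  shows "ex n (pi / 2) * gf n \<nu> * fcm (\<psi> \<nu>) n = ex m (pi / 2) * gf m \<nu> * fcm (\<psi> (- \<nu>)) n"
proof -
  let ?\<sigma> = "restrM m"
  define d where "d = (\<lambda>a n. ex n (pi / 2) * gf n a)"
  have eH: "ee m \<in> Hinf ?\<sigma>" by (rule ee_Hinf) simp
  have exn: "ex q t \<noteq> 0" for q t using norm_ex[of q t] by (metis norm_zero zero_neq_one)
  have main: "fcm (\<psi> (- a)) n * d a m = d a n * fcm (\<psi> a) n" if a: "gf m a \<noteq> 0" for a n
  proof -
    let ?R = "{(f, h). f \<in> Hinf ?\<sigma> \<and> h \<in> Hinf ?\<sigma> \<and> (\<forall>n. fcm h n * d a m = d a n * fcm f n)}"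
    have "(\<psi> a, \<psi> (- a)) \<in> ?R"
    proof (rule D2_pair[OF D2 \<psi>, where fx = "\<lambda>k. 0" and hx = "ee m"])
      fix f h assume "(f, h) \<in> ?R"
      then show "f \<in> Hinf ?\<sigma> \<and> h \<in> Hinf ?\<sigma>" by blast
    next
      fix f h f' h' assume "(f, h) \<in> ?R" "(f', h') \<in> ?R"
      then have H: "f \<in> Hinf ?\<sigma>" "h \<in> Hinf ?\<sigma>" "f' \<in> Hinf ?\<sigma>" "h' \<in> Hinf ?\<sigma>"
        and e: "fcm h n * d a m = d a n * fcm f n" "fcm h' n * d a m = d a n * fcm f' n" for n by auto
      have "fcm (\<lambda>k. h k + h' k) n * d a m = d a n * fcm (\<lambda>k. f k + f' k) n" for n
        unfolding fcm_add[OF H(2,4)] fcm_add[OF H(1,3)] distrib_left distrib_right e ..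
      then show "(\<lambda>k. f k + f' k, \<lambda>k. h k + h' k) \<in> ?R" using Hinf_add[OF H(1,3)] Hinf_add[OF H(2,4)] by blast
    next
      fix c f h assume "(f, h) \<in> ?R"
      then have H: "f \<in> Hinf ?\<sigma>" "h \<in> Hinf ?\<sigma>" and e: "fcm h n * d a m = d a n * fcm f n" for n by auto
      have "fcm (\<lambda>k. c * h k) n * d a m = d a n * fcm (\<lambda>k. c * f k) n" for n
        unfolding fc_scale using e[of n] by (simp only: mult_ac)
      then show "(\<lambda>k. c * f k, \<lambda>k. c * h k) \<in> ?R" using Hinf_scale[OF H(1)] Hinf_scale[OF H(2)] by blast
    next
      fix g f h assume g: "g \<in> SL2" and "(f, h) \<in> ?R"
      then have H: "f \<in> Hinf ?\<sigma>" "h \<in> Hinf ?\<sigma>" and e: "fcm h n * d a m = d a n * fcm f n" for n by auto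
      have "fcm (act (- a) g h) n * d a m = d a n * fcm (act a g f) n" for n
      proof (rule sums_unique2)
        show "(\<lambda>j. fcm h (int_decode j) * Mc g n (int_decode j) (- a) * d a m) sums (fcm (act (- a) g h) n * d a m)"
          by (intro sums_mult2 fcm_act_sums[OF H(2) g])
        have t: "fcm h p * Mc g n p (- a) * d a m = d a n * (fcm f p * Mc g n p a)" for p
        proof -
          have "fcm h p * Mc g n p (- a) * d a m = (fcm h p * d a m) * Mc g n p (- a)" by (simp only: mult_ac)
          also have "\<dots> = fcm f p * (d a p * Mc g n p (- a))" unfolding e by (simp only: mult_ac)
          also have "d a p * Mc g n p (- a) = d a n * Mc g n p a" unfolding d_def by (rule Mc_gf[OF g, symmetric])
          finally show ?thesis by (simp only: mult_ac)
        qed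
        show "(\<lambda>j. fcm h (int_decode j) * Mc g n (int_decode j) (- a) * d a m) sums (d a n * fcm (act a g f) n)"
          unfolding t by (intro sums_mult fcm_act_sums[OF H(1) g])
      qed
      then show "(act a g f, act (- a) g h) \<in> ?R" using act_Hinf[OF g] H by blast
    next
      fix f h assume fh: "f \<in> Hinf ?\<sigma>" "h \<in> Hinf ?\<sigma>" and lim: "\<And>N \<epsilon>. \<epsilon> > 0 \<Longrightarrow> \<exists>f' h'. (f', h') \<in> ?R \<and>
        (\<forall>n\<le>N. snorm n (\<lambda>k. f k - f' k) < \<epsilon> \<and> snorm n (\<lambda>k. h k - h' k) < \<epsilon>)"
      have "fcm h n * d a m = d a n * fcm f n" for n
      proof -
        let ?x = "norm (fcm h n * d a m - d a n * fcm f n)"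
        have "?x \<le> (norm (d a m) + norm (d a n)) * e" if e: "e > 0" for e
        proof -
          obtain f' h' where "(f', h') \<in> ?R" and cl: "\<forall>n\<le>0. snorm n (\<lambda>k. f k - f' k) < e \<and> snorm n (\<lambda>k. h k - h' k) < e"
            using lim[OF e, of 0] by blast
          then have H: "f' \<in> Hinf ?\<sigma>" "h' \<in> Hinf ?\<sigma>" and q: "fcm h' n * d a m = d a n * fcm f' n" by auto
          have "fcm h n * d a m - d a n * fcm f n = d a m * fcm (\<lambda>k. h k - h' k) n - d a n * fcm (\<lambda>k. f k - f' k) n"
            unfolding fcm_diff[OF fh(2) H(2)] fcm_diff[OF fh(1) H(1)] using q by (simp add: algebra_simps)
          also have "norm \<dots> \<le> norm (d a m) * norm (fcm (\<lambda>k. h k - h' k) n) + norm (d a n) * norm (fcm (\<lambda>k. f k - f' k) n)"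
            unfolding norm_mult[symmetric] by (rule norm_triangle_ineq4)
          also have "\<dots> \<le> norm (d a m) * e + norm (d a n) * e"
            using fcm_bound[OF Hinf_diff[OF fh(2) H(2)], of n] fcm_bound[OF Hinf_diff[OF fh(1) H(1)], of n] cl
            by (intro add_mono mult_left_mono) auto
          finally show ?thesis by (simp add: distrib_right)
        qed
        then have "?x \<le> 0" 
        proof -
          assume A: "\<And>e. e > 0 \<Longrightarrow> ?x \<le> (norm (d a m) + norm (d a n)) * e"
          let ?c = "norm (d a m) + norm (d a n) + 1"
          have c: "?c > 0" by (simp add: add_nonneg_pos)
          show "?x \<le> 0"
          proof (rule field_le_epsilon)
            fix e :: real assume e: "e > 0"
            have "?x \<le> (norm (d a m) + norm (d a n)) * (e / ?c)" by (rule A) (use e c in simp)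
            also have "\<dots> \<le> ?c * (e / ?c)" by (rule mult_right_mono) (use e c in auto)
            also have "\<dots> = e" using c by simp
            finally show "?x \<le> 0 + e" by simp
          qed
        qed
        then show ?thesis by simp
      qed
      then show "(f, h) \<in> ?R" using fh by blast
    next
      have "fcm (ee m) m * d a m \<noteq> d a m * fcm (\<lambda>k. 0) m" using a exn by (simp add: fc_ex fcm_0 d_def)
      then show "(\<lambda>k. 0, ee m) \<notin> ?R" by blast
    next
      show "(ee m, ee m) \<in> ?R" using eH by (auto simp: fc_ex)
    qed (use eH Hinf_0 in auto)
    then show ?thesis by blast
  qed
  let ?H = "\<lambda>\<nu>. ex n (pi / 2) * gf n \<nu> * fcm (\<psi> \<nu>) n - ex m (pi / 2) * gf m \<nu> * fcm (\<psi> (- \<nu>)) n"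
  note f1 = fam_fc_hol[OF \<psi>, of n]
  have 1: "?H holomorphic_on UNIV" by (intro holomorphic_intros gf_hol f1 hol_minus[OF f1])
  have 2: "gf m z * ?H z = 0" for z using main[of z n] unfolding d_def by (cases "gf m z = 0") (auto simp: mult_ac)
  have "?H \<nu> = 0" by (rule entire_mult_cancel[OF gf_hol 1 gf_nz 2])
  then show ?thesis by simp
qed

section \<open>Condition (2.a) in terms of Fourier coefficients\<close>

lemma ser_scale: assumes "rd a" shows "ser (\<lambda>n. c * a n) \<theta> = c * ser a \<theta>"
  unfolding ser_def suminf_mult[OF ser_summable(3)[OF assms], symmetric] by (simp only: mult.assoc)

lemma ser_shift: "ser a (\<theta> + t) = ser (\<lambda>n. ex n t * a n) \<theta>"
  unfolding ser_def ex_add by (simp only: mult_ac)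

text \<open>\<open>delta m mw\<close> and the rotation by s pi / 2 combine to
  \<open>ex (n - m)\<close> at that angle, which is the same for both representatives of w because n
  - m is even. The factor \<open>cpre\<close> is kept on both sides, as it is shown to be nonzero
  only for Re \<nu> > 0.\<close>

lemma J_w_functional:
  assumes mw: "represents_w mw" and an: "cpre analytic_on {\<nu>}" and f: "f \<in> Hinf (restrM m)" and h: "h \<in> Hinf (restrM m)"
  shows "J_wm mw m \<nu> f = (\<lambda>k. c_fun m \<nu> * h k) \<longleftrightarrow>
     (\<forall>n. cpre \<nu> * (ex n (pi / 2) * gf n \<nu> * fcm f n) = cpre \<nu> * (ex m (pi / 2) * gf m \<nu> * fcm h n))"
proof -
  let ?\<sigma> = "restrM m"
  obtain s :: int where s: "s = 1 \<or> s = -1" "mw = rot (of_int s * pi / 2)" by (rule represents_w_rot[OF mw])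
  let ?t = "of_int s * pi / 2"
  let ?a = "\<lambda>n. (cpre \<nu> * ex (n - m) (pi / 2)) * (gf n \<nu> * fcm f n)"
  have rd0: "rd (\<lambda>n. gf n \<nu> * fcm f n)" by (rule rd_gf[OF rd_fc[OF Hinf_SP[OF f]]])
  have rd: "rd ?a" by (rule rd_mult_poly[OF rd0, of _ "norm (cpre \<nu>)" 0]) (simp add: norm_mult)
  have rd1: "rd (\<lambda>n. ex n ?t * (gf n \<nu> * fcm f n))" by (rule rd_mult_poly[OF rd0, of _ 1 0]) simp
  have shift: "ex (n - m) ?t = ex (n - m) (pi / 2)" if "par ?\<sigma> n" for n
  proof (cases "s = 1")
    case False
    then have "s = -1" using s(1) by simp
    have "even (n - m)" using that par_even[OF par_restrM] by blast
    then have "ex (n - m) pi = 1" by (simp add: ex_pi)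
    moreover have "ex (n - m) (pi / 2) = ex (n - m) (- pi / 2) * ex (n - m) pi"
      unfolding ex_add[symmetric] by (rule arg_cong[of _ _ "ex (n - m)"]) simp
    ultimately show ?thesis using \<open>s = -1\<close> by simp
  qed simp
  have dm: "delta m mw * ex n ?t = ex (n - m) ?t" for n
  proof -
    have "delta m mw = ex (- m) ?t" unfolding s(2) delta_rot by (simp add: ex_def)
    then show ?thesis by (simp add: ex_mult)
  qed
  have LH: "sers ?a \<in> Hinf ?\<sigma>" by (rule sers_Hinf[OF rd]) (simp add: Hinf_par[OF f])
  have L: "J_wm mw m \<nu> f = sers ?a"
  proof
    fix k
    show "J_wm mw m \<nu> f k = sers ?a k"
    proof (cases "k \<in> SO2")
      case True
      then obtain \<theta> where k: "k = rot \<theta>" by (auto simp: SO2_def)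
      have "J_wm mw m \<nu> f k = (delta m mw * cpre \<nu>) * ser (\<lambda>n. ex n ?t * (gf n \<nu> * fcm f n)) \<theta>"
        unfolding J_wm_def k J_w_eq[OF s f an] ser_shift by simp
      also have "\<dots> = ser (\<lambda>n. (delta m mw * cpre \<nu>) * (ex n ?t * (gf n \<nu> * fcm f n))) \<theta>" by (rule ser_scale[OF rd1, symmetric])
      also have "(\<lambda>n. (delta m mw * cpre \<nu>) * (ex n ?t * (gf n \<nu> * fcm f n))) = ?a"
      proof
        fix n
        show "(delta m mw * cpre \<nu>) * (ex n ?t * (gf n \<nu> * fcm f n)) = ?a n"
        proof (cases "par ?\<sigma> n")
          case True
          have "(delta m mw * cpre \<nu>) * (ex n ?t * (gf n \<nu> * fcm f n)) = (delta m mw * ex n ?t) * (cpre \<nu> * (gf n \<nu> * fcm f n))"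
            by (simp only: mult_ac)
          then show ?thesis unfolding dm shift[OF True] by (simp only: mult_ac)
        qed (simp add: Hinf_par[OF f])
      qed
      finally show ?thesis unfolding k sers_rot .
    qed (simp add: J_wm_def J_w_def sers_def)
  qed
  have exm: "ex m (pi / 2) \<noteq> 0" using norm_ex[of m "pi / 2"] by (metis norm_zero zero_neq_one)
  have "sers ?a = (\<lambda>k. c_fun m \<nu> * h k) \<longleftrightarrow> (\<forall>n. fcm (sers ?a) n = fcm (\<lambda>k. c_fun m \<nu> * h k) n)"
    using Hinf_fcm_eqI[OF LH Hinf_scale[OF h, of "c_fun m \<nu>"]] by (intro iffI allI) simp_all
  also have "\<dots> \<longleftrightarrow> (\<forall>n. ?a n = cpre \<nu> * gf m \<nu> * fcm h n)"
    unfolding fcm_sers[OF rd] fc_scale c_fun_eq[OF an] ..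
  also have "\<dots> \<longleftrightarrow> (\<forall>n. ex m (pi / 2) * ?a n = ex m (pi / 2) * (cpre \<nu> * gf m \<nu> * fcm h n))" using exm by simp
  also have "\<dots> \<longleftrightarrow> (\<forall>n. cpre \<nu> * (ex n (pi / 2) * gf n \<nu> * fcm f n) = cpre \<nu> * (ex m (pi / 2) * gf m \<nu> * fcm h n))"
  proof -
    have "ex m (pi / 2) * ?a n = cpre \<nu> * ((ex m (pi / 2) * ex (n - m) (pi / 2)) * gf n \<nu> * fcm f n)" for n by (simp only: mult_ac)
    then have 1: "ex m (pi / 2) * ?a n = cpre \<nu> * (ex n (pi / 2) * gf n \<nu> * fcm f n)" for n unfolding ex_mult by simp
    have 2: "ex m (pi / 2) * (cpre \<nu> * gf m \<nu> * fcm h n) = cpre \<nu> * (ex m (pi / 2) * gf m \<nu> * fcm h n)" for n by (simp only: mult_ac)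
    show ?thesis unfolding 1 2 ..
  qed
  finally show ?thesis unfolding L .
qed

lemma D2_imp:
  assumes mw: "represents_w mw" and \<psi>: "fam (restrM m) UNIV \<psi>" and D2: "condition_D2 m \<psi>"
  shows "\<forall>\<^sub>\<approx>\<nu>. J_wm mw m \<nu> (\<psi> \<nu>) = (\<lambda>k. c_fun m \<nu> * \<psi> (- \<nu>) k)"
    "\<And>r. r \<in> red_pts (restrM m) \<Longrightarrow> \<psi> (of_real r) \<in> Wmod m r"
proof -
  have "\<forall>\<^sub>\<approx>\<nu>. cpre analytic_on {\<nu>}" by (rule meromorphic_on_imp_analytic_cosparse[OF cpre_mero])
  then show "\<forall>\<^sub>\<approx>\<nu>. J_wm mw m \<nu> (\<psi> \<nu>) = (\<lambda>k. c_fun m \<nu> * \<psi> (- \<nu>) k)"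
  proof eventually_elim
    case (elim \<nu>)
    show ?case unfolding J_w_functional[OF mw elim fam_Hinf[OF \<psi> UNIV_I] fam_Hinf[OF \<psi> UNIV_I]] D2_functional[OF D2 \<psi>] by simp
  qed
  fix r assume "r \<in> red_pts (restrM m)"
  then obtain s :: int where s: "2 * r + 1 = of_int s" "even (s - m)" by (rule red_pts_int)
  have "2 * of_real r + 1 = (of_real (2 * r + 1) :: complex)" by simp
  then have s': "2 * of_real r + 1 = (of_int s :: complex)" unfolding s(1) by simp
  have p: "par (restrM m) s" using s(2) par_even[OF par_restrM] by blast
  have "ee m \<in> kset (restrM m) (Nset s m)" unfolding ee_kset by (auto simp: Nset_def)
  then show "\<psi> (of_real r) \<in> Wmod m r"
    unfolding Wmod_eq[OF s] by (rule D2_submodule[OF D2 \<psi> Nset_submodule[OF s' p]])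
qed

subsection \<open>Division of entire functions\<close>

lemma entire_divide:
  assumes "f holomorphic_on UNIV" "f a = (0 :: complex)"
  obtains h where "h holomorphic_on UNIV" "\<And>z. f z = (z - a) * h z"
proof (rule that)
  let ?h = "\<lambda>z. if z = a then deriv f a else (f z - f a) / (z - a)"
  show "?h holomorphic_on UNIV" by (rule pole_lemma_open[OF assms(1)]) simp
  show "f z = (z - a) * ?h z" for z using assms(2) by simp
qed

text \<open>Injectivity of \<open>a\<close> makes the roots simple, so vanishing at each root
  suffices for division by the whole product.\<close>

lemma entire_divide_prod:
  fixes a :: "nat \<Rightarrow> complex"
  assumes "f holomorphic_on UNIV" "inj a" "\<And>l. l < i \<Longrightarrow> f (a l) = (0 :: complex)"
  shows "\<exists>h. h holomorphic_on UNIV \<and> (\<forall>z. f z = (\<Prod>l<i. z - a l) * h z)"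
proof -
  have "j \<le> i \<Longrightarrow> \<exists>h. h holomorphic_on UNIV \<and> (\<forall>z. f z = (\<Prod>l<j. z - a l) * h z)" for j
  proof (induction j)
    case 0 then show ?case using assms(1) by auto
  next
    case (Suc j)
    obtain h where h: "h holomorphic_on UNIV" "\<And>z. f z = (\<Prod>l<j. z - a l) * h z" using Suc by auto
    have "(\<Prod>l<j. a j - a l) \<noteq> 0" using assms(2) by (auto dest: injD)
    moreover have "(\<Prod>l<j. a j - a l) * h (a j) = 0" using h(2)[of "a j"] assms(3)[of j] Suc.prems by simp
    ultimately have "h (a j) = 0" by simp
    then obtain h' where "h' holomorphic_on UNIV" "\<And>z. h z = (z - a j) * h' z" using entire_divide[OF h(1)] by blast
    then show ?case using h(2) by (intro exI[of _ h']) (simp add: mult.assoc)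
  qed
  then show ?thesis by blast
qed

lemma Qup_factors: "Qup p i \<mu> = (\<Prod>l<i. \<mu> - (- ((1 + of_int p) / 2) - of_nat l))"
  unfolding Qup_def by (simp add: algebra_simps)

lemma Qup_divide:
  assumes "f holomorphic_on UNIV" "\<And>\<nu>. Qup p i \<nu> = 0 \<Longrightarrow> f \<nu> = 0"
  shows "\<exists>h. h holomorphic_on UNIV \<and> (\<forall>z. f z = Qup p i z * h z)"
  unfolding Qup_factors
proof (rule entire_divide_prod[OF assms(1)])
  show "inj (\<lambda>l. - ((1 + of_int p) / 2) - of_nat l :: complex)" by (auto simp: inj_def)
  show "f (- ((1 + of_int p) / 2) - of_nat l) = 0" if "l < i" for l
    by (rule assms(2)) (use that in \<open>auto simp: Qup_factors\<close>)
qed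

lemma Q_divide:
  assumes "f holomorphic_on UNIV" "\<And>\<nu>. Q p n \<nu> = 0 \<Longrightarrow> f \<nu> = 0"
  shows "\<exists>h. h holomorphic_on UNIV \<and> (\<forall>z. f z = Q p n z * h z)"
proof (cases "p \<le> n")
  case True
  then show ?thesis using Qup_divide[OF assms(1), of p "nat ((n - p) div 2)"] assms(2) by (simp add: Q_def)
next
  case False
  then show ?thesis using Qup_divide[OF assms(1), of "- p" "nat ((p - n) div 2)"] assms(2) by (simp add: Q_def)
qed

lemma Q_imag: assumes "Im \<mu> \<noteq> 0" shows "Q p n \<mu> \<noteq> 0"
proof -
  have "Qup q i \<mu> \<noteq> 0" for q i
  proof
    assume "Qup q i \<mu> = 0"
    then obtain l where "\<mu> + (1 + of_int q) / 2 + of_nat l = 0" using Qup_zero by blast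
    from arg_cong[OF this, of Im] show False using assms by simp
  qed
  then show ?thesis by (simp add: Q_def)
qed

lemma Q_zero_int:
  assumes "even (n - p)" "Q p n \<nu> = 0" obtains s :: int where "2 * \<nu> + 1 = of_int s" "even (s - p)"
proof -
  have Qup: "\<exists>s::int. 2 * \<nu> + 1 = of_int s \<and> even (s - q)" if z: "Qup q i \<nu> = 0" for q i
  proof -
    obtain l where l: "\<nu> + (1 + of_int q) / 2 + of_nat l = 0" using Qup_zero[OF z] by blast
    have "2 * \<nu> + 1 = 2 * (\<nu> + (1 + of_int q) / 2 + of_nat l) + of_int (- q - 2 * int l)" by (simp add: field_simps)
    then have "2 * \<nu> + 1 = of_int (- q - 2 * int l)" unfolding l by simp
    moreover have "even (- q - 2 * int l - q)" by simp
    ultimately show ?thesis by blast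
  qed
  have "\<exists>s::int. 2 * \<nu> + 1 = of_int s \<and> even (s - p)"
    using assms(1)
  proof (cases rule: even_cases)
    case (1 i) then show ?thesis using Qup assms(2) by (simp add: Q_up)
  next
    case (2 i)
    then obtain s :: int where "2 * \<nu> + 1 = of_int s" "even (s - - p)" using Qup[of "- p" i] assms(2) by (auto simp: Q_down)
    moreover from this have "even (s - p)" by presburger
    ultimately show ?thesis by blast
  qed
  then show ?thesis using that by blast
qed

text \<open>An even function vanishing at a also vanishes at -a. For a = 0 the first quotient is odd
  and vanishes at 0 once more, so z^2 - a^2 divides in every case.\<close>

lemma even_divide:
  assumes f: "f holomorphic_on UNIV" "\<And>z. f (- z) = f z" "f a = (0 :: complex)"
  obtains h where "h holomorphic_on UNIV" "\<And>z. h (- z) = h z" "\<And>z. f z = (z\<^sup>2 - a\<^sup>2) * h z"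
proof -
  obtain f1 where f1: "f1 holomorphic_on UNIV" "\<And>z. f z = (z - a) * f1 z" using entire_divide[OF f(1,3)] by blast
  have "f1 (- a) = 0"
  proof (cases "a = 0")
    case True
    have h: "(\<lambda>z. f1 z + f1 (- z)) holomorphic_on UNIV" by (intro holomorphic_intros f1 hol_minus)
    have z: "z * (f1 z + f1 (- z)) = 0" for z
    proof -
      have "z * f1 z = - (z * f1 (- z))" using f(2)[of z] unfolding f1(2)[of z] f1(2)[of "- z"] True by simp
      then show ?thesis unfolding distrib_left by simp
    qed
    have "f1 0 + f1 (- 0) = 0" by (rule entire_mult_cancel[of "\<lambda>z. z", OF _ h _ z, of 1]) auto
    then show ?thesis unfolding True by simp
  next
    case False
    then show ?thesis using f(2)[of a] f(3) f1(2)[of "- a"] by simp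
  qed
  then obtain h where h: "h holomorphic_on UNIV" "\<And>z. f1 z = (z - (- a)) * h z" using entire_divide[OF f1(1)] by blast
  have e: "f z = (z\<^sup>2 - a\<^sup>2) * h z" for z unfolding f1(2) h(2) by (simp add: power2_eq_square algebra_simps)
  have "h (- z) - h z = 0" for z
  proof (rule entire_mult_cancel[of "\<lambda>z. z\<^sup>2 - a\<^sup>2" "\<lambda>z. h (- z) - h z" "if a = 0 then 1 else 0"])
    show "(z\<^sup>2 - a\<^sup>2) * (h (- z) - h z) = 0" for z using f(2)[of z] e[of z] e[of "- z"] by (simp add: right_diff_distrib)
  qed (auto intro!: holomorphic_intros h hol_minus)
  then have ev: "h (- z) = h z" for z by simp
  show ?thesis by (rule that[OF h(1) ev e])
qed

text \<open>Newton interpolation in the variable z^2, where repeated points give contact of higher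
  order. The remainder stays even, which carries the induction.\<close>

lemma even_interpolate_list:
  assumes "h holomorphic_on UNIV" "\<And>z. h (- z) = (h z :: complex)"
  shows "\<exists>p r. r holomorphic_on UNIV \<and> (\<forall>z. r (- z) = r z) \<and>
     (\<forall>z. h z = poly p (z\<^sup>2) + poly (prod_list (map (\<lambda>a. [:- (a\<^sup>2), 1:]) as)) (z\<^sup>2) * r z)"
proof (induction "as")
  case Nil
  show ?case by (rule exI[of _ 0], rule exI[of _ h]) (use assms in simp)
next
  case (Cons a "as")
  let ?P = "prod_list (map (\<lambda>a. [:- (a\<^sup>2), 1:]) as)"
  obtain p r where r: "r holomorphic_on UNIV" "\<And>z. r (- z) = r z" "\<And>z. h z = poly p (z\<^sup>2) + poly ?P (z\<^sup>2) * r z"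
    using Cons.IH by blast
  obtain r' where r': "r' holomorphic_on UNIV" "\<And>z. r' (- z) = r' z" "\<And>z. r z - r a = (z\<^sup>2 - a\<^sup>2) * r' z"
  proof -
    have "(\<lambda>z. r z - r a) holomorphic_on UNIV" by (intro holomorphic_intros r(1))
    then show ?thesis using even_divide[of "\<lambda>z. r z - r a" a] that r(2) by auto
  qed
  have "h z = poly (p + smult (r a) ?P) (z\<^sup>2) + poly ([:- (a\<^sup>2), 1:] * ?P) (z\<^sup>2) * r' z" for z
  proof -
    have "h z = poly p (z\<^sup>2) + poly ?P (z\<^sup>2) * (r a + (z\<^sup>2 - a\<^sup>2) * r' z)" unfolding r(3)[of z] r'(3)[symmetric] by simp
    then show ?thesis by (simp add: algebra_simps)
  qed
  then show ?case by (intro exI[of _ "p + smult (r a) ?P"] exI[of _ r']) (use r'(1,2) in simp)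
qed

lemma even_interpolate:
  fixes L :: "(complex \<times> nat) list"
  assumes "h holomorphic_on UNIV" "\<And>z. h (- z) = (h z :: complex)"
  obtains p where "\<And>a d. (a, d) \<in> set L \<Longrightarrow> \<exists>r. r holomorphic_on UNIV \<and> (\<forall>z. h z - poly p (z\<^sup>2) = (z - a) ^ (d + 1) * r z)"
proof -
  \<comment> \<open>Each point is listed d + 1 times: (z^2 - a^2)^(d+1) is divisible by (z -
    a)^(d+1), so the jets of order d at a agree.\<close>
  define as where "as = concat (map (\<lambda>(a, d). replicate (d + 1) a) L)"
  let ?P = "\<lambda>as. prod_list (map (\<lambda>a. [:- (a\<^sup>2), 1:]) as) :: complex poly"
  obtain p r where r: "r holomorphic_on UNIV" "\<And>z. h z = poly p (z\<^sup>2) + poly (?P as) (z\<^sup>2) * r z"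
    using even_interpolate_list[OF assms, of "as"] by blast
  have "\<exists>r. r holomorphic_on UNIV \<and> (\<forall>z. h z - poly p (z\<^sup>2) = (z - a) ^ (d + 1) * r z)" if ad: "(a, d) \<in> set L" for a d
  proof -
    obtain L1 L2 where L: "L = L1 @ (a, d) # L2" using split_list[OF ad] by blast
    have "[:- (a\<^sup>2), 1:] ^ (d + 1) dvd ?P as" unfolding as_def L by (simp add: prod_list_replicate del: replicate_Suc power_Suc)
    then obtain q where q: "?P as = [:- (a\<^sup>2), 1:] ^ (d + 1) * q" by (elim dvdE)
    have "z\<^sup>2 - a\<^sup>2 = (z - a) * (z + a)" for z by (simp add: power2_eq_square algebra_simps)
    then have "poly (?P as) (z\<^sup>2) = (z - a) ^ (d + 1) * ((z + a) ^ (d + 1) * poly q (z\<^sup>2))" for z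
      unfolding q poly_mult poly_power by (simp add: power_mult_distrib mult.assoc[symmetric] del: power_Suc)
    then have "h z - poly p (z\<^sup>2) = (z - a) ^ (d + 1) * ((z + a) ^ (d + 1) * poly q (z\<^sup>2) * r z)" for z
      unfolding r(2)[of z] by (simp only: add_diff_cancel_left' mult.assoc)
    moreover have "(\<lambda>z. (z + a) ^ (d + 1) * poly q (z\<^sup>2) * r z) holomorphic_on UNIV"
      by (intro holomorphic_intros r(1))
    ultimately show ?thesis by blast
  qed
  then show ?thesis by (rule that)
qed

subsection \<open>The family of sections satisfying an intertwining condition\<close>

lemma mchar_inj: assumes "\<And>x. x \<in> Mgrp \<Longrightarrow> mchar \<sigma> x = mchar \<sigma>' x" shows "\<sigma> = \<sigma>'"
  using assms[of "- mat 1"] mat1_neq by (cases \<sigma>; cases \<sigma>') (auto simp: Mgrp_def)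

text \<open>If \<sigma> is not the restriction of the K-type m to M, equivariance under M forces t =
  0 near \<nu>, and the zero family belongs to every \<sigma>.\<close>

lemma hom_germ_mult:
  assumes t: "hom_germ m \<sigma> \<nu> t" and \<omega>: "fam (restrM m) UNIV \<omega>"
  shows "hol_germ \<sigma> \<nu> (\<lambda>\<mu> k. t \<mu> * \<omega> \<mu> k)"
proof (cases "\<sigma> = restrM m")
  case True
  then show ?thesis using t hol_germ_mult fam_hol_germ[OF \<omega>] unfolding hom_germ_def by blast
next
  case False
  then obtain x where x: "x \<in> Mgrp" "mchar \<sigma> x \<noteq> mchar (restrM m) x" using mchar_inj by blast
  have "\<forall>\<^sub>F \<mu> in nhds \<nu>. \<forall>x\<in>Mgrp. t \<mu> * delta m x = mchar \<sigma> x * t \<mu>" using t unfolding hom_germ_def by blast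
  then obtain U where U: "open U" "\<nu> \<in> U" "\<And>\<mu>. \<mu> \<in> U \<Longrightarrow> \<forall>x\<in>Mgrp. t \<mu> * delta m x = mchar \<sigma> x * t \<mu>"
    unfolding eventually_nhds by blast
  have z: "t \<mu> = 0" if "\<mu> \<in> U" for \<mu>
  proof -
    have "t \<mu> * delta m x = mchar \<sigma> x * t \<mu>" using U(3)[OF that] x(1) by blast
    then have "t \<mu> * mchar (restrM m) x = mchar \<sigma> x * t \<mu>" unfolding delta_Mgrp[OF x(1)] .
    then have "(mchar (restrM m) x - mchar \<sigma> x) * t \<mu> = 0" by (simp add: algebra_simps)
    then show ?thesis using x(2) by simp
  qed
  have "fam \<sigma> U (\<lambda>\<mu> k. t \<mu> * \<omega> \<mu> k)"
    by (rule fam_cong[OF _ fam_const[OF U(1) Hinf_0]]) (simp add: z)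
  then show ?thesis unfolding hol_germ_fam using U by blast
qed

text \<open>The radius and \<delta> are fixed before \<open>D\<close>. Near \<nu> the germ t is
  bounded on a disk of radius r, and Cauchy's inequality passes from a bound there to the Taylor
  coefficients; R = |\<nu>| + r makes the disk about 0 contain the one about \<nu>.\<close>

lemma hom_germ_small:
  assumes t: "hom_germ m \<sigma>' \<nu> t" and e: "e > 0"
  shows "\<exists>R \<delta>. \<delta> > 0 \<and> (\<forall>D. fam \<sigma> UNIV D \<longrightarrow> (\<forall>\<mu>\<in>cball 0 R. \<forall>n\<le>N. snorm n (D \<mu>) < \<delta>) \<longrightarrow>
     (\<forall>j\<le>d. \<forall>n\<le>N. snorm n (\<lambda>k. (deriv ^^ j) (\<lambda>\<mu>. t \<mu> * D \<mu> k) \<nu>) < e))"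
proof -
  obtain U where U: "open U" "\<nu> \<in> U" "t holomorphic_on U"
    using t analytic_at unfolding hom_germ_def by blast
  obtain r where r: "r > 0" "cball \<nu> r \<subseteq> U" using U open_contains_cball by blast
  have "compact (t ` cball \<nu> r)"
    by (intro compact_continuous_image continuous_on_subset[OF holomorphic_on_imp_continuous_on[OF U(3)] r(2)]) simp
  then obtain T where T: "T > 0" "\<And>\<mu>. \<mu> \<in> cball \<nu> r \<Longrightarrow> norm (t \<mu>) \<le> T"
    using bounded_pos[of "t ` cball \<nu> r"] compact_imp_bounded by blast
  define C where "C = (\<Sum>j\<le>d. fact j * T / r ^ j)"
  have C: "fact j * T / r ^ j \<le> C" if "j \<le> d" for j
    unfolding C_def by (rule member_le_sum) (use that T r in auto)
  have C0: "C > 0" using C[of 0] T by simp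
  define \<delta> where "\<delta> = e / (2 * C)"
  have \<delta>: "\<delta> > 0" using C0 e by (simp add: \<delta>_def)
  have "snorm n (\<lambda>k. (deriv ^^ j) (\<lambda>\<mu>. t \<mu> * D \<mu> k) \<nu>) < e"
    if D: "fam \<sigma> UNIV D" "\<forall>\<mu>\<in>cball 0 (norm \<nu> + r). \<forall>n\<le>N. snorm n (D \<mu>) < \<delta>" and jn: "j \<le> d" "n \<le> N" for D j n
  proof -
    have "snorm n (\<lambda>k. (deriv ^^ j) (\<lambda>\<mu>. t \<mu> * D \<mu> k) \<nu>) \<le> fact j * (T * \<delta>) / r ^ j"
    proof (rule snorm_deriv_bound[OF U(1) fam_mult[OF U(1,3) fam_subset[OF D(1) subset_UNIV U(1)]] r])
      fix \<mu> assume \<mu>: "\<mu> \<in> cball \<nu> r"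
      have "norm \<mu> \<le> norm \<nu> + norm (\<mu> - \<nu>)" using norm_triangle_ineq[of \<nu> "\<mu> - \<nu>"] by simp
      then have "\<mu> \<in> cball 0 (norm \<nu> + r)" using \<mu> by (simp add: dist_norm norm_minus_commute)
      then have "snorm n (D \<mu>) < \<delta>" using D(2) jn by blast
      moreover have "snorm n (\<lambda>k. t \<mu> * D \<mu> k) \<le> norm (t \<mu>) * snorm n (D \<mu>)"
        unfolding snorm_sn by (rule sn_scale[OF Hinf_SP[OF fam_Hinf[OF D(1) UNIV_I]]])
      moreover have "norm (t \<mu>) * snorm n (D \<mu>) \<le> T * \<delta>"
        using T calculation(1) snorm_nonneg[OF fam_Hinf[OF D(1) UNIV_I]] \<mu> by (intro mult_mono) auto
      ultimately show "snorm n (\<lambda>k. t \<mu> * D \<mu> k) \<le> T * \<delta>" by linarith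
    qed
    also have "\<dots> = (fact j * T / r ^ j) * \<delta>" by simp
    also have "\<dots> \<le> C * \<delta>" using C[OF jn(1)] \<delta> by (intro mult_right_mono) auto
    also have "\<dots> < e" using C0 e by (simp add: \<delta>_def)
    finally show ?thesis .
  qed
  then show ?thesis using \<delta> by (intro exI[of _ "norm \<nu> + r"] exI[of _ \<delta>]) blast
qed

lemma jets_close_small:
  assumes "list_all2 (\<lambda>(\<sigma>, \<nu>, d) t. hom_germ m \<sigma> \<nu> t) \<xi> ts" and e: "e > 0"
  shows "\<exists>R \<delta>. \<delta> > 0 \<and> (\<forall>\<phi> \<psi>. fam \<sigma> UNIV \<phi> \<longrightarrow> fam \<sigma> UNIV \<psi> \<longrightarrow>
     (\<forall>\<mu>\<in>cball 0 R. \<forall>n\<le>N. snorm n (\<lambda>k. \<phi> \<mu> k - \<psi> \<mu> k) < \<delta>) \<longrightarrow>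
     jets_close \<xi> N e (map (\<lambda>t \<mu> k. t \<mu> * \<phi> \<mu> k) ts) (map (\<lambda>t \<mu> k. t \<mu> * \<psi> \<mu> k) ts))"
  using assms(1)
proof (induction rule: list_all2_induct)
  case Nil
  show ?case by (intro exI[of _ 0] exI[of _ 1]) (simp add: jets_close_def)
next
  case (Cons x xs t ts)
  obtain \<sigma>' \<nu> d where x: "x = (\<sigma>', \<nu>, d)" by (cases x)
  obtain R1 \<delta>1 where 1: "\<delta>1 > 0" "\<And>D. fam \<sigma> UNIV D \<Longrightarrow> (\<forall>\<mu>\<in>cball 0 R1. \<forall>n\<le>N. snorm n (D \<mu>) < \<delta>1) \<Longrightarrow>
     (\<forall>j\<le>d. \<forall>n\<le>N. snorm n (\<lambda>k. (deriv ^^ j) (\<lambda>\<mu>. t \<mu> * D \<mu> k) \<nu>) < e)"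
    using hom_germ_small[OF _ e, of m \<sigma>' \<nu> t \<sigma> N d] Cons.hyps(1) unfolding x by auto
  from Cons.IH obtain R2 \<delta>2 where IH: "\<delta>2 > 0 \<and> (\<forall>\<phi> \<psi>. fam \<sigma> UNIV \<phi> \<longrightarrow> fam \<sigma> UNIV \<psi> \<longrightarrow>
     (\<forall>\<mu>\<in>cball 0 R2. \<forall>n\<le>N. snorm n (\<lambda>k. \<phi> \<mu> k - \<psi> \<mu> k) < \<delta>2) \<longrightarrow>
     jets_close xs N e (map (\<lambda>t \<mu> k. t \<mu> * \<phi> \<mu> k) ts) (map (\<lambda>t \<mu> k. t \<mu> * \<psi> \<mu> k) ts))" by (elim exE)
  note 2 = IH[THEN conjunct1] IH[THEN conjunct2, THEN spec, THEN spec, THEN mp, THEN mp, THEN mp]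
  have "jets_close (x # xs) N e (map (\<lambda>t \<mu> k. t \<mu> * \<phi> \<mu> k) (t # ts)) (map (\<lambda>t \<mu> k. t \<mu> * \<psi> \<mu> k) (t # ts))"
    if f: "fam \<sigma> UNIV \<phi>" "fam \<sigma> UNIV \<psi>" and
      s: "\<forall>\<mu>\<in>cball 0 (max R1 R2). \<forall>n\<le>N. snorm n (\<lambda>k. \<phi> \<mu> k - \<psi> \<mu> k) < min \<delta>1 \<delta>2" for \<phi> \<psi>
  proof -
    have "\<forall>\<mu>\<in>cball 0 R1. \<forall>n\<le>N. snorm n (\<lambda>k. \<phi> \<mu> k - \<psi> \<mu> k) < \<delta>1" using s by (simp add: le_max_iff_disj)
    from 1(2)[OF fam_diff[OF open_UNIV f] this]
    have a: "\<forall>j\<le>d. \<forall>n\<le>N. snorm n (\<lambda>k. (deriv ^^ j) (\<lambda>\<mu>. t \<mu> * \<phi> \<mu> k - t \<mu> * \<psi> \<mu> k) \<nu>) < e"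
      by (simp only: right_diff_distrib)
    have "\<forall>\<mu>\<in>cball 0 R2. \<forall>n\<le>N. snorm n (\<lambda>k. \<phi> \<mu> k - \<psi> \<mu> k) < \<delta>2" using s by (simp add: le_max_iff_disj)
    from 2(2)[OF f this] show ?thesis using a unfolding jets_close_def x by simp
  qed
  then show ?case using 1(1) 2(1) by (intro exI[of _ "max R1 R2"] exI[of _ "min \<delta>1 \<delta>2"]) simp
qed

text \<open>For an entire \<psi>, the conclusion of (D.2) for this datum and this tuple is
  membership of \<psi> in this set.\<close>

definition sections :: "int \<Rightarrow> xi \<Rightarrow> germ set list set \<Rightarrow> (complex \<Rightarrow> complex) list \<Rightarrow> germ set" where
  "sections m \<xi> W ts = {\<omega>. fam (restrM m) UNIV \<omega> \<and> jets \<xi> (map (\<lambda>t \<mu> k. t \<mu> * \<omega> \<mu> k) ts) \<in> W}"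

lemma sections_germs:
  assumes "list_all2 (\<lambda>(\<sigma>, \<nu>, d) t. hom_germ m \<sigma> \<nu> t) \<xi> ts" "fam (restrM m) UNIV \<omega>"
  shows "map (\<lambda>t \<mu> k. t \<mu> * \<omega> \<mu> k) ts \<in> germs \<xi>"
  unfolding germs_def mem_Collect_eq list_all2_map2
  by (rule list_all2_mono[OF assms(1)]) (use hom_germ_mult[OF _ assms(2)] in auto)

text \<open>\<open>jets_close_small\<close> reconciles the two topologies: uniform convergence on
  disks for the sections, Taylor coefficients for \<open>W\<close>.\<close>

lemma sections_inv_closed:
  assumes W: "closed_subrep \<xi> W" and ts: "list_all2 (\<lambda>(\<sigma>, \<nu>, d) t. hom_germ m \<sigma> \<nu> t) \<xi> ts"
  shows "inv_closed (restrM m) (sections m \<xi> W ts)"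
proof -
  let ?F = "\<lambda>\<omega>. map (\<lambda>t \<mu> k. t \<mu> * \<omega> \<mu> k) ts :: germ list"
  note g = sections_germs[OF ts]
  have Wadd: "\<forall>\<phi>s\<in>germs \<xi>. \<forall>\<eta>s\<in>germs \<xi>. jets \<xi> \<phi>s \<in> W \<and> jets \<xi> \<eta>s \<in> W \<longrightarrow>
          jets \<xi> (map2 (\<lambda>\<phi> \<eta> \<mu> k. \<phi> \<mu> k + \<eta> \<mu> k) \<phi>s \<eta>s) \<in> W"
    and Wscale: "\<forall>c. \<forall>\<phi>s\<in>germs \<xi>. jets \<xi> \<phi>s \<in> W \<longrightarrow> jets \<xi> (map (\<lambda>\<phi> \<mu> k. c * \<phi> \<mu> k) \<phi>s) \<in> W"
    and Wact: "\<forall>g\<in>SL2. \<forall>\<phi>s\<in>germs \<xi>. jets \<xi> \<phi>s \<in> W \<longrightarrow> jets \<xi> (map (act_germ g) \<phi>s) \<in> W"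
    and Wlim: "\<forall>\<phi>s\<in>germs \<xi>. (\<forall>N. \<forall>\<epsilon>>0. \<exists>\<eta>s\<in>germs \<xi>. jets \<xi> \<eta>s \<in> W \<and> jets_close \<xi> N \<epsilon> \<phi>s \<eta>s) \<longrightarrow> jets \<xi> \<phi>s \<in> W"
    by (rule W[unfolded closed_subrep_def, THEN conjunct2, THEN conjunct2, THEN conjunct1],
      rule W[unfolded closed_subrep_def, THEN conjunct2, THEN conjunct2, THEN conjunct2, THEN conjunct1],
      rule W[unfolded closed_subrep_def, THEN conjunct2, THEN conjunct2, THEN conjunct2, THEN conjunct2, THEN conjunct1],
      rule W[unfolded closed_subrep_def, THEN conjunct2, THEN conjunct2, THEN conjunct2, THEN conjunct2, THEN conjunct2])
  have D: "fam (restrM m) UNIV \<omega>" "jets \<xi> (?F \<omega>) \<in> W" if "\<omega> \<in> sections m \<xi> W ts" for \<omega>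
    using that unfolding sections_def by auto
  have I: "\<omega> \<in> sections m \<xi> W ts" if "fam (restrM m) UNIV \<omega>" "jets \<xi> (?F \<omega>) \<in> W" for \<omega>
    using that unfolding sections_def by auto
  show ?thesis unfolding inv_closed_def
  proof (intro conjI ballI allI impI)
    fix \<phi> \<psi> assume p: "\<phi> \<in> sections m \<xi> W ts" "\<psi> \<in> sections m \<xi> W ts"
    have "?F (\<lambda>\<mu> k. \<phi> \<mu> k + \<psi> \<mu> k) = map2 (\<lambda>\<phi> \<eta> \<mu> k. \<phi> \<mu> k + \<eta> \<mu> k) (?F \<phi>) (?F \<psi>)"
      unfolding map2_map_map distrib_left ..
    moreover have "jets \<xi> (map2 (\<lambda>\<phi> \<eta> \<mu> k. \<phi> \<mu> k + \<eta> \<mu> k) (?F \<phi>) (?F \<psi>)) \<in> W"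
      using Wadd[rule_format, OF g[OF D(1)[OF p(1)]] g[OF D(1)[OF p(2)]]] D(2)[OF p(1)] D(2)[OF p(2)] by blast
    ultimately show "(\<lambda>\<mu> k. \<phi> \<mu> k + \<psi> \<mu> k) \<in> sections m \<xi> W ts"
      by (intro I fam_add[OF D(1)[OF p(1)] D(1)[OF p(2)]]) (simp only:)
  next
    fix c \<phi> assume p: "\<phi> \<in> sections m \<xi> W ts"
    have "?F (\<lambda>\<mu> k. c * \<phi> \<mu> k) = map (\<lambda>\<phi> \<mu> k. c * \<phi> \<mu> k) (?F \<phi>)" by (simp add: mult.left_commute)
    moreover have "jets \<xi> (map (\<lambda>\<phi> \<mu> k. c * \<phi> \<mu> k) (?F \<phi>)) \<in> W" by (rule Wscale[rule_format, OF g[OF D(1)[OF p]] D(2)[OF p]])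
    ultimately show "(\<lambda>\<mu> k. c * \<phi> \<mu> k) \<in> sections m \<xi> W ts"
      by (intro I fam_scale[OF open_UNIV D(1)[OF p]]) (simp only:)
  next
    fix h \<phi> assume h: "h \<in> SL2" and p: "\<phi> \<in> sections m \<xi> W ts"
    have "?F (act_germ h \<phi>) = map (act_germ h) (?F \<phi>)" by (simp add: act_germ_def act_scale)
    moreover have "jets \<xi> (map (act_germ h) (?F \<phi>)) \<in> W" by (rule Wact[rule_format, OF h g[OF D(1)[OF p]] D(2)[OF p]])
    ultimately show "act_germ h \<phi> \<in> sections m \<xi> W ts"
      by (intro I fam_act[OF h open_UNIV D(1)[OF p]]) (simp only:)
  next
    fix \<phi> assume \<phi>: "fam (restrM m) UNIV \<phi>"
      and lim: "\<forall>R i. \<forall>\<epsilon>>0. \<exists>\<psi>\<in>sections m \<xi> W ts. \<forall>\<mu>\<in>cball 0 R. \<forall>j\<le>i. snorm j (\<lambda>k. \<phi> \<mu> k - \<psi> \<mu> k) < \<epsilon>"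
    have "jets \<xi> (?F \<phi>) \<in> W"
    proof (rule Wlim[rule_format, OF g[OF \<phi>]])
      fix N and e :: real assume e: "e > 0"
      from jets_close_small[OF ts e, of "restrM m" N] obtain R \<delta> where
        c: "\<delta> > 0 \<and> (\<forall>\<phi> \<psi>. fam (restrM m) UNIV \<phi> \<longrightarrow> fam (restrM m) UNIV \<psi> \<longrightarrow>
         (\<forall>\<mu>\<in>cball 0 R. \<forall>n\<le>N. snorm n (\<lambda>k. \<phi> \<mu> k - \<psi> \<mu> k) < \<delta>) \<longrightarrow> jets_close \<xi> N e (?F \<phi>) (?F \<psi>))" by (elim exE)
      note R = c[THEN conjunct1] c[THEN conjunct2, THEN spec, THEN spec, THEN mp, THEN mp, THEN mp]
      obtain \<psi> where \<psi>: "\<psi> \<in> sections m \<xi> W ts" "\<forall>\<mu>\<in>cball 0 R. \<forall>j\<le>N. snorm j (\<lambda>k. \<phi> \<mu> k - \<psi> \<mu> k) < \<delta>"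
        using lim R(1) by blast
      show "\<exists>\<eta>s\<in>germs \<xi>. jets \<xi> \<eta>s \<in> W \<and> jets_close \<xi> N e (?F \<phi>) \<eta>s"
        using g[OF D(1)[OF \<psi>(1)]] D(2)[OF \<psi>(1)] R(2)[OF \<phi> D(1)[OF \<psi>(1)] \<psi>(2)] by blast
    qed
    then show "\<phi> \<in> sections m \<xi> W ts" by (rule I[OF \<phi>])
  qed (rule D(1))
qed

lemma jets_cong:
  assumes "list_all2 (\<lambda>(\<sigma>, \<nu>, d) t. jet \<sigma> \<nu> d (F t) = jet \<sigma> \<nu> d (G t)) \<xi> ts"
  shows "jets \<xi> (map F ts) = jets \<xi> (map G ts)"
  using assms by (induction rule: list_all2_induct) (auto simp: jets_def)

lemma factor_imp_D2:
  assumes \<psi>: "fam (restrM m) UNIV \<psi>"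
    and fac: "\<And>n. par (restrM m) n \<Longrightarrow> \<exists>h. h holomorphic_on UNIV \<and> (\<forall>z. h (- z) = h z) \<and> (\<forall>z. fcm (\<psi> z) n = Q m n z * h z)"
  shows "condition_D2 m \<psi>"
  unfolding condition_D2_def
proof (intro allI impI ballI)
  fix \<xi> W ts assume dat: "intertwining_datum \<xi> W" and D: "ts \<in> D_set m \<xi> W"
  let ?S = "sections m \<xi> W ts"
  let ?\<sigma> = "restrM m"
  have W: "closed_subrep \<xi> W" using dat unfolding intertwining_datum_def by blast
  have ts: "list_all2 (\<lambda>(\<sigma>, \<nu>, d) t. hom_germ m \<sigma> \<nu> t) \<xi> ts" using D unfolding D_set_def by blast
  note S = sections_inv_closed[OF W ts]
  have "jets \<xi> (map (\<lambda>t. frobenius m t 1) ts) \<in> W" using D unfolding D_set_def by blast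
  then have 1: "fe (\<lambda>\<mu>. 1) m \<in> ?S"
    unfolding sections_def by (simp add: frobenius_eq fe_def fam_ee)
  have "\<psi> \<in> ?S"
  proof (rule inv_series[OF S 1 \<psi>])
    fix n assume n: "par ?\<sigma> n"
    then have ev: "even (n - m)" using par_even[OF par_restrM] by blast
    obtain h where h: "h holomorphic_on UNIV" "\<And>z. h (- z) = h z" "\<And>z. fcm (\<psi> z) n = Q m n z * h z" using fac[OF n] by blast
    \<comment> \<open>\<open>map snd \<xi>\<close> lists the pairs (\<nu>, d) of the datum, so one
      polynomial serves all components simultaneously, as required for a single element of
      \<open>W\<close>.\<close>
    obtain p where p: "\<And>a d. (a, d) \<in> set (map snd \<xi>) \<Longrightarrow> \<exists>r. r holomorphic_on UNIV \<and> (\<forall>z. h z - poly p (z\<^sup>2) = (z - a) ^ (d + 1) * r z)"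
      using even_interpolate[OF h(1,2), of "map snd \<xi>"] by blast
    have "fe (\<lambda>\<mu>. 1 * Q m n \<mu>) n \<in> ?S" by (rule inv_reach[OF S par_restrM _ 1 ev]) simp
    then have "fe (\<lambda>\<mu>. Q m n \<mu>) n \<in> ?S" by simp
    then have P: "fe (\<lambda>\<mu>. Q m n \<mu> * poly p (\<mu>\<^sup>2)) n \<in> ?S" by (rule inv_even_poly[OF S n Q_hol])
    have "jets \<xi> (map (\<lambda>t \<mu> k. t \<mu> * fe (\<lambda>\<mu>. fcm (\<psi> \<mu>) n) n \<mu> k) ts) =
        jets \<xi> (map (\<lambda>t \<mu> k. t \<mu> * fe (\<lambda>\<mu>. Q m n \<mu> * poly p (\<mu>\<^sup>2)) n \<mu> k) ts)"
    proof (rule jets_cong, rule list.rel_mono_strong[OF ts])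
      fix x :: "mhat \<times> complex \<times> nat" and t :: "complex \<Rightarrow> complex"
      assume x: "x \<in> set \<xi>" and "t \<in> set ts" and h0: "(\<lambda>(\<sigma>, \<nu>, d) t. hom_germ m \<sigma> \<nu> t) x t"
      obtain \<sigma> \<nu> d where x': "x = (\<sigma>, \<nu>, d)" by (cases x)
      then have t: "hom_germ m \<sigma> \<nu> t" using h0 by simp
      have "(\<nu>, d) \<in> set (map snd \<xi>)" using x unfolding x' by force
      then obtain r where r: "r holomorphic_on UNIV" "\<And>z. h z - poly p (z\<^sup>2) = (z - \<nu>) ^ (d + 1) * r z" using p by blast
      have "jet \<sigma> \<nu> d (\<lambda>\<mu> k. t \<mu> * fe (\<lambda>\<mu>. fcm (\<psi> \<mu>) n) n \<mu> k) =
         jet \<sigma> \<nu> d (\<lambda>\<mu> k. t \<mu> * fe (\<lambda>\<mu>. Q m n \<mu> * poly p (\<mu>\<^sup>2)) n \<mu> k)"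
      proof (rule jet_eqI[OF hom_germ_mult[OF t fam_fe[OF n, of "\<lambda>\<mu>. Q m n \<mu> * r \<mu>"]]])
        show "(\<lambda>\<mu>. Q m n \<mu> * r \<mu>) holomorphic_on UNIV" by (intro holomorphic_intros Q_hol r(1))
        have "t \<mu> * fe (\<lambda>\<mu>. fcm (\<psi> \<mu>) n) n \<mu> k - t \<mu> * fe (\<lambda>\<mu>. Q m n \<mu> * poly p (\<mu>\<^sup>2)) n \<mu> k =
            (\<mu> - \<nu>) ^ (d + 1) * (t \<mu> * fe (\<lambda>\<mu>. Q m n \<mu> * r \<mu>) n \<mu> k)" for \<mu> k
        proof -
          have "t \<mu> * fe (\<lambda>\<mu>. fcm (\<psi> \<mu>) n) n \<mu> k - t \<mu> * fe (\<lambda>\<mu>. Q m n \<mu> * poly p (\<mu>\<^sup>2)) n \<mu> k =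
             t \<mu> * Q m n \<mu> * ee n k * (h \<mu> - poly p (\<mu>\<^sup>2))" unfolding fe_def h(3) by (simp add: algebra_simps)
          also have "\<dots> = (\<mu> - \<nu>) ^ (d + 1) * (t \<mu> * fe (\<lambda>\<mu>. Q m n \<mu> * r \<mu>) n \<mu> k)"
            unfolding r(2) fe_def by (simp only: mult_ac)
          finally show ?thesis .
        qed
        then show "\<forall>\<^sub>F \<mu> in nhds \<nu>. \<forall>k. t \<mu> * fe (\<lambda>\<mu>. fcm (\<psi> \<mu>) n) n \<mu> k - t \<mu> * fe (\<lambda>\<mu>. Q m n \<mu> * poly p (\<mu>\<^sup>2)) n \<mu> k =
            (\<mu> - \<nu>) ^ (d + 1) * (t \<mu> * fe (\<lambda>\<mu>. Q m n \<mu> * r \<mu>) n \<mu> k)" by simp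
      qed
      then show "(\<lambda>(\<sigma>, \<nu>, d) t. jet \<sigma> \<nu> d (\<lambda>\<mu> k. t \<mu> * fe (\<lambda>\<mu>. fcm (\<psi> \<mu>) n) n \<mu> k) =
         jet \<sigma> \<nu> d (\<lambda>\<mu> k. t \<mu> * fe (\<lambda>\<mu>. Q m n \<mu> * poly p (\<mu>\<^sup>2)) n \<mu> k)) x t" unfolding x' by simp
    qed
    then show "fe (\<lambda>\<mu>. fcm (\<psi> \<mu>) n) n \<in> ?S"
      using P fam_fe[OF n fam_fc_hol[OF \<psi>]] unfolding sections_def by simp
  qed
  then show "jets \<xi> (map (\<lambda>t \<mu> k. t \<mu> * \<psi> \<mu> k) ts) \<in> W" unfolding sections_def by blast
qed

section \<open>From (2.a) and (2.b) to the factorization of the coefficients\<close>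

text \<open>(2.a) is given off a discrete set. In the half plane \<open>cpre\<close> is analytic and
  nonzero and cancels; continuity of the entire functions then supplies the point \<nu>
  itself.\<close>

lemma J_w_imp_functional:
  assumes mw: "represents_w mw" and \<psi>: "fam (restrM m) UNIV \<psi>"
    and J: "\<forall>\<^sub>\<approx>\<nu>. J_wm mw m \<nu> (\<psi> \<nu>) = (\<lambda>k. c_fun m \<nu> * \<psi> (- \<nu>) k)" and \<nu>: "Re \<nu> > 0"
  shows "ex n (pi / 2) * gf n \<nu> * fcm (\<psi> \<nu>) n = ex m (pi / 2) * gf m \<nu> * fcm (\<psi> (- \<nu>)) n"
proof -
  let ?A = "\<lambda>\<nu>. ex n (pi / 2) * gf n \<nu> * fcm (\<psi> \<nu>) n"
  let ?B = "\<lambda>\<nu>. ex m (pi / 2) * gf m \<nu> * fcm (\<psi> (- \<nu>)) n"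
  note f1 = fam_fc_hol[OF \<psi>, of n]
  have A: "?A holomorphic_on UNIV" by (intro holomorphic_intros gf_hol f1)
  have B: "?B holomorphic_on UNIV" by (intro holomorphic_intros gf_hol hol_minus[OF f1])
  have lim: "(h \<longlongrightarrow> h \<nu>) (at \<nu>)" if "h holomorphic_on UNIV" for h :: "complex \<Rightarrow> complex"
  proof -
    have "isCont h \<nu>" using holomorphic_on_imp_continuous_on[OF that] by (simp add: continuous_on_eq_continuous_at)
    then show ?thesis by (simp add: isCont_def)
  qed
  have "\<forall>\<^sub>F \<mu> in at \<nu>. J_wm mw m \<mu> (\<psi> \<mu>) = (\<lambda>k. c_fun m \<mu> * \<psi> (- \<mu>) k)"
    by (rule eventually_cosparse_imp_eventually_at[OF J UNIV_I])
  moreover have "\<forall>\<^sub>F \<mu> in at \<nu>. Re \<mu> > 0"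
    using eventually_at_in_open'[OF open_halfspace_Re_gt[of 0], of \<nu>] \<nu> by simp
  ultimately have "\<forall>\<^sub>F \<mu> in at \<nu>. ?A \<mu> = ?B \<mu>"
  proof eventually_elim
    case (elim \<mu>)
    have "\<forall>n. cpre \<mu> * (ex n (pi / 2) * gf n \<mu> * fcm (\<psi> \<mu>) n) = cpre \<mu> * (ex m (pi / 2) * gf m \<mu> * fcm (\<psi> (- \<mu>)) n)"
      using J_w_functional[OF mw cpre_analytic[OF elim(2)] fam_Hinf[OF \<psi> UNIV_I] fam_Hinf[OF \<psi> UNIV_I]] elim(1) by blast
    then have "cpre \<mu> * ?A \<mu> = cpre \<mu> * ?B \<mu>" by (rule spec)
    then show ?case using cpre_nz[OF elim(2)] by (simp only: mult_left_cancel not_False_eq_True)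
  qed
  from tendsto_cong[OF this, of "?B \<nu>"] have "(?A \<longlongrightarrow> ?B \<nu>) (at \<nu>)" using lim[OF B] by (rule iffD2)
  then show ?thesis using lim[OF A] by (rule tendsto_unique[OF at_neq_bot, rotated])
qed

text \<open>A zero of \<open>Q m n\<close> is a reducibility point at which, by
  \<open>Q_zero_Nset\<close>, the type n does not occur in the module of (2.b); so the coefficient
  vanishes there and the division is possible. The functional equation gives evenness of the
  quotient after cancelling Q(z) Q(-z).\<close>

lemma functional_imp_factor:
  assumes \<psi>: "fam (restrM m) UNIV \<psi>" and n: "par (restrM m) n"
    and F: "\<And>\<nu>. Re \<nu> > 0 \<Longrightarrow> ex n (pi / 2) * gf n \<nu> * fcm (\<psi> \<nu>) n = ex m (pi / 2) * gf m \<nu> * fcm (\<psi> (- \<nu>)) n"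
    and W: "\<And>r. r \<in> red_pts (restrM m) \<Longrightarrow> \<psi> (of_real r) \<in> Wmod m r"
  shows "\<exists>h. h holomorphic_on UNIV \<and> (\<forall>z. h (- z) = h z) \<and> (\<forall>z. fcm (\<psi> z) n = Q m n z * h z)"
proof -
  have ev: "even (n - m)" using n par_even[OF par_restrM] by blast
  have zero: "fcm (\<psi> \<nu>) n = 0" if Q0: "Q m n \<nu> = 0" for \<nu>
  proof -
    obtain s :: int where s: "2 * \<nu> + 1 = of_int s" "even (s - m)" by (rule Q_zero_int[OF ev Q0])
    define r :: real where "r = (of_int s - 1) / 2"
    have r2: "2 * r + 1 = of_int s" unfolding r_def by argo
    have "2 * \<nu> = of_int s - 1" using s(1) by (simp add: eq_diff_eq)
    then have \<nu>: "\<nu> = of_real r" by (simp add: r_def eq_divide_eq mult.commute)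
    have "r \<in> red_pts (restrM m)"
    proof (cases "even m")
      case True
      then have "even s" using s(2) by simp
      then obtain j where "s = 2 * j" by (elim evenE)
      then have "r = 1 / 2 + of_int (j - 1)" by (simp add: r_def field_simps)
      then have "\<exists>j. r = 1 / 2 + of_int j" by blast
      then show ?thesis using True by (simp add: restrM_def)
    next
      case False
      then have "odd s" using s(2) by simp
      then obtain j where "s = 2 * j + 1" by (elim oddE)
      then have "r = of_int j" by (simp add: r_def)
      then have "\<exists>j. r = of_int j" by blast
      then show ?thesis using False by (simp add: restrM_def)
    qed
    from W[OF this] have "\<psi> \<nu> \<in> kset (restrM m) (Nset s m)" unfolding \<nu>[symmetric] Wmod_eq[OF r2 s(2)] .
    then show ?thesis by (rule ksetD(2)[OF _ Q_zero_Nset[OF ev Q0 s(1)]])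
  qed
  note f1 = fam_fc_hol[OF \<psi>, of n]
  obtain h where h: "h holomorphic_on UNIV" "\<And>z. fcm (\<psi> z) n = Q m n z * h z"
    using Q_divide[OF f1 zero] by blast
  have "h (- z) = h z" for z
  proof -
    let ?H = "\<lambda>z. h z - h (- z)" and ?Q = "\<lambda>z. Q m n z * Q m n (- z)"
    have Q: "?Q holomorphic_on UNIV" by (intro holomorphic_intros Q_hol hol_minus)
    have H: "?H holomorphic_on UNIV" by (intro holomorphic_intros h(1) hol_minus)
    \<comment> \<open>All zeros of \<open>Q m n\<close> are real, so the product does not vanish at
      i.\<close>
    have nz: "?Q \<i> \<noteq> 0" using Q_imag[of \<i> m n] Q_imag[of "- \<i>" m n] by simp
    have "?Q z * ?H z = 0" for z
      using functional_eq_Q[OF ev f1 F, of z] unfolding h(2) by (simp add: algebra_simps)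
    then have "?H z = 0" by (rule entire_mult_cancel[OF Q H nz])
    then show ?thesis by simp
  qed
  then show ?thesis using h by blast
qed

theorem theorem6:
  fixes m :: int and mw :: mat2 and \<psi> :: "complex \<Rightarrow> mat2 \<Rightarrow> complex"
  assumes "represents_w mw"
    and "hol_into (restrM m) UNIV \<psi>"
  shows "condition_D2 m \<psi> \<longleftrightarrow>
     (\<forall>\<^sub>\<approx>\<nu>. J_wm mw m \<nu> (\<psi> \<nu>) = (\<lambda>k. c_fun m \<nu> * \<psi> (- \<nu>) k)) \<and>
     (\<forall>r \<in> red_pts (restrM m). \<psi> (of_real r) \<in> Wmod m r)"
proof -
  have \<psi>: "fam (restrM m) UNIV \<psi>" using assms(2) hol_into_iff_fam[OF open_UNIV] by blast
  show ?thesis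
  proof
    assume "condition_D2 m \<psi>"
    from D2_imp[OF assms(1) \<psi> this] show "(\<forall>\<^sub>\<approx>\<nu>. J_wm mw m \<nu> (\<psi> \<nu>) = (\<lambda>k. c_fun m \<nu> * \<psi> (- \<nu>) k)) \<and>
     (\<forall>r \<in> red_pts (restrM m). \<psi> (of_real r) \<in> Wmod m r)" by blast
  next
    assume a: "(\<forall>\<^sub>\<approx>\<nu>. J_wm mw m \<nu> (\<psi> \<nu>) = (\<lambda>k. c_fun m \<nu> * \<psi> (- \<nu>) k)) \<and>
     (\<forall>r \<in> red_pts (restrM m). \<psi> (of_real r) \<in> Wmod m r)"
    show "condition_D2 m \<psi>"
    proof (rule factor_imp_D2[OF \<psi>])
      fix n assume n: "par (restrM m) n"
      show "\<exists>h. h holomorphic_on UNIV \<and> (\<forall>z. h (- z) = h z) \<and> (\<forall>z. fcm (\<psi> z) n = Q m n z * h z)"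
        by (rule functional_imp_factor[OF \<psi> n J_w_imp_functional[OF assms(1) \<psi> conjunct1[OF a]]])
          (use a in blast)+
    qed
  qed
qed

end
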